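(* Let $k$ be a field and let $H$ be a finite dimensional Hopf algebra over $k$. Let $A, B$ be Hopf subalgebras of $H$ and let $A', B'$ be normal Hopf subalgebras of $A$ and $B$, respectively. Then the following hold: (i) $A'(A\cap B')$ is a normal Hopf subalgebra of $A'(A\cap B)$. (ii) $B'(A'\cap B)$ is a normal Hopf subalgebra of $B'(A\cap B)$. (iii) $A'(A \cap B') \cap A \cap B = (A' \cap B) (A \cap B') = B'(A' \cap B) \cap A \cap B$. (iv) There is an isomorphism of Hopf algebras $$\dfrac{A'(A\cap B)}{A'(A\cap B)\,(A'(A\cap B'))^+} \cong \dfrac{B'(A\cap B)}{B'(A\cap B)\,(B'(A'\cap B))^+}.$$
   Context: A Hopf subalgebra $K$ of a Hopf algebra $L$ is normal in $L$ if it is stable under both adjoint actions of $L$: $h_{(1)}a\mathcal S(h_{(2)})\in K$ and $\mathcal S(h_{(1)})ah_{(2)}\in K$ for all $a\in K$, $h\in L$. In that case, with $K^+=K\cap\ker\epsilon$, $LK^+$ is a Hopf ideal of $L$ and $L/LK^+$ is a quotient Hopf algebra. For subspaces $X,Y\subseteq H$, $XY$ denotes the linear span of the products $xy$, $x\in X$, $y\in Y$. *)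

theory Defs
  imports
    "HOL-Algebra.Subrings"
    "HOL-Algebra.QuotRing"
    "Jordan_Normal_Form.Missing_VectorSpace"
begin

section \<open>Tensor products of vector spaces\<close>

text \<open>
  The tensor product \<open>V \<otimes> W\<close> is constructed as the quotient of the vector space on the
  basis \<open>V \<times> W\<close> by the subspace spanned by the bilinearity relators; a tensor is thus a
  coset of finitely supported coefficient functions.
\<close>

text \<open>The fields \<open>mult\<close> and \<open>one\<close> are irrelevant here: only the module structure is used.\<close>

definition free_module :: "('a, 'm) ring_scheme \<Rightarrow> 'x set \<Rightarrow> ('a, 'x \<Rightarrow> 'a) module" where
  "free_module k X =
    \<lparr>carrier = {f. f \<in> UNIV \<rightarrow> carrier k \<and> finite {x. f x \<noteq> \<zero>\<^bsub>k\<^esub>} \<and> {x. f x \<noteq> \<zero>\<^bsub>k\<^esub>} \<subseteq> X},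
     mult = undefined, one = undefined,
     zero = (\<lambda>_. \<zero>\<^bsub>k\<^esub>), add = (\<lambda>f g x. f x \<oplus>\<^bsub>k\<^esub> g x),
     smult = (\<lambda>c f x. c \<otimes>\<^bsub>k\<^esub> f x)\<rparr>"

definition delta :: "('a, 'm) ring_scheme \<Rightarrow> 'x \<Rightarrow> 'x \<Rightarrow> 'a" where
  "delta k p = (\<lambda>q. if q = p then \<one>\<^bsub>k\<^esub> else \<zero>\<^bsub>k\<^esub>)"

definition bilinear_relators ::
  "('a, 'm) ring_scheme \<Rightarrow> ('a, 'b, 'n) module_scheme \<Rightarrow> ('a, 'c, 'o) module_scheme
    \<Rightarrow> ('b \<times> 'c \<Rightarrow> 'a) set" where
  "bilinear_relators k V W =
    (let F = free_module k (carrier V \<times> carrier W) in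
      {delta k (v \<oplus>\<^bsub>V\<^esub> v', w) \<ominus>\<^bsub>F\<^esub> (delta k (v, w) \<oplus>\<^bsub>F\<^esub> delta k (v', w)) | v v' w.
          v \<in> carrier V \<and> v' \<in> carrier V \<and> w \<in> carrier W}
    \<union> {delta k (v, w \<oplus>\<^bsub>W\<^esub> w') \<ominus>\<^bsub>F\<^esub> (delta k (v, w) \<oplus>\<^bsub>F\<^esub> delta k (v, w')) | v w w'.
          v \<in> carrier V \<and> w \<in> carrier W \<and> w' \<in> carrier W}
    \<union> {delta k (c \<odot>\<^bsub>V\<^esub> v, w) \<ominus>\<^bsub>F\<^esub> c \<odot>\<^bsub>F\<^esub> delta k (v, w) | c v w.
          c \<in> carrier k \<and> v \<in> carrier V \<and> w \<in> carrier W}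
    \<union> {delta k (v, c \<odot>\<^bsub>W\<^esub> w) \<ominus>\<^bsub>F\<^esub> c \<odot>\<^bsub>F\<^esub> delta k (v, w) | c v w.
          c \<in> carrier k \<and> v \<in> carrier V \<and> w \<in> carrier W})"

text \<open>
  Extends \<^const>\<open>FactRing\<close> by scalar multiplication; for a subspace that is not an ideal only
  the module fields are meaningful.
\<close>

definition quot_algebra :: "('a, 'b, 'n) module_scheme \<Rightarrow> 'b set \<Rightarrow> ('a, 'b set) module" where
  "quot_algebra M N =
    \<lparr>carrier = a_rcosets\<^bsub>M\<^esub> N, mult = rcoset_mult M N, one = N +>\<^bsub>M\<^esub> \<one>\<^bsub>M\<^esub>,
     zero = N, add = set_add M,
     smult = (\<lambda>c X. \<Union>x\<in>X. N +>\<^bsub>M\<^esub> (c \<odot>\<^bsub>M\<^esub> x))\<rparr>"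

definition tensor_relations ::
  "('a, 'm) ring_scheme \<Rightarrow> ('a, 'b, 'n) module_scheme \<Rightarrow> ('a, 'c, 'o) module_scheme
    \<Rightarrow> ('b \<times> 'c \<Rightarrow> 'a) set" where
  "tensor_relations k V W =
    module.span k (free_module k (carrier V \<times> carrier W)) (bilinear_relators k V W)"

definition tensor_module ::
  "('a, 'm) ring_scheme \<Rightarrow> ('a, 'b, 'n) module_scheme \<Rightarrow> ('a, 'c, 'o) module_scheme
    \<Rightarrow> ('a, ('b \<times> 'c \<Rightarrow> 'a) set) module" where
  "tensor_module k V W =
    quot_algebra (free_module k (carrier V \<times> carrier W)) (tensor_relations k V W)"

definition tens ::
  "('a, 'm) ring_scheme \<Rightarrow> ('a, 'b, 'n) module_scheme \<Rightarrow> ('a, 'c, 'o) module_scheme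
    \<Rightarrow> 'b \<Rightarrow> 'c \<Rightarrow> ('b \<times> 'c \<Rightarrow> 'a) set" where
  "tens k V W v w =
    tensor_relations k V W +>\<^bsub>free_module k (carrier V \<times> carrier W)\<^esub> delta k (v, w)"

text \<open>
  The linear map \<open>V \<otimes> W \<rightarrow> M\<close> induced by a bilinear map \<open>\<beta> : V \<times> W \<rightarrow> M\<close>, sending
  \<open>v \<otimes> w\<close> to \<open>\<beta> v w\<close>. Bilinearity makes the value independent of the representative, so that
  \<^const>\<open>the_elem\<close> is applied to a singleton.
  In Sweedler notation \<open>tensor_lift k M \<beta> (\<Delta> h)\<close> is \<open>\<Sum> \<beta> h\<^sub>(\<^sub>1\<^sub>) h\<^sub>(\<^sub>2\<^sub>)\<close>.
\<close>

definition tensor_lift ::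
  "('a, 'm) ring_scheme \<Rightarrow> ('a, 'd, 'n) module_scheme \<Rightarrow> ('b \<Rightarrow> 'c \<Rightarrow> 'd)
    \<Rightarrow> ('b \<times> 'c \<Rightarrow> 'a) set \<Rightarrow> 'd" where
  "tensor_lift k M \<beta> t =
    the_elem ((\<lambda>f. \<Oplus>\<^bsub>M\<^esub>p\<in>{p. f p \<noteq> \<zero>\<^bsub>k\<^esub>}. f p \<odot>\<^bsub>M\<^esub> \<beta> (fst p) (snd p)) ` t)"

text \<open>The map \<open>f \<otimes> g\<close> with codomain \<open>V \<otimes> W\<close>.\<close>

definition tensor_map ::
  "('a, 'm) ring_scheme \<Rightarrow> ('a, 'd, 'n) module_scheme \<Rightarrow> ('a, 'e, 'o) module_scheme
    \<Rightarrow> ('b \<Rightarrow> 'd) \<Rightarrow> ('c \<Rightarrow> 'e) \<Rightarrow> ('b \<times> 'c \<Rightarrow> 'a) set \<Rightarrow> ('d \<times> 'e \<Rightarrow> 'a) set" where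
  "tensor_map k V W f g = tensor_lift k (tensor_module k V W) (\<lambda>v w. tens k V W (f v) (g w))"

text \<open>The canonical map \<open>(U \<otimes> V) \<otimes> W \<rightarrow> U \<otimes> (V \<otimes> W)\<close>.\<close>

definition tensor_assoc where
  "tensor_assoc k U V W =
    (let T = tensor_module k U (tensor_module k V W) in
      tensor_lift k T
        (\<lambda>s w. tensor_lift k T (\<lambda>u v. tens k U (tensor_module k V W) u (tens k V W v w)) s))"

text \<open>The algebra \<open>V \<otimes> W\<close>, with \<open>(v \<otimes> w)(v' \<otimes> w') = vv' \<otimes> ww'\<close>.\<close>

definition tensor_algebra ::
  "('a, 'm) ring_scheme \<Rightarrow> ('a, 'b, 'n) module_scheme \<Rightarrow> ('a, 'c, 'o) module_scheme
    \<Rightarrow> ('a, ('b \<times> 'c \<Rightarrow> 'a) set) module" where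
  "tensor_algebra k V W =
    (let T = tensor_module k V W in
      T\<lparr>mult := (\<lambda>s t. tensor_lift k T
                  (\<lambda>v w. tensor_lift k T
                    (\<lambda>v' w'. tens k V W (v \<otimes>\<^bsub>V\<^esub> v') (w \<otimes>\<^bsub>W\<^esub> w')) t) s),
        one := tens k V W \<one>\<^bsub>V\<^esub> \<one>\<^bsub>W\<^esub>\<rparr>)"


section \<open>Hopf algebras\<close>

text \<open>The locale \<^locale>\<open>algebra\<close> of HOL-Algebra is restricted to commutative algebras.\<close>

locale assoc_algebra = vectorspace k A + ring A
  for k (structure) and A (structure) +
  assumes smult_mult_left:
    "\<lbrakk>c \<in> carrier k; x \<in> carrier A; y \<in> carrier A\<rbrakk>
      \<Longrightarrow> (c \<odot>\<^bsub>A\<^esub> x) \<otimes>\<^bsub>A\<^esub> y = c \<odot>\<^bsub>A\<^esub> (x \<otimes>\<^bsub>A\<^esub> y)"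
  and smult_mult_right:
    "\<lbrakk>c \<in> carrier k; x \<in> carrier A; y \<in> carrier A\<rbrakk>
      \<Longrightarrow> x \<otimes>\<^bsub>A\<^esub> (c \<odot>\<^bsub>A\<^esub> y) = c \<odot>\<^bsub>A\<^esub> (x \<otimes>\<^bsub>A\<^esub> y)"

record ('a, 'b) hopf = "('a, 'b) module" +
  comult :: "'b \<Rightarrow> ('b \<times> 'b \<Rightarrow> 'a) set"
  counit :: "'b \<Rightarrow> 'a"
  antipode :: "'b \<Rightarrow> 'b"

locale hopf_algebra = assoc_algebra k H
  for k :: "('a, 'm) ring_scheme" (structure) and H :: "('a, 'b, 'n) hopf_scheme" (structure) +
  assumes comult_ring_hom: "comult H \<in> ring_hom H (tensor_algebra k H H)"
  and comult_linear: "comult H \<in> module_hom k H (tensor_algebra k H H)"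
  and counit_ring_hom: "counit H \<in> ring_hom H k"
  and counit_linear:
    "\<lbrakk>c \<in> carrier k; x \<in> carrier H\<rbrakk> \<Longrightarrow> counit H (c \<odot>\<^bsub>H\<^esub> x) = c \<otimes>\<^bsub>k\<^esub> counit H x"
  and coassoc:
    "h \<in> carrier H \<Longrightarrow>
      tensor_assoc k H H H (tensor_map k (tensor_module k H H) H (comult H) id (comult H h))
      = tensor_map k H (tensor_module k H H) id (comult H) (comult H h)"
  and counit_left:
    "h \<in> carrier H \<Longrightarrow> tensor_lift k H (\<lambda>x y. counit H x \<odot>\<^bsub>H\<^esub> y) (comult H h) = h"
  and counit_right:
    "h \<in> carrier H \<Longrightarrow> tensor_lift k H (\<lambda>x y. counit H y \<odot>\<^bsub>H\<^esub> x) (comult H h) = h"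
  and antipode_linear: "antipode H \<in> module_hom k H H"
  and antipode_left:
    "h \<in> carrier H \<Longrightarrow>
      tensor_lift k H (\<lambda>x y. antipode H x \<otimes>\<^bsub>H\<^esub> y) (comult H h) = counit H h \<odot>\<^bsub>H\<^esub> \<one>\<^bsub>H\<^esub>"
  and antipode_right:
    "h \<in> carrier H \<Longrightarrow>
      tensor_lift k H (\<lambda>x y. x \<otimes>\<^bsub>H\<^esub> antipode H y) (comult H h) = counit H h \<odot>\<^bsub>H\<^esub> \<one>\<^bsub>H\<^esub>"

text \<open>The last conjunct but one says \<open>\<Delta>(K) \<subseteq> K \<otimes> K\<close>, with \<open>K \<otimes> K\<close> regarded inside \<open>H \<otimes> H\<close>.\<close>

definition hopf_subalgebra ::
  "('a, 'm) ring_scheme \<Rightarrow> ('a, 'b, 'n) hopf_scheme \<Rightarrow> 'b set \<Rightarrow> bool" where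
  "hopf_subalgebra k H K \<longleftrightarrow>
    subspace k K H \<and> subring K H \<and>
    comult H ` K \<subseteq> module.span k (tensor_module k H H) {tens k H H x y | x y. x \<in> K \<and> y \<in> K} \<and>
    antipode H ` K \<subseteq> K"

text \<open>
  A Hopf subalgebra as a Hopf algebra in its own right. Its comultiplication has to take values
  in the tensor product \<open>K \<otimes> K\<close> formed from \<open>K\<close> alone, which embeds in \<open>H \<otimes> H\<close>
  because the base ring is a field.
\<close>

definition sub_hopf ::
  "('a, 'm) ring_scheme \<Rightarrow> ('a, 'b, 'n) hopf_scheme \<Rightarrow> 'b set \<Rightarrow> ('a, 'b, 'n) hopf_scheme" where
  "sub_hopf k H K =
    H\<lparr>carrier := K,
      comult := (\<lambda>x. THE t. t \<in> carrier (tensor_module k (H\<lparr>carrier := K\<rparr>) (H\<lparr>carrier := K\<rparr>)) \<and>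
                  tensor_map k H H id id t = comult H x)\<rparr>"

definition normal_hopf_subalgebra ::
  "('a, 'm) ring_scheme \<Rightarrow> ('a, 'b, 'n) hopf_scheme \<Rightarrow> 'b set \<Rightarrow> bool" where
  "normal_hopf_subalgebra k L K \<longleftrightarrow>
    hopf_subalgebra k L K \<and>
    (\<forall>a\<in>K. \<forall>h\<in>carrier L.
      tensor_lift k L (\<lambda>x y. x \<otimes>\<^bsub>L\<^esub> a \<otimes>\<^bsub>L\<^esub> antipode L y) (comult L h) \<in> K \<and>
      tensor_lift k L (\<lambda>x y. antipode L x \<otimes>\<^bsub>L\<^esub> a \<otimes>\<^bsub>L\<^esub> y) (comult L h) \<in> K)"

definition span_prod ::
  "('a, 'm) ring_scheme \<Rightarrow> ('a, 'b, 'n) module_scheme \<Rightarrow> 'b set \<Rightarrow> 'b set \<Rightarrow> 'b set" where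
  "span_prod k H X Y = module.span k H {x \<otimes>\<^bsub>H\<^esub> y | x y. x \<in> X \<and> y \<in> Y}"

text \<open>\<open>K\<^sup>+ = K \<inter> ker \<epsilon>\<close>\<close>

definition augmentation ::
  "('a, 'm) ring_scheme \<Rightarrow> ('a, 'b, 'n) hopf_scheme \<Rightarrow> 'b set \<Rightarrow> 'b set" where
  "augmentation k L K = {x \<in> K. counit L x = \<zero>\<^bsub>k\<^esub>}"

text \<open>
  The quotient of \<open>L\<close> by a Hopf ideal \<open>I\<close>, with projection \<open>\<pi>\<close>: comultiplication, counit
  and antipode are those induced by \<open>(\<pi> \<otimes> \<pi>) \<circ> \<Delta>\<close>, \<open>\<epsilon>\<close> and \<open>\<pi> \<circ> S\<close>, whose values on a coset do not
  depend on the representative when \<open>I\<close> is a Hopf ideal.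
\<close>

definition quot_hopf ::
  "('a, 'm) ring_scheme \<Rightarrow> ('a, 'b, 'n) hopf_scheme \<Rightarrow> 'b set \<Rightarrow> ('a, 'b set) hopf" where
  "quot_hopf k L I =
    module.extend (quot_algebra L I)
     \<lparr>comult = (\<lambda>X. the_elem ((\<lambda>x. tensor_map k (quot_algebra L I) (quot_algebra L I)
                        (\<lambda>y. I +>\<^bsub>L\<^esub> y) (\<lambda>y. I +>\<^bsub>L\<^esub> y) (comult L x)) ` X)),
     counit = (\<lambda>X. the_elem (counit L ` X)),
     antipode = (\<lambda>X. the_elem ((\<lambda>x. I +>\<^bsub>L\<^esub> antipode L x) ` X))\<rparr>"

text \<open>The quotient \<open>L / LK\<^sup>+\<close> by a normal Hopf subalgebra \<open>K\<close>.\<close>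

definition normal_quotient ::
  "('a, 'm) ring_scheme \<Rightarrow> ('a, 'b, 'n) hopf_scheme \<Rightarrow> 'b set \<Rightarrow> ('a, 'b set) hopf" where
  "normal_quotient k L K = quot_hopf k L (span_prod k L (carrier L) (augmentation k L K))"

definition hopf_iso ::
  "('a, 'm) ring_scheme \<Rightarrow> ('a, 'b, 'n) hopf_scheme \<Rightarrow> ('a, 'c, 'o) hopf_scheme
    \<Rightarrow> ('b \<Rightarrow> 'c) set" where
  "hopf_iso k L M =
    {f \<in> ring_iso L M. f \<in> module_hom k L M \<and>
      (\<forall>x\<in>carrier L.
        comult M (f x) = tensor_map k M M f f (comult L x) \<and>
        counit M (f x) = counit L x \<and>
        antipode M (f x) = f (antipode L x))}"

definition hopf_isomorphic ::
  "('a, 'm) ring_scheme \<Rightarrow> ('a, 'b, 'n) hopf_scheme \<Rightarrow> ('a, 'c, 'o) hopf_scheme \<Rightarrow> bool" where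
  "hopf_isomorphic k L M \<longleftrightarrow> hopf_algebra k L \<and> hopf_algebra k M \<and> hopf_iso k L M \<noteq> {}"

end

theory Submission
  imports Defs
begin

text \<open>
  Put \<open>D = A \<inter> B\<close>, \<open>P = A'D\<close> and \<open>M = A'(A \<inter> B')\<close>. Normality of \<open>A'\<close> in \<open>A\<close> lets elements of \<open>D\<close> be moved
  past \<open>A'\<close>, so that \<open>P\<close> and \<open>M\<close> are Hopf subalgebras and \<open>M\<close> is normal in \<open>P = DM\<close>. For (iv), the projection
  \<open>D \<rightarrow> P/PM\<^sup>+\<close> is onto, and its kernel \<open>D \<inter> PM\<^sup>+\<close> equals \<open>D(D \<inter> M)\<^sup>+\<close>; by (iii) this is symmetric in the
  two sides. The kernel formula comes from integrals: a Frobenius pair on the quotient yields a map \<open>E : P \<rightarrow> P\<close>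
  with values in the coinvariants, which an integral of \<open>M\<close> identifies with \<open>M\<close>, and a lift \<open>t \<in> D\<close> of the
  integral of the quotient reconstructs \<open>d\<close> as \<open>\<Sum> S(t\<^sub>(\<^sub>1\<^sub>)) E(t\<^sub>(\<^sub>2\<^sub>) d)\<close>. Part (iii) is a modular law: if
  \<open>K \<subseteq> C \<subseteq> NK\<close> and \<open>L\<close> is the integral of \<open>N \<inter> C\<close>, the kernel formula gives \<open>LC = LK\<close>, and
  \<open>L\<close> generates \<open>N \<inter> C\<close> under its dual, whence \<open>C = (N \<inter> C)K\<close>.
\<close>

section \<open>Quotient modules\<close>

text \<open>The inclusion of \<open>D(D \<inter> M)^+\<close> in \<open>D \<inter> PM^+\<close> is
  immediate; the reverse one is the crux, because an element of \<open>D\<close> may be a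
  combination of products whose factors leave \<open>D\<close>. The reconstruction formula stays
  inside \<open>D\<close>: since \<open>P = DM\<close>, the lift \<open>t\<close> can be taken in
  \<open>D\<close>; \<open>E\<close> is a slice of the comultiplication, so it preserves
  \<open>D\<close>; and the counit of \<open>E(x)\<close> is the integral evaluated at the class of
  \<open>x\<close>, which vanishes on \<open>PM^+\<close>. That coinvariants lie in \<open>M\<close>
  rests on a Frobenius pair for \<open>M\<close> and on the inverse of the antipode. Nonzero
  integrals come from an explicit trace over a dual basis. The formal obstacle is that
  \<open>K \<otimes> K\<close>, built from a Hopf subalgebra \<open>K\<close> alone, consists of
  other cosets than \<open>H \<otimes> H\<close>. A linear retraction of \<open>H\<close> onto
  \<open>K\<close> provides a left inverse of the comparison map, so Sweedler sums over
  \<open>K\<close> can be evaluated in \<open>H\<close>.\<close>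

lemma finsum_bij:
  assumes "abelian_monoid G" "bij_betw h A B" "f \<in> B \<rightarrow> carrier G"
  shows "finsum G f B = finsum G (\<lambda>x. f (h x)) A"
proof -
  interpret abelian_monoid G by fact
  have "inj_on h A" "h ` A = B" using assms(2) by (auto simp: bij_betw_def)
  with add.finprod_reindex[of f h A] assms(3) show ?thesis by simp
qed

context module
begin

lemma submodule_abelian_subgroup:
  assumes "submodule R N M" shows "abelian_subgroup N M"
proof -
  interpret N: submodule R N M by fact
  have "a_inv M x \<in> N" if "x \<in> N" for x
  proof -
    have "x \<in> carrier M" using that N.subset by blast
    then have "a_inv M x = (\<ominus> \<one>) \<odot>\<^bsub>M\<^esub> x" by (simp add: smult_minus_1)
    then show ?thesis using that by simp
  qed
  then have "additive_subgroup N M"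
    unfolding additive_subgroup_def
    by (intro subgroup.intro) (use N.subset in \<open>auto simp: a_inv_def[symmetric]\<close>)
  then show ?thesis by (rule abelian_subgroupI3) (rule M.abelian_group_axioms)
qed

lemma submodule_minus_closed:
  assumes "submodule R N M" "x \<in> N" "y \<in> N" shows "x \<ominus>\<^bsub>M\<^esub> y \<in> N"
proof -
  interpret abelian_subgroup N M by (rule submodule_abelian_subgroup) fact
  show ?thesis using assms by (simp add: a_minus_def)
qed

lemma rcos_eq_iff:
  assumes "submodule R N M" "x \<in> carrier M" "y \<in> carrier M"
  shows "N +>\<^bsub>M\<^esub> x = N +>\<^bsub>M\<^esub> y \<longleftrightarrow> x \<ominus>\<^bsub>M\<^esub> y \<in> N"
proof -
  interpret abelian_subgroup N M by (rule submodule_abelian_subgroup) fact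
  show ?thesis
    using assms(2,3) a_rcos_module[OF assms(3,2)] a_rcos_self[OF assms(2)]
      a_repr_independence'[of x y] by (auto simp: a_minus_def)
qed

lemma quot_carrier:
  assumes "X \<in> carrier (quot_algebra M N)"
  obtains x where "x \<in> carrier M" "X = N +>\<^bsub>M\<^esub> x"
  using assms by (auto simp: quot_algebra_def A_RCOSETS_def')

lemma rcos_in_quot: "x \<in> carrier M \<Longrightarrow> N +>\<^bsub>M\<^esub> x \<in> carrier (quot_algebra M N)"
  by (auto simp: quot_algebra_def A_RCOSETS_def')

lemma quot_add:
  assumes "submodule R N M" "x \<in> carrier M" "y \<in> carrier M"
  shows "(N +>\<^bsub>M\<^esub> x) \<oplus>\<^bsub>quot_algebra M N\<^esub> (N +>\<^bsub>M\<^esub> y) = N +>\<^bsub>M\<^esub> (x \<oplus>\<^bsub>M\<^esub> y)"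
proof -
  interpret abelian_subgroup N M by (rule submodule_abelian_subgroup) fact
  show ?thesis using assms by (simp add: quot_algebra_def a_rcos_sum)
qed

lemma rcos_elem:
  assumes "submodule R N M" "x \<in> carrier M"
  shows "y \<in> N +>\<^bsub>M\<^esub> x \<longleftrightarrow> y \<in> carrier M \<and> y \<ominus>\<^bsub>M\<^esub> x \<in> N"
proof -
  interpret abelian_subgroup N M by (rule submodule_abelian_subgroup) fact
  show ?thesis
    using a_rcos_module[OF assms(2)] a_elemrcos_carrier[OF assms(2)] unfolding a_minus_def by blast
qed

lemma quot_smult:
  assumes N: "submodule R N M" and x: "x \<in> carrier M" and c: "c \<in> carrier R"
  shows "c \<odot>\<^bsub>quot_algebra M N\<^esub> (N +>\<^bsub>M\<^esub> x) = N +>\<^bsub>M\<^esub> (c \<odot>\<^bsub>M\<^esub> x)"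
proof -
  interpret N: abelian_subgroup N M by (rule submodule_abelian_subgroup) fact
  have *: "N +>\<^bsub>M\<^esub> (c \<odot>\<^bsub>M\<^esub> y) = N +>\<^bsub>M\<^esub> (c \<odot>\<^bsub>M\<^esub> x)" if "y \<in> N +>\<^bsub>M\<^esub> x" for y
  proof -
    have y: "y \<in> carrier M" "y \<ominus>\<^bsub>M\<^esub> x \<in> N" using that rcos_elem[OF N x] by auto
    have "c \<odot>\<^bsub>M\<^esub> y \<ominus>\<^bsub>M\<^esub> c \<odot>\<^bsub>M\<^esub> x = c \<odot>\<^bsub>M\<^esub> (y \<ominus>\<^bsub>M\<^esub> x)"
      using x y c by (simp add: a_minus_def smult_r_distr smult_r_minus)
    also have "\<dots> \<in> N" using y c N by (simp add: submodule.smult_closed)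
    finally show ?thesis using rcos_eq_iff[OF N] x y c by simp
  qed
  have "x \<in> N +>\<^bsub>M\<^esub> x" using x by (rule N.a_rcos_self)
  with * have "(\<Union>y\<in>N +>\<^bsub>M\<^esub> x. N +>\<^bsub>M\<^esub> (c \<odot>\<^bsub>M\<^esub> y)) = N +>\<^bsub>M\<^esub> (c \<odot>\<^bsub>M\<^esub> x)" by blast
  then show ?thesis by (simp add: quot_algebra_def)
qed

lemma quot_zero: assumes "submodule R N M"
  shows "\<zero>\<^bsub>quot_algebra M N\<^esub> = N +>\<^bsub>M\<^esub> \<zero>\<^bsub>M\<^esub>"
proof -
  interpret N: abelian_subgroup N M by (rule submodule_abelian_subgroup) fact
  show ?thesis by (simp add: quot_algebra_def N.a_subset)
qed

lemma quot_module:
  assumes N: "submodule R N M" shows "module R (quot_algebra M N)"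
proof -
  note [simp] = quot_add[OF N] quot_smult[OF N] quot_zero[OF N] rcos_in_quot
  let ?Q = "quot_algebra M N"
  have ag: "abelian_group ?Q"
  proof (rule abelian_groupI)
    fix X Y assume "X \<in> carrier ?Q" "Y \<in> carrier ?Q"
    then show "X \<oplus>\<^bsub>?Q\<^esub> Y \<in> carrier ?Q" "X \<oplus>\<^bsub>?Q\<^esub> Y = Y \<oplus>\<^bsub>?Q\<^esub> X"
      by (auto elim!: quot_carrier simp: M.a_comm)
  next
    fix X Y Z assume "X \<in> carrier ?Q" "Y \<in> carrier ?Q" "Z \<in> carrier ?Q"
    then show "X \<oplus>\<^bsub>?Q\<^esub> Y \<oplus>\<^bsub>?Q\<^esub> Z = X \<oplus>\<^bsub>?Q\<^esub> (Y \<oplus>\<^bsub>?Q\<^esub> Z)"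
      by (auto elim!: quot_carrier simp: M.a_assoc)
  next
    fix X assume "X \<in> carrier ?Q"
    then obtain x where x: "x \<in> carrier M" "X = N +>\<^bsub>M\<^esub> x" by (rule quot_carrier)
    then show "\<zero>\<^bsub>?Q\<^esub> \<oplus>\<^bsub>?Q\<^esub> X = X" by simp
    show "\<exists>Y\<in>carrier ?Q. Y \<oplus>\<^bsub>?Q\<^esub> X = \<zero>\<^bsub>?Q\<^esub>"
      by (rule bexI[of _ "N +>\<^bsub>M\<^esub> (\<ominus>\<^bsub>M\<^esub> x)"]) (use x in \<open>simp_all add: M.l_neg\<close>)
  qed simp
  show ?thesis
  proof (rule moduleI)
    show "cring R" by (rule R.is_cring)
  qed (use ag in \<open>auto elim!: quot_carrier simp: smult_l_distr smult_r_distr smult_assoc1\<close>)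
qed

lemma quot_proj_hom: "submodule R N M \<Longrightarrow> (\<lambda>x. N +>\<^bsub>M\<^esub> x) \<in> module_hom R M (quot_algebra M N)"
  by (auto simp: module_hom_def rcos_in_quot quot_add quot_smult)

text \<open>A function that is constant on a coset has a singleton image there; every
  \<open>the_elem\<close> in \<open>tensor_lift\<close> and \<open>quot_hopf\<close> relies on
  this.\<close>

lemma the_elem_rcos:
  assumes N: "submodule R N M" and x: "x \<in> carrier M"
    and f: "\<And>y. y \<in> carrier M \<Longrightarrow> y \<ominus>\<^bsub>M\<^esub> x \<in> N \<Longrightarrow> f y = f x"
  shows "the_elem (f ` (N +>\<^bsub>M\<^esub> x)) = f x"
proof -
  interpret N: abelian_subgroup N M by (rule submodule_abelian_subgroup) fact
  have "x \<in> N +>\<^bsub>M\<^esub> x" using x by (rule N.a_rcos_self)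
  moreover have "f y = f x" if "y \<in> N +>\<^bsub>M\<^esub> x" for y
    using that rcos_elem[OF N x] f by auto
  ultimately have "f ` (N +>\<^bsub>M\<^esub> x) = {f x}" by blast
  then show ?thesis by simp
qed

end

section \<open>Free modules\<close>

context field
begin

lemma free_module_simps [simp]:
  "\<zero>\<^bsub>free_module R X\<^esub> = (\<lambda>_. \<zero>)"
  "f \<oplus>\<^bsub>free_module R X\<^esub> g = (\<lambda>x. f x \<oplus> g x)"
  "c \<odot>\<^bsub>free_module R X\<^esub> f = (\<lambda>x. c \<otimes> f x)"
  by (simp_all add: free_module_def)

lemma free_carrier:
  "f \<in> carrier (free_module R X) \<longleftrightarrow>
    (\<forall>x. f x \<in> carrier R) \<and> finite {x. f x \<noteq> \<zero>} \<and> {x. f x \<noteq> \<zero>} \<subseteq> X"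
  by (auto simp: free_module_def)

lemma free_is_module: "module R (free_module R X)"
proof (rule moduleI)
  let ?F = "free_module R X"
  have add: "f \<oplus>\<^bsub>?F\<^esub> g \<in> carrier ?F" if "f \<in> carrier ?F" "g \<in> carrier ?F" for f g
  proof -
    have "{x. f x \<oplus> g x \<noteq> \<zero>} \<subseteq> {x. f x \<noteq> \<zero>} \<union> {x. g x \<noteq> \<zero>}" using that by (auto simp: free_carrier)
    then show ?thesis using that by (auto simp: free_carrier intro: finite_subset)
  qed
  have sm: "c \<odot>\<^bsub>?F\<^esub> f \<in> carrier ?F" if "f \<in> carrier ?F" "c \<in> carrier R" for c f
  proof -
    have "{x. c \<otimes> f x \<noteq> \<zero>} \<subseteq> {x. f x \<noteq> \<zero>}" using that by (auto simp: free_carrier)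
    then show ?thesis using that by (auto simp: free_carrier intro: finite_subset)
  qed
  show "cring R" by (rule is_cring)
  show "abelian_group ?F"
  proof (rule abelian_groupI)
    fix f assume f: "f \<in> carrier ?F"
    show "\<exists>g\<in>carrier ?F. g \<oplus>\<^bsub>?F\<^esub> f = \<zero>\<^bsub>?F\<^esub>"
      by (rule bexI[of _ "(\<ominus> \<one>) \<odot>\<^bsub>?F\<^esub> f"], use f sm in \<open>auto simp: free_carrier l_minus l_neg\<close>)
  next
    show "f \<oplus>\<^bsub>?F\<^esub> g \<in> carrier ?F" if "f \<in> carrier ?F" "g \<in> carrier ?F" for f g
      using add that by blast
  qed (auto simp: free_carrier a_ac)
  show "c \<odot>\<^bsub>?F\<^esub> f \<in> carrier ?F" if "c \<in> carrier R" "f \<in> carrier ?F" for c f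
    using sm that by blast
qed (auto simp: free_carrier l_distr r_distr m_assoc)

lemma delta_in_free: "p \<in> X \<Longrightarrow> delta R p \<in> carrier (free_module R X)"
  by (auto simp: free_carrier delta_def)

end

section \<open>Tensor products\<close>

context field
begin

abbreviation lin where "lin V W f \<equiv> f \<in> module_hom R V W"

definition bilin where
  "bilin V W M \<beta> \<longleftrightarrow> (\<forall>v\<in>carrier V. lin W M (\<beta> v)) \<and> (\<forall>w\<in>carrier W. lin V M (\<lambda>v. \<beta> v w))"

lemma linI:
  assumes "\<And>x. x \<in> carrier V \<Longrightarrow> f x \<in> carrier W"
    and "\<And>x y. x \<in> carrier V \<Longrightarrow> y \<in> carrier V \<Longrightarrow> f (x \<oplus>\<^bsub>V\<^esub> y) = f x \<oplus>\<^bsub>W\<^esub> f y"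
    and "\<And>c x. c \<in> carrier R \<Longrightarrow> x \<in> carrier V \<Longrightarrow> f (c \<odot>\<^bsub>V\<^esub> x) = c \<odot>\<^bsub>W\<^esub> f x"
  shows "lin V W f"
  using assms by (auto simp: module_hom_def)

lemma lin_closed: "lin V W f \<Longrightarrow> x \<in> carrier V \<Longrightarrow> f x \<in> carrier W"
  by (auto simp: module_hom_def)

lemma lin_add: "lin V W f \<Longrightarrow> x \<in> carrier V \<Longrightarrow> y \<in> carrier V \<Longrightarrow> f (x \<oplus>\<^bsub>V\<^esub> y) = f x \<oplus>\<^bsub>W\<^esub> f y"
  by (rule module_hom_add)

lemma lin_smult: "lin V W f \<Longrightarrow> c \<in> carrier R \<Longrightarrow> x \<in> carrier V \<Longrightarrow> f (c \<odot>\<^bsub>V\<^esub> x) = c \<odot>\<^bsub>W\<^esub> f x"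
  by (rule module_hom_smult)

lemma bilinD1: "bilin V W M \<beta> \<Longrightarrow> v \<in> carrier V \<Longrightarrow> lin W M (\<beta> v)"
  by (simp add: bilin_def)

lemma bilinD2: "bilin V W M \<beta> \<Longrightarrow> w \<in> carrier W \<Longrightarrow> lin V M (\<lambda>v. \<beta> v w)"
  by (simp add: bilin_def)

lemma bilinI:
  assumes "\<And>v. v \<in> carrier V \<Longrightarrow> lin W M (\<lambda>w. \<beta> v w)"
    and "\<And>w. w \<in> carrier W \<Longrightarrow> lin V M (\<lambda>v. \<beta> v w)"
  shows "bilin V W M \<beta>"
  using assms by (simp add: bilin_def)

lemma bilin_closed: "bilin V W M \<beta> \<Longrightarrow> v \<in> carrier V \<Longrightarrow> w \<in> carrier W \<Longrightarrow> \<beta> v w \<in> carrier M"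
  by (rule lin_closed[OF bilinD1])

lemma lin_mod_hom: "module R V \<Longrightarrow> module R W \<Longrightarrow> lin V W f \<Longrightarrow> mod_hom R V W f"
  by (simp add: mod_hom_def mod_hom_axioms_def)

lemma lin_zero: "module R V \<Longrightarrow> module R W \<Longrightarrow> lin V W f \<Longrightarrow> f \<zero>\<^bsub>V\<^esub> = \<zero>\<^bsub>W\<^esub>"
  by (rule mod_hom.f0_is_0[OF lin_mod_hom])

lemma lin_minus:
  "module R V \<Longrightarrow> module R W \<Longrightarrow> lin V W f \<Longrightarrow> x \<in> carrier V \<Longrightarrow> y \<in> carrier V \<Longrightarrow>
    f (x \<ominus>\<^bsub>V\<^esub> y) = f x \<ominus>\<^bsub>W\<^esub> f y"
  by (rule mod_hom.f_minus[OF lin_mod_hom])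

lemma lin_finsum:
  assumes V: "module R V" and W: "module R W" and f: "lin V W f" and g: "g \<in> A \<rightarrow> carrier V"
  shows "f (\<Oplus>\<^bsub>V\<^esub>a\<in>A. g a) = (\<Oplus>\<^bsub>W\<^esub>a\<in>A. f (g a))"
proof -
  interpret V: module R V by fact
  interpret W: module R W by fact
  show ?thesis using g
  proof (induction A rule: infinite_finite_induct)
    case (insert a A)
    have "(\<lambda>a. f (g a)) \<in> insert a A \<rightarrow> carrier W" using insert.prems lin_closed[OF f] by auto
    moreover have "finsum V g A \<in> carrier V" using insert.prems by (intro V.finsum_closed) auto
    ultimately show ?case
      using insert lin_add[OF f] by (simp add: Pi_iff)
  qed (auto simp: lin_zero[OF V W f])
qed

lemma submodule_kernel:
  assumes "module R V" "module R W" "lin V W f"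
  shows "LinearCombinations.submodule R {x \<in> carrier V. f x = \<zero>\<^bsub>W\<^esub>} V"
  using mod_hom.ker_is_submodule[OF lin_mod_hom[OF assms]] mod_hom.ker_def[OF lin_mod_hom[OF assms]]
  by simp

text \<open>The value of a tensor lift on one representative:
  \<open>tensor_lift R M \<beta> t\<close> is \<open>the_elem\<close> of the image of
  \<open>t\<close> under \<open>ev M \<beta>\<close>.\<close>

definition ev where
  "ev M \<beta> f = (\<Oplus>\<^bsub>M\<^esub>p\<in>{p. f p \<noteq> \<zero>}. f p \<odot>\<^bsub>M\<^esub> \<beta> (fst p) (snd p))"

text \<open>Supports shrink when terms cancel, so linearity of \<open>ev\<close> is proved by
  comparing sums over one common finite index set.\<close>

lemma ev_superset:
  assumes M: "module R M" and \<beta>: "\<And>v w. (v, w) \<in> X \<Longrightarrow> \<beta> v w \<in> carrier M"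
    and f: "f \<in> carrier (free_module R X)" and S: "finite S" "{p. f p \<noteq> \<zero>} \<subseteq> S" "S \<subseteq> X"
  shows "ev M \<beta> f = (\<Oplus>\<^bsub>M\<^esub>p\<in>S. f p \<odot>\<^bsub>M\<^esub> \<beta> (fst p) (snd p))"
proof -
  interpret M: module R M by fact
  have *: "\<beta> (fst p) (snd p) \<in> carrier M" if "p \<in> S" for p
    using \<beta>[of "fst p" "snd p"] that S by auto
  show ?thesis unfolding ev_def
  proof (rule M.add.finprod_mono_neutral_cong_left[OF S(1,2)])
    show "(\<lambda>p. f p \<odot>\<^bsub>M\<^esub> \<beta> (fst p) (snd p)) \<in> S \<rightarrow> carrier M"
      using * f by (auto simp: free_carrier)
  qed (use * in auto)
qed

lemma ev_lin:
  assumes M: "module R M" and \<beta>: "\<And>v w. (v, w) \<in> X \<Longrightarrow> \<beta> v w \<in> carrier M"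
  shows "lin (free_module R X) M (ev M \<beta>)"
proof (rule linI)
  interpret M: module R M by fact
  interpret F: module R "free_module R X" by (rule free_is_module)
  let ?F = "free_module R X" and ?b = "\<lambda>p. \<beta> (fst p) (snd p)"
  have b: "?b p \<in> carrier M" if "p \<in> X" for p using \<beta>[of "fst p" "snd p"] that by auto
  show "ev M \<beta> f \<in> carrier M" if "f \<in> carrier ?F" for f
    unfolding ev_def using that b by (intro M.finsum_closed) (auto simp: free_carrier)
  show "ev M \<beta> (f \<oplus>\<^bsub>?F\<^esub> g) = ev M \<beta> f \<oplus>\<^bsub>M\<^esub> ev M \<beta> g" if fg: "f \<in> carrier ?F" "g \<in> carrier ?F" for f g
  proof -
    let ?S = "{p. f p \<noteq> \<zero>} \<union> {p. g p \<noteq> \<zero>}"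
    have S: "finite ?S" "?S \<subseteq> X" using fg by (auto simp: free_carrier)
    have "f \<oplus>\<^bsub>?F\<^esub> g \<in> carrier ?F" using fg by (rule F.a_closed)
    moreover have "{p. (f \<oplus>\<^bsub>?F\<^esub> g) p \<noteq> \<zero>} \<subseteq> ?S" using fg by (auto simp: free_carrier)
    ultimately have "ev M \<beta> (f \<oplus>\<^bsub>?F\<^esub> g) = (\<Oplus>\<^bsub>M\<^esub>p\<in>?S. (f \<oplus>\<^bsub>?F\<^esub> g) p \<odot>\<^bsub>M\<^esub> ?b p)"
      using S by (intro ev_superset[OF M \<beta>]) auto
    also have "\<dots> = (\<Oplus>\<^bsub>M\<^esub>p\<in>?S. f p \<odot>\<^bsub>M\<^esub> ?b p \<oplus>\<^bsub>M\<^esub> g p \<odot>\<^bsub>M\<^esub> ?b p)"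
      by (rule M.finsum_cong') (use fg S b in \<open>auto simp: free_carrier M.smult_l_distr subset_iff\<close>)
    also have "\<dots> = (\<Oplus>\<^bsub>M\<^esub>p\<in>?S. f p \<odot>\<^bsub>M\<^esub> ?b p) \<oplus>\<^bsub>M\<^esub> (\<Oplus>\<^bsub>M\<^esub>p\<in>?S. g p \<odot>\<^bsub>M\<^esub> ?b p)"
      by (rule M.finsum_addf) (use fg S b in \<open>auto simp: free_carrier subset_iff\<close>)
    also have "\<dots> = ev M \<beta> f \<oplus>\<^bsub>M\<^esub> ev M \<beta> g"
      using S fg by (subst (1 2) ev_superset[OF M \<beta>, where S = ?S]) auto
    finally show ?thesis .
  qed
  show "ev M \<beta> (c \<odot>\<^bsub>?F\<^esub> f) = c \<odot>\<^bsub>M\<^esub> ev M \<beta> f" if f: "f \<in> carrier ?F" and c: "c \<in> carrier R" for c f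
  proof -
    let ?S = "{p. f p \<noteq> \<zero>}"
    have S: "finite ?S" "?S \<subseteq> X" using f by (auto simp: free_carrier)
    have "c \<odot>\<^bsub>?F\<^esub> f \<in> carrier ?F" using c f by (rule F.smult_closed)
    moreover have "{p. (c \<odot>\<^bsub>?F\<^esub> f) p \<noteq> \<zero>} \<subseteq> ?S" using c by auto
    ultimately have "ev M \<beta> (c \<odot>\<^bsub>?F\<^esub> f) = (\<Oplus>\<^bsub>M\<^esub>p\<in>?S. (c \<odot>\<^bsub>?F\<^esub> f) p \<odot>\<^bsub>M\<^esub> ?b p)"
      using S by (intro ev_superset[OF M \<beta>]) auto
    also have "\<dots> = (\<Oplus>\<^bsub>M\<^esub>p\<in>?S. c \<odot>\<^bsub>M\<^esub> (f p \<odot>\<^bsub>M\<^esub> ?b p))"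
      by (rule M.finsum_cong') (use f S b c in \<open>auto simp: free_carrier M.smult_assoc1 subset_iff\<close>)
    also have "\<dots> = c \<odot>\<^bsub>M\<^esub> (\<Oplus>\<^bsub>M\<^esub>p\<in>?S. f p \<odot>\<^bsub>M\<^esub> ?b p)"
      by (rule M.finsum_smult_ldistr[symmetric]) (use f S b c in \<open>auto simp: free_carrier subset_iff\<close>)
    finally show ?thesis by (simp add: ev_def)
  qed
qed

lemma ev_delta:
  assumes M: "module R M" and \<beta>: "\<beta> v w \<in> carrier M"
  shows "ev M \<beta> (delta R (v, w)) = \<beta> v w"
proof -
  interpret M: module R M by fact
  have "{p. delta R (v, w) p \<noteq> \<zero>} = {(v, w)}" by (auto simp: delta_def)
  with \<beta> show ?thesis by (simp add: ev_def delta_def)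
qed

lemma free_induct [consumes 1, case_names zero add]:
  assumes f: "f \<in> carrier (free_module R X)"
    and zero: "P (\<lambda>_. \<zero>)"
    and add: "\<And>c p g. \<lbrakk>c \<in> carrier R; p \<in> X; g \<in> carrier (free_module R X); P g\<rbrakk>
      \<Longrightarrow> P ((c \<odot>\<^bsub>free_module R X\<^esub> delta R p) \<oplus>\<^bsub>free_module R X\<^esub> g)"
  shows "P f"
proof -
  have "finite S \<Longrightarrow> f \<in> carrier (free_module R X) \<Longrightarrow> {p. f p \<noteq> \<zero>} \<subseteq> S \<Longrightarrow> P f" for S f
  proof (induction S arbitrary: f rule: finite_induct)
    case empty
    then have "f = (\<lambda>_. \<zero>)" by auto
    with zero show ?case by simp
  next
    case (insert p S)
    show ?case
    proof (cases "f p = \<zero>")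
      case True
      then have "{p. f p \<noteq> \<zero>} \<subseteq> S" using insert.prems by auto
      with insert show ?thesis by blast
    next
      case False
      \<comment> \<open>Deleting \<open>p\<close> from the support writes \<open>f\<close> as a
        multiple of one basis vector plus a function supported in \<open>S\<close>.\<close>
      define g where "g = f(p := \<zero>)"
      have "{q. g q \<noteq> \<zero>} \<subseteq> {q. f q \<noteq> \<zero>}" by (auto simp: g_def)
      then have g: "g \<in> carrier (free_module R X)"
        using insert.prems(1) by (auto simp: free_carrier g_def intro: finite_subset)
      have "{p. g p \<noteq> \<zero>} \<subseteq> S" using insert.prems(2) by (auto simp: g_def)
      with insert.IH g have "P g" by blast
      moreover have "f = (f p \<odot>\<^bsub>free_module R X\<^esub> delta R p) \<oplus>\<^bsub>free_module R X\<^esub> g"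
        using insert.prems(1) by (auto simp: g_def delta_def free_carrier fun_eq_iff)
      moreover have "f p \<in> carrier R" "p \<in> X" using insert.prems(1) False by (auto simp: free_carrier)
      ultimately show ?thesis using add[of "f p" p g] g by simp
    qed
  qed
  from this[of "{p. f p \<noteq> \<zero>}" f] f show ?thesis by (simp add: free_carrier)
qed

text \<open>A linear map that kills \<open>N\<close> is constant on cosets of \<open>N\<close>. This
  gives the well-definedness of tensor lifts and later of the comultiplication, counit and antipode
  of a quotient.\<close>

lemma rcos_lin_zero:
  assumes M: "module R M" and W: "module R W" and N: "LinearCombinations.submodule R N M"
    and f: "lin M W f" and ker: "\<And>x. x \<in> N \<Longrightarrow> f x = \<zero>\<^bsub>W\<^esub>" and x: "x \<in> carrier M"
  shows "the_elem (f ` (N +>\<^bsub>M\<^esub> x)) = f x"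
proof (rule module.the_elem_rcos[OF M N x])
  fix y assume y: "y \<in> carrier M" "y \<ominus>\<^bsub>M\<^esub> x \<in> N"
  interpret M: module R M by fact
  interpret W: module R W by fact
  have "f y \<ominus>\<^bsub>W\<^esub> f x = \<zero>\<^bsub>W\<^esub>" using lin_minus[OF M W f y(1) x] ker[OF y(2)] by simp
  then show "f y = f x" using lin_closed[OF f] x y by simp
qed

section \<open>The universal property of the tensor product\<close>

context
  fixes V :: "('a, 'c, 'n) module_scheme" and W :: "('a, 'd, 'o) module_scheme"
  assumes V: "module R V" and W: "module R W"
begin

interpretation V: module R V by (rule V)
interpretation W: module R W by (rule W)

abbreviation (input) FF where "FF \<equiv> free_module R (carrier V \<times> carrier W)"

interpretation F: module R FF by (rule free_is_module)

lemma bilinear_relators_closed: "bilinear_relators R V W \<subseteq> carrier FF"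
  unfolding bilinear_relators_def Let_def
  by (intro Un_least subsetI)
    (clarsimp simp del: free_module_simps, intro F.minus_closed F.a_closed F.smult_closed delta_in_free; simp)+

lemma tensor_relations_submodule: "LinearCombinations.submodule R (tensor_relations R V W) FF"
  unfolding tensor_relations_def using bilinear_relators_closed by (rule F.span_is_submodule)

lemma bilinear_relators_subset: "bilinear_relators R V W \<subseteq> tensor_relations R V W"
  unfolding tensor_relations_def using bilinear_relators_closed by (rule F.in_own_span)

lemma tensor_module_module: "module R (tensor_module R V W)"
  unfolding tensor_module_def using tensor_relations_submodule by (rule F.quot_module)

lemma tens_closed [simp, intro]:
  "v \<in> carrier V \<Longrightarrow> w \<in> carrier W \<Longrightarrow> tens R V W v w \<in> carrier (tensor_module R V W)"
  unfolding tensor_module_def tens_def by (intro F.rcos_in_quot delta_in_free) simp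

lemma tens_bilin: "bilin V W (tensor_module R V W) (tens R V W)"
proof (intro bilinI linI)
  let ?T = "tensor_module R V W"
  note N = tensor_relations_submodule
  note [simp del] = free_module_simps
  have d: "delta R (v, w) \<in> carrier FF" if "v \<in> carrier V" "w \<in> carrier W" for v w
    using that by (intro delta_in_free) simp
  have T: "?T = quot_algebra FF (tensor_relations R V W)" by (simp add: tensor_module_def)
  note Q = F.quot_add[OF N] F.quot_smult[OF N] F.rcos_eq_iff[OF N] d F.a_closed F.smult_closed
  show "tens R V W v (w \<oplus>\<^bsub>W\<^esub> w') = tens R V W v w \<oplus>\<^bsub>?T\<^esub> tens R V W v w'"
    if "v \<in> carrier V" "w \<in> carrier W" "w' \<in> carrier W" for v w w'
  proof -
    have "delta R (v, w \<oplus>\<^bsub>W\<^esub> w') \<ominus>\<^bsub>FF\<^esub> (delta R (v, w) \<oplus>\<^bsub>FF\<^esub> delta R (v, w')) \<in> tensor_relations R V W"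
      using that by (intro subsetD[OF bilinear_relators_subset]) (auto simp: bilinear_relators_def Let_def)
    then show ?thesis using that by (simp add: T tens_def Q)
  qed
  show "tens R V W (v \<oplus>\<^bsub>V\<^esub> v') w = tens R V W v w \<oplus>\<^bsub>?T\<^esub> tens R V W v' w"
    if "w \<in> carrier W" "v \<in> carrier V" "v' \<in> carrier V" for v v' w
  proof -
    have "delta R (v \<oplus>\<^bsub>V\<^esub> v', w) \<ominus>\<^bsub>FF\<^esub> (delta R (v, w) \<oplus>\<^bsub>FF\<^esub> delta R (v', w)) \<in> tensor_relations R V W"
      using that by (intro subsetD[OF bilinear_relators_subset]) (auto simp: bilinear_relators_def Let_def)
    then show ?thesis using that by (simp add: T tens_def Q)
  qed
  show "tens R V W v (c \<odot>\<^bsub>W\<^esub> w) = c \<odot>\<^bsub>?T\<^esub> tens R V W v w"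
    if "v \<in> carrier V" "c \<in> carrier R" "w \<in> carrier W" for v w c
  proof -
    have "delta R (v, c \<odot>\<^bsub>W\<^esub> w) \<ominus>\<^bsub>FF\<^esub> c \<odot>\<^bsub>FF\<^esub> delta R (v, w) \<in> tensor_relations R V W"
      using that by (intro subsetD[OF bilinear_relators_subset]) (auto simp: bilinear_relators_def Let_def)
    then show ?thesis using that by (simp add: T tens_def Q)
  qed
  show "tens R V W (c \<odot>\<^bsub>V\<^esub> v) w = c \<odot>\<^bsub>?T\<^esub> tens R V W v w"
    if "w \<in> carrier W" "c \<in> carrier R" "v \<in> carrier V" for v w c
  proof -
    have "delta R (c \<odot>\<^bsub>V\<^esub> v, w) \<ominus>\<^bsub>FF\<^esub> c \<odot>\<^bsub>FF\<^esub> delta R (v, w) \<in> tensor_relations R V W"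
      using that by (intro subsetD[OF bilinear_relators_subset]) (auto simp: bilinear_relators_def Let_def)
    then show ?thesis using that by (simp add: T tens_def Q)
  qed
qed (use tens_closed in auto)

text \<open>No scalar occurs in the induction step, because a coefficient can be absorbed into the
  first tensor factor.\<close>

lemma tensor_induct [consumes 1, case_names zero add]:
  assumes t: "t \<in> carrier (tensor_module R V W)"
    and zero: "P \<zero>\<^bsub>tensor_module R V W\<^esub>"
    and add: "\<And>v w t. \<lbrakk>v \<in> carrier V; w \<in> carrier W; t \<in> carrier (tensor_module R V W); P t\<rbrakk>
      \<Longrightarrow> P (tens R V W v w \<oplus>\<^bsub>tensor_module R V W\<^esub> t)"
  shows "P t"
proof -
  note N = tensor_relations_submodule
  let ?N = "tensor_relations R V W" and ?T = "tensor_module R V W"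
  obtain f where f: "f \<in> carrier FF" "t = ?N +>\<^bsub>FF\<^esub> f"
    using t unfolding tensor_module_def by (rule F.quot_carrier)
  have "P (?N +>\<^bsub>FF\<^esub> f)" using f(1)
  proof (induction f rule: free_induct)
    case zero
    then show ?case using assms(2) F.quot_zero[OF N] by (simp add: tensor_module_def)
  next
    case (add c p g)
    obtain v w where p: "p = (v, w)" "v \<in> carrier V" "w \<in> carrier W" using add(2) by auto
    have d: "delta R p \<in> carrier FF" using add(2) by (rule delta_in_free)
    have "?N +>\<^bsub>FF\<^esub> ((c \<odot>\<^bsub>FF\<^esub> delta R p) \<oplus>\<^bsub>FF\<^esub> g)
        = c \<odot>\<^bsub>?T\<^esub> tens R V W v w \<oplus>\<^bsub>?T\<^esub> (?N +>\<^bsub>FF\<^esub> g)"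
      using add d unfolding tensor_module_def tens_def p(1)[symmetric]
      by (simp add: F.quot_add[OF N] F.quot_smult[OF N] del: free_module_simps)
    also have "c \<odot>\<^bsub>?T\<^esub> tens R V W v w = tens R V W (c \<odot>\<^bsub>V\<^esub> v) w"
      using lin_smult[OF bilinD2[OF tens_bilin p(3)] add(1) p(2)] by simp
    finally show ?case
      using assms(3)[of "c \<odot>\<^bsub>V\<^esub> v" w "?N +>\<^bsub>FF\<^esub> g"] add p F.rcos_in_quot[OF add(3), of ?N]
      by (simp add: tensor_module_def)
  qed
  with f show ?thesis by simp
qed

text \<open>The kernel of \<open>ev\<close> is a submodule, so only the four families of relators
  have to be checked, and each is one of the bilinearity laws of \<open>\<beta>\<close>.\<close>

lemma ev_relations:
  assumes M: "module R M" and \<beta>: "bilin V W M \<beta>" and x: "x \<in> tensor_relations R V W"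
  shows "ev M \<beta> x = \<zero>\<^bsub>M\<^esub>"
proof -
  interpret M: module R M by fact
  note [simp del] = free_module_simps
  have l: "lin FF M (ev M \<beta>)" by (rule ev_lin[OF M]) (use bilin_closed[OF \<beta>] in auto)
  let ?K = "{x \<in> carrier FF. ev M \<beta> x = \<zero>\<^bsub>M\<^esub>}"
  have d: "delta R (v, w) \<in> carrier FF" if "v \<in> carrier V" "w \<in> carrier W" for v w
    using that by (intro delta_in_free) simp
  have e: "ev M \<beta> (delta R (v, w)) = \<beta> v w" if "v \<in> carrier V" "w \<in> carrier W" for v w
    by (rule ev_delta) (rule M bilin_closed[OF \<beta> that])+
  note b = lin_add[OF bilinD1[OF \<beta>]] lin_add[OF bilinD2[OF \<beta>]] lin_smult[OF bilinD1[OF \<beta>]] lin_smult[OF bilinD2[OF \<beta>]]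
  have "ev M \<beta> y = \<zero>\<^bsub>M\<^esub>" if "y \<in> bilinear_relators R V W" for y
    using that unfolding bilinear_relators_def Let_def
    by (elim UnE CollectE exE conjE; hypsubst)
      (simp_all add: lin_minus[OF free_is_module M l] lin_add[OF l] lin_smult[OF l] e d b bilin_closed[OF \<beta>])
  then have "bilinear_relators R V W \<subseteq> ?K" using bilinear_relators_closed by blast
  then have "tensor_relations R V W \<subseteq> ?K"
    unfolding tensor_relations_def
    by (rule F.span_is_subset[OF _ submodule_kernel[OF free_is_module M l]])
  with x show ?thesis by auto
qed

lemma tensor_lift_coset:
  assumes M: "module R M" and \<beta>: "bilin V W M \<beta>" and f: "f \<in> carrier FF"
  shows "tensor_lift R M \<beta> (tensor_relations R V W +>\<^bsub>FF\<^esub> f) = ev M \<beta> f"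
proof -
  have l: "lin FF M (ev M \<beta>)" by (rule ev_lin[OF M]) (use bilin_closed[OF \<beta>] in auto)
  have "tensor_lift R M \<beta> X = the_elem (ev M \<beta> ` X)" for X
    by (simp add: tensor_lift_def ev_def[abs_def])
  then show ?thesis
    using rcos_lin_zero[OF free_is_module M tensor_relations_submodule l ev_relations[OF M \<beta>] f] by simp
qed

lemma tensor_lift_lin:
  assumes M: "module R M" and \<beta>: "bilin V W M \<beta>"
  shows "lin (tensor_module R V W) M (tensor_lift R M \<beta>)"
proof (rule linI)
  note [simp del] = free_module_simps
  note N = tensor_relations_submodule
  have l: "lin FF M (ev M \<beta>)" by (rule ev_lin[OF M]) (use bilin_closed[OF \<beta>] in auto)
  note s = tensor_lift_coset[OF M \<beta>] F.quot_add[OF N] F.quot_smult[OF N] lin_add[OF l] lin_smult[OF l] lin_closed[OF l]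
  fix x assume x: "x \<in> carrier (tensor_module R V W)"
  then obtain f where f: "f \<in> carrier FF" "x = tensor_relations R V W +>\<^bsub>FF\<^esub> f"
    unfolding tensor_module_def by (rule F.quot_carrier)
  then show "tensor_lift R M \<beta> x \<in> carrier M" by (simp add: s)
  show "tensor_lift R M \<beta> (c \<odot>\<^bsub>tensor_module R V W\<^esub> x) = c \<odot>\<^bsub>M\<^esub> tensor_lift R M \<beta> x" if "c \<in> carrier R" for c
    using f that by (simp add: s tensor_module_def)
  fix y assume "y \<in> carrier (tensor_module R V W)"
  then obtain g where "g \<in> carrier FF" "y = tensor_relations R V W +>\<^bsub>FF\<^esub> g"
    unfolding tensor_module_def by (rule F.quot_carrier)
  with f show "tensor_lift R M \<beta> (x \<oplus>\<^bsub>tensor_module R V W\<^esub> y) = tensor_lift R M \<beta> x \<oplus>\<^bsub>M\<^esub> tensor_lift R M \<beta> y"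
    by (simp add: s tensor_module_def)
qed

lemma tensor_lift_tens:
  assumes M: "module R M" and \<beta>: "bilin V W M \<beta>" and "v \<in> carrier V" "w \<in> carrier W"
  shows "tensor_lift R M \<beta> (tens R V W v w) = \<beta> v w"
  unfolding tens_def using assms
  by (subst tensor_lift_coset[OF M \<beta>]) (auto simp: delta_in_free ev_delta bilin_closed[OF \<beta>])

text \<open>The uniqueness half of the universal property; identities between linear maps on tensors
  are reduced to pure tensors through it.\<close>

lemma tensor_lin_ext:
  assumes M: "module R M" and f: "lin (tensor_module R V W) M f" and g: "lin (tensor_module R V W) M g"
    and eq: "\<And>v w. v \<in> carrier V \<Longrightarrow> w \<in> carrier W \<Longrightarrow> f (tens R V W v w) = g (tens R V W v w)"
    and t: "t \<in> carrier (tensor_module R V W)"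
  shows "f t = g t"
  using t
proof (induction t rule: tensor_induct)
  case zero
  show ?case by (simp add: lin_zero[OF tensor_module_module M f] lin_zero[OF tensor_module_module M g])
next
  case (add v w t)
  then show ?case using lin_add[OF f, of "tens R V W v w" t] lin_add[OF g, of "tens R V W v w" t] eq
    by simp
qed

end

end

text \<open>Rules showing that an expression is linear in one variable. Each manipulation of a
  Sweedler sum has bilinearity side conditions, and these are solved by resolution with this
  collection.\<close>

named_theorems lin_intros

text \<open>The base field as a module over itself, so that functionals are instances of
  \<open>module_hom\<close> and scalar-valued Sweedler sums are instances of
  \<open>sweedler\<close>.\<close>

definition scalar_module :: "('a, 'm) ring_scheme \<Rightarrow> ('a, 'a) module" where
  "scalar_module k = \<lparr>carrier = carrier k, mult = (\<otimes>\<^bsub>k\<^esub>), one = \<one>\<^bsub>k\<^esub>,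
     zero = \<zero>\<^bsub>k\<^esub>, add = (\<oplus>\<^bsub>k\<^esub>), smult = (\<otimes>\<^bsub>k\<^esub>)\<rparr>"

lemma scalar_module_simps [simp]:
  "carrier (scalar_module k) = carrier k" "\<zero>\<^bsub>scalar_module k\<^esub> = \<zero>\<^bsub>k\<^esub>"
  "x \<oplus>\<^bsub>scalar_module k\<^esub> y = x \<oplus>\<^bsub>k\<^esub> y" "x \<odot>\<^bsub>scalar_module k\<^esub> y = x \<otimes>\<^bsub>k\<^esub> y"
  by (simp_all add: scalar_module_def)

section \<open>Closure properties of linear maps and tensor lifts\<close>

context field
begin

declare tensor_module_module [simp]

abbreviation K1 where "K1 \<equiv> scalar_module R"

abbreviation functional where "functional V f \<equiv> lin V K1 f"

lemma scalar_module_module [simp]: "module R K1"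
proof (rule moduleI)
  show "abelian_group K1"
    by (rule abelian_groupI) (auto simp: a_ac intro: bexI[of _ "\<ominus> _"] l_neg)
qed (auto simp: is_cring l_distr r_distr m_assoc)

lemma finsum_scalar [simp]: "finsum K1 f A = finsum R f A"
  by (simp add: finsum_def finprod_def scalar_module_def)

lemma lin_id [lin_intros]: "lin V V (\<lambda>x. x)"
  by (rule linI) auto

lemma lin_comp: "lin V W g \<Longrightarrow> lin U V f \<Longrightarrow> lin U W (\<lambda>x. g (f x))"
  by (rule linI) (simp_all add: lin_closed lin_add lin_smult)

lemma lin_cong: "lin V W f \<Longrightarrow> (\<And>x. x \<in> carrier V \<Longrightarrow> f x = g x) \<Longrightarrow> module R V \<Longrightarrow> lin V W g"
  by (rule linI)
    (metis lin_closed, metis lin_add module.axioms(2) abelian_groupE(1), metis lin_smult module.smult_closed)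

lemma lin_const_smult [lin_intros]:
  assumes "module R W" "c \<in> carrier R" "lin V W f"
  shows "lin V W (\<lambda>x. c \<odot>\<^bsub>W\<^esub> f x)"
proof -
  interpret W: module R W by fact
  show ?thesis using assms
    by (intro linI) (auto simp: lin_closed lin_add lin_smult W.smult_r_distr W.smult_assoc1[symmetric] m_comm)
qed

lemma lin_smult_vec [lin_intros]:
  assumes "module R W" "w \<in> carrier W" "functional V f"
  shows "lin V W (\<lambda>x. f x \<odot>\<^bsub>W\<^esub> w)"
proof -
  interpret W: module R W by fact
  show ?thesis using assms lin_closed[OF assms(3)]
    by (intro linI) (auto simp: lin_add[OF assms(3)] lin_smult[OF assms(3)] W.smult_l_distr W.smult_assoc1)
qed

lemma lin_scalar_mult1 [lin_intros]:
  "functional V f \<Longrightarrow> c \<in> carrier R \<Longrightarrow> functional V (\<lambda>x. f x \<otimes> c)"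
  using lin_smult_vec[where W = K1 and w = c] by simp

lemma lin_scalar_mult2 [lin_intros]:
  "functional V f \<Longrightarrow> c \<in> carrier R \<Longrightarrow> functional V (\<lambda>x. c \<otimes> f x)"
  using lin_const_smult[where W = K1 and c = c] by simp

lemma lin_plus [lin_intros]:
  assumes "module R W" "lin V W f" "lin V W g"
  shows "lin V W (\<lambda>x. f x \<oplus>\<^bsub>W\<^esub> g x)"
proof -
  interpret W: module R W by fact
  show ?thesis using assms
    by (intro linI) (auto simp: lin_closed lin_add lin_smult W.smult_r_distr W.a_ac)
qed

lemma lin_diff [lin_intros]:
  assumes "module R W" "lin V W f" "lin V W g"
  shows "lin V W (\<lambda>x. f x \<ominus>\<^bsub>W\<^esub> g x)"
proof -
  interpret W: module R W by fact
  note [simp] = lin_closed[OF assms(2)] lin_add[OF assms(2)] lin_smult[OF assms(2)]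
    lin_closed[OF assms(3)] lin_add[OF assms(3)] lin_smult[OF assms(3)]
  show ?thesis
    by (rule linI) (auto simp: a_minus_def W.smult_r_distr W.smult_r_minus W.minus_add W.a_ac)
qed

lemma lin_sum [lin_intros]:
  assumes "module R W" "\<And>i. i \<in> A \<Longrightarrow> lin V W (f i)"
  shows "lin V W (\<lambda>x. \<Oplus>\<^bsub>W\<^esub>i\<in>A. f i x)"
proof -
  interpret W: module R W by fact
  note [simp] = lin_closed[OF assms(2)] lin_add[OF assms(2)] lin_smult[OF assms(2)]
  show ?thesis
  proof (rule linI)
    show "(\<Oplus>\<^bsub>W\<^esub>i\<in>A. f i x) \<in> carrier W" if "x \<in> carrier V" for x using that by (intro W.finsum_closed) auto
    show "(\<Oplus>\<^bsub>W\<^esub>i\<in>A. f i (x \<oplus>\<^bsub>V\<^esub> y)) = (\<Oplus>\<^bsub>W\<^esub>i\<in>A. f i x) \<oplus>\<^bsub>W\<^esub> (\<Oplus>\<^bsub>W\<^esub>i\<in>A. f i y)"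
      if "x \<in> carrier V" "y \<in> carrier V" for x y
    proof -
      have "(\<Oplus>\<^bsub>W\<^esub>i\<in>A. f i (x \<oplus>\<^bsub>V\<^esub> y)) = (\<Oplus>\<^bsub>W\<^esub>i\<in>A. f i x \<oplus>\<^bsub>W\<^esub> f i y)"
        using that by (intro W.finsum_cong') auto
      with that show ?thesis by (simp add: W.finsum_addf)
    qed
    show "(\<Oplus>\<^bsub>W\<^esub>i\<in>A. f i (c \<odot>\<^bsub>V\<^esub> x)) = c \<odot>\<^bsub>W\<^esub> (\<Oplus>\<^bsub>W\<^esub>i\<in>A. f i x)"
      if "x \<in> carrier V" "c \<in> carrier R" for x c
    proof (cases "finite A")
      case True
      have "(\<Oplus>\<^bsub>W\<^esub>i\<in>A. f i (c \<odot>\<^bsub>V\<^esub> x)) = (\<Oplus>\<^bsub>W\<^esub>i\<in>A. c \<odot>\<^bsub>W\<^esub> f i x)"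
        using that by (intro W.finsum_cong') auto
      with True that show ?thesis by (simp add: W.finsum_smult_ldistr)
    qed (use that in auto)
  qed
qed

lemma lin_sum_scalar [lin_intros]:
  "(\<And>i. i \<in> A \<Longrightarrow> functional V (f i)) \<Longrightarrow> functional V (\<lambda>x. \<Oplus>i\<in>A. f i x)"
  by (rule lin_sum[where W = K1, simplified])

lemma lin_tens1 [lin_intros]:
  "module R V \<Longrightarrow> module R W \<Longrightarrow> w \<in> carrier W \<Longrightarrow> lin U V f \<Longrightarrow>
    lin U (tensor_module R V W) (\<lambda>x. tens R V W (f x) w)"
  by (rule lin_comp[OF bilinD2[OF tens_bilin]])

lemma lin_tens2 [lin_intros]:
  "module R V \<Longrightarrow> module R W \<Longrightarrow> v \<in> carrier V \<Longrightarrow> lin U W f \<Longrightarrow>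
    lin U (tensor_module R V W) (\<lambda>x. tens R V W v (f x))"
  by (rule lin_comp[OF bilinD1[OF tens_bilin]])

lemma tensor_lift_lin_arg [lin_intros]:
  "module R V \<Longrightarrow> module R W \<Longrightarrow> module R M \<Longrightarrow> bilin V W M \<beta> \<Longrightarrow> lin U (tensor_module R V W) f \<Longrightarrow>
    lin U M (\<lambda>x. tensor_lift R M \<beta> (f x))"
  by (rule lin_comp[OF tensor_lift_lin])

lemma bilin_cong:
  assumes "bilin V W M \<beta>" "\<And>v w. v \<in> carrier V \<Longrightarrow> w \<in> carrier W \<Longrightarrow> \<beta> v w = \<beta>' v w"
    "module R V" "module R W"
  shows "bilin V W M \<beta>'"
  using assms by (auto intro!: bilinI intro: lin_cong[OF bilinD1] lin_cong[OF bilinD2])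

lemma tensor_lift_cong:
  assumes "module R V" "module R W" "module R M" "bilin V W M \<beta>" "t \<in> carrier (tensor_module R V W)"
    and "\<And>v w. v \<in> carrier V \<Longrightarrow> w \<in> carrier W \<Longrightarrow> \<beta> v w = \<beta>' v w"
  shows "tensor_lift R M \<beta> t = tensor_lift R M \<beta>' t"
proof -
  note b = bilin_cong[OF assms(4,6,1,2)]
  show ?thesis
    by (rule tensor_lin_ext[OF assms(1,2,3) tensor_lift_lin tensor_lift_lin _ assms(5)])
      (use assms b in \<open>simp_all add: tensor_lift_tens\<close>)
qed

lemma lin_tensor_lift:
  assumes V: "module R V" and W: "module R W" and M: "module R M" and M': "module R M'"
    and b: "bilin V W M \<beta>" and F: "lin M M' F" and t: "t \<in> carrier (tensor_module R V W)"
  shows "F (tensor_lift R M \<beta> t) = tensor_lift R M' (\<lambda>v w. F (\<beta> v w)) t"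
proof -
  have b': "bilin V W M' (\<lambda>v w. F (\<beta> v w))"
    by (intro bilinI lin_comp[OF F] bilinD1[OF b] bilinD2[OF b])
  show ?thesis
    by (rule tensor_lin_ext[OF V W M' lin_comp[OF F tensor_lift_lin[OF V W M b]] tensor_lift_lin[OF V W M' b'] _ t])
      (simp add: tensor_lift_tens[OF V W M b] tensor_lift_tens[OF V W M' b'])
qed

text \<open>Linearity in a parameter of the bilinear map. In a nested Sweedler sum the inner
  bilinear map depends on the outer variables, and this rule makes the outer integrand
  bilinear.\<close>

lemma tensor_lift_lin_ker [lin_intros]:
  assumes V: "module R V" and W: "module R W" and M: "module R M" and U: "module R U"
    and t: "t \<in> carrier (tensor_module R V W)"
    and b: "\<And>x. x \<in> carrier U \<Longrightarrow> bilin V W M (\<lambda>v w. \<beta> x v w)"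
    and l: "\<And>v w. v \<in> carrier V \<Longrightarrow> w \<in> carrier W \<Longrightarrow> lin U M (\<lambda>x. \<beta> x v w)"
  shows "lin U M (\<lambda>x. tensor_lift R M (\<lambda>v w. \<beta> x v w) t)"
proof -
  interpret U: module R U by (rule U)
  interpret M: module R M by (rule M)
  note ext = tensor_lin_ext[OF V W M _ _ _ t]
  note T = tensor_lift_tens[OF V W M b] and B = b[THEN tensor_lift_lin[OF V W M]]
  show ?thesis
  proof (rule linI)
    show "tensor_lift R M (\<beta> x) t \<in> carrier M" if "x \<in> carrier U" for x
      using lin_closed[OF B[OF that] t] .
    show "tensor_lift R M (\<beta> (x \<oplus>\<^bsub>U\<^esub> y)) t = tensor_lift R M (\<beta> x) t \<oplus>\<^bsub>M\<^esub> tensor_lift R M (\<beta> y) t"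
      if "x \<in> carrier U" "y \<in> carrier U" for x y
      by (rule ext[OF B lin_plus[OF M B B]]) (use that in \<open>simp_all add: T lin_add[OF l]\<close>)
    show "tensor_lift R M (\<beta> (c \<odot>\<^bsub>U\<^esub> x)) t = c \<odot>\<^bsub>M\<^esub> tensor_lift R M (\<beta> x) t"
      if "c \<in> carrier R" "x \<in> carrier U" for x c
      by (rule ext[OF B lin_const_smult[OF M _ B]]) (use that in \<open>simp_all add: T lin_smult[OF l]\<close>)
  qed
qed

text \<open>The tensors whose lift lies in \<open>U\<close> form a submodule, so only the generators
  matter. This is how the condition \<open>\<Delta>(K) \<subseteq> K \<otimes> K\<close> is
  exploited.\<close>

lemma tensor_lift_mem:
  assumes V: "module R V" and W: "module R W" and M: "module R M" and b: "bilin V W M \<beta>"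
    and U: "LinearCombinations.submodule R U M" and X: "X \<subseteq> carrier V" and Y: "Y \<subseteq> carrier W"
    and \<beta>: "\<And>x y. x \<in> X \<Longrightarrow> y \<in> Y \<Longrightarrow> \<beta> x y \<in> U"
    and t: "t \<in> module.span R (tensor_module R V W) {tens R V W x y | x y. x \<in> X \<and> y \<in> Y}"
  shows "tensor_lift R M \<beta> t \<in> U"
proof -
  interpret T: module R "tensor_module R V W" using V W by simp
  interpret U: LinearCombinations.submodule R U M by (rule U)
  note l = tensor_lift_lin[OF V W M b]
  let ?P = "{t \<in> carrier (tensor_module R V W). tensor_lift R M \<beta> t \<in> U}"
  have "LinearCombinations.submodule R ?P (tensor_module R V W)"
    by unfold_locales
      (auto simp: lin_add[OF l] lin_smult[OF l] lin_zero[OF T.module_axioms M l])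
  moreover have "{tens R V W x y | x y. x \<in> X \<and> y \<in> Y} \<subseteq> ?P"
    using X Y \<beta> by (auto simp: V W subset_iff tensor_lift_tens[OF V W M b])
  ultimately show ?thesis using t T.span_is_subset by blast
qed

text \<open>A Fubini rule: both sides are linear in \<open>s\<close>, and on a pure tensor both
  reduce to the same lift over \<open>t\<close>.\<close>

lemma tensor_lift_swap:
  assumes V: "module R V" "module R W" "module R V'" "module R W'" "module R M"
    and s: "s \<in> carrier (tensor_module R V W)" and t: "t \<in> carrier (tensor_module R V' W')"
    and b1: "\<And>v w. v \<in> carrier V \<Longrightarrow> w \<in> carrier W \<Longrightarrow> bilin V' W' M (\<lambda>v' w'. \<beta> v w v' w')"
    and b2: "\<And>v' w'. v' \<in> carrier V' \<Longrightarrow> w' \<in> carrier W' \<Longrightarrow> bilin V W M (\<lambda>v w. \<beta> v w v' w')"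
  shows "tensor_lift R M (\<lambda>v w. tensor_lift R M (\<lambda>v' w'. \<beta> v w v' w') t) s
      = tensor_lift R M (\<lambda>v' w'. tensor_lift R M (\<lambda>v w. \<beta> v w v' w') s) t"
proof -
  have B1: "bilin V W M (\<lambda>v w. tensor_lift R M (\<lambda>v' w'. \<beta> v w v' w') t)"
    using V t by (intro bilinI tensor_lift_lin_ker[of V' W'] b1 bilinD1[OF b2] bilinD2[OF b2])
  have B2: "bilin V' W' M (\<lambda>v' w'. \<beta> v w v' w')" if "v \<in> carrier V" "w \<in> carrier W" for v w
    using b1 that .
  have L: "lin (tensor_module R V W) M (\<lambda>s. tensor_lift R M (\<lambda>v' w'. tensor_lift R M (\<lambda>v w. \<beta> v w v' w') s) t)"
    using V t by (intro tensor_lift_lin_ker[of V' W'] tensor_lift_lin[of V W] bilinI b2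
        tensor_lift_lin_ker[of V W] bilinD1[OF b1] bilinD2[OF b1]) auto
  show ?thesis
  proof (rule tensor_lin_ext[OF V(1,2,5) tensor_lift_lin[OF V(1,2,5) B1] L _ s])
    fix v w assume vw: "v \<in> carrier V" "w \<in> carrier W"
    have "tensor_lift R M (\<lambda>v' w'. tensor_lift R M (\<lambda>v w. \<beta> v w v' w') (tens R V W v w)) t
        = tensor_lift R M (\<lambda>v' w'. \<beta> v w v' w') t"
      using V vw t by (intro tensor_lift_cong[symmetric, OF _ _ _ B2]) (simp_all add: tensor_lift_tens b2)
    then show "tensor_lift R M (\<lambda>v w. tensor_lift R M (\<lambda>v' w'. \<beta> v w v' w') t) (tens R V W v w)
      = tensor_lift R M (\<lambda>v' w'. tensor_lift R M (\<lambda>v w. \<beta> v w v' w') (tens R V W v w)) t"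
      using V vw by (simp add: tensor_lift_tens B1)
  qed
qed

lemma tensor_map_eq:
  "tensor_map R V W f g t = tensor_lift R (tensor_module R V W) (\<lambda>v w. tens R V W (f v) (g w)) t"
  by (simp add: tensor_map_def)

lemma tensor_map_bilin:
  assumes "module R V" "module R W" "lin V' V f" "lin W' W g"
  shows "bilin V' W' (tensor_module R V W) (\<lambda>v w. tens R V W (f v) (g w))"
  using assms by (auto intro!: bilinI lin_intros simp: lin_closed)

end

section \<open>Sweedler sums\<close>

text \<open>\<open>sweedler k C M \<beta> h\<close> is \<open>\<Sum> \<beta> h\<^sub>(\<^sub>1\<^sub>) h\<^sub>(\<^sub>2\<^sub>)\<close>; iterated sums are nested.\<close>

definition sweedler ::
  "('a, 'm) ring_scheme \<Rightarrow> ('a, 'b, 'n) hopf_scheme \<Rightarrow> ('a, 'd, 'o) module_scheme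
    \<Rightarrow> ('b \<Rightarrow> 'b \<Rightarrow> 'd) \<Rightarrow> 'b \<Rightarrow> 'd" where
  "sweedler k C M \<beta> h = tensor_lift k M \<beta> (comult C h)"

text \<open>Only linearity of the comultiplication is assumed, so that Sweedler sums are available
  on subspaces and quotients before these are known to be Hopf algebras.\<close>

locale comult_space = field k + C: module k C
  for k :: "('a, 'm) ring_scheme" (structure) and C :: "('a, 'b, 'n) hopf_scheme" (structure) +
  assumes comult_lin: "comult C \<in> module_hom k C (tensor_module k C C)"
begin

abbreviation sw where "sw M \<beta> h \<equiv> sweedler k C M \<beta> h"

lemma C_module [simp]: "module k C" by (rule C.module_axioms)

lemma comult_closed [simp]: "h \<in> carrier C \<Longrightarrow> comult C h \<in> carrier (tensor_module k C C)"
  by (rule lin_closed[OF comult_lin])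

lemma sw_lin: "module k M \<Longrightarrow> bilin C C M \<beta> \<Longrightarrow> lin C M (sw M \<beta>)"
  unfolding sweedler_def using comult_lin by (intro lin_intros) auto

lemma sw_lin_arg [lin_intros]:
  "module k M \<Longrightarrow> lin U C f \<Longrightarrow> bilin C C M \<beta> \<Longrightarrow> lin U M (\<lambda>x. sw M \<beta> (f x))"
  by (rule lin_comp[OF sw_lin])

lemma sw_lin_ker [lin_intros]:
  assumes "module k M" "module k U" "h \<in> carrier C"
    and "\<And>x. x \<in> carrier U \<Longrightarrow> bilin C C M (\<lambda>v w. \<beta> x v w)"
    and "\<And>v w. v \<in> carrier C \<Longrightarrow> w \<in> carrier C \<Longrightarrow> lin U M (\<lambda>x. \<beta> x v w)"
  shows "lin U M (\<lambda>x. sw M (\<lambda>v w. \<beta> x v w) h)"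
  unfolding sweedler_def using assms by (intro tensor_lift_lin_ker[of C C]) auto

lemma sw_closed: "module k M \<Longrightarrow> h \<in> carrier C \<Longrightarrow> bilin C C M \<beta> \<Longrightarrow> sw M \<beta> h \<in> carrier M"
  by (rule lin_closed[OF sw_lin])

lemma sw_cong:
  "module k M \<Longrightarrow> h \<in> carrier C \<Longrightarrow> bilin C C M \<beta> \<Longrightarrow>
    (\<And>x y. x \<in> carrier C \<Longrightarrow> y \<in> carrier C \<Longrightarrow> \<beta> x y = \<beta>' x y) \<Longrightarrow> sw M \<beta> h = sw M \<beta>' h"
  unfolding sweedler_def by (rule tensor_lift_cong) auto

lemma sw_hom:
  "module k M \<Longrightarrow> module k M' \<Longrightarrow> h \<in> carrier C \<Longrightarrow> bilin C C M \<beta> \<Longrightarrow> lin M M' F \<Longrightarrow>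
    F (sw M \<beta> h) = sw M' (\<lambda>x y. F (\<beta> x y)) h"
  unfolding sweedler_def by (rule lin_tensor_lift) auto

lemma sw_swap:
  assumes "module k M" "g \<in> carrier C" "h \<in> carrier C"
    and "\<And>v w. v \<in> carrier C \<Longrightarrow> w \<in> carrier C \<Longrightarrow> bilin C C M (\<lambda>v' w'. \<beta> v w v' w')"
    and "\<And>v' w'. v' \<in> carrier C \<Longrightarrow> w' \<in> carrier C \<Longrightarrow> bilin C C M (\<lambda>v w. \<beta> v w v' w')"
  shows "sw M (\<lambda>v w. sw M (\<lambda>v' w'. \<beta> v w v' w') h) g = sw M (\<lambda>v' w'. sw M (\<lambda>v w. \<beta> v w v' w') g) h"
  unfolding sweedler_def using assms by (intro tensor_lift_swap[of C C C C]) auto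

end

section \<open>Finite-dimensional vector spaces\<close>

text \<open>The completeness relation of a basis with its coordinate functionals, which is the form
  in which traces and expansions of tensor legs use it.\<close>

definition dual_basis where
  "dual_basis k V E c \<longleftrightarrow> finite E \<and> E \<subseteq> carrier V \<and>
    (\<forall>b\<in>E. c b \<in> module_hom k V (scalar_module k)) \<and>
    (\<forall>v\<in>carrier V. v = (\<Oplus>\<^bsub>V\<^esub>b\<in>E. c b v \<odot>\<^bsub>V\<^esub> b))"

context vectorspace
begin

lemma coordinates_exist:
  assumes A: "finite A" "basis A"
  obtains c where "dual_basis K V A c" "\<forall>b\<in>A. \<forall>b'\<in>A. c b b' = (if b' = b then \<one>\<^bsub>K\<^esub> else \<zero>\<^bsub>K\<^esub>)"
proof -
  have AV: "A \<subseteq> carrier V" using A(2) by (simp add: basis_def)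
  define a where "a v = (THE a. a \<in> A \<rightarrow>\<^sub>E carrier K \<and> lincomb a A = v)" for v
  have ex1: "\<exists>!a. a \<in> A \<rightarrow>\<^sub>E carrier K \<and> lincomb a A = v" if "v \<in> carrier V" for v
    using basis_criterion[OF A(1) AV] A(2) that by blast
  have a: "a v \<in> A \<rightarrow>\<^sub>E carrier K" "lincomb (a v) A = v" if "v \<in> carrier V" for v
    using theI'[OF ex1[OF that]] unfolding a_def by auto
  have uniq: "a v b = f b" if "v \<in> carrier V" "f \<in> A \<rightarrow> carrier K" "lincomb f A = v" "b \<in> A" for v f b
  proof -
    \<comment> \<open>Uniqueness of coordinates holds among extensional functions, so
      \<open>f\<close> is first cut down to \<open>A\<close>.\<close>
    have "lincomb (restrict f A) A = v"
      using that AV by (subst lincomb_cong[OF refl AV, where b = f]) auto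
    then have "a v = restrict f A"
      using ex1[OF that(1)] a[OF that(1)] that(2) by (metis restrict_PiE_iff Pi_iff restrict_PiE)
    then show ?thesis using that by simp
  qed
  have av: "a v \<in> A \<rightarrow> carrier K" if "v \<in> carrier V" for v using a(1)[OF that] by auto
  show ?thesis
  proof (rule that[of "\<lambda>b v. a v b"])
    show "dual_basis K V A (\<lambda>b v. a v b)"
      unfolding dual_basis_def
    proof (intro conjI ballI A(1) AV)
      fix b assume b: "b \<in> A"
      show "(\<lambda>v. a v b) \<in> module_hom K V (scalar_module K)"
      proof (rule linI)
        show "a (x \<oplus>\<^bsub>V\<^esub> y) b = a x b \<oplus>\<^bsub>scalar_module K\<^esub> a y b"
          if "x \<in> carrier V" "y \<in> carrier V" for x y
          using that b av a(2)
          by (simp, intro uniq[of _ "\<lambda>b. a x b \<oplus>\<^bsub>K\<^esub> a y b"]) (auto simp: lincomb_sum[OF A(1) AV] Pi_iff)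
        show "a (c \<odot>\<^bsub>V\<^esub> x) b = c \<odot>\<^bsub>scalar_module K\<^esub> a x b"
          if "c \<in> carrier K" "x \<in> carrier V" for x c
          using that b av a(2)
          by (simp, intro uniq[of _ "\<lambda>b. c \<otimes>\<^bsub>K\<^esub> a x b"]) (auto simp: lincomb_smult[OF AV] Pi_iff)
      qed (use av b in auto)
    next
      fix v assume "v \<in> carrier V"
      then show "v = (\<Oplus>\<^bsub>V\<^esub>b\<in>A. a v b \<odot>\<^bsub>V\<^esub> b)" using a(2)[of v] by (simp add: lincomb_def)
    qed
    show "\<forall>b\<in>A. \<forall>b'\<in>A. a b' b = (if b' = b then \<one>\<^bsub>K\<^esub> else \<zero>\<^bsub>K\<^esub>)"
    proof (intro ballI)
    fix b b' assume b: "b \<in> A" "b' \<in> A"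
    have "lincomb (\<lambda>x. if b' = x then \<one>\<^bsub>K\<^esub> else \<zero>\<^bsub>K\<^esub>) A = (\<Oplus>\<^bsub>V\<^esub>x\<in>A. if b' = x then x else \<zero>\<^bsub>V\<^esub>)"
      unfolding lincomb_def using AV by (intro finsum_cong') (auto simp: subset_iff)
    also have "\<dots> = b'" using b A(1) AV finsum_singleton[of b' A "\<lambda>x. x"] by auto
    finally show "a b' b = (if b' = b then \<one>\<^bsub>K\<^esub> else \<zero>\<^bsub>K\<^esub>)"
      using b AV by (intro uniq) auto
    qed
  qed
qed

text \<open>A maximal independent subset of \<open>W\<close> spans \<open>W\<close>; enlarging it to
  a maximal independent subset of the whole space gives a basis.\<close>

lemma adapted_basis:
  assumes fd: "fin_dim" and W: "subspace K W V"
  obtains E E' where "finite E" "basis E" "E' \<subseteq> E" "span E' = W"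
proof -
  interpret W: subspace K W V by (rule W)
  interpret Wm: LinearCombinations.submodule K W V by (rule W.submod)
  have fin: "finite S \<and> card S \<le> dim" if "S \<subseteq> carrier V \<and> lin_indpt S" for S
    using that fd by (auto intro: li_le_dim)
  have "lin_indpt {}" by (rule finite_lin_indpt2) auto
  then have "\<exists>A. finite A \<and> maximal A (\<lambda>S. S \<subseteq> W \<and> lin_indpt S)"
    using fin Wm.subset by (intro maximal_exists[where N = dim and B = "{}"]) blast+
  then obtain A where A: "finite A" "maximal A (\<lambda>S. S \<subseteq> W \<and> lin_indpt S)" by blast
  then have AW: "A \<subseteq> W" "lin_indpt A" by (auto simp: maximal_def)
  have "W \<subseteq> span A"
  proof
    fix w assume w: "w \<in> W"
    show "w \<in> span A"
    proof (rule ccontr)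
      assume n: "w \<notin> span A"
      have AV: "A \<subseteq> carrier V" using AW Wm.subset by blast
      then have "w \<notin> A" using n in_own_span by blast
      then have "lin_indpt (A \<union> {w})" using lin_dep_iff_in_span[OF AV AW(2)] w Wm.subset n by blast
      with A(2) AW w have "A \<union> {w} = A" unfolding maximal_def by blast
      with \<open>w \<notin> A\<close> show False by blast
    qed
  qed
  then have span: "span A = W" using span_is_subset[OF AW(1) W.submod] by blast
  have "\<exists>E. finite E \<and> maximal E (\<lambda>S. S \<subseteq> carrier V \<and> lin_indpt S \<and> A \<subseteq> S)"
    using fin AW Wm.subset by (intro maximal_exists[where N = dim and B = A]) blast+
  then obtain E where E: "finite E" "maximal E (\<lambda>S. S \<subseteq> carrier V \<and> lin_indpt S \<and> A \<subseteq> S)" by blast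
  then have "maximal E (\<lambda>S. S \<subseteq> carrier V \<and> lin_indpt S)" unfolding maximal_def by blast
  then have "basis E" by (rule max_li_is_basis)
  with E span that show ?thesis by (auto simp: maximal_def)
qed

text \<open>In a basis adapted to \<open>W\<close>, forget the coordinates outside \<open>W\<close>.
  The retraction plays the part of the injectivity of
  \<open>K \<otimes> K \<rightarrow> H \<otimes> H\<close> over a field.\<close>

lemma retraction_exists:
  assumes fd: "fin_dim" and W: "subspace K W V"
  obtains r where "lin V V r" "\<And>v. v \<in> carrier V \<Longrightarrow> r v \<in> W" "\<And>w. w \<in> W \<Longrightarrow> r w = w"
proof -
  obtain E E' where E: "finite E" "basis E" "E' \<subseteq> E" "span E' = W"
    by (rule adapted_basis[OF assms])
  obtain c where c: "dual_basis K V E c"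
      "\<forall>b\<in>E. \<forall>b'\<in>E. c b b' = (if b' = b then \<one>\<^bsub>K\<^esub> else \<zero>\<^bsub>K\<^esub>)"
    by (rule coordinates_exist[OF E(1,2)])
  have EV: "E \<subseteq> carrier V" using E(2) by (simp add: basis_def)
  have E'V: "E' \<subseteq> carrier V" and finE': "finite E'" using EV E finite_subset by auto
  have l: "functional V (c b)" if "b \<in> E'" for b using that c(1) E(3) by (auto simp: dual_basis_def)
  note [simp] = lin_closed[OF l, simplified]
  define r where "r v = (\<Oplus>\<^bsub>V\<^esub>b\<in>E'. c b v \<odot>\<^bsub>V\<^esub> b)" for v
  have r: "lin V V r" unfolding r_def[abs_def]
    using E'V l by (intro lin_intros) (auto simp: module_axioms)
  have rW: "r v \<in> W" if "v \<in> carrier V" for v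
  proof -
    have "r v = lincomb (\<lambda>b. c b v) E'" by (simp add: r_def lincomb_def)
    moreover have "(\<lambda>b. c b v) \<in> E' \<rightarrow> carrier K" using that by auto
    ultimately show ?thesis using E(4) finE' by (auto simp: span_def)
  qed
  have rid: "r b = b" if b: "b \<in> E'" for b
  proof -
    have "r b = (\<Oplus>\<^bsub>V\<^esub>x\<in>E'. if b = x then x else \<zero>\<^bsub>V\<^esub>)"
      unfolding r_def using b E'V E(3) by (intro finsum_cong') (auto simp: c(2) subset_iff)
    also have "\<dots> = b" using b finE' E'V finsum_singleton[of b E' "\<lambda>x. x"] by auto
    finally show ?thesis .
  qed
  have "r w = w" if "w \<in> W" for w
  proof -
    have "LinearCombinations.submodule K {x \<in> carrier V. r x \<ominus>\<^bsub>V\<^esub> x = \<zero>\<^bsub>V\<^esub>} V"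
      using r by (intro submodule_kernel[OF module_axioms module_axioms] lin_intros module_axioms)
    moreover have "E' \<subseteq> {x \<in> carrier V. r x \<ominus>\<^bsub>V\<^esub> x = \<zero>\<^bsub>V\<^esub>}"
      using E'V rid lin_closed[OF r] by auto
    ultimately have "span E' \<subseteq> {x \<in> carrier V. r x \<ominus>\<^bsub>V\<^esub> x = \<zero>\<^bsub>V\<^esub>}" using span_is_subset by blast
    with that E(4) have "w \<in> carrier V" "r w \<ominus>\<^bsub>V\<^esub> w = \<zero>\<^bsub>V\<^esub>" by auto
    then show ?thesis using lin_closed[OF r] by simp
  qed
  with r rW that show ?thesis by blast
qed

lemma dual_basis_exists:
  assumes fd: "fin_dim"
  obtains E c where "dual_basis K V E c"
  using finite_basis_exists[OF fd] coordinates_exist by metis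

lemma functional_separates:
  assumes fd: "fin_dim" and x: "x \<in> carrier V" and f: "\<And>f. functional V f \<Longrightarrow> f x = \<zero>\<^bsub>K\<^esub>"
  shows "x = \<zero>\<^bsub>V\<^esub>"
proof -
  obtain E c where c: "dual_basis K V E c" using dual_basis_exists[OF fd] .
  then have "x = (\<Oplus>\<^bsub>V\<^esub>b\<in>E. c b x \<odot>\<^bsub>V\<^esub> b)" using x by (simp add: dual_basis_def)
  also have "\<dots> = (\<Oplus>\<^bsub>V\<^esub>b\<in>E. \<zero>\<^bsub>V\<^esub>)"
  proof (intro finsum_cong' refl)
    fix b assume "b \<in> E"
    then have "c b x = \<zero>\<^bsub>K\<^esub>" "b \<in> carrier V" using c f by (auto simp: dual_basis_def)
    then show "c b x \<odot>\<^bsub>V\<^esub> b = \<zero>\<^bsub>V\<^esub>" by simp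
  qed auto
  finally show ?thesis by simp
qed

text \<open>The image of a basis stays independent and has the right cardinality, so it is a basis.
  The case of interest is the antipode.\<close>

lemma inj_endo_surj:
  assumes fd: "fin_dim" and T: "lin V V T" and inj: "\<And>x. x \<in> carrier V \<Longrightarrow> T x = \<zero>\<^bsub>V\<^esub> \<Longrightarrow> x = \<zero>\<^bsub>V\<^esub>"
    and y: "y \<in> carrier V"
  shows "\<exists>x\<in>carrier V. T x = y"
proof -
  obtain A where A: "finite A" "basis A" using finite_basis_exists[OF fd] by blast
  have AV: "A \<subseteq> carrier V" and li: "lin_indpt A" using A(2) by (auto simp: basis_def)
  have inj_on: "inj_on T (carrier V)"
  proof (rule inj_onI)
    fix a b assume ab: "a \<in> carrier V" "b \<in> carrier V" "T a = T b"
    then have "T (a \<ominus>\<^bsub>V\<^esub> b) = \<zero>\<^bsub>V\<^esub>"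
      using lin_minus[OF module_axioms module_axioms T] lin_closed[OF T] by simp
    then show "a = b" using ab inj[of "a \<ominus>\<^bsub>V\<^esub> b"] by simp
  qed
  note Tc = lin_closed[OF T]
  have lin_T: "lincomb a (T ` A) = T (lincomb (\<lambda>x. a (T x)) A)" if a: "a \<in> T ` A \<rightarrow> carrier K" for a
  proof -
    have aT: "a (T x) \<in> carrier K" "x \<in> carrier V" if "x \<in> A" for x using a AV that by auto
    have "lincomb a (T ` A) = (\<Oplus>\<^bsub>V\<^esub>x\<in>A. a (T x) \<odot>\<^bsub>V\<^esub> T x)"
      unfolding lincomb_def using that AV Tc
      by (subst finsum_bij[OF abelian_monoid_axioms, of T A]) (auto intro!: inj_on_imp_bij_betw inj_on_subset[OF inj_on])
    also have "\<dots> = (\<Oplus>\<^bsub>V\<^esub>x\<in>A. T (a (T x) \<odot>\<^bsub>V\<^esub> x))"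
      by (intro finsum_cong' refl) (auto simp: aT Tc lin_smult[OF T])
    also have "\<dots> = T (\<Oplus>\<^bsub>V\<^esub>x\<in>A. a (T x) \<odot>\<^bsub>V\<^esub> x)"
      using that AV by (intro lin_finsum[OF module_axioms module_axioms T, symmetric]) auto
    finally show ?thesis by (simp add: lincomb_def)
  qed
  have "lin_indpt (T ` A)"
  proof (rule finite_lin_indpt2)
    fix a assume a: "a \<in> T ` A \<rightarrow> carrier K" "lincomb a (T ` A) = \<zero>\<^bsub>V\<^esub>"
    have c: "(\<lambda>x. a (T x)) \<in> A \<rightarrow> carrier K" using a by auto
    then have "lincomb (\<lambda>x. a (T x)) A = \<zero>\<^bsub>V\<^esub>" using inj lin_T[OF a(1)] a(2) AV by auto
    then have "(\<lambda>x. a (T x)) \<in> A \<rightarrow> {\<zero>\<^bsub>K\<^esub>}" using not_lindepD[OF li A(1) subset_refl c] by simp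
    then show "\<forall>v\<in>T ` A. a v = \<zero>\<^bsub>K\<^esub>" by auto
  qed (use A AV Tc in auto)
  moreover have "card (T ` A) = dim"
    using dim_basis[OF A] card_image[OF inj_on_subset[OF inj_on AV]] by simp
  ultimately have "basis (T ` A)"
    using fd A AV Tc by (intro dim_li_is_basis) auto
  then have "y \<in> span (T ` A)" using y by (simp add: basis_def)
  then obtain a where "a \<in> T ` A \<rightarrow> carrier K" "lincomb a (T ` A) = y"
    using finite_in_span[of "T ` A" y] A AV Tc by auto
  moreover from this have "lincomb (\<lambda>x. a (T x)) A \<in> carrier V" using AV by (intro lincomb_closed) auto
  ultimately show ?thesis using lin_T by metis
qed

end

section \<open>Coassociativity\<close>

context field
begin

lemma tensor_lift_comp:
  assumes "module R V" "module R W" "module R V'" "module R W'" "module R M"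
    and "lin V' V f" "lin W' W g" "bilin V W M \<beta>" "t \<in> carrier (tensor_module R V' W')"
  shows "tensor_lift R M \<beta> (tensor_lift R (tensor_module R V W) (\<lambda>v w. tens R V W (f v) (g w)) t)
    = tensor_lift R M (\<lambda>v w. \<beta> (f v) (g w)) t"
proof -
  have b: "bilin V' W' (tensor_module R V W) (\<lambda>v w. tens R V W (f v) (g w))"
    using assms by (intro tensor_map_bilin)
  then have "bilin V' W' M (\<lambda>v w. tensor_lift R M \<beta> (tens R V W (f v) (g w)))"
    by (intro bilinI lin_comp[OF tensor_lift_lin[OF assms(1,2,5,8)]] bilinD1[OF b] bilinD2[OF b])
  with b show ?thesis using assms
    by (subst lin_tensor_lift[OF assms(3,4) _ assms(5) _ tensor_lift_lin[OF assms(1,2,5,8)] assms(9)])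
      (auto intro!: tensor_lift_cong[of V' W'] simp: tensor_lift_tens lin_closed)
qed

lemma tensor_lift_self:
  "module R V \<Longrightarrow> module R W \<Longrightarrow> t \<in> carrier (tensor_module R V W) \<Longrightarrow>
    tensor_lift R (tensor_module R V W) (tens R V W) t = t"
  by (rule tensor_lin_ext[OF _ _ _ tensor_lift_lin lin_id])
    (auto simp: tens_bilin tensor_lift_tens)

end

context comult_space
begin

abbreviation CC where "CC \<equiv> tensor_module k C C"
abbreviation CCC where "CCC \<equiv> tensor_module k C CC"

lemma comult_sw: "h \<in> carrier C \<Longrightarrow> comult C h = sw CC (tens k C C) h"
  by (simp add: sweedler_def tensor_lift_self)

definition "trilin M \<tau> \<longleftrightarrow>
  (\<forall>y\<in>carrier C. \<forall>z\<in>carrier C. lin C M (\<lambda>x. \<tau> x y z)) \<and>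
  (\<forall>x\<in>carrier C. \<forall>z\<in>carrier C. lin C M (\<lambda>y. \<tau> x y z)) \<and>
  (\<forall>x\<in>carrier C. \<forall>y\<in>carrier C. lin C M (\<lambda>z. \<tau> x y z))"

lemma trilinI:
  assumes "\<And>y z. y \<in> carrier C \<Longrightarrow> z \<in> carrier C \<Longrightarrow> lin C M (\<lambda>x. \<tau> x y z)"
    and "\<And>x z. x \<in> carrier C \<Longrightarrow> z \<in> carrier C \<Longrightarrow> lin C M (\<lambda>y. \<tau> x y z)"
    and "\<And>x y. x \<in> carrier C \<Longrightarrow> y \<in> carrier C \<Longrightarrow> lin C M (\<lambda>z. \<tau> x y z)"
  shows "trilin M \<tau>"
  using assms by (simp add: trilin_def)

lemma trilin_bilin:
  assumes "trilin M \<tau>"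
  shows "x \<in> carrier C \<Longrightarrow> bilin C C M (\<lambda>y z. \<tau> x y z)"
    "y \<in> carrier C \<Longrightarrow> bilin C C M (\<lambda>x z. \<tau> x y z)"
    "z \<in> carrier C \<Longrightarrow> bilin C C M (\<lambda>x y. \<tau> x y z)"
  using assms by (auto simp: trilin_def intro!: bilinI)

lemma trilin_bilin_sw1:
  assumes M: "module k M" and \<tau>: "trilin M \<tau>"
  shows "bilin C C M (\<lambda>x z. sw M (\<lambda>x1 x2. \<tau> x1 x2 z) x)"
  using M \<tau> by (intro bilinI lin_intros trilin_bilin[OF \<tau>]) (auto simp: trilin_def)

lemma trilin_bilin_sw2:
  assumes M: "module k M" and \<tau>: "trilin M \<tau>"
  shows "bilin C C M (\<lambda>x z. sw M (\<lambda>z1 z2. \<tau> x z1 z2) z)"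
  using M \<tau> by (intro bilinI lin_intros trilin_bilin[OF \<tau>]) (auto simp: trilin_def)

abbreviation (input) "tens3 x y z \<equiv> tens k C CC x (tens k C C y z)"

lemma tens3_trilin: "trilin CCC (\<lambda>x y z. tens3 x y z)"
  by (intro trilinI lin_intros) auto

lemma coassoc_lhs:
  assumes h: "h \<in> carrier C"
  shows "tensor_assoc k C C C (tensor_map k CC C (comult C) id (comult C h))
    = sw CCC (\<lambda>x y. sw CCC (\<lambda>x1 x2. tens3 x1 x2 y) x) h"
proof -
  have b: "bilin CC C CCC (\<lambda>s w. tensor_lift k CCC (\<lambda>u v. tens3 u v w) s)"
    by (intro bilinI lin_intros) (auto intro: lin_id)
  show ?thesis
    unfolding tensor_assoc_def Let_def tensor_map_eq sweedler_def id_def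
    by (subst tensor_lift_comp[of CC C C C CCC "comult C" "\<lambda>x. x"])
      (use comult_lin h b in \<open>auto intro!: lin_id\<close>)
qed

lemma coassoc_rhs:
  assumes h: "h \<in> carrier C"
  shows "tensor_map k C CC id (comult C) (comult C h)
    = sw CCC (\<lambda>x y. sw CCC (\<lambda>y1 y2. tens3 x y1 y2) y) h"
proof -
  have eq: "tens k C CC x (comult C y) = sw CCC (\<lambda>y1 y2. tens3 x y1 y2) y"
    if "x \<in> carrier C" "y \<in> carrier C" for x y
    using that by (subst comult_sw, simp, subst sw_hom[of CC CCC]) (auto intro!: lin_intros bilinI)
  have "bilin C C CCC (\<lambda>x y. tens k C CC x (comult C y))"
    using comult_lin by (intro bilinI lin_intros) auto
  then have "sw CCC (\<lambda>x y. tens k C CC x (comult C y)) h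
      = sw CCC (\<lambda>x y. sw CCC (\<lambda>y1 y2. tens3 x y1 y2) y) h"
    using h eq by (intro sw_cong) auto
  then show ?thesis by (simp add: tensor_map_eq sweedler_def)
qed

text \<open>A trilinear \<open>\<tau>\<close> factors through a linear map \<open>F\<close> on
  \<open>C \<otimes> (C \<otimes> C)\<close>; the nested form of coassociativity is the image of the
  tensor identity under \<open>F\<close>.\<close>

lemma sw_coassoc_if:
  assumes ax: "tensor_assoc k C C C (tensor_map k CC C (comult C) id (comult C h))
      = tensor_map k C CC id (comult C) (comult C h)"
    and h: "h \<in> carrier C" and M: "module k M" and \<tau>: "trilin M \<tau>"
  shows "sw M (\<lambda>x z. sw M (\<lambda>x1 x2. \<tau> x1 x2 z) x) h = sw M (\<lambda>x z. sw M (\<lambda>z1 z2. \<tau> x z1 z2) z) h"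
proof -
  define F where "F = tensor_lift k M (\<lambda>x s. tensor_lift k M (\<lambda>y z. \<tau> x y z) s)"
  have b: "bilin C CC M (\<lambda>x s. tensor_lift k M (\<lambda>y z. \<tau> x y z) s)"
    using M \<tau> by (intro bilinI lin_intros trilin_bilin[OF \<tau>]) (auto simp: trilin_def intro: lin_id)
  have F: "lin CCC M F" unfolding F_def using M b by (intro tensor_lift_lin) auto
  have FT: "F (tens3 x y z) = \<tau> x y z" if "x \<in> carrier C" "y \<in> carrier C" "z \<in> carrier C" for x y z
    unfolding F_def using M b that \<tau>
    by (simp add: tensor_lift_tens[of C CC] tensor_lift_tens[of C C] trilin_bilin)
  note T = tens3_trilin
  have t: "trilin M (\<lambda>x y z. F (tens3 x y z))"
    using T by (auto simp: trilin_def intro!: lin_comp[OF F])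
  note B = trilin_bilin_sw1[OF _ T] trilin_bilin_sw2[OF _ T] trilin_bilin_sw1[OF M t] trilin_bilin_sw2[OF M t]
     trilin_bilin[OF T] trilin_bilin[OF t]
  have "F (sw CCC (\<lambda>x y. sw CCC (\<lambda>x1 x2. tens3 x1 x2 y) x) h) = sw M (\<lambda>x y. sw M (\<lambda>x1 x2. F (tens3 x1 x2 y)) x) h"
  proof -
    have "F (sw CCC (\<lambda>x1 x2. tens3 x1 x2 y) x) = sw M (\<lambda>x1 x2. F (tens3 x1 x2 y)) x"
      if "x \<in> carrier C" "y \<in> carrier C" for x y
      using M that F B by (intro sw_hom) auto
    then show ?thesis using M h F B by (subst sw_hom[where M' = M]) (auto intro!: sw_cong[symmetric])
  qed
  also have "\<dots> = sw M (\<lambda>x y. sw M (\<lambda>x1 x2. \<tau> x1 x2 y) x) h"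
    using M h B by (intro sw_cong) (auto simp: FT)
  finally have l: "F (sw CCC (\<lambda>x y. sw CCC (\<lambda>x1 x2. tens3 x1 x2 y) x) h) = sw M (\<lambda>x y. sw M (\<lambda>x1 x2. \<tau> x1 x2 y) x) h" .
  have "F (sw CCC (\<lambda>x y. sw CCC (\<lambda>x1 x2. tens3 x x1 x2) y) h) = sw M (\<lambda>x y. sw M (\<lambda>x1 x2. F (tens3 x x1 x2)) y) h"
  proof -
    have "F (sw CCC (\<lambda>x1 x2. tens3 x x1 x2) y) = sw M (\<lambda>x1 x2. F (tens3 x x1 x2)) y"
      if "x \<in> carrier C" "y \<in> carrier C" for x y
      using M that F B by (intro sw_hom) auto
    then show ?thesis using M h F B by (subst sw_hom[where M' = M]) (auto intro!: sw_cong[symmetric])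
  qed
  also have "\<dots> = sw M (\<lambda>x y. sw M (\<lambda>x1 x2. \<tau> x x1 x2) y) h"
    using M h B by (intro sw_cong) (auto simp: FT)
  finally show ?thesis using l ax h by (simp add: coassoc_lhs coassoc_rhs)
qed

end

section \<open>Changing the irrelevant fields of a record\<close>

lemma abelian_group_cong:
  assumes "abelian_group M" "carrier M' = carrier M" "add M' = add M" "zero M' = zero M"
  shows "abelian_group M'"
proof -
  interpret M: abelian_group M by fact
  show ?thesis
    by (rule abelian_groupI) (auto simp: assms M.a_ac intro: bexI[of _ "\<ominus>\<^bsub>M\<^esub> _"] M.l_neg)
qed

lemma module_cong:
  assumes "module R M" "carrier M' = carrier M" "add M' = add M" "zero M' = zero M" "smult M' = smult M"
  shows "module R M'"
proof -
  interpret M: module R M by fact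
  have "abelian_group M'" by (rule abelian_group_cong[OF M.abelian_group_axioms assms(2-4)])
  then show ?thesis
    by (rule moduleI[OF M.is_cring])
      (simp_all add: assms M.smult_l_distr M.smult_r_distr M.smult_assoc1)
qed

lemma ring_cong:
  assumes "ring M" "carrier M' = carrier M" "add M' = add M" "zero M' = zero M"
    "mult M' = mult M" "one M' = one M"
  shows "ring M'"
proof -
  interpret M: ring M by fact
  have "abelian_group M'" by (rule abelian_group_cong[OF M.abelian_group_axioms assms(2-4)])
  moreover have "monoid M'" by (rule monoidI) (simp_all add: assms M.m_assoc)
  ultimately show ?thesis by (rule ringI) (simp_all add: assms M.l_distr M.r_distr)
qed

text \<open>Tensor products see only carrier, addition and scalar multiplication. Hence the
  comultiplications of \<open>sub_hopf\<close> and \<open>quot_hopf\<close>, which are defined with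
  the bare underlying space, take values in the tensor square of the finished record.\<close>

lemma tensor_module_cong:
  assumes "carrier V' = carrier V" "add V' = add V" "smult V' = smult V"
    "carrier W' = carrier W" "add W' = add W" "smult W' = smult W"
  shows "tensor_module k V' W' = tensor_module k V W" "tens k V' W' = tens k V W"
  using assms
  by (simp_all add: tensor_module_def tens_def fun_eq_iff tensor_relations_def bilinear_relators_def)

lemma module_hom_cong:
  assumes "carrier V' = carrier V" "add V' = add V" "smult V' = smult V"
    "carrier W' = carrier W" "add W' = add W" "smult W' = smult W"
  shows "module_hom k V' W' = module_hom k V W"
  using assms by (simp add: module_hom_def)

lemma tensor_algebra_simps [simp]:
  "carrier (tensor_algebra k V W) = carrier (tensor_module k V W)"
  "add (tensor_algebra k V W) = add (tensor_module k V W)"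
  "zero (tensor_algebra k V W) = zero (tensor_module k V W)"
  "smult (tensor_algebra k V W) = smult (tensor_module k V W)"
  "\<one>\<^bsub>tensor_algebra k V W\<^esub> = tens k V W \<one>\<^bsub>V\<^esub> \<one>\<^bsub>W\<^esub>"
  by (simp_all add: tensor_algebra_def Let_def)

lemma module_hom_tensor_algebra [simp]:
  "module_hom k U (tensor_algebra k V W) = module_hom k U (tensor_module k V W)"
  by (rule module_hom_cong) simp_all

section \<open>Sweedler calculus in a Hopf algebra\<close>

lemma tensor_algebra_mult_comult:
  "comult C g \<otimes>\<^bsub>tensor_algebra k C C\<^esub> comult C h =
    sweedler k C (tensor_module k C C)
      (\<lambda>x y. sweedler k C (tensor_module k C C) (\<lambda>u v. tens k C C (x \<otimes>\<^bsub>C\<^esub> u) (y \<otimes>\<^bsub>C\<^esub> v)) h) g"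
  by (simp add: tensor_algebra_def Let_def sweedler_def)

text \<open>The axioms as identities between nested Sweedler sums, the form in which they pass to
  subalgebras and quotients.\<close>

lemma (in comult_space) hopf_algebraI:
  assumes "assoc_algebra k C"
    and mult: "\<And>g h. g \<in> carrier C \<Longrightarrow> h \<in> carrier C \<Longrightarrow>
      sw CC (tens k C C) (g \<otimes>\<^bsub>C\<^esub> h) = sw CC (\<lambda>x y. sw CC (\<lambda>u v. tens k C C (x \<otimes>\<^bsub>C\<^esub> u) (y \<otimes>\<^bsub>C\<^esub> v)) h) g"
    and one: "comult C \<one>\<^bsub>C\<^esub> = tens k C C \<one>\<^bsub>C\<^esub> \<one>\<^bsub>C\<^esub>"
    and counit: "counit C \<in> ring_hom C k"
      "\<And>c x. \<lbrakk>c \<in> carrier k; x \<in> carrier C\<rbrakk> \<Longrightarrow> counit C (c \<odot>\<^bsub>C\<^esub> x) = c \<otimes>\<^bsub>k\<^esub> counit C x"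
    and coassoc: "\<And>h. h \<in> carrier C \<Longrightarrow>
      sw CCC (\<lambda>x y. sw CCC (\<lambda>x1 x2. tens3 x1 x2 y) x) h = sw CCC (\<lambda>x y. sw CCC (\<lambda>y1 y2. tens3 x y1 y2) y) h"
    and counit_lr: "\<And>h. h \<in> carrier C \<Longrightarrow> sw C (\<lambda>x y. counit C x \<odot>\<^bsub>C\<^esub> y) h = h"
      "\<And>h. h \<in> carrier C \<Longrightarrow> sw C (\<lambda>x y. counit C y \<odot>\<^bsub>C\<^esub> x) h = h"
    and antipode: "antipode C \<in> module_hom k C C"
      "\<And>h. h \<in> carrier C \<Longrightarrow> sw C (\<lambda>x y. antipode C x \<otimes>\<^bsub>C\<^esub> y) h = counit C h \<odot>\<^bsub>C\<^esub> \<one>\<^bsub>C\<^esub>"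
      "\<And>h. h \<in> carrier C \<Longrightarrow> sw C (\<lambda>x y. x \<otimes>\<^bsub>C\<^esub> antipode C y) h = counit C h \<odot>\<^bsub>C\<^esub> \<one>\<^bsub>C\<^esub>"
  shows "hopf_algebra k C"
proof -
  interpret A: assoc_algebra k C by fact
  show ?thesis
  proof (intro hopf_algebra.intro hopf_algebra_axioms.intro assms(1) counit antipode)
    show "comult C \<in> ring_hom C (tensor_algebra k C C)"
    proof (rule ring_hom_memI)
      fix x y assume "x \<in> carrier C" "y \<in> carrier C"
      then show "comult C (x \<otimes>\<^bsub>C\<^esub> y) = comult C x \<otimes>\<^bsub>tensor_algebra k C C\<^esub> comult C y"
        using mult[of x y] comult_sw[of "x \<otimes>\<^bsub>C\<^esub> y"] unfolding tensor_algebra_mult_comult by simp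
    qed (use one lin_add[OF comult_lin] in auto)
    show "comult C \<in> module_hom k C (tensor_algebra k C C)" using comult_lin by simp
  qed (use coassoc counit_lr antipode in \<open>simp_all add: coassoc_lhs coassoc_rhs sweedler_def[symmetric]\<close>)
qed

sublocale hopf_algebra \<subseteq> comult_space k H
  by unfold_locales (use comult_linear in simp)

context hopf_algebra
begin

lemma lin_mult_right [lin_intros]:
  "lin V H f \<Longrightarrow> c \<in> carrier H \<Longrightarrow> lin V H (\<lambda>x. f x \<otimes>\<^bsub>H\<^esub> c)"
  by (rule linI) (simp_all add: lin_closed lin_add lin_smult smult_mult_left l_distr)

lemma lin_mult_left [lin_intros]:
  "lin V H f \<Longrightarrow> c \<in> carrier H \<Longrightarrow> lin V H (\<lambda>x. c \<otimes>\<^bsub>H\<^esub> f x)"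
  by (rule linI) (simp_all add: lin_closed lin_add lin_smult smult_mult_right r_distr)

lemma antipode_lin [lin_intros]: "lin V H f \<Longrightarrow> lin V H (\<lambda>x. antipode H (f x))"
  by (rule lin_comp[OF antipode_linear])

lemma antipode_closed [simp, intro]: "x \<in> carrier H \<Longrightarrow> antipode H x \<in> carrier H"
  by (rule lin_closed[OF antipode_linear])

lemma counit_closed [simp, intro]: "x \<in> carrier H \<Longrightarrow> counit H x \<in> carrier k"
  using counit_ring_hom by (rule ring_hom_closed)

lemma counit_functional: "functional H (counit H)"
  by (rule linI) (simp_all add: ring_hom_add[OF counit_ring_hom] counit_linear)

lemma counit_lin [lin_intros]: "lin V H f \<Longrightarrow> functional V (\<lambda>x. counit H (f x))"
  by (rule lin_comp[OF counit_functional])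

lemma counit_mult [simp]:
  "x \<in> carrier H \<Longrightarrow> y \<in> carrier H \<Longrightarrow> counit H (x \<otimes>\<^bsub>H\<^esub> y) = counit H x \<otimes>\<^bsub>k\<^esub> counit H y"
  using counit_ring_hom by (rule ring_hom_mult)

lemma counit_one [simp]: "counit H \<one>\<^bsub>H\<^esub> = \<one>\<^bsub>k\<^esub>"
  using counit_ring_hom by (rule ring_hom_one)

lemma sw_coassoc:
  assumes "module k M" "h \<in> carrier H"
    and "\<And>y z. y \<in> carrier H \<Longrightarrow> z \<in> carrier H \<Longrightarrow> lin H M (\<lambda>x. \<tau> x y z)"
    and "\<And>x z. x \<in> carrier H \<Longrightarrow> z \<in> carrier H \<Longrightarrow> lin H M (\<lambda>y. \<tau> x y z)"
    and "\<And>x y. x \<in> carrier H \<Longrightarrow> y \<in> carrier H \<Longrightarrow> lin H M (\<lambda>z. \<tau> x y z)"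
  shows "sw M (\<lambda>x z. sw M (\<lambda>x1 x2. \<tau> x1 x2 z) x) h = sw M (\<lambda>x z. sw M (\<lambda>z1 z2. \<tau> x z1 z2) z) h"
  by (rule sw_coassoc_if[OF coassoc]) (use assms in \<open>auto intro!: trilinI\<close>)

lemma sw_mult:
  assumes M: "module k M" and \<beta>: "bilin H H M \<beta>" and g: "g \<in> carrier H" and h: "h \<in> carrier H"
  shows "sw M \<beta> (g \<otimes>\<^bsub>H\<^esub> h) = sw M (\<lambda>x y. sw M (\<lambda>u v. \<beta> (x \<otimes>\<^bsub>H\<^esub> u) (y \<otimes>\<^bsub>H\<^esub> v)) h) g"
proof -
  let ?F = "tensor_lift k M \<beta>" and ?t = "\<lambda>x y u v. tens k H H (x \<otimes>\<^bsub>H\<^esub> u) (y \<otimes>\<^bsub>H\<^esub> v)"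
  have F: "lin CC M ?F" using M \<beta> by (intro tensor_lift_lin) auto
  have t1: "bilin H H CC (?t x y)" if "x \<in> carrier H" "y \<in> carrier H" for x y
    using that by (intro bilinI lin_intros) auto
  have t2: "bilin H H CC (\<lambda>x y. sw CC (?t x y) h)"
    using h by (intro bilinI lin_intros) auto
  have "comult H (g \<otimes>\<^bsub>H\<^esub> h) = sw CC (\<lambda>x y. sw CC (?t x y) h) g"
    using ring_hom_mult[OF comult_ring_hom g h] by (simp add: tensor_algebra_mult_comult)
  then have "sw M \<beta> (g \<otimes>\<^bsub>H\<^esub> h) = ?F (sw CC (\<lambda>x y. sw CC (?t x y) h) g)"
    by (simp add: sweedler_def[of _ _ _ _ "g \<otimes>\<^bsub>H\<^esub> h"])
  also have "\<dots> = sw M (\<lambda>x y. ?F (sw CC (?t x y) h)) g"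
    using M g t2 F by (intro sw_hom) auto
  also have "\<dots> = sw M (\<lambda>x y. sw M (\<lambda>u v. \<beta> (x \<otimes>\<^bsub>H\<^esub> u) (y \<otimes>\<^bsub>H\<^esub> v)) h) g"
  proof (rule sw_cong)
    show "bilin H H M (\<lambda>x y. ?F (sw CC (?t x y) h))"
      by (intro bilinI lin_comp[OF F] bilinD1[OF t2] bilinD2[OF t2])
    fix x y assume xy: "x \<in> carrier H" "y \<in> carrier H"
    have "?F (sw CC (?t x y) h) = sw M (\<lambda>u v. ?F (?t x y u v)) h"
      using xy M h t1 F by (intro sw_hom) auto
    also have "\<dots> = sw M (\<lambda>u v. \<beta> (x \<otimes>\<^bsub>H\<^esub> u) (y \<otimes>\<^bsub>H\<^esub> v)) h"
      using xy M h \<beta> t1[OF xy]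
      by (intro sw_cong bilinI lin_comp[OF F] bilinD1[OF t1] bilinD2[OF t1]) (auto simp: tensor_lift_tens)
    finally show "?F (sw CC (?t x y) h) = sw M (\<lambda>u v. \<beta> (x \<otimes>\<^bsub>H\<^esub> u) (y \<otimes>\<^bsub>H\<^esub> v)) h" .
  qed (use M g in auto)
  finally show ?thesis .
qed

lemma sw_one: "module k M \<Longrightarrow> bilin H H M \<beta> \<Longrightarrow> sw M \<beta> \<one>\<^bsub>H\<^esub> = \<beta> \<one>\<^bsub>H\<^esub> \<one>\<^bsub>H\<^esub>"
  using ring_hom_one[OF comult_ring_hom] by (simp add: sweedler_def tensor_lift_tens)

text \<open>The linear map \<open>F\<close> stands for the surrounding expression, so that a counit
  can be cancelled deep inside a formula. The three rules that follow are built in the same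
  way.\<close>

lemma sw_counit_left:
  assumes "module k M" "lin H M F" "h \<in> carrier H"
  shows "sw M (\<lambda>x y. counit H x \<odot>\<^bsub>M\<^esub> F y) h = F h"
proof -
  have b: "bilin H H H (\<lambda>x y. counit H x \<odot>\<^bsub>H\<^esub> y)" by (intro bilinI lin_intros) auto
  have "F h = F (sw H (\<lambda>x y. counit H x \<odot>\<^bsub>H\<^esub> y) h)" using counit_left assms by (simp add: sweedler_def)
  also have "\<dots> = sw M (\<lambda>x y. F (counit H x \<odot>\<^bsub>H\<^esub> y)) h" using assms b by (intro sw_hom) auto
  also have "\<dots> = sw M (\<lambda>x y. counit H x \<odot>\<^bsub>M\<^esub> F y) h"
    using assms by (intro sw_cong bilinI lin_comp[OF assms(2)] bilinD1[OF b] bilinD2[OF b]) (auto simp: lin_smult)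
  finally show ?thesis by simp
qed

lemma sw_counit_right:
  assumes "module k M" "lin H M F" "h \<in> carrier H"
  shows "sw M (\<lambda>x y. counit H y \<odot>\<^bsub>M\<^esub> F x) h = F h"
proof -
  have b: "bilin H H H (\<lambda>x y. counit H y \<odot>\<^bsub>H\<^esub> x)" by (intro bilinI lin_intros) auto
  have "F h = F (sw H (\<lambda>x y. counit H y \<odot>\<^bsub>H\<^esub> x) h)" using counit_right assms by (simp add: sweedler_def)
  also have "\<dots> = sw M (\<lambda>x y. F (counit H y \<odot>\<^bsub>H\<^esub> x)) h" using assms b by (intro sw_hom) auto
  also have "\<dots> = sw M (\<lambda>x y. counit H y \<odot>\<^bsub>M\<^esub> F x) h"
    using assms by (intro sw_cong bilinI lin_comp[OF assms(2)] bilinD1[OF b] bilinD2[OF b]) (auto simp: lin_smult)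
  finally show ?thesis by simp
qed

lemma sw_antipode_left:
  assumes "module k M" "lin H M F" "h \<in> carrier H"
  shows "sw M (\<lambda>x y. F (antipode H x \<otimes>\<^bsub>H\<^esub> y)) h = counit H h \<odot>\<^bsub>M\<^esub> F \<one>\<^bsub>H\<^esub>"
proof -
  have b: "bilin H H H (\<lambda>x y. antipode H x \<otimes>\<^bsub>H\<^esub> y)" by (intro bilinI lin_intros) auto
  have "sw M (\<lambda>x y. F (antipode H x \<otimes>\<^bsub>H\<^esub> y)) h = F (sw H (\<lambda>x y. antipode H x \<otimes>\<^bsub>H\<^esub> y) h)"
    using assms b by (intro sw_hom[symmetric]) auto
  also have "\<dots> = F (counit H h \<odot>\<^bsub>H\<^esub> \<one>\<^bsub>H\<^esub>)" using antipode_left assms by (simp add: sweedler_def)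
  finally show ?thesis using assms by (simp add: lin_smult)
qed

lemma sw_antipode_right:
  assumes "module k M" "lin H M F" "h \<in> carrier H"
  shows "sw M (\<lambda>x y. F (x \<otimes>\<^bsub>H\<^esub> antipode H y)) h = counit H h \<odot>\<^bsub>M\<^esub> F \<one>\<^bsub>H\<^esub>"
proof -
  have b: "bilin H H H (\<lambda>x y. x \<otimes>\<^bsub>H\<^esub> antipode H y)" by (intro bilinI lin_intros) auto
  have "sw M (\<lambda>x y. F (x \<otimes>\<^bsub>H\<^esub> antipode H y)) h = F (sw H (\<lambda>x y. x \<otimes>\<^bsub>H\<^esub> antipode H y) h)"
    using assms b by (intro sw_hom[symmetric]) auto
  also have "\<dots> = F (counit H h \<odot>\<^bsub>H\<^esub> \<one>\<^bsub>H\<^esub>)" using antipode_right assms by (simp add: sweedler_def)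
  finally show ?thesis using assms by (simp add: lin_smult)
qed

end

section \<open>Hopf subalgebras\<close>

context hopf_algebra
begin

lemma bilin_diff:
  assumes "module k M" "bilin V W M \<beta>" "bilin V W M \<beta>'"
  shows "bilin V W M (\<lambda>x y. \<beta> x y \<ominus>\<^bsub>M\<^esub> \<beta>' x y)"
  using assms by (intro bilinI lin_intros bilinD1[OF assms(2)] bilinD2[OF assms(2)]
    bilinD1[OF assms(3)] bilinD2[OF assms(3)])

lemma sw_diff:
  assumes M: "module k M" and b: "bilin H H M \<beta>" and b': "bilin H H M \<beta>'" and h: "h \<in> carrier H"
  shows "sw M (\<lambda>x y. \<beta> x y \<ominus>\<^bsub>M\<^esub> \<beta>' x y) h = sw M \<beta> h \<ominus>\<^bsub>M\<^esub> sw M \<beta>' h"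
proof -
  note L = tensor_lift_lin[OF C_module C_module M]
  show ?thesis unfolding sweedler_def
    by (rule tensor_lin_ext[OF C_module C_module M L[OF bilin_diff[OF M b b']] lin_diff[OF M L[OF b] L[OF b']]])
      (simp_all add: tensor_lift_tens M b b' bilin_diff h)
qed

text \<open>Since \<open>\<Delta>(K) \<subseteq> K \<otimes> K\<close>, both legs of an element of
  \<open>K\<close> may be taken in \<open>K\<close>.\<close>

lemma sw_mem:
  assumes "hopf_subalgebra k H K" "x \<in> K" "module k M" "bilin H H M \<beta>" "LinearCombinations.submodule k U M"
    and "\<And>u v. u \<in> K \<Longrightarrow> v \<in> K \<Longrightarrow> \<beta> u v \<in> U"
  shows "sw M \<beta> x \<in> U"
  unfolding sweedler_def
  using assms by (intro tensor_lift_mem[of H H M \<beta> U K K])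
    (auto simp: hopf_subalgebra_def subspace_def LinearCombinations.submodule_def)

lemma zero_submodule: "module k M \<Longrightarrow> LinearCombinations.submodule k {\<zero>\<^bsub>M\<^esub>} M"
proof -
  assume "module k M"
  then interpret M: module k M .
  show ?thesis by unfold_locales auto
qed

lemma sub_closed: "hopf_subalgebra k H K \<Longrightarrow> x \<in> K \<Longrightarrow> x \<in> carrier H"
  by (auto simp: hopf_subalgebra_def subspace_def LinearCombinations.submodule_def)

text \<open>The integrands agree only on \<open>K\<close>, not on \<open>H\<close>. Their difference
  vanishes on \<open>K\<close>, so its Sweedler sum lies in the zero submodule.\<close>

lemma sw_cong_sub:
  assumes K: "hopf_subalgebra k H K" "x \<in> K" and M: "module k M" and b: "bilin H H M \<beta>" "bilin H H M \<beta>'"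
    and eq: "\<And>u v. u \<in> K \<Longrightarrow> v \<in> K \<Longrightarrow> \<beta> u v = \<beta>' u v"
  shows "sw M \<beta> x = sw M \<beta>' x"
proof -
  interpret M: module k M by fact
  have x: "x \<in> carrier H" using sub_closed[OF K] .
  have "sw M (\<lambda>x y. \<beta> x y \<ominus>\<^bsub>M\<^esub> \<beta>' x y) x \<in> {\<zero>\<^bsub>M\<^esub>}"
    by (rule sw_mem[OF K M bilin_diff[OF M b] zero_submodule[OF M]])
      (use sub_closed[OF K(1)] b eq in \<open>auto simp: bilin_closed\<close>)
  then show ?thesis using x b sw_closed[OF M x] by (simp add: sw_diff M)
qed

end

text \<open>The retraction \<open>r\<close> induces \<open>r \<otimes> r\<close> from
  \<open>H \<otimes> H\<close> to the tensor square of \<open>K\<close>, a left inverse of the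
  canonical map in the other direction.\<close>

locale retracted_sub = hopf_algebra +
  fixes K r
  assumes K: "hopf_subalgebra k H K" and r: "lin H H r"
    and rK: "\<And>x. x \<in> carrier H \<Longrightarrow> r x \<in> K" and r_id: "\<And>x. x \<in> K \<Longrightarrow> r x = x"
begin

abbreviation Kh where "Kh \<equiv> sub_hopf k H K"
abbreviation (input) Kc where "Kc \<equiv> H\<lparr>carrier := K\<rparr>"

lemma K_subspace: "subspace k K H" and K_subring: "subring K H"
  and K_antipode: "x \<in> K \<Longrightarrow> antipode H x \<in> K"
  using K by (auto simp: hopf_subalgebra_def)

lemma KH: "x \<in> K \<Longrightarrow> x \<in> carrier H" using sub_closed[OF K] .

lemma K_mult: "x \<in> K \<Longrightarrow> y \<in> K \<Longrightarrow> x \<otimes>\<^bsub>H\<^esub> y \<in> K" and K_one: "\<one>\<^bsub>H\<^esub> \<in> K"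
  using K_subring by (auto simp: subringE)

lemma sub_simps [simp]:
  "carrier Kh = K" "add Kh = add H" "mult Kh = mult H" "zero Kh = zero H" "one Kh = one H"
  "smult Kh = smult H" "counit Kh = counit H" "antipode Kh = antipode H"
  by (simp_all add: sub_hopf_def)

lemma Kc_module: "module k Kc"
  using submodule_is_module[of K] K_subspace by (simp add: subspace_def)

lemma Kh_module [simp]: "module k Kh"
  by (rule module_cong[OF Kc_module]) simp_all

lemma Kc_tensor: "tensor_module k Kc Kc = tensor_module k Kh Kh" "tens k Kc Kc = tens k Kh Kh"
  by (rule tensor_module_cong; simp)+

lemma r_lin [lin_intros]: "lin V H f \<Longrightarrow> lin V Kh (\<lambda>x. r (f x))"
  by (rule linI) (simp_all add: rK lin_closed lin_add[OF r] lin_smult[OF r] lin_add lin_smult)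

lemma incl_lin: "lin V Kh f \<Longrightarrow> lin V H f"
  using KH by (auto simp: module_hom_def)

lemma incl_id [lin_intros]: "lin Kh H (\<lambda>x. x)"
  by (rule incl_lin) (rule lin_id)

abbreviation KK where "KK \<equiv> tensor_module k Kh Kh"

lemma bilin_r:
  assumes b: "bilin Kh Kh M \<beta>" shows "bilin H H M (\<lambda>u v. \<beta> (r u) (r v))"
  by (rule bilinI; rule lin_comp[OF bilinD1[OF b] r_lin[OF lin_id]] lin_comp[OF bilinD2[OF b] r_lin[OF lin_id]])
    (simp_all add: rK)

lemma lin_restrict: "lin H M f \<Longrightarrow> lin Kh M f"
  by (rule lin_comp[OF _ incl_id])

lemma bilin_restrict:
  assumes b: "bilin H H M \<beta>" shows "bilin Kh Kh M \<beta>"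
  by (rule bilinI; rule lin_restrict) (simp_all add: KH bilinD1[OF b] bilinD2[OF b])

text \<open>Resolves the definite description in \<open>sub_hopf\<close>: the required tensor is the
  image of \<open>\<Delta>(x)\<close> under \<open>r \<otimes> r\<close>.\<close>

lemma comult_sub:
  assumes x: "x \<in> K"
  shows "comult Kh x = sw KK (\<lambda>u v. tens k Kh Kh (r u) (r v)) x"
proof -
  let ?t = "sw KK (\<lambda>u v. tens k Kh Kh (r u) (r v)) x"
  have xH: "x \<in> carrier H" using x by (rule KH)
  have b: "bilin H H KK (\<lambda>u v. tens k Kh Kh (r u) (r v))"
    by (rule bilin_r) (simp add: tens_bilin)
  have b': "bilin H H CC (\<lambda>u v. tens k H H (r u) (r v))"
    using r by (intro tensor_map_bilin) auto
  have bt: "bilin H H CC (tens k H H)" by (simp add: tens_bilin)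
  have tm: "tensor_map k H H id id t = tensor_lift k CC (tens k H H) t" for t
    by (simp add: tensor_map_def)
  have "tensor_map k H H id id ?t = w" if "w = sw CC (\<lambda>u v. tens k H H (r u) (r v)) x" for w
    unfolding tm sweedler_def that
    by (rule tensor_lift_comp[of Kh Kh H H _ r r]) (use xH bilin_restrict[OF bt] in \<open>auto intro!: lin_intros\<close>)
  then have "tensor_map k H H id id ?t = sw CC (\<lambda>u v. tens k H H (r u) (r v)) x" by simp
  also have "\<dots> = sw CC (tens k H H) x"
    using b' bt r_id by (intro sw_cong_sub[OF K x]) auto
  also have "\<dots> = comult H x" using xH by (simp add: comult_sw)
  finally have 1: "tensor_map k H H id id ?t = comult H x" .
  \<comment> \<open>Uniqueness: applying \<open>r \<otimes> r\<close> to the image of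
    \<open>t\<close> in \<open>H \<otimes> H\<close> returns \<open>t\<close>.\<close>
  have 2: "t = ?t" if t: "t \<in> carrier KK" "tensor_map k H H id id t = comult H x" for t
  proof -
    have "t = tensor_lift k KK (tens k Kh Kh) t" using t by (simp add: tensor_lift_self)
    also have "\<dots> = tensor_lift k KK (\<lambda>u v. tens k Kh Kh (r u) (r v)) t"
      using t r_id by (intro tensor_lift_cong[of Kh Kh]) (auto simp: tens_bilin)
    also have "\<dots> = tensor_lift k KK (\<lambda>u v. tens k Kh Kh (r u) (r v)) (tensor_lift k CC (tens k H H) t)"
      by (rule tensor_lift_comp[of H H Kh Kh _ "\<lambda>x. x" "\<lambda>x. x", symmetric]) (use t b in \<open>auto intro!: lin_intros\<close>)
    also have "\<dots> = ?t" using t tm by (simp add: sweedler_def)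
    finally show ?thesis .
  qed
  have 3: "?t \<in> carrier KK" using xH b by (intro sw_closed) auto
  have "comult Kh x = (THE t. t \<in> carrier KK \<and> tensor_map k H H id id t = comult H x)"
    unfolding Kc_tensor[symmetric] by (subst sub_hopf_def) simp
  also have "\<dots> = ?t" by (rule the_equality, rule conjI[OF 3 1]) (elim conjE, rule 2)
  finally show ?thesis .
qed

sublocale sub: comult_space k Kh
proof (intro comult_space.intro comult_space_axioms.intro field_axioms Kh_module)
  have b: "bilin H H KK (\<lambda>u v. tens k Kh Kh (r u) (r v))"
    by (rule bilin_r) (simp add: tens_bilin)
  have "lin Kh KK (\<lambda>x. sw KK (\<lambda>u v. tens k Kh Kh (r u) (r v)) x)"
    by (rule sw_lin_arg[OF _ incl_id b]) simp
  then show "comult Kh \<in> module_hom k Kh KK"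
    by (rule lin_cong) (simp_all add: comult_sub)
qed

text \<open>Here \<open>\<beta>\<close> need only be bilinear on \<open>K\<close>; inserting
  \<open>r\<close> in both arguments extends it to \<open>H\<close>, where the sum is then
  taken.\<close>

lemma sw_sub_r:
  assumes M: "module k M" and b: "bilin Kh Kh M \<beta>" and x: "x \<in> K"
  shows "sub.sw M \<beta> x = sw M (\<lambda>u v. \<beta> (r u) (r v)) x"
  using x unfolding sweedler_def[of _ Kh]
  by (simp add: comult_sub, unfold sweedler_def)
    (rule tensor_lift_comp[of Kh Kh H H M r r], use M b x KH in \<open>auto intro!: lin_intros\<close>)

lemma sw_sub:
  assumes M: "module k M" and b: "bilin H H M \<beta>" and x: "x \<in> K"
  shows "sub.sw M \<beta> x = sw M \<beta> x"
proof -
  have "sub.sw M \<beta> x = sw M (\<lambda>u v. \<beta> (r u) (r v)) x"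
    using assms by (intro sw_sub_r bilin_restrict)
  also have "\<dots> = sw M \<beta> x"
    using b M bilin_r[OF bilin_restrict[OF b]] r_id by (intro sw_cong_sub[OF K x]) auto
  finally show ?thesis .
qed

lemma sub_lin_mult_right [lin_intros]:
  assumes "lin V Kh f" "c \<in> K" shows "lin V Kh (\<lambda>x. f x \<otimes>\<^bsub>H\<^esub> c)"
proof -
  have "lin V H (\<lambda>x. f x \<otimes>\<^bsub>H\<^esub> c)"
    using assms KH by (intro lin_intros incl_lin) auto
  moreover have "f x \<otimes>\<^bsub>H\<^esub> c \<in> K" if "x \<in> carrier V" for x
    using assms that K_mult lin_closed[OF assms(1)] by simp
  ultimately show ?thesis by (auto simp: module_hom_def)
qed

lemma sub_lin_mult_left [lin_intros]:
  assumes "lin V Kh f" "c \<in> K" shows "lin V Kh (\<lambda>x. c \<otimes>\<^bsub>H\<^esub> f x)"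
proof -
  have "lin V H (\<lambda>x. c \<otimes>\<^bsub>H\<^esub> f x)"
    using assms KH by (intro lin_intros incl_lin) auto
  moreover have "c \<otimes>\<^bsub>H\<^esub> f x \<in> K" if "x \<in> carrier V" for x
    using assms that K_mult lin_closed[OF assms(1)] by simp
  ultimately show ?thesis by (auto simp: module_hom_def)
qed

lemma sub_antipode_lin [lin_intros]:
  assumes "lin V Kh f" shows "lin V Kh (\<lambda>x. antipode H (f x))"
proof -
  have "lin V H (\<lambda>x. antipode H (f x))" using assms by (intro lin_intros incl_lin)
  moreover have "antipode H (f x) \<in> K" if "x \<in> carrier V" for x
    using that K_antipode lin_closed[OF assms(1)] by simp
  ultimately show ?thesis by (auto simp: module_hom_def)
qed

lemma sub_functional [lin_intros]: "lin V Kh f \<Longrightarrow> functional V (\<lambda>x. counit H (f x))"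
  by (intro lin_intros incl_lin)

lemma sub_sw_incl:
  assumes "bilin H H H \<beta>" "bilin Kh Kh Kh \<beta>" "x \<in> K"
  shows "sub.sw Kh \<beta> x = sw H \<beta> x"
proof -
  have "sub.sw Kh \<beta> x = sub.sw H \<beta> x"
    by (rule sub.sw_hom[where F = "\<lambda>x. x"]) (use assms in \<open>auto intro: lin_intros\<close>)
  also have "\<dots> = sw H \<beta> x" using assms by (intro sw_sub) auto
  finally show ?thesis .
qed

lemma sub_assoc_algebra: "assoc_algebra k Kh"
proof -
  have "ring Kc" by (rule subring_is_ring[OF K_subring])
  then have "ring Kh" by (rule ring_cong) simp_all
  then show ?thesis
    by (intro assoc_algebra.intro vectorspace.intro assoc_algebra_axioms.intro Kh_module field_axioms)
      (simp_all add: KH smult_mult_left smult_mult_right)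
qed

abbreviation (input) TT where "TT \<equiv> tens k Kh Kh"

lemma sub_mult:
  assumes g: "g \<in> K" and h: "h \<in> K"
  shows "sub.sw KK TT (g \<otimes>\<^bsub>H\<^esub> h) =
    sub.sw KK (\<lambda>x y. sub.sw KK (\<lambda>u v. TT (x \<otimes>\<^bsub>H\<^esub> u) (y \<otimes>\<^bsub>H\<^esub> v)) h) g"
proof -
  note [simp] = KH K_mult rK g h r_id
  let ?l = "\<lambda>x y. sw KK (\<lambda>u v. TT (r (x \<otimes>\<^bsub>H\<^esub> u)) (r (y \<otimes>\<^bsub>H\<^esub> v))) h"
  let ?m = "\<lambda>x y. sw KK (\<lambda>u v. TT (r x \<otimes>\<^bsub>H\<^esub> r u) (r y \<otimes>\<^bsub>H\<^esub> r v)) h"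
  let ?r = "\<lambda>x y. sub.sw KK (\<lambda>u v. TT (x \<otimes>\<^bsub>H\<^esub> u) (y \<otimes>\<^bsub>H\<^esub> v)) h"
  have bl: "bilin H H KK ?l" by (intro bilinI lin_intros) auto
  have bm: "bilin H H KK ?m" by (intro bilinI lin_intros) auto
  have br: "bilin Kh Kh KK ?r" by (intro bilinI lin_intros) auto
  have bT: "bilin Kh Kh KK TT" by (simp add: tens_bilin)
  have "sub.sw KK TT (g \<otimes>\<^bsub>H\<^esub> h) = sw KK (\<lambda>u v. TT (r u) (r v)) (g \<otimes>\<^bsub>H\<^esub> h)"
    by (rule sw_sub_r) (simp_all add: tens_bilin)
  also have "\<dots> = sw KK ?l g"
    by (rule sw_mult[OF _ bilin_r[OF bT]]) simp_all
  \<comment> \<open>A linear retraction need not be multiplicative, but on \<open>K\<close> it is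
    the identity and products of elements of \<open>K\<close> stay in \<open>K\<close>.\<close>
  also have "\<dots> = sw KK ?m g"
  proof (rule sw_cong_sub[OF K g _ bl bm])
    fix x y assume [simp]: "x \<in> K" "y \<in> K"
    show "?l x y = ?m x y"
      by (rule sw_cong_sub[OF K h]) (auto intro!: bilinI lin_intros)
  qed simp
  also have "\<dots> = sw KK (\<lambda>x y. ?r (r x) (r y)) g"
  proof (rule sw_cong[OF _ _ bm])
    fix x y assume [simp]: "x \<in> carrier H" "y \<in> carrier H"
    show "?m x y = ?r (r x) (r y)"
      by (rule sw_sub_r[symmetric]) (auto intro!: bilinI lin_intros)
  qed simp_all
  also have "\<dots> = sub.sw KK ?r g" by (rule sw_sub_r[symmetric, OF _ br]) simp_all
  finally show ?thesis .
qed

text \<open>With \<open>r\<close> placed on all three legs, both sides become nested sums over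
  \<open>H\<close>, where coassociativity is available.\<close>

lemma sub_coassoc:
  assumes h: "h \<in> K"
  shows "sub.sw sub.CCC (\<lambda>x y. sub.sw sub.CCC (\<lambda>x1 x2. tens k Kh KK x1 (TT x2 y)) x) h
    = sub.sw sub.CCC (\<lambda>x y. sub.sw sub.CCC (\<lambda>y1 y2. tens k Kh KK x (TT y1 y2)) y) h"
proof -
  note [simp] = KH rK h r_id
  let ?T = "\<lambda>x y z. tens k Kh KK x (TT y z)"
  let ?T' = "\<lambda>x y z. ?T (r x) (r y) (r z)"
  have 1: "sub.sw sub.CCC (\<lambda>x y. sub.sw sub.CCC (\<lambda>x1 x2. ?T x1 x2 y) x) h
      = sw sub.CCC (\<lambda>x y. sw sub.CCC (\<lambda>x1 x2. ?T' x1 x2 y) x) h"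
  proof -
    have "sub.sw sub.CCC (\<lambda>x y. sub.sw sub.CCC (\<lambda>x1 x2. ?T x1 x2 y) x) h
        = sw sub.CCC (\<lambda>x y. sub.sw sub.CCC (\<lambda>x1 x2. ?T x1 x2 (r y)) (r x)) h"
      by (rule sw_sub_r) (auto intro!: bilinI lin_intros)
    also have "\<dots> = sw sub.CCC (\<lambda>x y. sw sub.CCC (\<lambda>x1 x2. ?T' x1 x2 y) x) h"
    proof (rule sw_cong_sub[OF K h])
      fix x y assume [simp]: "x \<in> K" "y \<in> K"
      have "sub.sw sub.CCC (\<lambda>x1 x2. ?T x1 x2 (r y)) x = sw sub.CCC (\<lambda>x1 x2. ?T' x1 x2 y) x"
        by (rule sw_sub_r) (auto intro!: bilinI lin_intros)
      then show "sub.sw sub.CCC (\<lambda>x1 x2. ?T x1 x2 (r y)) (r x) = sw sub.CCC (\<lambda>x1 x2. ?T' x1 x2 y) x"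
        by simp
    qed (auto intro!: bilinI lin_intros)
    finally show ?thesis .
  qed
  have 2: "sub.sw sub.CCC (\<lambda>x y. sub.sw sub.CCC (\<lambda>y1 y2. ?T x y1 y2) y) h
      = sw sub.CCC (\<lambda>x y. sw sub.CCC (\<lambda>y1 y2. ?T' x y1 y2) y) h"
  proof -
    have "sub.sw sub.CCC (\<lambda>x y. sub.sw sub.CCC (\<lambda>y1 y2. ?T x y1 y2) y) h
        = sw sub.CCC (\<lambda>x y. sub.sw sub.CCC (\<lambda>y1 y2. ?T (r x) y1 y2) (r y)) h"
      by (rule sw_sub_r) (auto intro!: bilinI lin_intros)
    also have "\<dots> = sw sub.CCC (\<lambda>x y. sw sub.CCC (\<lambda>y1 y2. ?T' x y1 y2) y) h"
    proof (rule sw_cong_sub[OF K h])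
      fix x y assume [simp]: "x \<in> K" "y \<in> K"
      have "sub.sw sub.CCC (\<lambda>y1 y2. ?T (r x) y1 y2) y = sw sub.CCC (\<lambda>y1 y2. ?T' x y1 y2) y"
        by (rule sw_sub_r) (auto intro!: bilinI lin_intros)
      then show "sub.sw sub.CCC (\<lambda>y1 y2. ?T (r x) y1 y2) (r y) = sw sub.CCC (\<lambda>y1 y2. ?T' x y1 y2) y"
        by simp
    qed (auto intro!: bilinI lin_intros)
    finally show ?thesis .
  qed
  show ?thesis unfolding 1 2
    by (rule sw_coassoc) (auto intro!: bilinI lin_intros)
qed

lemma sub_hopf_algebra: "hopf_algebra k Kh"
proof (rule sub.hopf_algebraI[OF sub_assoc_algebra])
  note [simp] = KH
  show "comult Kh \<one>\<^bsub>Kh\<^esub> = TT \<one>\<^bsub>Kh\<^esub> \<one>\<^bsub>Kh\<^esub>"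
    using K_one by (simp add: comult_sub sw_one[OF _ bilin_r[OF tens_bilin]] r_id)
  show "counit Kh \<in> ring_hom Kh k"
    using counit_ring_hom KH by (auto simp: ring_hom_def)
  show "antipode Kh \<in> module_hom k Kh Kh" by (simp, intro lin_intros)
  fix h assume h: "h \<in> carrier Kh"
  then have [simp]: "h \<in> K" by simp
  have l1: "lin Kh Kh (\<lambda>x. counit H w \<odot>\<^bsub>H\<^esub> x)" if "w \<in> K" for w
    using lin_const_smult[OF Kh_module _ lin_id, of "counit H w"] that by simp
  have l2: "lin Kh Kh (\<lambda>x. counit H x \<odot>\<^bsub>H\<^esub> w)" if "w \<in> K" for w
    using lin_smult_vec[OF Kh_module _ sub_functional[OF lin_id], of w] that by simp
  have "sub.sw Kh (\<lambda>x y. counit H x \<odot>\<^bsub>H\<^esub> y) h = sw H (\<lambda>x y. counit H x \<odot>\<^bsub>H\<^esub> y) h"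
    by (rule sub_sw_incl; (rule bilinI)?) (simp_all add: l1 l2, (intro lin_intros; simp)+)
  then show "sub.sw Kh (\<lambda>x y. counit Kh x \<odot>\<^bsub>Kh\<^esub> y) h = h"
    using sw_counit_left[OF C_module lin_id, of h] by simp
  have "sub.sw Kh (\<lambda>x y. counit H y \<odot>\<^bsub>H\<^esub> x) h = sw H (\<lambda>x y. counit H y \<odot>\<^bsub>H\<^esub> x) h"
    by (rule sub_sw_incl; (rule bilinI)?) (simp_all add: l1 l2, (intro lin_intros; simp)+)
  then show "sub.sw Kh (\<lambda>x y. counit Kh y \<odot>\<^bsub>Kh\<^esub> x) h = h"
    using sw_counit_right[OF C_module lin_id, of h] by simp
  show "sub.sw Kh (\<lambda>x y. antipode Kh x \<otimes>\<^bsub>Kh\<^esub> y) h = counit Kh h \<odot>\<^bsub>Kh\<^esub> \<one>\<^bsub>Kh\<^esub>"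
    using sw_antipode_left[OF C_module lin_id, of h] K_antipode
    by (simp, subst sub_sw_incl) (auto intro!: bilinI lin_intros)
  show "sub.sw Kh (\<lambda>x y. x \<otimes>\<^bsub>Kh\<^esub> antipode Kh y) h = counit Kh h \<odot>\<^bsub>Kh\<^esub> \<one>\<^bsub>Kh\<^esub>"
    using sw_antipode_right[OF C_module lin_id, of h] K_antipode
    by (simp, subst sub_sw_incl) (auto intro!: bilinI lin_intros)
qed (use sub_mult sub_coassoc counit_linear KH in simp_all)

end

section \<open>Slices of the comultiplication in finite dimension\<close>

locale fd_hopf_algebra = hopf_algebra +
  assumes fin_dim: "vectorspace.fin_dim k H"
begin

lemma hopf_subalgebra_D:
  assumes "hopf_subalgebra k H K"
  shows "subspace k K H" "LinearCombinations.submodule k K H" "K \<subseteq> carrier H"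
    "\<zero>\<^bsub>H\<^esub> \<in> K" "\<one>\<^bsub>H\<^esub> \<in> K"
    "\<And>x y. x \<in> K \<Longrightarrow> y \<in> K \<Longrightarrow> x \<oplus>\<^bsub>H\<^esub> y \<in> K"
    "\<And>x y. x \<in> K \<Longrightarrow> y \<in> K \<Longrightarrow> x \<otimes>\<^bsub>H\<^esub> y \<in> K"
    "\<And>c x. c \<in> carrier k \<Longrightarrow> x \<in> K \<Longrightarrow> c \<odot>\<^bsub>H\<^esub> x \<in> K"
    "\<And>x. x \<in> K \<Longrightarrow> antipode H x \<in> K"
  using assms by (auto simp: hopf_subalgebra_def subspace_def LinearCombinations.submodule_def subringE)

lemma hopf_subalgebra_slices:
  assumes K: "hopf_subalgebra k H K" and x: "x \<in> K" and g: "functional H g"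
  shows "sw H (\<lambda>u v. g v \<odot>\<^bsub>H\<^esub> u) x \<in> K" "sw H (\<lambda>u v. g u \<odot>\<^bsub>H\<^esub> v) x \<in> K"
proof -
  note [simp] = sub_closed[OF K] lin_closed[OF g, simplified] hopf_subalgebra_D(8)[OF K]
  note g' = lin_comp[OF g]
  show "sw H (\<lambda>u v. g v \<odot>\<^bsub>H\<^esub> u) x \<in> K"
    by (rule sw_mem[OF K x _ _ hopf_subalgebra_D(2)[OF K]]) (auto intro!: bilinI lin_intros g')
  show "sw H (\<lambda>u v. g u \<odot>\<^bsub>H\<^esub> v) x \<in> K"
    by (rule sw_mem[OF K x _ _ hopf_subalgebra_D(2)[OF K]]) (auto intro!: bilinI lin_intros g')
qed

text \<open>Expanding the second leg in a basis turns the first leg into slices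
  \<open>(id \<otimes> c e) (\<Delta> h)\<close>, so the two legs can be treated one at a
  time.\<close>

lemma sw_expand_left:
  assumes c: "dual_basis k H E c" and h: "h \<in> carrier H" and M: "module k M" and b: "bilin H H M \<beta>"
  shows "sw M \<beta> h = (\<Oplus>\<^bsub>M\<^esub>e\<in>E. \<beta> (sw H (\<lambda>u v. c e v \<odot>\<^bsub>H\<^esub> u) h) e)"
proof -
  interpret M: module k M by fact
  have E: "finite E" "E \<subseteq> carrier H" and cf: "\<And>e. e \<in> E \<Longrightarrow> functional H (c e)"
    and ex: "\<And>v. v \<in> carrier H \<Longrightarrow> v = (\<Oplus>\<^bsub>H\<^esub>e\<in>E. c e v \<odot>\<^bsub>H\<^esub> e)"
    using c by (auto simp: dual_basis_def)
  have [simp]: "e \<in> carrier H" if "e \<in> E" for e using that E by auto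
  note [simp] = lin_closed[OF cf, simplified] bilin_closed[OF b]
  note cl = lin_comp[OF cf]
  have b1: "bilin H H M (\<lambda>u v. \<beta> (c e v \<odot>\<^bsub>H\<^esub> u) e)" if "e \<in> E" for e
    by (rule bilinI; rule lin_comp[OF bilinD2[OF b]])
       (use that in \<open>auto intro!: lin_intros cl\<close>)
  have bs: "bilin H H M (\<lambda>u v. \<Oplus>\<^bsub>M\<^esub>e\<in>E. \<beta> (c e v \<odot>\<^bsub>H\<^esub> u) e)"
    by (rule bilinI; rule lin_sum[OF M]) (simp_all add: bilinD1[OF b1] bilinD2[OF b1])
  have "\<beta> u v = (\<Oplus>\<^bsub>M\<^esub>e\<in>E. \<beta> (c e v \<odot>\<^bsub>H\<^esub> u) e)" if "u \<in> carrier H" "v \<in> carrier H" for u v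
  proof -
    have "\<beta> u v = \<beta> u (\<Oplus>\<^bsub>H\<^esub>e\<in>E. c e v \<odot>\<^bsub>H\<^esub> e)" using ex[OF that(2)] by simp
    also have "\<dots> = (\<Oplus>\<^bsub>M\<^esub>e\<in>E. \<beta> u (c e v \<odot>\<^bsub>H\<^esub> e))"
      using that by (intro lin_finsum[OF C_module M bilinD1[OF b]]) auto
    also have "\<dots> = (\<Oplus>\<^bsub>M\<^esub>e\<in>E. \<beta> (c e v \<odot>\<^bsub>H\<^esub> u) e)"
      using that by (intro M.finsum_cong' refl) (auto simp: lin_smult[OF bilinD1[OF b]] lin_smult[OF bilinD2[OF b]])
    finally show ?thesis .
  qed
  then have "sw M \<beta> h = sw M (\<lambda>u v. \<Oplus>\<^bsub>M\<^esub>e\<in>E. \<beta> (c e v \<odot>\<^bsub>H\<^esub> u) e) h"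
    by (intro sw_cong[OF M h b])
  also have "\<dots> = (\<Oplus>\<^bsub>M\<^esub>e\<in>E. sw M (\<lambda>u v. \<beta> (c e v \<odot>\<^bsub>H\<^esub> u) e) h)"
  proof -
    note L = tensor_lift_lin[OF C_module C_module M]
    have cl: "tensor_lift k M (\<lambda>u v. \<beta> (c e v \<odot>\<^bsub>H\<^esub> u) e) t \<in> carrier M" if "e \<in> E" "t \<in> carrier CC" for e t
      using lin_closed[OF L[OF b1[OF that(1)]] that(2)] .
    show ?thesis unfolding sweedler_def
      by (rule tensor_lin_ext[OF C_module C_module M L[OF bs] lin_sum[OF M L[OF b1]]])
        (use h in \<open>auto simp: tensor_lift_tens[OF C_module C_module M] bs b1 intro!: M.finsum_cong'\<close>)
  qed
  also have "\<dots> = (\<Oplus>\<^bsub>M\<^esub>e\<in>E. \<beta> (sw H (\<lambda>u v. c e v \<odot>\<^bsub>H\<^esub> u) h) e)"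
  proof (intro M.finsum_cong' refl Pi_I)
    fix e assume e: "e \<in> E"
    have bb: "bilin H H H (\<lambda>u v. c e v \<odot>\<^bsub>H\<^esub> u)" using e by (auto intro!: bilinI lin_intros cl)
    show "sw M (\<lambda>u v. \<beta> (c e v \<odot>\<^bsub>H\<^esub> u) e) h = \<beta> (sw H (\<lambda>u v. c e v \<odot>\<^bsub>H\<^esub> u) h) e"
      by (rule sw_hom[symmetric, OF C_module M h bb bilinD2[OF b]]) (use e in simp)
    show "\<beta> (sw H (\<lambda>u v. c e v \<odot>\<^bsub>H\<^esub> u) h) e \<in> carrier M"
      using sw_closed[OF C_module h bb] e by simp
  qed
  finally show ?thesis .
qed

lemma retraction:
  assumes K: "hopf_subalgebra k H K"
  obtains r where "retracted_sub k H K r"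
proof -
  obtain r where "lin H H r" "\<And>v. v \<in> carrier H \<Longrightarrow> r v \<in> K" "\<And>w. w \<in> K \<Longrightarrow> r w = w"
    using retraction_exists[OF fin_dim hopf_subalgebra_D(1)[OF K]] by blast
  then have "retracted_sub k H K r"
    by (intro retracted_sub.intro retracted_sub_axioms.intro hopf_algebra_axioms K)
  then show ?thesis by (rule that)
qed

lemma sw_expand_right:
  assumes c: "dual_basis k H E c" and h: "h \<in> carrier H" and M: "module k M" and b: "bilin H H M \<beta>"
  shows "sw M \<beta> h = (\<Oplus>\<^bsub>M\<^esub>e\<in>E. \<beta> e (sw H (\<lambda>u v. c e u \<odot>\<^bsub>H\<^esub> v) h))"
proof -
  interpret M: module k M by fact
  have E: "finite E" "E \<subseteq> carrier H" and cf: "\<And>e. e \<in> E \<Longrightarrow> functional H (c e)"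
    and ex: "\<And>v. v \<in> carrier H \<Longrightarrow> v = (\<Oplus>\<^bsub>H\<^esub>e\<in>E. c e v \<odot>\<^bsub>H\<^esub> e)"
    using c by (auto simp: dual_basis_def)
  have [simp]: "e \<in> carrier H" if "e \<in> E" for e using that E by auto
  note [simp] = lin_closed[OF cf, simplified] bilin_closed[OF b]
  note cl = lin_comp[OF cf]
  have b1: "bilin H H M (\<lambda>u v. \<beta> e (c e u \<odot>\<^bsub>H\<^esub> v))" if "e \<in> E" for e
    by (rule bilinI; rule lin_comp[OF bilinD1[OF b]])
       (use that in \<open>auto intro!: lin_intros cl\<close>)
  have bs: "bilin H H M (\<lambda>u v. \<Oplus>\<^bsub>M\<^esub>e\<in>E. \<beta> e (c e u \<odot>\<^bsub>H\<^esub> v))"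
    by (rule bilinI; rule lin_sum[OF M]) (simp_all add: bilinD1[OF b1] bilinD2[OF b1])
  have "\<beta> u v = (\<Oplus>\<^bsub>M\<^esub>e\<in>E. \<beta> e (c e u \<odot>\<^bsub>H\<^esub> v))" if "u \<in> carrier H" "v \<in> carrier H" for u v
  proof -
    have "\<beta> u v = \<beta> (\<Oplus>\<^bsub>H\<^esub>e\<in>E. c e u \<odot>\<^bsub>H\<^esub> e) v" using ex[OF that(1)] by simp
    also have "\<dots> = (\<Oplus>\<^bsub>M\<^esub>e\<in>E. \<beta> (c e u \<odot>\<^bsub>H\<^esub> e) v)"
      using that by (intro lin_finsum[OF C_module M bilinD2[OF b]]) auto
    also have "\<dots> = (\<Oplus>\<^bsub>M\<^esub>e\<in>E. \<beta> e (c e u \<odot>\<^bsub>H\<^esub> v))"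
      using that by (intro M.finsum_cong' refl) (auto simp: lin_smult[OF bilinD1[OF b]] lin_smult[OF bilinD2[OF b]])
    finally show ?thesis .
  qed
  then have "sw M \<beta> h = sw M (\<lambda>u v. \<Oplus>\<^bsub>M\<^esub>e\<in>E. \<beta> e (c e u \<odot>\<^bsub>H\<^esub> v)) h"
    by (intro sw_cong[OF M h b])
  also have "\<dots> = (\<Oplus>\<^bsub>M\<^esub>e\<in>E. sw M (\<lambda>u v. \<beta> e (c e u \<odot>\<^bsub>H\<^esub> v)) h)"
  proof -
    note L = tensor_lift_lin[OF C_module C_module M]
    have cl: "tensor_lift k M (\<lambda>u v. \<beta> e (c e u \<odot>\<^bsub>H\<^esub> v)) t \<in> carrier M" if "e \<in> E" "t \<in> carrier CC" for e t
      using lin_closed[OF L[OF b1[OF that(1)]] that(2)] .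
    show ?thesis unfolding sweedler_def
      by (rule tensor_lin_ext[OF C_module C_module M L[OF bs] lin_sum[OF M L[OF b1]]])
        (use h in \<open>auto simp: tensor_lift_tens[OF C_module C_module M] bs b1 intro!: M.finsum_cong'\<close>)
  qed
  also have "\<dots> = (\<Oplus>\<^bsub>M\<^esub>e\<in>E. \<beta> e (sw H (\<lambda>u v. c e u \<odot>\<^bsub>H\<^esub> v) h))"
  proof (intro M.finsum_cong' refl Pi_I)
    fix e assume e: "e \<in> E"
    have bb: "bilin H H H (\<lambda>u v. c e u \<odot>\<^bsub>H\<^esub> v)" using e by (auto intro!: bilinI lin_intros cl)
    show "sw M (\<lambda>u v. \<beta> e (c e u \<odot>\<^bsub>H\<^esub> v)) h = \<beta> e (sw H (\<lambda>u v. c e u \<odot>\<^bsub>H\<^esub> v) h)"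
      by (rule sw_hom[symmetric, OF C_module M h bb bilinD1[OF b]]) (use e in simp)
    show "\<beta> e (sw H (\<lambda>u v. c e u \<odot>\<^bsub>H\<^esub> v) h) \<in> carrier M"
      using sw_closed[OF C_module h bb] e by simp
  qed
  finally show ?thesis .
qed

lemma H_basis: obtains E c where "dual_basis k H E c"
  using dual_basis_exists[OF fin_dim] .

text \<open>Membership in \<open>K \<otimes> K\<close> is tested on the slices \<open>(id \<otimes> g) (\<Delta> x)\<close> and \<open>(g \<otimes> id) (\<Delta> x)\<close>,
  a condition that is visibly stable under intersections.\<close>

lemma hopf_subalgebraI:
  assumes KH: "K \<subseteq> carrier H" and zero: "\<zero>\<^bsub>H\<^esub> \<in> K"
    and add: "\<And>x y. x \<in> K \<Longrightarrow> y \<in> K \<Longrightarrow> x \<oplus>\<^bsub>H\<^esub> y \<in> K"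
    and smult: "\<And>c x. c \<in> carrier k \<Longrightarrow> x \<in> K \<Longrightarrow> c \<odot>\<^bsub>H\<^esub> x \<in> K"
    and one: "\<one>\<^bsub>H\<^esub> \<in> K" and mult: "\<And>x y. x \<in> K \<Longrightarrow> y \<in> K \<Longrightarrow> x \<otimes>\<^bsub>H\<^esub> y \<in> K"
    and S: "\<And>x. x \<in> K \<Longrightarrow> antipode H x \<in> K"
    and right: "\<And>x g. x \<in> K \<Longrightarrow> functional H g \<Longrightarrow> sw H (\<lambda>u v. g v \<odot>\<^bsub>H\<^esub> u) x \<in> K"
    and left: "\<And>x g. x \<in> K \<Longrightarrow> functional H g \<Longrightarrow> sw H (\<lambda>u v. g u \<odot>\<^bsub>H\<^esub> v) x \<in> K"
  shows "hopf_subalgebra k H K"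
proof -
  have sm: "LinearCombinations.submodule k K H"
    by (intro LinearCombinations.submodule.intro C_module KH zero add smult)
  then have ss: "subspace k K H" by (intro subspace.intro vectorspace_axioms)
  interpret KA: abelian_subgroup K H by (rule submodule_abelian_subgroup[OF sm])
  have sr: "subring K H"
    by (rule subringI) (use KH one mult add in auto)
  obtain r where r: "lin H H r" "\<And>v. v \<in> carrier H \<Longrightarrow> r v \<in> K" "\<And>w. w \<in> K \<Longrightarrow> r w = w"
    using retraction_exists[OF fin_dim ss] by blast
  obtain E c where c: "dual_basis k H E c" by (rule H_basis)
  then have cf: "\<And>e. e \<in> E \<Longrightarrow> functional H (c e)" and EH: "\<And>e. e \<in> E \<Longrightarrow> e \<in> carrier H"
    by (auto simp: dual_basis_def)
  let ?U = "LinearCombinations.module.span k CC {tens k H H x y | x y. x \<in> K \<and> y \<in> K}"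
  note CCm = tensor_module_module[OF C_module C_module]
  interpret T: module k CC by (rule tensor_module_module[OF C_module C_module])
  have Usub: "{tens k H H x y | x y. x \<in> K \<and> y \<in> K} \<subseteq> carrier CC"
    using tens_closed[OF C_module C_module] KH by blast
  have "comult H x \<in> ?U" if x: "x \<in> K" for x
  proof -
    have xH: "x \<in> carrier H" using x KH by auto
    note r' = lin_comp[OF r(1)]
    have bt: "bilin H H CC (tens k H H)" by (simp add: tens_bilin)
    have b1: "bilin H H CC (\<lambda>u v. tens k H H (r u) v)" using r by (intro tensor_map_bilin lin_id) auto
    have b2: "bilin H H CC (\<lambda>u v. tens k H H (r u) (r v))" using r by (intro tensor_map_bilin) auto
    have "comult H x = sw CC (tens k H H) x" by (rule comult_sw[OF xH])
    \<comment> \<open>With the second leg expanded, the first legs are slices of \<open>x\<close>;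
      they lie in \<open>K\<close>, where \<open>r\<close> does nothing.\<close>
    also have "\<dots> = sw CC (\<lambda>u v. tens k H H (r u) v) x"
      unfolding sw_expand_left[OF c xH CCm bt] sw_expand_left[OF c xH CCm b1]
    proof (intro T.finsum_cong' refl Pi_I)
      fix e assume e: "e \<in> E"
      note R = right[OF x cf[OF e]]
      show "tens k H H (r (sw H (\<lambda>u v. c e v \<odot>\<^bsub>H\<^esub> u) x)) e \<in> carrier CC"
        using R r(2) EH[OF e] KH by (intro tens_closed C_module) auto
      show "tens k H H (sw H (\<lambda>u v. c e v \<odot>\<^bsub>H\<^esub> u) x) e = tens k H H (r (sw H (\<lambda>u v. c e v \<odot>\<^bsub>H\<^esub> u) x)) e"
        using R r(3) by simp
    qed
    \<comment> \<open>The same with the first leg expanded and the slices in second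
      position.\<close>
    also have "\<dots> = sw CC (\<lambda>u v. tens k H H (r u) (r v)) x"
      unfolding sw_expand_right[OF c xH CCm b1] sw_expand_right[OF c xH CCm b2]
    proof (intro T.finsum_cong' refl Pi_I)
      fix e assume e: "e \<in> E"
      note R = left[OF x cf[OF e]]
      show "tens k H H (r e) (r (sw H (\<lambda>u v. c e u \<odot>\<^bsub>H\<^esub> v) x)) \<in> carrier CC"
        using R r(2) EH[OF e] KH by (intro tens_closed C_module) auto
      show "tens k H H (r e) (sw H (\<lambda>u v. c e u \<odot>\<^bsub>H\<^esub> v) x) = tens k H H (r e) (r (sw H (\<lambda>u v. c e u \<odot>\<^bsub>H\<^esub> v) x))"
        using R r(3) by simp
    qed
    also have "\<dots> \<in> ?U"
    proof -
      have "LinearCombinations.submodule k ?U CC" using Usub by (rule T.span_is_submodule)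
      moreover have "{tens k H H x y | x y. x \<in> K \<and> y \<in> K} \<subseteq> ?U" using Usub by (rule T.in_own_span)
      moreover have "sw CC (\<lambda>u v. tens k H H (r u) (r v)) x
        = (\<Oplus>\<^bsub>CC\<^esub>e\<in>E. tens k H H (r (sw H (\<lambda>u v. c e v \<odot>\<^bsub>H\<^esub> u) x)) (r e))"
        by (rule sw_expand_left[OF c xH CCm b2])
      moreover have "(\<Oplus>\<^bsub>CC\<^esub>e\<in>A. tens k H H (r (sw H (\<lambda>u v. c e v \<odot>\<^bsub>H\<^esub> u) x)) (r e)) \<in> ?U" if "A \<subseteq> E" for A
      proof -
        have "finite A" using that c finite_subset by (auto simp: dual_basis_def)
        then show ?thesis using that
        proof (induction A rule: finite_induct)
          case empty
          then show ?case using T.span_is_submodule[OF Usub] by (simp add: LinearCombinations.submodule_def)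
        next
          case (insert a A)
          have "tens k H H (r (sw H (\<lambda>u v. c e v \<odot>\<^bsub>H\<^esub> u) x)) (r e) \<in> ?U" if "e \<in> E" for e
            using right[OF x cf[OF that]] r EH[OF that] KH
            by (intro subsetD[OF T.in_own_span[OF Usub]]) auto
          then have *: "\<And>e. e \<in> insert a A \<Longrightarrow> tens k H H (r (sw H (\<lambda>u v. c e v \<odot>\<^bsub>H\<^esub> u) x)) (r e) \<in> ?U"
            using insert.prems by auto
          moreover have "?U \<subseteq> carrier CC" using Usub by (rule T.span_is_subset2)
          ultimately show ?case
            using insert T.span_is_submodule[OF Usub]
            by (subst T.finsum_insert) (auto simp: LinearCombinations.submodule_def)
        qed
      qed
      ultimately show ?thesis by simp
    qed
    finally show ?thesis .
  qed
  with ss sr S show ?thesis by (auto simp: hopf_subalgebra_def)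
qed

lemma hopf_subalgebra_Int:
  assumes "hopf_subalgebra k H K" "hopf_subalgebra k H L" shows "hopf_subalgebra k H (K \<inter> L)"
  by (rule hopf_subalgebraI)
    (use assms hopf_subalgebra_D[OF assms(1)] hopf_subalgebra_D[OF assms(2)] in
      \<open>auto intro: hopf_subalgebra_slices\<close>)

lemma sub_hopf_simps [simp]:
  "carrier (sub_hopf k H K) = K" "add (sub_hopf k H K) = add H" "mult (sub_hopf k H K) = mult H"
  "zero (sub_hopf k H K) = zero H" "one (sub_hopf k H K) = one H" "smult (sub_hopf k H K) = smult H"
  "counit (sub_hopf k H K) = counit H" "antipode (sub_hopf k H K) = antipode H"
  by (simp_all add: sub_hopf_def)

lemma sub_hopf_is_fd:
  assumes K: "hopf_subalgebra k H K"
  shows "fd_hopf_algebra k (sub_hopf k H K)"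
proof -
  obtain r where "retracted_sub k H K r" using retraction[OF K] .
  then interpret R: retracted_sub k H K r .
  interpret S: hopf_algebra k "sub_hopf k H K" by (rule R.sub_hopf_algebra)
  \<comment> \<open>The retraction exhibits \<open>K\<close> as a linear image of \<open>H\<close>,
    which bounds its dimension.\<close>
  have "linear_map k H (sub_hopf k H K) r"
    by (intro linear_map.intro vectorspace.intro field_axioms mod_hom.intro
        mod_hom_axioms.intro C_module R.Kh_module R.r_lin lin_id)
  moreover have "r ` carrier H = carrier (sub_hopf k H K)"
    using R.rK R.r_id R.KH by (auto simp: image_iff) (metis R.r_id R.KH)
  ultimately have "vectorspace.fin_dim k (sub_hopf k H K)"
    using linear_map.rank_nullity_main(2) fin_dim by blast
  then show ?thesis
    by (intro fd_hopf_algebra.intro fd_hopf_algebra_axioms.intro R.sub_hopf_algebra)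
qed

lemma sw_sub_hopf:
  assumes K: "hopf_subalgebra k H K" and "module k M" "bilin H H M \<beta>" "x \<in> K"
  shows "sweedler k (sub_hopf k H K) M \<beta> x = sw M \<beta> x"
proof -
  obtain r where "retracted_sub k H K r" using retraction[OF K] .
  then interpret R: retracted_sub k H K r .
  show ?thesis using assms by (intro R.sw_sub)
qed

lemma sub_hopf_lin:
  assumes K: "hopf_subalgebra k H K"
  shows "lin H M f \<Longrightarrow> lin (sub_hopf k H K) M f" "lin V (sub_hopf k H K) f' \<Longrightarrow> lin V H f'"
    "bilin H H M \<beta> \<Longrightarrow> bilin (sub_hopf k H K) (sub_hopf k H K) M \<beta>"
proof -
  obtain r where "retracted_sub k H K r" using retraction[OF K] .
  then interpret R: retracted_sub k H K r .
  show "lin H M f \<Longrightarrow> lin (sub_hopf k H K) M f" "lin V (sub_hopf k H K) f' \<Longrightarrow> lin V H f'"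
    "bilin H H M \<beta> \<Longrightarrow> bilin (sub_hopf k H K) (sub_hopf k H K) M \<beta>"
    by (rule R.lin_restrict R.incl_lin R.bilin_restrict, assumption)+
qed

lemma sw_sub_hopf_incl:
  assumes K: "hopf_subalgebra k H K" and "bilin H H H \<beta>" "bilin (sub_hopf k H K) (sub_hopf k H K) (sub_hopf k H K) \<beta>" "x \<in> K"
  shows "sweedler k (sub_hopf k H K) (sub_hopf k H K) \<beta> x = sw H \<beta> x"
proof -
  obtain r where "retracted_sub k H K r" using retraction[OF K] .
  then interpret R: retracted_sub k H K r .
  show ?thesis using assms by (intro R.sub_sw_incl)
qed

lemma functional_extend:
  assumes K: "hopf_subalgebra k H K" and g: "functional (sub_hopf k H K) g"
  obtains g' where "functional H g'" "\<And>x. x \<in> K \<Longrightarrow> g' x = g x"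
proof -
  obtain r where "retracted_sub k H K r" using retraction[OF K] .
  then interpret R: retracted_sub k H K r .
  show ?thesis
  proof (rule that)
    show "functional H (\<lambda>x. g (r x))" by (rule lin_comp[OF g R.r_lin[OF lin_id]])
  qed (simp add: R.r_id)
qed

text \<open>By the slice criterion only functionals matter: those on \<open>H\<close> restrict to
  \<open>L\<close>, those on \<open>L\<close> extend to \<open>H\<close>, and the slices of elements
  of \<open>L\<close> agree.\<close>

lemma hopf_subalgebra_sub_hopf_iff:
  assumes L: "hopf_subalgebra k H L"
  shows "hopf_subalgebra k (sub_hopf k H L) K \<longleftrightarrow> hopf_subalgebra k H K \<and> K \<subseteq> L"
proof -
  let ?L = "sub_hopf k H L"
  interpret S: fd_hopf_algebra k ?L by (rule sub_hopf_is_fd[OF L])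
  have bH: "bilin H H H (\<lambda>u v. g v \<odot>\<^bsub>H\<^esub> u)" "bilin H H H (\<lambda>u v. g u \<odot>\<^bsub>H\<^esub> v)" if "functional H g" for g
    using that lin_closed[OF that] by (auto intro!: bilinI lin_intros lin_comp[OF that])
  have bL: "bilin ?L ?L ?L (\<lambda>u v. g v \<odot>\<^bsub>H\<^esub> u)" "bilin ?L ?L ?L (\<lambda>u v. g u \<odot>\<^bsub>H\<^esub> v)" if "functional ?L g" for g
    using that lin_closed[OF that]
      lin_const_smult[OF S.C_module _ lin_id] lin_smult_vec[OF S.C_module _ that]
    by (auto intro!: bilinI)
  have slice: "S.sw ?L (\<lambda>u v. g v \<odot>\<^bsub>H\<^esub> u) x = sw H (\<lambda>u v. g v \<odot>\<^bsub>H\<^esub> u) x"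
    "S.sw ?L (\<lambda>u v. g u \<odot>\<^bsub>H\<^esub> v) x = sw H (\<lambda>u v. g u \<odot>\<^bsub>H\<^esub> v) x"
    if "functional H g" "x \<in> L" for g x
    using sw_sub_hopf_incl[OF L bH(1)[OF that(1)] bL(1)[OF sub_hopf_lin(1)[OF L that(1)]] that(2)]
      sw_sub_hopf_incl[OF L bH(2)[OF that(1)] bL(2)[OF sub_hopf_lin(1)[OF L that(1)]] that(2)]
    by auto
  show ?thesis
  proof
    assume K: "hopf_subalgebra k ?L K"
    note D = S.hopf_subalgebra_D[OF K, simplified]
    note LD = hopf_subalgebra_D[OF L]
    have KL: "K \<subseteq> L" using D by simp
    have "hopf_subalgebra k H K"
    proof (rule hopf_subalgebraI)
      fix x g assume x: "x \<in> K" and g: "functional H g"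
      show "sw H (\<lambda>u v. g v \<odot>\<^bsub>H\<^esub> u) x \<in> K" "sw H (\<lambda>u v. g u \<odot>\<^bsub>H\<^esub> v) x \<in> K"
        using S.hopf_subalgebra_slices[OF K x sub_hopf_lin(1)[OF L g]] slice[OF g] x KL by auto
    qed (use D KL LD in auto)
    with KL show "hopf_subalgebra k H K \<and> K \<subseteq> L" by simp
  next
    assume "hopf_subalgebra k H K \<and> K \<subseteq> L"
    then have K: "hopf_subalgebra k H K" and KL: "K \<subseteq> L" by auto
    note D = hopf_subalgebra_D[OF K]
    show "hopf_subalgebra k ?L K"
    proof (rule S.hopf_subalgebraI)
      fix x g assume x: "x \<in> K" and g: "functional ?L g"
      obtain g' where g': "functional H g'" "\<And>x. x \<in> L \<Longrightarrow> g' x = g x"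
        using functional_extend[OF L g] by blast
      have "S.sw ?L (\<lambda>u v. g v \<odot>\<^bsub>?L\<^esub> u) x = S.sw ?L (\<lambda>u v. g' v \<odot>\<^bsub>H\<^esub> u) x"
        by (rule S.sw_cong) (use x KL bL[OF g] g' in auto)
      then show "S.sw ?L (\<lambda>u v. g v \<odot>\<^bsub>?L\<^esub> u) x \<in> K"
        using slice[OF g'(1)] hopf_subalgebra_slices[OF K x g'(1)] x KL by auto
      have "S.sw ?L (\<lambda>u v. g u \<odot>\<^bsub>?L\<^esub> v) x = S.sw ?L (\<lambda>u v. g' u \<odot>\<^bsub>H\<^esub> v) x"
        by (rule S.sw_cong) (use x KL bL[OF g] g' in auto)
      then show "S.sw ?L (\<lambda>u v. g u \<odot>\<^bsub>?L\<^esub> v) x \<in> K"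
        using slice[OF g'(1)] hopf_subalgebra_slices[OF K x g'(1)] x KL by auto
    qed (use D KL in auto)
  qed
qed

end

section \<open>The antipode\<close>

context hopf_algebra
begin

lemma antipode_one [simp]: "antipode H \<one>\<^bsub>H\<^esub> = \<one>\<^bsub>H\<^esub>"
proof -
  have b: "bilin H H H (\<lambda>x y. antipode H x \<otimes>\<^bsub>H\<^esub> y)" by (auto intro!: bilinI lin_intros)
  have "antipode H \<one>\<^bsub>H\<^esub> = sw H (\<lambda>x y. antipode H x \<otimes>\<^bsub>H\<^esub> y) \<one>\<^bsub>H\<^esub>"
    by (simp add: sw_one[OF C_module b])
  also have "\<dots> = \<one>\<^bsub>H\<^esub>" using sw_antipode_left[OF C_module lin_id, of "\<one>\<^bsub>H\<^esub>"] by simp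
  finally show ?thesis .
qed

lemma counit_antipode [simp]:
  assumes h: "h \<in> carrier H" shows "counit H (antipode H h) = counit H h"
proof -
  have "counit H h = sw K1 (\<lambda>x y. counit H (antipode H x \<otimes>\<^bsub>H\<^esub> y)) h"
    using sw_antipode_left[OF scalar_module_module counit_functional h] h by simp
  also have "\<dots> = sw K1 (\<lambda>x y. counit H y \<odot>\<^bsub>K1\<^esub> counit H (antipode H x)) h"
    by (rule sw_cong) (use h in \<open>auto intro!: bilinI lin_intros simp: m_comm\<close>)
  also have "\<dots> = counit H (antipode H h)"
    by (rule sw_counit_right) (use h in \<open>auto intro!: lin_intros\<close>)
  finally show ?thesis by simp
qed

text \<open>The convolution argument: \<open>S(gh)\<close> and \<open>S(h)S(g)\<close> are both
  inverse to the product map on \<open>H \<otimes> H\<close>. Concretely,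
  \<open>S(g_1 h_1) g_2 h_2 S(h_3) S(g_3)\<close> is evaluated from the right and from the
  left.\<close>

lemma antipode_mult:
  assumes g: "g \<in> carrier H" and h: "h \<in> carrier H"
  shows "antipode H (g \<otimes>\<^bsub>H\<^esub> h) = antipode H h \<otimes>\<^bsub>H\<^esub> antipode H g"
proof -
  let ?S = "antipode H"
  note [simp] = g h
  define Y where "Y a p q b r s = (?S (a \<otimes>\<^bsub>H\<^esub> b) \<otimes>\<^bsub>H\<^esub> (p \<otimes>\<^bsub>H\<^esub> r)) \<otimes>\<^bsub>H\<^esub> (?S s \<otimes>\<^bsub>H\<^esub> ?S q)" for a p q b r s
  have Y [lin_intros]: "lin H H (\<lambda>a. Y a p q b r s)" "lin H H (\<lambda>p. Y a p q b r s)" "lin H H (\<lambda>q. Y a p q b r s)"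
    "lin H H (\<lambda>b. Y a p q b r s)" "lin H H (\<lambda>r. Y a p q b r s)" "lin H H (\<lambda>s. Y a p q b r s)"
    if "a \<in> carrier H" "p \<in> carrier H" "q \<in> carrier H" "b \<in> carrier H" "r \<in> carrier H" "s \<in> carrier H"
    for a p q b r s
    unfolding Y_def using that by (auto intro!: lin_intros)
  define E where "E = sw H (\<lambda>a a'. sw H (\<lambda>p q. sw H (\<lambda>b b'. sw H (\<lambda>r s. Y a p q b r s) b') h) a') g"
  have "E = ?S (g \<otimes>\<^bsub>H\<^esub> h)"
  proof -
    have 1: "sw H (\<lambda>r s. Y a p q b r s) b' = counit H b' \<odot>\<^bsub>H\<^esub> (?S (a \<otimes>\<^bsub>H\<^esub> b) \<otimes>\<^bsub>H\<^esub> (p \<otimes>\<^bsub>H\<^esub> ?S q))"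
      if [simp]: "a \<in> carrier H" "p \<in> carrier H" "q \<in> carrier H" "b \<in> carrier H" "b' \<in> carrier H" for a p q b b'
    proof -
      let ?F = "\<lambda>z. ?S (a \<otimes>\<^bsub>H\<^esub> b) \<otimes>\<^bsub>H\<^esub> (p \<otimes>\<^bsub>H\<^esub> (z \<otimes>\<^bsub>H\<^esub> ?S q))"
      have "sw H (\<lambda>r s. Y a p q b r s) b' = sw H (\<lambda>r s. ?F (r \<otimes>\<^bsub>H\<^esub> ?S s)) b'"
        by (rule sw_cong) (auto intro!: bilinI lin_intros simp: Y_def m_assoc)
      also have "\<dots> = counit H b' \<odot>\<^bsub>H\<^esub> ?F \<one>\<^bsub>H\<^esub>" by (rule sw_antipode_right) (auto intro!: lin_intros)
      finally show ?thesis by simp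
    qed
    have 2: "sw H (\<lambda>b b'. sw H (\<lambda>r s. Y a p q b r s) b') h = ?S (a \<otimes>\<^bsub>H\<^esub> h) \<otimes>\<^bsub>H\<^esub> (p \<otimes>\<^bsub>H\<^esub> ?S q)"
      if [simp]: "a \<in> carrier H" "p \<in> carrier H" "q \<in> carrier H" for a p q
    proof -
      have "sw H (\<lambda>b b'. sw H (\<lambda>r s. Y a p q b r s) b') h
        = sw H (\<lambda>b b'. counit H b' \<odot>\<^bsub>H\<^esub> (?S (a \<otimes>\<^bsub>H\<^esub> b) \<otimes>\<^bsub>H\<^esub> (p \<otimes>\<^bsub>H\<^esub> ?S q))) h"
        by (rule sw_cong) (auto intro!: bilinI lin_intros simp: 1)
      also have "\<dots> = ?S (a \<otimes>\<^bsub>H\<^esub> h) \<otimes>\<^bsub>H\<^esub> (p \<otimes>\<^bsub>H\<^esub> ?S q)"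
        by (rule sw_counit_right) (auto intro!: lin_intros)
      finally show ?thesis .
    qed
    have 3: "sw H (\<lambda>p q. sw H (\<lambda>b b'. sw H (\<lambda>r s. Y a p q b r s) b') h) a' = counit H a' \<odot>\<^bsub>H\<^esub> ?S (a \<otimes>\<^bsub>H\<^esub> h)"
      if [simp]: "a \<in> carrier H" "a' \<in> carrier H" for a a'
    proof -
      have "sw H (\<lambda>p q. sw H (\<lambda>b b'. sw H (\<lambda>r s. Y a p q b r s) b') h) a'
        = sw H (\<lambda>p q. ?S (a \<otimes>\<^bsub>H\<^esub> h) \<otimes>\<^bsub>H\<^esub> (p \<otimes>\<^bsub>H\<^esub> ?S q)) a'"
        by (rule sw_cong) (auto intro!: bilinI lin_intros simp: 2)
      also have "\<dots> = counit H a' \<odot>\<^bsub>H\<^esub> (?S (a \<otimes>\<^bsub>H\<^esub> h) \<otimes>\<^bsub>H\<^esub> \<one>\<^bsub>H\<^esub>)"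
        by (rule sw_antipode_right) (auto intro!: lin_intros)
      finally show ?thesis by simp
    qed
    have "E = sw H (\<lambda>a a'. counit H a' \<odot>\<^bsub>H\<^esub> ?S (a \<otimes>\<^bsub>H\<^esub> h)) g"
      unfolding E_def by (rule sw_cong) (auto intro!: bilinI lin_intros simp: 3)
    also have "\<dots> = ?S (g \<otimes>\<^bsub>H\<^esub> h)" by (rule sw_counit_right) (auto intro!: lin_intros)
    finally show ?thesis .
  qed
  \<comment> \<open>The other bracketing: coassociativity brings \<open>a, p\<close> and
    \<open>b, r\<close> together, so that \<open>S(g_1 h_1) g_2 h_2\<close> collapses.\<close>
  moreover have "E = ?S h \<otimes>\<^bsub>H\<^esub> ?S g"
  proof -
    have 1: "sw H (\<lambda>b b'. sw H (\<lambda>r s. Y a p q b r s) b') h = sw H (\<lambda>b' s. sw H (\<lambda>b r. Y a p q b r s) b') h"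
      if [simp]: "a \<in> carrier H" "p \<in> carrier H" "q \<in> carrier H" for a p q
      by (rule sw_coassoc[symmetric]) (auto intro!: lin_intros)
    have "E = sw H (\<lambda>a a'. sw H (\<lambda>p q. sw H (\<lambda>b' s. sw H (\<lambda>b r. Y a p q b r s) b') h) a') g"
      unfolding E_def
      by (rule sw_cong, simp_all, (auto intro!: bilinI lin_intros)[1], rule sw_cong)
        (auto intro!: bilinI lin_intros simp: 1)
    also have "\<dots> = sw H (\<lambda>a' q. sw H (\<lambda>a p. sw H (\<lambda>b' s. sw H (\<lambda>b r. Y a p q b r s) b') h) a') g"
      by (rule sw_coassoc[symmetric]) (auto intro!: bilinI lin_intros)
    also have "\<dots> = sw H (\<lambda>a' q. sw H (\<lambda>b' s. sw H (\<lambda>a p. sw H (\<lambda>b r. Y a p q b r s) b') a') h) g"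
      by (rule sw_cong, simp_all, (auto intro!: bilinI lin_intros)[1], rule sw_swap)
        (auto intro!: bilinI lin_intros)
    also have "\<dots> = sw H (\<lambda>a' q. sw H (\<lambda>b' s. counit H b' \<odot>\<^bsub>H\<^esub> (counit H a' \<odot>\<^bsub>H\<^esub> (?S s \<otimes>\<^bsub>H\<^esub> ?S q))) h) g"
    proof (rule sw_cong, simp_all, (auto intro!: bilinI lin_intros)[1], rule sw_cong, simp_all, (auto intro!: bilinI lin_intros)[1])
      fix a' q b' s assume [simp]: "a' \<in> carrier H" "q \<in> carrier H" "b' \<in> carrier H" "s \<in> carrier H"
      \<comment> \<open>Multiplicativity of the comultiplication read backwards: the double sum is a
        single one over \<open>a' b'\<close>.\<close>
      have "sw H (\<lambda>a p. sw H (\<lambda>b r. Y a p q b r s) b') a' = sw H (\<lambda>x y. (?S x \<otimes>\<^bsub>H\<^esub> y) \<otimes>\<^bsub>H\<^esub> (?S s \<otimes>\<^bsub>H\<^esub> ?S q)) (a' \<otimes>\<^bsub>H\<^esub> b')"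
        unfolding Y_def by (rule sw_mult[symmetric]) (auto intro!: bilinI lin_intros)
      also have "\<dots> = counit H (a' \<otimes>\<^bsub>H\<^esub> b') \<odot>\<^bsub>H\<^esub> (\<one>\<^bsub>H\<^esub> \<otimes>\<^bsub>H\<^esub> (?S s \<otimes>\<^bsub>H\<^esub> ?S q))"
        by (rule sw_antipode_left) (auto intro!: lin_intros)
      finally show "sw H (\<lambda>a p. sw H (\<lambda>b r. Y a p q b r s) b') a' = counit H b' \<odot>\<^bsub>H\<^esub> (counit H a' \<odot>\<^bsub>H\<^esub> (?S s \<otimes>\<^bsub>H\<^esub> ?S q))"
        by (simp add: smult_assoc1[symmetric] R.m_comm)
    qed
    also have "\<dots> = sw H (\<lambda>a' q. counit H a' \<odot>\<^bsub>H\<^esub> (?S h \<otimes>\<^bsub>H\<^esub> ?S q)) g"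
      by (rule sw_cong, simp_all, (auto intro!: bilinI lin_intros)[1], rule sw_counit_left)
        (auto intro!: lin_intros)
    also have "\<dots> = ?S h \<otimes>\<^bsub>H\<^esub> ?S g"
      by (rule sw_counit_left) (auto intro!: lin_intros)
    finally show ?thesis .
  qed
  ultimately show ?thesis by simp
qed

end

section \<open>Adjoint actions and products of Hopf subalgebras\<close>

context hopf_algebra
begin

definition adl where "adl h a = sw H (\<lambda>x y. x \<otimes>\<^bsub>H\<^esub> a \<otimes>\<^bsub>H\<^esub> antipode H y) h"
definition adr where "adr h a = sw H (\<lambda>x y. antipode H x \<otimes>\<^bsub>H\<^esub> a \<otimes>\<^bsub>H\<^esub> y) h"

lemma adl_lin1 [lin_intros]: "lin V H f \<Longrightarrow> a \<in> carrier H \<Longrightarrow> lin V H (\<lambda>h. adl (f h) a)"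
  unfolding adl_def by (auto intro!: bilinI lin_intros)

lemma adl_lin2 [lin_intros]:
  assumes "module k V" and f: "lin V H f" and "h \<in> carrier H"
  shows "lin V H (\<lambda>a. adl h (f a))"
proof -
  note [simp] = lin_closed[OF f]
  show ?thesis unfolding adl_def using assms by (auto intro!: bilinI lin_intros)
qed

lemma adr_lin1 [lin_intros]: "lin V H f \<Longrightarrow> a \<in> carrier H \<Longrightarrow> lin V H (\<lambda>h. adr (f h) a)"
  unfolding adr_def by (auto intro!: bilinI lin_intros)

lemma adr_lin2 [lin_intros]:
  assumes "module k V" and f: "lin V H f" and "h \<in> carrier H"
  shows "lin V H (\<lambda>a. adr h (f a))"
proof -
  note [simp] = lin_closed[OF f]
  show ?thesis unfolding adr_def using assms by (auto intro!: bilinI lin_intros)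
qed

lemma ad_closed [simp, intro]:
  "h \<in> carrier H \<Longrightarrow> a \<in> carrier H \<Longrightarrow> adl h a \<in> carrier H"
  "h \<in> carrier H \<Longrightarrow> a \<in> carrier H \<Longrightarrow> adr h a \<in> carrier H"
  using lin_closed[OF adl_lin1[OF lin_id]] lin_closed[OF adr_lin1[OF lin_id]] by auto

lemma adl_mult:
  assumes [simp]: "g \<in> carrier H" "h \<in> carrier H" "a \<in> carrier H"
  shows "adl (g \<otimes>\<^bsub>H\<^esub> h) a = adl g (adl h a)"
proof -
  have "adl (g \<otimes>\<^bsub>H\<^esub> h) a = sw H (\<lambda>x y. sw H (\<lambda>u v. (x \<otimes>\<^bsub>H\<^esub> u) \<otimes>\<^bsub>H\<^esub> a \<otimes>\<^bsub>H\<^esub> antipode H (y \<otimes>\<^bsub>H\<^esub> v)) h) g"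
    unfolding adl_def by (rule sw_mult) (auto intro!: bilinI lin_intros)
  also have "\<dots> = adl g (adl h a)"
    unfolding adl_def[of g]
  proof (rule sw_cong, simp_all, (auto intro!: bilinI lin_intros)[1])
    fix x y assume [simp]: "x \<in> carrier H" "y \<in> carrier H"
    have "sw H (\<lambda>u v. (x \<otimes>\<^bsub>H\<^esub> u) \<otimes>\<^bsub>H\<^esub> a \<otimes>\<^bsub>H\<^esub> antipode H (y \<otimes>\<^bsub>H\<^esub> v)) h
      = sw H (\<lambda>u v. x \<otimes>\<^bsub>H\<^esub> (u \<otimes>\<^bsub>H\<^esub> a \<otimes>\<^bsub>H\<^esub> antipode H v) \<otimes>\<^bsub>H\<^esub> antipode H y) h"
      by (rule sw_cong) (auto intro!: bilinI lin_intros simp: antipode_mult m_assoc)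
    also have "\<dots> = x \<otimes>\<^bsub>H\<^esub> adl h a \<otimes>\<^bsub>H\<^esub> antipode H y"
      unfolding adl_def by (rule sw_hom[symmetric]) (auto intro!: bilinI lin_intros)
    finally show "sw H (\<lambda>u v. x \<otimes>\<^bsub>H\<^esub> u \<otimes>\<^bsub>H\<^esub> a \<otimes>\<^bsub>H\<^esub> antipode H (y \<otimes>\<^bsub>H\<^esub> v)) h = x \<otimes>\<^bsub>H\<^esub> adl h a \<otimes>\<^bsub>H\<^esub> antipode H y" .
  qed
  finally show ?thesis .
qed

lemma adr_mult:
  assumes [simp]: "g \<in> carrier H" "h \<in> carrier H" "a \<in> carrier H"
  shows "adr (g \<otimes>\<^bsub>H\<^esub> h) a = adr h (adr g a)"
proof -
  have "adr (g \<otimes>\<^bsub>H\<^esub> h) a = sw H (\<lambda>x y. sw H (\<lambda>u v. antipode H (x \<otimes>\<^bsub>H\<^esub> u) \<otimes>\<^bsub>H\<^esub> a \<otimes>\<^bsub>H\<^esub> (y \<otimes>\<^bsub>H\<^esub> v)) h) g"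
    unfolding adr_def by (rule sw_mult) (auto intro!: bilinI lin_intros)
  also have "\<dots> = sw H (\<lambda>u v. sw H (\<lambda>x y. antipode H (x \<otimes>\<^bsub>H\<^esub> u) \<otimes>\<^bsub>H\<^esub> a \<otimes>\<^bsub>H\<^esub> (y \<otimes>\<^bsub>H\<^esub> v)) g) h"
    by (rule sw_swap) (auto intro!: bilinI lin_intros)
  also have "\<dots> = adr h (adr g a)"
    unfolding adr_def[of h]
  proof (rule sw_cong, simp_all, (auto intro!: bilinI lin_intros)[1])
    fix u v assume [simp]: "u \<in> carrier H" "v \<in> carrier H"
    have "sw H (\<lambda>x y. antipode H (x \<otimes>\<^bsub>H\<^esub> u) \<otimes>\<^bsub>H\<^esub> a \<otimes>\<^bsub>H\<^esub> (y \<otimes>\<^bsub>H\<^esub> v)) g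
      = sw H (\<lambda>x y. antipode H u \<otimes>\<^bsub>H\<^esub> (antipode H x \<otimes>\<^bsub>H\<^esub> a \<otimes>\<^bsub>H\<^esub> y) \<otimes>\<^bsub>H\<^esub> v) g"
      by (rule sw_cong) (auto intro!: bilinI lin_intros simp: antipode_mult m_assoc)
    also have "\<dots> = antipode H u \<otimes>\<^bsub>H\<^esub> adr g a \<otimes>\<^bsub>H\<^esub> v"
      unfolding adr_def by (rule sw_hom[symmetric]) (auto intro!: bilinI lin_intros)
    finally show "sw H (\<lambda>x y. antipode H (x \<otimes>\<^bsub>H\<^esub> u) \<otimes>\<^bsub>H\<^esub> a \<otimes>\<^bsub>H\<^esub> (y \<otimes>\<^bsub>H\<^esub> v)) g = antipode H u \<otimes>\<^bsub>H\<^esub> adr g a \<otimes>\<^bsub>H\<^esub> v" .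
  qed
  finally show ?thesis .
qed

text \<open>Insert \<open>S(h_2) h_3\<close> in place of a counit. This is the rule that moves
  \<open>h\<close> to the right of \<open>a\<close> at the price of an adjoint action.\<close>

lemma mult_adl:
  assumes [simp]: "h \<in> carrier H" "a \<in> carrier H"
  shows "h \<otimes>\<^bsub>H\<^esub> a = sw H (\<lambda>x y. adl x a \<otimes>\<^bsub>H\<^esub> y) h"
proof -
  have "sw H (\<lambda>x y. adl x a \<otimes>\<^bsub>H\<^esub> y) h = sw H (\<lambda>x y. sw H (\<lambda>u v. u \<otimes>\<^bsub>H\<^esub> a \<otimes>\<^bsub>H\<^esub> (antipode H v \<otimes>\<^bsub>H\<^esub> y)) x) h"
  proof (rule sw_cong, simp_all, (auto intro!: bilinI lin_intros)[1])
    fix x y assume [simp]: "x \<in> carrier H" "y \<in> carrier H"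
    have "adl x a \<otimes>\<^bsub>H\<^esub> y = sw H (\<lambda>u v. u \<otimes>\<^bsub>H\<^esub> a \<otimes>\<^bsub>H\<^esub> antipode H v \<otimes>\<^bsub>H\<^esub> y) x"
      unfolding adl_def by (rule sw_hom) (auto intro!: bilinI lin_intros)
    also have "\<dots> = sw H (\<lambda>u v. u \<otimes>\<^bsub>H\<^esub> a \<otimes>\<^bsub>H\<^esub> (antipode H v \<otimes>\<^bsub>H\<^esub> y)) x"
      by (rule sw_cong) (auto intro!: bilinI lin_intros simp: m_assoc)
    finally show "adl x a \<otimes>\<^bsub>H\<^esub> y = sw H (\<lambda>u v. u \<otimes>\<^bsub>H\<^esub> a \<otimes>\<^bsub>H\<^esub> (antipode H v \<otimes>\<^bsub>H\<^esub> y)) x" .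
  qed
  also have "\<dots> = sw H (\<lambda>u x. sw H (\<lambda>v y. u \<otimes>\<^bsub>H\<^esub> a \<otimes>\<^bsub>H\<^esub> (antipode H v \<otimes>\<^bsub>H\<^esub> y)) x) h"
    by (rule sw_coassoc) (auto intro!: bilinI lin_intros)
  also have "\<dots> = sw H (\<lambda>u x. counit H x \<odot>\<^bsub>H\<^esub> (u \<otimes>\<^bsub>H\<^esub> a)) h"
  proof (rule sw_cong, simp_all, (auto intro!: bilinI lin_intros)[1])
    fix x y assume [simp]: "x \<in> carrier H" "y \<in> carrier H"
    have "sw H (\<lambda>v z. x \<otimes>\<^bsub>H\<^esub> a \<otimes>\<^bsub>H\<^esub> (antipode H v \<otimes>\<^bsub>H\<^esub> z)) y = counit H y \<odot>\<^bsub>H\<^esub> (x \<otimes>\<^bsub>H\<^esub> a \<otimes>\<^bsub>H\<^esub> \<one>\<^bsub>H\<^esub>)"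
      by (rule sw_antipode_left) (auto intro!: lin_intros)
    then show "sw H (\<lambda>v z. x \<otimes>\<^bsub>H\<^esub> a \<otimes>\<^bsub>H\<^esub> (antipode H v \<otimes>\<^bsub>H\<^esub> z)) y = counit H y \<odot>\<^bsub>H\<^esub> (x \<otimes>\<^bsub>H\<^esub> a)" by simp
  qed
  also have "\<dots> = h \<otimes>\<^bsub>H\<^esub> a" by (rule sw_counit_right) (auto intro!: lin_intros)
  finally show ?thesis by simp
qed

text \<open>The mirror image, obtained by inserting \<open>h_1 S(h_2)\<close>: it moves
  \<open>h\<close> to the left of \<open>a\<close>.\<close>

lemma mult_adr:
  assumes [simp]: "h \<in> carrier H" "a \<in> carrier H"
  shows "a \<otimes>\<^bsub>H\<^esub> h = sw H (\<lambda>x y. x \<otimes>\<^bsub>H\<^esub> adr y a) h"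
proof -
  have "sw H (\<lambda>x y. x \<otimes>\<^bsub>H\<^esub> adr y a) h = sw H (\<lambda>x y. sw H (\<lambda>u v. (x \<otimes>\<^bsub>H\<^esub> antipode H u) \<otimes>\<^bsub>H\<^esub> (a \<otimes>\<^bsub>H\<^esub> v)) y) h"
  proof (rule sw_cong, simp_all, (auto intro!: bilinI lin_intros)[1])
    fix x y assume [simp]: "x \<in> carrier H" "y \<in> carrier H"
    have "x \<otimes>\<^bsub>H\<^esub> adr y a = sw H (\<lambda>u v. x \<otimes>\<^bsub>H\<^esub> (antipode H u \<otimes>\<^bsub>H\<^esub> a \<otimes>\<^bsub>H\<^esub> v)) y"
      unfolding adr_def by (rule sw_hom) (auto intro!: bilinI lin_intros)
    also have "\<dots> = sw H (\<lambda>u v. (x \<otimes>\<^bsub>H\<^esub> antipode H u) \<otimes>\<^bsub>H\<^esub> (a \<otimes>\<^bsub>H\<^esub> v)) y"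
      by (rule sw_cong) (auto intro!: bilinI lin_intros simp: m_assoc)
    finally show "x \<otimes>\<^bsub>H\<^esub> adr y a = sw H (\<lambda>u v. (x \<otimes>\<^bsub>H\<^esub> antipode H u) \<otimes>\<^bsub>H\<^esub> (a \<otimes>\<^bsub>H\<^esub> v)) y" .
  qed
  also have "\<dots> = sw H (\<lambda>x v. sw H (\<lambda>x u. (x \<otimes>\<^bsub>H\<^esub> antipode H u) \<otimes>\<^bsub>H\<^esub> (a \<otimes>\<^bsub>H\<^esub> v)) x) h"
    by (rule sw_coassoc[symmetric]) (auto intro!: bilinI lin_intros)
  also have "\<dots> = sw H (\<lambda>x v. counit H x \<odot>\<^bsub>H\<^esub> (a \<otimes>\<^bsub>H\<^esub> v)) h"
  proof (rule sw_cong, simp_all, (auto intro!: bilinI lin_intros)[1])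
    fix x y assume [simp]: "x \<in> carrier H" "y \<in> carrier H"
    have "sw H (\<lambda>v z. v \<otimes>\<^bsub>H\<^esub> antipode H z \<otimes>\<^bsub>H\<^esub> (a \<otimes>\<^bsub>H\<^esub> y)) x = counit H x \<odot>\<^bsub>H\<^esub> (\<one>\<^bsub>H\<^esub> \<otimes>\<^bsub>H\<^esub> (a \<otimes>\<^bsub>H\<^esub> y))"
      by (rule sw_antipode_right) (auto intro!: lin_intros)
    then show "sw H (\<lambda>v z. v \<otimes>\<^bsub>H\<^esub> antipode H z \<otimes>\<^bsub>H\<^esub> (a \<otimes>\<^bsub>H\<^esub> y)) x = counit H x \<odot>\<^bsub>H\<^esub> (a \<otimes>\<^bsub>H\<^esub> y)" by simp
  qed
  also have "\<dots> = a \<otimes>\<^bsub>H\<^esub> h" by (rule sw_counit_left) (auto intro!: lin_intros)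
  finally show ?thesis by simp
qed

text \<open>In \<open>h_1 a b S(h_2)\<close> the rule \<open>mult_adl\<close> moves
  \<open>h_1\<close> past \<open>a\<close>; what remains around \<open>b\<close> is again an adjoint
  action.\<close>

lemma adl_prod:
  assumes [simp]: "h \<in> carrier H" "a \<in> carrier H" "b \<in> carrier H"
  shows "adl h (a \<otimes>\<^bsub>H\<^esub> b) = sw H (\<lambda>x y. adl x a \<otimes>\<^bsub>H\<^esub> adl y b) h"
proof -
  have "adl h (a \<otimes>\<^bsub>H\<^esub> b) = sw H (\<lambda>x y. (x \<otimes>\<^bsub>H\<^esub> a) \<otimes>\<^bsub>H\<^esub> (b \<otimes>\<^bsub>H\<^esub> antipode H y)) h"
    unfolding adl_def by (rule sw_cong) (auto intro!: bilinI lin_intros simp: m_assoc)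
  also have "\<dots> = sw H (\<lambda>x y. sw H (\<lambda>u v. adl u a \<otimes>\<^bsub>H\<^esub> v \<otimes>\<^bsub>H\<^esub> (b \<otimes>\<^bsub>H\<^esub> antipode H y)) x) h"
  proof (rule sw_cong, simp_all, (auto intro!: bilinI lin_intros)[1])
    fix x y assume [simp]: "x \<in> carrier H" "y \<in> carrier H"
    show "x \<otimes>\<^bsub>H\<^esub> a \<otimes>\<^bsub>H\<^esub> (b \<otimes>\<^bsub>H\<^esub> antipode H y) = sw H (\<lambda>u v. adl u a \<otimes>\<^bsub>H\<^esub> v \<otimes>\<^bsub>H\<^esub> (b \<otimes>\<^bsub>H\<^esub> antipode H y)) x"
      unfolding mult_adl[of x a, simplified] by (rule sw_hom) (auto intro!: bilinI lin_intros)
  qed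
  also have "\<dots> = sw H (\<lambda>u y. sw H (\<lambda>v y. adl u a \<otimes>\<^bsub>H\<^esub> v \<otimes>\<^bsub>H\<^esub> (b \<otimes>\<^bsub>H\<^esub> antipode H y)) y) h"
    by (rule sw_coassoc) (auto intro!: bilinI lin_intros)
  also have "\<dots> = sw H (\<lambda>x y. adl x a \<otimes>\<^bsub>H\<^esub> adl y b) h"
  proof (rule sw_cong, simp_all, (auto intro!: bilinI lin_intros)[1])
    fix x y assume [simp]: "x \<in> carrier H" "y \<in> carrier H"
    have "sw H (\<lambda>v z. adl x a \<otimes>\<^bsub>H\<^esub> v \<otimes>\<^bsub>H\<^esub> (b \<otimes>\<^bsub>H\<^esub> antipode H z)) y
      = sw H (\<lambda>v z. adl x a \<otimes>\<^bsub>H\<^esub> (v \<otimes>\<^bsub>H\<^esub> b \<otimes>\<^bsub>H\<^esub> antipode H z)) y"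
      by (rule sw_cong) (auto intro!: bilinI lin_intros simp: m_assoc)
    also have "\<dots> = adl x a \<otimes>\<^bsub>H\<^esub> adl y b"
      unfolding adl_def[of y] by (rule sw_hom[symmetric]) (auto intro!: bilinI lin_intros)
    finally show "sw H (\<lambda>v z. adl x a \<otimes>\<^bsub>H\<^esub> v \<otimes>\<^bsub>H\<^esub> (b \<otimes>\<^bsub>H\<^esub> antipode H z)) y = adl x a \<otimes>\<^bsub>H\<^esub> adl y b" .
  qed
  finally show ?thesis .
qed

lemma adr_prod:
  assumes [simp]: "h \<in> carrier H" "a \<in> carrier H" "b \<in> carrier H"
  shows "adr h (a \<otimes>\<^bsub>H\<^esub> b) = sw H (\<lambda>x y. adr x a \<otimes>\<^bsub>H\<^esub> adr y b) h"
proof -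
  have "adr h (a \<otimes>\<^bsub>H\<^esub> b) = sw H (\<lambda>x y. (antipode H x \<otimes>\<^bsub>H\<^esub> a) \<otimes>\<^bsub>H\<^esub> (b \<otimes>\<^bsub>H\<^esub> y)) h"
    unfolding adr_def by (rule sw_cong) (auto intro!: bilinI lin_intros simp: m_assoc)
  also have "\<dots> = sw H (\<lambda>x y. sw H (\<lambda>u v. antipode H x \<otimes>\<^bsub>H\<^esub> a \<otimes>\<^bsub>H\<^esub> (u \<otimes>\<^bsub>H\<^esub> adr v b)) y) h"
  proof (rule sw_cong, simp_all, (auto intro!: bilinI lin_intros)[1])
    fix x y assume [simp]: "x \<in> carrier H" "y \<in> carrier H"
    show "antipode H x \<otimes>\<^bsub>H\<^esub> a \<otimes>\<^bsub>H\<^esub> (b \<otimes>\<^bsub>H\<^esub> y) = sw H (\<lambda>u v. antipode H x \<otimes>\<^bsub>H\<^esub> a \<otimes>\<^bsub>H\<^esub> (u \<otimes>\<^bsub>H\<^esub> adr v b)) y"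
      unfolding mult_adr[of y b, simplified] by (rule sw_hom) (auto intro!: bilinI lin_intros)
  qed
  also have "\<dots> = sw H (\<lambda>x v. sw H (\<lambda>x u. antipode H x \<otimes>\<^bsub>H\<^esub> a \<otimes>\<^bsub>H\<^esub> (u \<otimes>\<^bsub>H\<^esub> adr v b)) x) h"
    by (rule sw_coassoc[symmetric]) (auto intro!: bilinI lin_intros)
  also have "\<dots> = sw H (\<lambda>x y. adr x a \<otimes>\<^bsub>H\<^esub> adr y b) h"
  proof (rule sw_cong, simp_all, (auto intro!: bilinI lin_intros)[1])
    fix x y assume [simp]: "x \<in> carrier H" "y \<in> carrier H"
    have "sw H (\<lambda>x u. antipode H x \<otimes>\<^bsub>H\<^esub> a \<otimes>\<^bsub>H\<^esub> (u \<otimes>\<^bsub>H\<^esub> adr y b)) x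
      = sw H (\<lambda>x u. antipode H x \<otimes>\<^bsub>H\<^esub> a \<otimes>\<^bsub>H\<^esub> u \<otimes>\<^bsub>H\<^esub> adr y b) x"
      by (rule sw_cong) (auto intro!: bilinI lin_intros simp: m_assoc)
    also have "\<dots> = adr x a \<otimes>\<^bsub>H\<^esub> adr y b"
      unfolding adr_def[of x] by (rule sw_hom[symmetric]) (auto intro!: bilinI lin_intros)
    finally show "sw H (\<lambda>x u. antipode H x \<otimes>\<^bsub>H\<^esub> a \<otimes>\<^bsub>H\<^esub> (u \<otimes>\<^bsub>H\<^esub> adr y b)) x = adr x a \<otimes>\<^bsub>H\<^esub> adr y b" .
  qed
  finally show ?thesis .
qed

section \<open>Spans of products and the Hopf subalgebras they form\<close>

lemma span_prod_closed:
  assumes "X \<subseteq> carrier H" "Y \<subseteq> carrier H"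
  shows "LinearCombinations.submodule k (span_prod k H X Y) H" "span_prod k H X Y \<subseteq> carrier H"
    "x \<in> X \<Longrightarrow> y \<in> Y \<Longrightarrow> x \<otimes>\<^bsub>H\<^esub> y \<in> span_prod k H X Y"
proof -
  have s: "{x \<otimes>\<^bsub>H\<^esub> y | x y. x \<in> X \<and> y \<in> Y} \<subseteq> carrier H" using assms by blast
  show "LinearCombinations.submodule k (span_prod k H X Y) H" "span_prod k H X Y \<subseteq> carrier H"
    unfolding span_prod_def using span_is_submodule[OF s] span_is_subset2[OF s] .
  show "x \<in> X \<Longrightarrow> y \<in> Y \<Longrightarrow> x \<otimes>\<^bsub>H\<^esub> y \<in> span_prod k H X Y"
    unfolding span_prod_def using in_own_span[OF s] by blast
qed

lemma span_prod_subset: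
  assumes "LinearCombinations.submodule k U H" "\<And>x y. x \<in> X \<Longrightarrow> y \<in> Y \<Longrightarrow> x \<otimes>\<^bsub>H\<^esub> y \<in> U"
  shows "span_prod k H X Y \<subseteq> U"
  unfolding span_prod_def using assms by (intro span_is_subset) auto

lemma submodule_vimage:
  assumes f: "lin H H f" and U: "LinearCombinations.submodule k U H"
  shows "LinearCombinations.submodule k {x \<in> carrier H. f x \<in> U} H"
proof -
  interpret U: LinearCombinations.submodule k U H by (rule U)
  show ?thesis
    by (intro LinearCombinations.submodule.intro C_module)
      (auto simp: lin_add[OF f] lin_smult[OF f] lin_zero[OF C_module C_module f])
qed

lemma span_prod_lin_mem:
  assumes f: "lin H H f" and U: "LinearCombinations.submodule k U H" and XY: "X \<subseteq> carrier H" "Y \<subseteq> carrier H"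
    and g: "\<And>x y. x \<in> X \<Longrightarrow> y \<in> Y \<Longrightarrow> f (x \<otimes>\<^bsub>H\<^esub> y) \<in> U" and z: "z \<in> span_prod k H X Y"
  shows "f z \<in> U"
proof -
  have "span_prod k H X Y \<subseteq> {x \<in> carrier H. f x \<in> U}"
    by (rule span_prod_subset[OF submodule_vimage[OF f U]]) (use g XY in blast)
  with z show ?thesis by blast
qed

text \<open>Stability under both adjoint actions with the acting set separated from the ambient
  algebra, so that several subalgebras can act on one another inside a fixed
  \<open>H\<close>.\<close>

definition normalizes where
  "normalizes D N \<longleftrightarrow> (\<forall>d\<in>D. \<forall>n\<in>N. adl d n \<in> N \<and> adr d n \<in> N)"

end

context fd_hopf_algebra
begin

lemma normalizes_mono: "normalizes D N \<Longrightarrow> D' \<subseteq> D \<Longrightarrow> normalizes D' N"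
  by (auto simp: normalizes_def)

text \<open>Formulated for a stable subset \<open>X\<close> because it is applied both to a whole
  Hopf subalgebra and to its augmentation ideal.\<close>

lemma normalizes_commute:
  assumes N: "hopf_subalgebra k H N" and D: "hopf_subalgebra k H D" and nm: "normalizes D N"
    and X: "X \<subseteq> N" "\<And>d x. d \<in> D \<Longrightarrow> x \<in> X \<Longrightarrow> adl d x \<in> X \<and> adr d x \<in> X"
    and d: "d \<in> D" and x: "x \<in> X"
  shows "d \<otimes>\<^bsub>H\<^esub> x \<in> span_prod k H X D" "x \<otimes>\<^bsub>H\<^esub> d \<in> span_prod k H D X"
proof -
  note DH = hopf_subalgebra_D(3)[OF D] and NH = hopf_subalgebra_D(3)[OF N]
  have XH: "X \<subseteq> carrier H" using X NH by auto
  have [simp]: "d \<in> carrier H" "x \<in> carrier H" using d x DH XH by auto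
  have "sw H (\<lambda>u v. adl u x \<otimes>\<^bsub>H\<^esub> v) d \<in> span_prod k H X D"
    by (rule sw_mem[OF D d C_module _ span_prod_closed(1)[OF XH DH]])
      (use X x in \<open>auto intro!: bilinI lin_intros span_prod_closed(3)[OF XH DH]\<close>)
  then show "d \<otimes>\<^bsub>H\<^esub> x \<in> span_prod k H X D" by (simp add: mult_adl[symmetric])
  have "sw H (\<lambda>u v. u \<otimes>\<^bsub>H\<^esub> adr v x) d \<in> span_prod k H D X"
    by (rule sw_mem[OF D d C_module _ span_prod_closed(1)[OF DH XH]])
      (use X x in \<open>auto intro!: bilinI lin_intros span_prod_closed(3)[OF DH XH]\<close>)
  then show "x \<otimes>\<^bsub>H\<^esub> d \<in> span_prod k H D X" by (simp add: mult_adr[symmetric])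
qed

lemma span_prod_commute:
  assumes N: "hopf_subalgebra k H N" and D: "hopf_subalgebra k H D" and nm: "normalizes D N"
  shows "span_prod k H N D = span_prod k H D N"
proof -
  note DH = hopf_subalgebra_D(3)[OF D] and NH = hopf_subalgebra_D(3)[OF N]
  have a: "\<And>d x. d \<in> D \<Longrightarrow> x \<in> N \<Longrightarrow> adl d x \<in> N \<and> adr d x \<in> N" using nm by (auto simp: normalizes_def)
  note c = normalizes_commute[OF N D nm subset_refl a]
  show ?thesis
    using span_prod_subset[OF span_prod_closed(1)[OF DH NH], of N D]
      span_prod_subset[OF span_prod_closed(1)[OF NH DH], of D N] c by blast
qed

text \<open>Because \<open>DN = ND\<close>, the span is closed under left multiplication by
  \<open>N\<close> and by \<open>D\<close>, hence under products, and it contains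
  \<open>S(nd) = S(d) S(n)\<close>. Its slices are controlled by multiplicativity of the
  comultiplication.\<close>

lemma span_prod_hopf_subalgebra:
  assumes N: "hopf_subalgebra k H N" and D: "hopf_subalgebra k H D" and nm: "normalizes D N"
  shows "hopf_subalgebra k H (span_prod k H N D)" "N \<subseteq> span_prod k H N D" "D \<subseteq> span_prod k H N D"
proof -
  note DD = hopf_subalgebra_D[OF D] and ND = hopf_subalgebra_D[OF N]
  let ?P = "span_prod k H N D"
  note P = span_prod_closed[OF ND(3) DD(3)]
  interpret P: LinearCombinations.submodule k ?P H by (rule P(1))
  have NH: "n \<in> carrier H" if "n \<in> N" for n using that ND by auto
  have DH: "n \<in> carrier H" if "n \<in> D" for n using that DD by auto
  have PH: "n \<in> carrier H" if "n \<in> ?P" for n using that P by auto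
  show "N \<subseteq> ?P" using P(3)[OF _ DD(5)] NH by fastforce
  show "D \<subseteq> ?P" using P(3)[OF ND(5)] DH by fastforce
  have DN: "d \<otimes>\<^bsub>H\<^esub> n \<in> ?P" if "d \<in> D" "n \<in> N" for d n
    using span_prod_commute[OF assms] span_prod_closed(3)[OF DD(3) ND(3) that] by simp
  have NP: "n \<otimes>\<^bsub>H\<^esub> p \<in> ?P" if "n \<in> N" "p \<in> ?P" for n p
  proof (rule span_prod_lin_mem[OF _ P(1) ND(3) DD(3) _ that(2)])
    fix x y assume "x \<in> N" "y \<in> D"
    then show "n \<otimes>\<^bsub>H\<^esub> (x \<otimes>\<^bsub>H\<^esub> y) \<in> ?P"
      using P(3)[OF ND(7)[OF that(1)]] that NH DH by (simp add: m_assoc[symmetric])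
  qed (use that NH in \<open>auto intro!: lin_intros\<close>)
  have PD: "p \<otimes>\<^bsub>H\<^esub> d \<in> ?P" if "d \<in> D" "p \<in> ?P" for d p
  proof (rule span_prod_lin_mem[OF _ P(1) ND(3) DD(3) _ that(2)])
    fix x y assume "x \<in> N" "y \<in> D"
    then show "(x \<otimes>\<^bsub>H\<^esub> y) \<otimes>\<^bsub>H\<^esub> d \<in> ?P"
      using P(3)[OF _ DD(7)[OF _ that(1)]] that NH DH by (simp add: m_assoc)
  qed (use that DH in \<open>auto intro!: lin_intros\<close>)
  have DP: "d \<otimes>\<^bsub>H\<^esub> p \<in> ?P" if "d \<in> D" "p \<in> ?P" for d p
  proof (rule span_prod_lin_mem[OF _ P(1) ND(3) DD(3) _ that(2)])
    fix x y assume "x \<in> N" "y \<in> D"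
    then show "d \<otimes>\<^bsub>H\<^esub> (x \<otimes>\<^bsub>H\<^esub> y) \<in> ?P"
      using PD[OF _ DN[OF that(1)]] that NH DH by (simp add: m_assoc[symmetric])
  qed (use that DH in \<open>auto intro!: lin_intros\<close>)
  show "hopf_subalgebra k H ?P"
  proof (rule hopf_subalgebraI)
    show "\<one>\<^bsub>H\<^esub> \<in> ?P" using P(3)[OF ND(5) DD(5)] by simp
    show "p \<otimes>\<^bsub>H\<^esub> q \<in> ?P" if "p \<in> ?P" "q \<in> ?P" for p q
    proof (rule span_prod_lin_mem[OF _ P(1) ND(3) DD(3) _ that(1)])
      fix x y assume "x \<in> N" "y \<in> D"
      then show "(x \<otimes>\<^bsub>H\<^esub> y) \<otimes>\<^bsub>H\<^esub> q \<in> ?P"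
        using NP[OF _ DP[OF _ that(2)]] PH[OF that(2)] NH DH by (simp add: m_assoc)
    qed (use that PH in \<open>auto intro!: lin_intros\<close>)
    show "antipode H p \<in> ?P" if "p \<in> ?P" for p
    proof (rule span_prod_lin_mem[OF _ P(1) ND(3) DD(3) _ that])
      fix x y assume "x \<in> N" "y \<in> D"
      then show "antipode H (x \<otimes>\<^bsub>H\<^esub> y) \<in> ?P"
        using DN[OF DD(9) ND(9)] NH DH by (simp add: antipode_mult)
    qed (auto intro!: lin_intros)
    fix p g assume p: "p \<in> ?P" and g: "functional H g"
    note gl = lin_comp[OF g] and [simp] = lin_closed[OF g, simplified]
    show "sw H (\<lambda>u v. g v \<odot>\<^bsub>H\<^esub> u) p \<in> ?P"
    proof (rule span_prod_lin_mem[OF _ P(1) ND(3) DD(3) _ p])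
      fix x y assume xy: "x \<in> N" "y \<in> D"
      have "sw H (\<lambda>u v. g v \<odot>\<^bsub>H\<^esub> u) (x \<otimes>\<^bsub>H\<^esub> y)
        = sw H (\<lambda>a b. sw H (\<lambda>u v. g (b \<otimes>\<^bsub>H\<^esub> v) \<odot>\<^bsub>H\<^esub> (a \<otimes>\<^bsub>H\<^esub> u)) y) x"
        by (rule sw_mult) (use xy NH DH in \<open>auto intro!: bilinI lin_intros gl\<close>)
      also have "\<dots> \<in> ?P"
        by (rule sw_mem[OF N xy(1) C_module _ P(1)], (use xy NH DH in \<open>auto intro!: bilinI lin_intros gl\<close>)[1],
            rule sw_mem[OF D xy(2) C_module _ P(1)])
          (use xy NH DH P in \<open>auto intro!: bilinI lin_intros gl P.smult_closed\<close>)
      finally show "sw H (\<lambda>u v. g v \<odot>\<^bsub>H\<^esub> u) (x \<otimes>\<^bsub>H\<^esub> y) \<in> ?P" .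
    qed (auto intro!: bilinI lin_intros gl)
    show "sw H (\<lambda>u v. g u \<odot>\<^bsub>H\<^esub> v) p \<in> ?P"
    proof (rule span_prod_lin_mem[OF _ P(1) ND(3) DD(3) _ p])
      fix x y assume xy: "x \<in> N" "y \<in> D"
      have "sw H (\<lambda>u v. g u \<odot>\<^bsub>H\<^esub> v) (x \<otimes>\<^bsub>H\<^esub> y)
        = sw H (\<lambda>a b. sw H (\<lambda>u v. g (a \<otimes>\<^bsub>H\<^esub> u) \<odot>\<^bsub>H\<^esub> (b \<otimes>\<^bsub>H\<^esub> v)) y) x"
        by (rule sw_mult) (use xy NH DH in \<open>auto intro!: bilinI lin_intros gl\<close>)
      also have "\<dots> \<in> ?P"
        by (rule sw_mem[OF N xy(1) C_module _ P(1)], (use xy NH DH in \<open>auto intro!: bilinI lin_intros gl\<close>)[1],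
            rule sw_mem[OF D xy(2) C_module _ P(1)])
          (use xy NH DH P in \<open>auto intro!: bilinI lin_intros gl P.smult_closed\<close>)
      finally show "sw H (\<lambda>u v. g u \<odot>\<^bsub>H\<^esub> v) (x \<otimes>\<^bsub>H\<^esub> y) \<in> ?P" .
    qed (auto intro!: bilinI lin_intros gl)
  qed (use P P.zero_closed in \<open>auto\<close>)
qed

lemma normalizes_sub:
  assumes M: "hopf_subalgebra k H M" and "N \<subseteq> M" and N: "hopf_subalgebra k H N"
  shows "normalizes N M"
  unfolding normalizes_def adl_def adr_def
proof (intro ballI conjI)
  note D = hopf_subalgebra_D[OF M]
  fix n m assume nm: "n \<in> N" "m \<in> M"
  have mH: "m \<in> carrier H" using nm D by auto
  have NM: "\<And>x. x \<in> N \<Longrightarrow> x \<in> M" using assms(2) by auto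
  show "sw H (\<lambda>x y. x \<otimes>\<^bsub>H\<^esub> m \<otimes>\<^bsub>H\<^esub> antipode H y) n \<in> M"
    by (rule sw_mem[OF N nm(1) C_module _ D(2)]) (use nm mH D NM in \<open>auto intro!: bilinI lin_intros\<close>)
  show "sw H (\<lambda>x y. antipode H x \<otimes>\<^bsub>H\<^esub> m \<otimes>\<^bsub>H\<^esub> y) n \<in> M"
    by (rule sw_mem[OF N nm(1) C_module _ D(2)]) (use nm mH D NM in \<open>auto intro!: bilinI lin_intros\<close>)
qed

text \<open>The adjoint actions distribute over products along the comultiplication of the acting
  element, whose legs stay in \<open>D\<close>.\<close>

lemma normalizes_prod:
  assumes D: "hopf_subalgebra k H D" and NK: "N \<subseteq> carrier H" "K \<subseteq> carrier H"
    and nN: "normalizes D N" and nK: "normalizes D K"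
  shows "normalizes D (span_prod k H N K)"
  unfolding normalizes_def
proof (intro ballI conjI)
  note P = span_prod_closed[OF NK]
  have [simp]: "n \<in> carrier H" if "n \<in> N" for n using that NK by auto
  have [simp]: "n \<in> carrier H" if "n \<in> K" for n using that NK by auto
  fix d p assume d: "d \<in> D" and p: "p \<in> span_prod k H N K"
  have [simp]: "d \<in> carrier H" using d hopf_subalgebra_D[OF D] by auto
  show "adl d p \<in> span_prod k H N K"
  proof (rule span_prod_lin_mem[OF _ P(1) NK _ p])
    fix x y assume xy: "x \<in> N" "y \<in> K"
    have "sw H (\<lambda>u v. adl u x \<otimes>\<^bsub>H\<^esub> adl v y) d \<in> span_prod k H N K"
      by (rule sw_mem[OF D d C_module _ P(1)])
        (use xy nN nK P(3) in \<open>auto intro!: bilinI lin_intros simp: normalizes_def\<close>)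
    then show "adl d (x \<otimes>\<^bsub>H\<^esub> y) \<in> span_prod k H N K" using xy by (simp add: adl_prod)
  qed (auto intro!: lin_intros)
  show "adr d p \<in> span_prod k H N K"
  proof (rule span_prod_lin_mem[OF _ P(1) NK _ p])
    fix x y assume xy: "x \<in> N" "y \<in> K"
    have "sw H (\<lambda>u v. adr u x \<otimes>\<^bsub>H\<^esub> adr v y) d \<in> span_prod k H N K"
      by (rule sw_mem[OF D d C_module _ P(1)])
        (use xy nN nK P(3) in \<open>auto intro!: bilinI lin_intros simp: normalizes_def\<close>)
    then show "adr d (x \<otimes>\<^bsub>H\<^esub> y) \<in> span_prod k H N K" using xy by (simp add: adr_prod)
  qed (auto intro!: lin_intros)
qed

text \<open>Acting by a product is acting twice, by \<open>adl_mult\<close> and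
  \<open>adr_mult\<close>.\<close>

lemma prod_normalizes:
  assumes M: "hopf_subalgebra k H M" and XY: "X \<subseteq> carrier H" "Y \<subseteq> carrier H"
    and nX: "normalizes X M" and nY: "normalizes Y M"
  shows "normalizes (span_prod k H X Y) M"
  unfolding normalizes_def
proof (intro ballI conjI)
  note D = hopf_subalgebra_D[OF M]
  fix z m assume z: "z \<in> span_prod k H X Y" and m: "m \<in> M"
  have [simp]: "m \<in> carrier H" using m D by auto
  show "adl z m \<in> M"
    by (rule span_prod_lin_mem[OF _ D(2) XY _ z])
      (use XY nX nY m in \<open>auto intro!: lin_intros simp: adl_mult normalizes_def subset_iff\<close>)
  show "adr z m \<in> M"
    by (rule span_prod_lin_mem[OF _ D(2) XY _ z])
      (use XY nX nY m in \<open>auto intro!: lin_intros simp: adr_mult normalizes_def subset_iff\<close>)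
qed

text \<open>Turns relative normality into a statement in the fixed algebra \<open>H\<close>: the
  adjoint actions computed in \<open>sub_hopf k H A\<close> coincide with those of
  \<open>H\<close>.\<close>

lemma normal_sub_hopf_iff:
  assumes A: "hopf_subalgebra k H A"
  shows "normal_hopf_subalgebra k (sub_hopf k H A) K \<longleftrightarrow>
    hopf_subalgebra k H K \<and> K \<subseteq> A \<and> normalizes A K"
proof -
  note D = hopf_subalgebra_D[OF A]
  interpret S: fd_hopf_algebra k "sub_hopf k H A" by (rule sub_hopf_is_fd[OF A])
  have "S.adl h a = adl h a" "S.adr h a = adr h a" if "a \<in> A" "h \<in> A" for a h
  proof -
    have [simp]: "a \<in> carrier H" "a \<in> carrier (sub_hopf k H A)" using that D by auto
    have bl: "bilin H H H (\<lambda>x y. x \<otimes>\<^bsub>H\<^esub> a \<otimes>\<^bsub>H\<^esub> antipode H y)" "bilin H H H (\<lambda>x y. antipode H x \<otimes>\<^bsub>H\<^esub> a \<otimes>\<^bsub>H\<^esub> y)"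
      by (auto intro!: bilinI lin_intros)
    let ?A = "sub_hopf k H A"
    have aA: "a \<in> carrier ?A" using that by simp
    have "bilin ?A ?A ?A (\<lambda>x y. x \<otimes>\<^bsub>?A\<^esub> a \<otimes>\<^bsub>?A\<^esub> antipode ?A y)"
      by (rule bilinI; (rule S.lin_mult_left S.lin_mult_right S.antipode_lin lin_id S.m_closed S.antipode_closed aA | assumption)+)
    moreover have "bilin ?A ?A ?A (\<lambda>x y. antipode ?A x \<otimes>\<^bsub>?A\<^esub> a \<otimes>\<^bsub>?A\<^esub> y)"
      by (rule bilinI; (rule S.lin_mult_left S.lin_mult_right S.antipode_lin lin_id S.m_closed S.antipode_closed aA | assumption)+)
    ultimately show "S.adl h a = adl h a" "S.adr h a = adr h a"
      unfolding S.adl_def S.adr_def adl_def adr_def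
      using sw_sub_hopf_incl[OF A bl(1) _ that(2)] sw_sub_hopf_incl[OF A bl(2) _ that(2)] by auto
  qed
  moreover have "normal_hopf_subalgebra k (sub_hopf k H A) K \<longleftrightarrow>
     hopf_subalgebra k (sub_hopf k H A) K \<and> (\<forall>a\<in>K. \<forall>h\<in>A. S.adl h a \<in> K \<and> S.adr h a \<in> K)"
    by (simp add: normal_hopf_subalgebra_def S.adl_def S.adr_def sweedler_def)
  ultimately show ?thesis
    unfolding hopf_subalgebra_sub_hopf_iff[OF A] normalizes_def by (auto simp: subset_iff)
qed

end

section \<open>Integrals\<close>

lemma (in abelian_monoid) finsum_swap:
  assumes "finite A" "finite B" "\<And>x y. x \<in> A \<Longrightarrow> y \<in> B \<Longrightarrow> f x y \<in> carrier G"
  shows "(\<Oplus>x\<in>A. \<Oplus>y\<in>B. f x y) = (\<Oplus>y\<in>B. \<Oplus>x\<in>A. f x y)"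
  using assms(1,3)
proof (induction A rule: finite_induct)
  case (insert a A)
  have "(\<Oplus>x\<in>insert a A. \<Oplus>y\<in>B. f x y) = (\<Oplus>y\<in>B. f a y) \<oplus> (\<Oplus>x\<in>A. \<Oplus>y\<in>B. f x y)"
    using insert by (subst finsum_insert) (auto intro!: finsum_closed)
  also have "\<dots> = (\<Oplus>y\<in>B. f a y) \<oplus> (\<Oplus>y\<in>B. \<Oplus>x\<in>A. f x y)" using insert by simp
  also have "\<dots> = (\<Oplus>y\<in>B. f a y \<oplus> (\<Oplus>x\<in>A. f x y))"
    using insert.prems by (intro finsum_addf[symmetric]) (auto intro!: finsum_closed)
  also have "\<dots> = (\<Oplus>y\<in>B. \<Oplus>x\<in>insert a A. f x y)"
    using insert by (intro finsum_cong' refl) (auto intro!: finsum_closed finsum_insert[symmetric])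
  finally show ?case .
qed auto

context fd_hopf_algebra
begin

lemma sw_sum:
  assumes M: "module k M" and h: "h \<in> carrier H" and b: "\<And>e. e \<in> E \<Longrightarrow> bilin H H M (\<beta> e)"
  shows "sw M (\<lambda>u v. \<Oplus>\<^bsub>M\<^esub>e\<in>E. \<beta> e u v) h = (\<Oplus>\<^bsub>M\<^esub>e\<in>E. sw M (\<beta> e) h)"
proof -
  interpret M: module k M by fact
  note L = tensor_lift_lin[OF C_module C_module M]
  have bs: "bilin H H M (\<lambda>u v. \<Oplus>\<^bsub>M\<^esub>e\<in>E. \<beta> e u v)"
    by (rule bilinI; rule lin_sum[OF M]) (simp_all add: bilinD1[OF b] bilinD2[OF b])
  show ?thesis unfolding sweedler_def
    by (rule tensor_lin_ext[OF C_module C_module M L[OF bs] lin_sum[OF M L[OF b]]])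
      (use h in \<open>auto simp: tensor_lift_tens[OF C_module C_module M] bs b bilin_closed[OF b] intro!: M.finsum_cong'\<close>)
qed

definition right_integral where
  "right_integral L \<longleftrightarrow> L \<in> carrier H \<and> (\<forall>n\<in>carrier H. L \<otimes>\<^bsub>H\<^esub> n = counit H n \<odot>\<^bsub>H\<^esub> L)"

section \<open>Existence of a nonzero right integral\<close>

context
  fixes E c
  assumes c: "dual_basis k H E c"
begin

lemma E_fin: "finite E" and E_H [simp]: "e \<in> E \<Longrightarrow> e \<in> carrier H"
  and c_functional: "e \<in> E \<Longrightarrow> functional H (c e)"
  and c_expand: "v \<in> carrier H \<Longrightarrow> (\<Oplus>\<^bsub>H\<^esub>e\<in>E. c e v \<odot>\<^bsub>H\<^esub> e) = v"
  using c by (auto simp: dual_basis_def)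

lemma c_lin [lin_intros]: "e \<in> E \<Longrightarrow> lin V H f \<Longrightarrow> functional V (\<lambda>x. c e (f x))"
  by (rule lin_comp[OF c_functional])

lemma c_closed [simp]: "e \<in> E \<Longrightarrow> v \<in> carrier H \<Longrightarrow> c e v \<in> carrier k"
  using lin_closed[OF c_functional] by simp

lemma lin_c_expand:
  assumes M: "module k M" and F: "lin H M F" and v: "v \<in> carrier H"
  shows "(\<Oplus>\<^bsub>M\<^esub>e\<in>E. c e v \<odot>\<^bsub>M\<^esub> F e) = F v"
proof -
  interpret M: module k M by fact
  have "F v = F (\<Oplus>\<^bsub>H\<^esub>e\<in>E. c e v \<odot>\<^bsub>H\<^esub> e)" using c_expand[OF v] by simp
  also have "\<dots> = (\<Oplus>\<^bsub>M\<^esub>e\<in>E. F (c e v \<odot>\<^bsub>H\<^esub> e))" using v by (intro lin_finsum[OF C_module M F]) auto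
  also have "\<dots> = (\<Oplus>\<^bsub>M\<^esub>e\<in>E. c e v \<odot>\<^bsub>M\<^esub> F e)"
    using v lin_closed[OF F] by (intro M.finsum_cong' refl) (auto simp: lin_smult[OF F])
  finally show ?thesis by simp
qed

text \<open>The square of the antipode is chosen so that in \<open>kap_mult\<close> the product
  \<open>S(S(p)) S(a)\<close> becomes \<open>S(a S(p))\<close> and collapses.\<close>

definition kap where "kap f z = sw H (\<lambda>x y. c f (antipode H (antipode H x)) \<odot>\<^bsub>H\<^esub> y) z"

lemma kap_lin [lin_intros]: "f \<in> E \<Longrightarrow> lin V H g \<Longrightarrow> lin V H (\<lambda>x. kap f (g x))"
  unfolding kap_def by (auto intro!: bilinI lin_intros)

lemma kap_closed [simp]: "f \<in> E \<Longrightarrow> z \<in> carrier H \<Longrightarrow> kap f z \<in> carrier H"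
  using lin_closed[OF kap_lin[OF _ lin_id]] .

text \<open>The trace \<open>\<Sum> f\<^sup>*(S\<^sup>2((m f)\<^sub>(\<^sub>1\<^sub>))) (m f)\<^sub>(\<^sub>2\<^sub>)\<close>: it is the projection of \<open>m\<close> onto the
  coinvariants of \<open>H\<close>, regarded as a Hopf module over the dual Hopf algebra.\<close>

definition integral_of where "integral_of m = (\<Oplus>\<^bsub>H\<^esub>f\<in>E. kap f (m \<otimes>\<^bsub>H\<^esub> f))"

lemma integral_of_closed [simp]: "m \<in> carrier H \<Longrightarrow> integral_of m \<in> carrier H"
  unfolding integral_of_def by (intro finsum_closed) auto

text \<open>Summing over \<open>g\<close> replaces the basis vector by \<open>S(S(z_1 n_2))\<close>;
  the factor \<open>S(S(n_2)) S(n_1) = S(n_1 S(n_2))\<close> then cancels, leaving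
  \<open>z_2 n_3\<close>.\<close>

lemma kap_mult:
  assumes [simp]: "f \<in> E" "z \<in> carrier H" "n \<in> carrier H"
  shows "kap f z \<otimes>\<^bsub>H\<^esub> n = sw H (\<lambda>a b. \<Oplus>\<^bsub>H\<^esub>g\<in>E. c f (g \<otimes>\<^bsub>H\<^esub> antipode H a) \<odot>\<^bsub>H\<^esub> kap g (z \<otimes>\<^bsub>H\<^esub> b)) n"
proof -
  let ?S = "antipode H"
  define G where "G w q = sw H (\<lambda>x y. c f (?S (?S x) \<otimes>\<^bsub>H\<^esub> ?S w) \<odot>\<^bsub>H\<^esub> (y \<otimes>\<^bsub>H\<^esub> q)) z" for w q
  have Gl1: "lin H H (\<lambda>w. G w q)" if "q \<in> carrier H" for q
    unfolding G_def using that by (auto intro!: bilinI lin_intros)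
  have Gl2: "lin H H (\<lambda>q. G w q)" if "w \<in> carrier H" for w
    unfolding G_def using that by (auto intro!: bilinI lin_intros)
  note Gl [lin_intros] = lin_comp[OF Gl1] lin_comp[OF Gl2]
  have 1: "(\<Oplus>\<^bsub>H\<^esub>g\<in>E. c f (g \<otimes>\<^bsub>H\<^esub> ?S a) \<odot>\<^bsub>H\<^esub> kap g (z \<otimes>\<^bsub>H\<^esub> b)) = sw H (\<lambda>p q. G (a \<otimes>\<^bsub>H\<^esub> ?S p) q) b"
    if [simp]: "a \<in> carrier H" "b \<in> carrier H" for a b
  proof -
    have "(\<Oplus>\<^bsub>H\<^esub>g\<in>E. c f (g \<otimes>\<^bsub>H\<^esub> ?S a) \<odot>\<^bsub>H\<^esub> kap g (z \<otimes>\<^bsub>H\<^esub> b))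
      = (\<Oplus>\<^bsub>H\<^esub>g\<in>E. sw H (\<lambda>x y. c f (g \<otimes>\<^bsub>H\<^esub> ?S a) \<odot>\<^bsub>H\<^esub> (c g (?S (?S x)) \<odot>\<^bsub>H\<^esub> y)) (z \<otimes>\<^bsub>H\<^esub> b))"
    proof (intro finsum_cong' refl Pi_I)
      fix g assume [simp]: "g \<in> E"
      show "c f (g \<otimes>\<^bsub>H\<^esub> ?S a) \<odot>\<^bsub>H\<^esub> kap g (z \<otimes>\<^bsub>H\<^esub> b) = sw H (\<lambda>x y. c f (g \<otimes>\<^bsub>H\<^esub> ?S a) \<odot>\<^bsub>H\<^esub> (c g (?S (?S x)) \<odot>\<^bsub>H\<^esub> y)) (z \<otimes>\<^bsub>H\<^esub> b)"
        unfolding kap_def by (rule sw_hom) (auto intro!: bilinI lin_intros)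
      show "sw H (\<lambda>x y. c f (g \<otimes>\<^bsub>H\<^esub> ?S a) \<odot>\<^bsub>H\<^esub> (c g (?S (?S x)) \<odot>\<^bsub>H\<^esub> y)) (z \<otimes>\<^bsub>H\<^esub> b) \<in> carrier H"
        by (rule sw_closed) (auto intro!: bilinI lin_intros)
    qed
    also have "\<dots> = sw H (\<lambda>x y. \<Oplus>\<^bsub>H\<^esub>g\<in>E. c f (g \<otimes>\<^bsub>H\<^esub> ?S a) \<odot>\<^bsub>H\<^esub> (c g (?S (?S x)) \<odot>\<^bsub>H\<^esub> y)) (z \<otimes>\<^bsub>H\<^esub> b)"
      by (rule sw_sum[symmetric]) (auto intro!: bilinI lin_intros)
    also have "\<dots> = sw H (\<lambda>x y. c f (?S (?S x) \<otimes>\<^bsub>H\<^esub> ?S a) \<odot>\<^bsub>H\<^esub> y) (z \<otimes>\<^bsub>H\<^esub> b)"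
    proof (rule sw_cong, simp_all, (auto intro!: bilinI lin_intros)[1])
      fix x y assume [simp]: "x \<in> carrier H" "y \<in> carrier H"
      have "(\<Oplus>\<^bsub>H\<^esub>g\<in>E. c f (g \<otimes>\<^bsub>H\<^esub> ?S a) \<odot>\<^bsub>H\<^esub> (c g (?S (?S x)) \<odot>\<^bsub>H\<^esub> y))
        = (\<Oplus>\<^bsub>H\<^esub>g\<in>E. c g (?S (?S x)) \<odot>\<^bsub>H\<^esub> (c f (g \<otimes>\<^bsub>H\<^esub> ?S a) \<odot>\<^bsub>H\<^esub> y))"
        by (intro finsum_cong' refl) (auto simp: smult_assoc1[symmetric] R.m_comm)
      also have "\<dots> = c f (?S (?S x) \<otimes>\<^bsub>H\<^esub> ?S a) \<odot>\<^bsub>H\<^esub> y"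
        by (rule lin_c_expand) (auto intro!: lin_intros)
      finally show "(\<Oplus>\<^bsub>H\<^esub>g\<in>E. c f (g \<otimes>\<^bsub>H\<^esub> ?S a) \<odot>\<^bsub>H\<^esub> (c g (?S (?S x)) \<odot>\<^bsub>H\<^esub> y)) = c f (?S (?S x) \<otimes>\<^bsub>H\<^esub> ?S a) \<odot>\<^bsub>H\<^esub> y" .
    qed
    also have "\<dots> = sw H (\<lambda>x y. sw H (\<lambda>p q. c f (?S (?S (x \<otimes>\<^bsub>H\<^esub> p)) \<otimes>\<^bsub>H\<^esub> ?S a) \<odot>\<^bsub>H\<^esub> (y \<otimes>\<^bsub>H\<^esub> q)) b) z"
      by (rule sw_mult) (auto intro!: bilinI lin_intros)
    also have "\<dots> = sw H (\<lambda>p q. sw H (\<lambda>x y. c f (?S (?S (x \<otimes>\<^bsub>H\<^esub> p)) \<otimes>\<^bsub>H\<^esub> ?S a) \<odot>\<^bsub>H\<^esub> (y \<otimes>\<^bsub>H\<^esub> q)) z) b"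
      by (rule sw_swap) (auto intro!: bilinI lin_intros)
    also have "\<dots> = sw H (\<lambda>p q. G (a \<otimes>\<^bsub>H\<^esub> ?S p) q) b"
      unfolding G_def
      by (rule sw_cong, simp_all, (auto intro!: bilinI lin_intros)[1], rule sw_cong)
        (auto intro!: bilinI lin_intros simp: antipode_mult m_assoc)
    finally show ?thesis .
  qed
  have "sw H (\<lambda>a b. \<Oplus>\<^bsub>H\<^esub>g\<in>E. c f (g \<otimes>\<^bsub>H\<^esub> ?S a) \<odot>\<^bsub>H\<^esub> kap g (z \<otimes>\<^bsub>H\<^esub> b)) n
    = sw H (\<lambda>a b. sw H (\<lambda>p q. G (a \<otimes>\<^bsub>H\<^esub> ?S p) q) b) n"
    by (rule sw_cong) (auto intro!: bilinI lin_intros simp: 1)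
  also have "\<dots> = sw H (\<lambda>b q. sw H (\<lambda>a p. G (a \<otimes>\<^bsub>H\<^esub> ?S p) q) b) n"
    by (rule sw_coassoc[symmetric]) (auto intro!: lin_intros)
  also have "\<dots> = sw H (\<lambda>b q. counit H b \<odot>\<^bsub>H\<^esub> G \<one>\<^bsub>H\<^esub> q) n"
    by (rule sw_cong, simp_all, (auto intro!: bilinI lin_intros)[1], rule sw_antipode_right)
      (auto intro!: lin_intros)
  also have "\<dots> = G \<one>\<^bsub>H\<^esub> n" by (rule sw_counit_left) (auto intro!: lin_intros)
  also have "\<dots> = sw H (\<lambda>x y. (c f (?S (?S x)) \<odot>\<^bsub>H\<^esub> y) \<otimes>\<^bsub>H\<^esub> n) z"
    unfolding G_def by (rule sw_cong) (auto intro!: bilinI lin_intros simp: smult_mult_left)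
  also have "\<dots> = kap f z \<otimes>\<^bsub>H\<^esub> n"
    unfolding kap_def by (rule sw_hom[symmetric]) (auto intro!: bilinI lin_intros)
  finally show ?thesis by simp
qed

text \<open>After \<open>kap_mult\<close> the sum over \<open>f\<close> substitutes
  \<open>g S(n_1)\<close> for \<open>f\<close> in \<open>m f n_2\<close>, and
  \<open>S(n_1) n_2\<close> collapses to the counit of \<open>n\<close>.\<close>

lemma right_integral_integral_of:
  assumes [simp]: "m \<in> carrier H" shows "right_integral (integral_of m)"
  unfolding right_integral_def
proof (intro conjI ballI)
  let ?S = "antipode H"
  fix n assume [simp]: "n \<in> carrier H"
  have "integral_of m \<otimes>\<^bsub>H\<^esub> n = (\<Oplus>\<^bsub>H\<^esub>f\<in>E. kap f (m \<otimes>\<^bsub>H\<^esub> f) \<otimes>\<^bsub>H\<^esub> n)"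
    unfolding integral_of_def by (rule lin_finsum[OF C_module C_module]) (auto intro!: lin_intros)
  also have "\<dots> = (\<Oplus>\<^bsub>H\<^esub>f\<in>E. sw H (\<lambda>a b. \<Oplus>\<^bsub>H\<^esub>g\<in>E. c f (g \<otimes>\<^bsub>H\<^esub> ?S a) \<odot>\<^bsub>H\<^esub> kap g (m \<otimes>\<^bsub>H\<^esub> f \<otimes>\<^bsub>H\<^esub> b)) n)"
    by (intro finsum_cong' refl Pi_I) (auto intro!: sw_closed bilinI lin_intros simp: kap_mult)
  also have "\<dots> = sw H (\<lambda>a b. \<Oplus>\<^bsub>H\<^esub>f\<in>E. \<Oplus>\<^bsub>H\<^esub>g\<in>E. c f (g \<otimes>\<^bsub>H\<^esub> ?S a) \<odot>\<^bsub>H\<^esub> kap g (m \<otimes>\<^bsub>H\<^esub> f \<otimes>\<^bsub>H\<^esub> b)) n"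
    by (rule sw_sum[symmetric]) (auto intro!: bilinI lin_intros)
  also have "\<dots> = sw H (\<lambda>a b. \<Oplus>\<^bsub>H\<^esub>g\<in>E. kap g (m \<otimes>\<^bsub>H\<^esub> g \<otimes>\<^bsub>H\<^esub> (?S a \<otimes>\<^bsub>H\<^esub> b))) n"
  proof (rule sw_cong, simp_all, (auto intro!: bilinI lin_intros)[1])
    fix a b assume [simp]: "a \<in> carrier H" "b \<in> carrier H"
    have "(\<Oplus>\<^bsub>H\<^esub>f\<in>E. \<Oplus>\<^bsub>H\<^esub>g\<in>E. c f (g \<otimes>\<^bsub>H\<^esub> ?S a) \<odot>\<^bsub>H\<^esub> kap g (m \<otimes>\<^bsub>H\<^esub> f \<otimes>\<^bsub>H\<^esub> b))
      = (\<Oplus>\<^bsub>H\<^esub>g\<in>E. \<Oplus>\<^bsub>H\<^esub>f\<in>E. c f (g \<otimes>\<^bsub>H\<^esub> ?S a) \<odot>\<^bsub>H\<^esub> kap g (m \<otimes>\<^bsub>H\<^esub> f \<otimes>\<^bsub>H\<^esub> b))"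
      by (rule finsum_swap) (auto simp: E_fin)
    also have "\<dots> = (\<Oplus>\<^bsub>H\<^esub>g\<in>E. kap g (m \<otimes>\<^bsub>H\<^esub> (g \<otimes>\<^bsub>H\<^esub> ?S a) \<otimes>\<^bsub>H\<^esub> b))"
      by (intro finsum_cong' refl Pi_I lin_c_expand) (auto intro!: lin_intros)
    also have "\<dots> = (\<Oplus>\<^bsub>H\<^esub>g\<in>E. kap g (m \<otimes>\<^bsub>H\<^esub> g \<otimes>\<^bsub>H\<^esub> (?S a \<otimes>\<^bsub>H\<^esub> b)))"
      by (intro finsum_cong' refl Pi_I) (auto simp: m_assoc)
    finally show "(\<Oplus>\<^bsub>H\<^esub>f\<in>E. \<Oplus>\<^bsub>H\<^esub>g\<in>E. c f (g \<otimes>\<^bsub>H\<^esub> ?S a) \<odot>\<^bsub>H\<^esub> kap g (m \<otimes>\<^bsub>H\<^esub> f \<otimes>\<^bsub>H\<^esub> b))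
      = (\<Oplus>\<^bsub>H\<^esub>g\<in>E. kap g (m \<otimes>\<^bsub>H\<^esub> g \<otimes>\<^bsub>H\<^esub> (?S a \<otimes>\<^bsub>H\<^esub> b)))" .
  qed
  also have "\<dots> = counit H n \<odot>\<^bsub>H\<^esub> (\<Oplus>\<^bsub>H\<^esub>g\<in>E. kap g (m \<otimes>\<^bsub>H\<^esub> g \<otimes>\<^bsub>H\<^esub> \<one>\<^bsub>H\<^esub>))"
    by (rule sw_antipode_left[where F = "\<lambda>w. \<Oplus>\<^bsub>H\<^esub>g\<in>E. kap g (m \<otimes>\<^bsub>H\<^esub> g \<otimes>\<^bsub>H\<^esub> w)"]) (auto intro!: lin_intros)
  also have "(\<Oplus>\<^bsub>H\<^esub>g\<in>E. kap g (m \<otimes>\<^bsub>H\<^esub> g \<otimes>\<^bsub>H\<^esub> \<one>\<^bsub>H\<^esub>)) = integral_of m"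
    unfolding integral_of_def by (intro finsum_cong' refl Pi_I) auto
  finally show "integral_of m \<otimes>\<^bsub>H\<^esub> n = counit H n \<odot>\<^bsub>H\<^esub> integral_of m" .
qed simp

text \<open>The operation opposite to \<open>kap\<close>: it recovers an element from its images
  under the projections to the integrals, as in the structure theorem for Hopf modules.\<close>

definition eta where "eta l w = sw H (\<lambda>x y. c l (antipode H x) \<odot>\<^bsub>H\<^esub> y) w"

lemma eta_lin [lin_intros]: "l \<in> E \<Longrightarrow> lin V H g \<Longrightarrow> lin V H (\<lambda>x. eta l (g x))"
  unfolding eta_def by (auto intro!: bilinI lin_intros)

lemma eta_closed [simp]: "l \<in> E \<Longrightarrow> w \<in> carrier H \<Longrightarrow> eta l w \<in> carrier H"
  using lin_closed[OF eta_lin[OF _ lin_id]] .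

text \<open>The two completeness relations turn the coefficient into \<open>c e\<close> applied to
  \<open>S(z_2) S(S(z_1)) = S(S(z_1) z_2)\<close>, which collapses and leaves
  \<open>z\<close>.\<close>

lemma eta_kap_trace:
  assumes [simp]: "e \<in> E" "z \<in> carrier H"
  shows "(\<Oplus>\<^bsub>H\<^esub>l\<in>E. \<Oplus>\<^bsub>H\<^esub>f\<in>E. c e (l \<otimes>\<^bsub>H\<^esub> f) \<odot>\<^bsub>H\<^esub> eta l (kap f z)) = c e \<one>\<^bsub>H\<^esub> \<odot>\<^bsub>H\<^esub> z"
proof -
  let ?S = "antipode H"
  have 1: "c e (l \<otimes>\<^bsub>H\<^esub> f) \<odot>\<^bsub>H\<^esub> eta l (kap f z) =
    sw H (\<lambda>x y. sw H (\<lambda>p q. c f (?S (?S x)) \<odot>\<^bsub>H\<^esub> (c l (?S p) \<odot>\<^bsub>H\<^esub> (c e (l \<otimes>\<^bsub>H\<^esub> f) \<odot>\<^bsub>H\<^esub> q))) y) z"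
    if [simp]: "l \<in> E" "f \<in> E" for l f
  proof -
    have "c e (l \<otimes>\<^bsub>H\<^esub> f) \<odot>\<^bsub>H\<^esub> eta l (kap f z)
      = sw H (\<lambda>x y. c e (l \<otimes>\<^bsub>H\<^esub> f) \<odot>\<^bsub>H\<^esub> eta l (c f (?S (?S x)) \<odot>\<^bsub>H\<^esub> y)) z"
      unfolding kap_def by (rule sw_hom) (auto intro!: bilinI lin_intros)
    also have "\<dots> = sw H (\<lambda>x y. sw H (\<lambda>p q. c f (?S (?S x)) \<odot>\<^bsub>H\<^esub> (c l (?S p) \<odot>\<^bsub>H\<^esub> (c e (l \<otimes>\<^bsub>H\<^esub> f) \<odot>\<^bsub>H\<^esub> q))) y) z"
    proof (rule sw_cong, simp_all, (auto intro!: bilinI lin_intros)[1])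
      fix x y assume [simp]: "x \<in> carrier H" "y \<in> carrier H"
      let ?a = "c f (?S (?S x))" and ?b = "c e (l \<otimes>\<^bsub>H\<^esub> f)"
      have "?b \<odot>\<^bsub>H\<^esub> eta l (?a \<odot>\<^bsub>H\<^esub> y) = ?b \<odot>\<^bsub>H\<^esub> (?a \<odot>\<^bsub>H\<^esub> eta l y)"
        using lin_smult[OF eta_lin[OF _ lin_id], of l ?a y] by simp
      also have "\<dots> = sw H (\<lambda>p q. ?b \<odot>\<^bsub>H\<^esub> (?a \<odot>\<^bsub>H\<^esub> (c l (?S p) \<odot>\<^bsub>H\<^esub> q))) y"
        unfolding eta_def by (rule sw_hom[where F = "\<lambda>w. ?b \<odot>\<^bsub>H\<^esub> (?a \<odot>\<^bsub>H\<^esub> w)"]) (auto intro!: bilinI lin_intros)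
      also have "\<dots> = sw H (\<lambda>p q. ?a \<odot>\<^bsub>H\<^esub> (c l (?S p) \<odot>\<^bsub>H\<^esub> (?b \<odot>\<^bsub>H\<^esub> q))) y"
        by (rule sw_cong) (auto intro!: bilinI lin_intros simp: smult_assoc1[symmetric] R.m_ac)
      finally show "?b \<odot>\<^bsub>H\<^esub> eta l (?a \<odot>\<^bsub>H\<^esub> y) = sw H (\<lambda>p q. ?a \<odot>\<^bsub>H\<^esub> (c l (?S p) \<odot>\<^bsub>H\<^esub> (?b \<odot>\<^bsub>H\<^esub> q))) y" .
    qed
    finally show ?thesis .
  qed
  let ?t = "\<lambda>l f x p q. c f (?S (?S x)) \<odot>\<^bsub>H\<^esub> (c l (?S p) \<odot>\<^bsub>H\<^esub> (c e (l \<otimes>\<^bsub>H\<^esub> f) \<odot>\<^bsub>H\<^esub> q))"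
  have "(\<Oplus>\<^bsub>H\<^esub>l\<in>E. \<Oplus>\<^bsub>H\<^esub>f\<in>E. c e (l \<otimes>\<^bsub>H\<^esub> f) \<odot>\<^bsub>H\<^esub> eta l (kap f z))
     = (\<Oplus>\<^bsub>H\<^esub>l\<in>E. \<Oplus>\<^bsub>H\<^esub>f\<in>E. sw H (\<lambda>x y. sw H (\<lambda>p q. ?t l f x p q) y) z)"
    by (intro finsum_cong' refl Pi_I finsum_closed 1 sw_closed) (auto intro!: bilinI lin_intros)
  also have "\<dots> = sw H (\<lambda>x y. \<Oplus>\<^bsub>H\<^esub>l\<in>E. \<Oplus>\<^bsub>H\<^esub>f\<in>E. sw H (\<lambda>p q. ?t l f x p q) y) z"
  proof -
    have "(\<Oplus>\<^bsub>H\<^esub>l\<in>E. \<Oplus>\<^bsub>H\<^esub>f\<in>E. sw H (\<lambda>x y. sw H (\<lambda>p q. ?t l f x p q) y) z)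
      = (\<Oplus>\<^bsub>H\<^esub>l\<in>E. sw H (\<lambda>x y. \<Oplus>\<^bsub>H\<^esub>f\<in>E. sw H (\<lambda>p q. ?t l f x p q) y) z)"
      by (intro finsum_cong' refl Pi_I sw_sum[symmetric] sw_closed) (auto intro!: bilinI lin_intros)
    then show ?thesis by (subst sw_sum) (auto intro!: bilinI lin_intros)
  qed
  also have "\<dots> = sw H (\<lambda>x y. sw H (\<lambda>p q. c e (?S p \<otimes>\<^bsub>H\<^esub> ?S (?S x)) \<odot>\<^bsub>H\<^esub> q) y) z"
  proof (rule sw_cong, simp_all, (auto intro!: bilinI lin_intros)[1])
    fix x y assume [simp]: "x \<in> carrier H" "y \<in> carrier H"
    have "(\<Oplus>\<^bsub>H\<^esub>l\<in>E. \<Oplus>\<^bsub>H\<^esub>f\<in>E. sw H (\<lambda>p q. ?t l f x p q) y)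
      = (\<Oplus>\<^bsub>H\<^esub>l\<in>E. sw H (\<lambda>p q. \<Oplus>\<^bsub>H\<^esub>f\<in>E. ?t l f x p q) y)"
      by (intro finsum_cong' refl Pi_I sw_sum[symmetric] sw_closed) (auto intro!: bilinI lin_intros)
    also have "\<dots> = sw H (\<lambda>p q. \<Oplus>\<^bsub>H\<^esub>l\<in>E. \<Oplus>\<^bsub>H\<^esub>f\<in>E. ?t l f x p q) y"
      by (rule sw_sum[symmetric]) (auto intro!: bilinI lin_intros)
    also have "\<dots> = sw H (\<lambda>p q. c e (?S p \<otimes>\<^bsub>H\<^esub> ?S (?S x)) \<odot>\<^bsub>H\<^esub> q) y"
    proof (rule sw_cong, simp_all, (auto intro!: bilinI lin_intros)[1])
      fix p q assume [simp]: "p \<in> carrier H" "q \<in> carrier H"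
      have "(\<Oplus>\<^bsub>H\<^esub>l\<in>E. \<Oplus>\<^bsub>H\<^esub>f\<in>E. ?t l f x p q)
        = (\<Oplus>\<^bsub>H\<^esub>l\<in>E. c l (?S p) \<odot>\<^bsub>H\<^esub> (c e (l \<otimes>\<^bsub>H\<^esub> ?S (?S x)) \<odot>\<^bsub>H\<^esub> q))"
      proof (intro finsum_cong' refl Pi_I)
        fix l assume [simp]: "l \<in> E"
        show "(\<Oplus>\<^bsub>H\<^esub>f\<in>E. ?t l f x p q) = c l (?S p) \<odot>\<^bsub>H\<^esub> (c e (l \<otimes>\<^bsub>H\<^esub> ?S (?S x)) \<odot>\<^bsub>H\<^esub> q)"
          by (rule lin_c_expand) (auto intro!: lin_intros)
      qed auto
      also have "\<dots> = c e (?S p \<otimes>\<^bsub>H\<^esub> ?S (?S x)) \<odot>\<^bsub>H\<^esub> q"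
        by (rule lin_c_expand) (auto intro!: lin_intros)
      finally show "(\<Oplus>\<^bsub>H\<^esub>l\<in>E. \<Oplus>\<^bsub>H\<^esub>f\<in>E. ?t l f x p q) = c e (?S p \<otimes>\<^bsub>H\<^esub> ?S (?S x)) \<odot>\<^bsub>H\<^esub> q" .
    qed
    finally show "(\<Oplus>\<^bsub>H\<^esub>l\<in>E. \<Oplus>\<^bsub>H\<^esub>f\<in>E. sw H (\<lambda>p q. ?t l f x p q) y)
      = sw H (\<lambda>p q. c e (?S p \<otimes>\<^bsub>H\<^esub> ?S (?S x)) \<odot>\<^bsub>H\<^esub> q) y" .
  qed
  also have "\<dots> = sw H (\<lambda>a q. sw H (\<lambda>x p. c e (?S p \<otimes>\<^bsub>H\<^esub> ?S (?S x)) \<odot>\<^bsub>H\<^esub> q) a) z"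
    by (rule sw_coassoc[symmetric]) (auto intro!: lin_intros)
  also have "\<dots> = sw H (\<lambda>a q. counit H a \<odot>\<^bsub>H\<^esub> (c e \<one>\<^bsub>H\<^esub> \<odot>\<^bsub>H\<^esub> q)) z"
  proof (rule sw_cong, simp_all, (auto intro!: bilinI lin_intros)[1])
    fix a q assume [simp]: "a \<in> carrier H" "q \<in> carrier H"
    have "sw H (\<lambda>x p. c e (?S p \<otimes>\<^bsub>H\<^esub> ?S (?S x)) \<odot>\<^bsub>H\<^esub> q) a
      = sw H (\<lambda>x p. c e (?S (?S x \<otimes>\<^bsub>H\<^esub> p)) \<odot>\<^bsub>H\<^esub> q) a"
      by (rule sw_cong) (auto intro!: bilinI lin_intros simp: antipode_mult)
    also have "\<dots> = counit H a \<odot>\<^bsub>H\<^esub> (c e (?S \<one>\<^bsub>H\<^esub>) \<odot>\<^bsub>H\<^esub> q)"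
      by (rule sw_antipode_left) (auto intro!: lin_intros)
    finally show "sw H (\<lambda>x p. c e (?S p \<otimes>\<^bsub>H\<^esub> ?S (?S x)) \<odot>\<^bsub>H\<^esub> q) a = counit H a \<odot>\<^bsub>H\<^esub> (c e \<one>\<^bsub>H\<^esub> \<odot>\<^bsub>H\<^esub> q)" by simp
  qed
  also have "\<dots> = c e \<one>\<^bsub>H\<^esub> \<odot>\<^bsub>H\<^esub> z" by (rule sw_counit_left) (auto intro!: lin_intros)
  finally show ?thesis .
qed

text \<open>The unit is rebuilt from the integrals \<open>integral_of l\<close>, so they cannot all
  vanish.\<close>

lemma eta_integral_of: "(\<Oplus>\<^bsub>H\<^esub>l\<in>E. eta l (integral_of l)) = \<one>\<^bsub>H\<^esub>"
proof -
  have "(\<Oplus>\<^bsub>H\<^esub>l\<in>E. eta l (integral_of l)) = (\<Oplus>\<^bsub>H\<^esub>l\<in>E. \<Oplus>\<^bsub>H\<^esub>f\<in>E. eta l (kap f (l \<otimes>\<^bsub>H\<^esub> f)))"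
    unfolding integral_of_def
    by (intro finsum_cong' refl Pi_I lin_finsum[OF C_module C_module] finsum_closed) (auto intro!: lin_intros)
  also have "\<dots> = (\<Oplus>\<^bsub>H\<^esub>l\<in>E. \<Oplus>\<^bsub>H\<^esub>f\<in>E. \<Oplus>\<^bsub>H\<^esub>e\<in>E. c e (l \<otimes>\<^bsub>H\<^esub> f) \<odot>\<^bsub>H\<^esub> eta l (kap f e))"
    by (intro finsum_cong' refl Pi_I lin_c_expand[symmetric] finsum_closed) (auto intro!: lin_intros)
  also have "\<dots> = (\<Oplus>\<^bsub>H\<^esub>l\<in>E. \<Oplus>\<^bsub>H\<^esub>e\<in>E. \<Oplus>\<^bsub>H\<^esub>f\<in>E. c e (l \<otimes>\<^bsub>H\<^esub> f) \<odot>\<^bsub>H\<^esub> eta l (kap f e))"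
    by (intro finsum_cong' refl Pi_I finsum_swap finsum_closed) (auto simp: E_fin)
  also have "\<dots> = (\<Oplus>\<^bsub>H\<^esub>e\<in>E. \<Oplus>\<^bsub>H\<^esub>l\<in>E. \<Oplus>\<^bsub>H\<^esub>f\<in>E. c e (l \<otimes>\<^bsub>H\<^esub> f) \<odot>\<^bsub>H\<^esub> eta l (kap f e))"
    by (intro finsum_swap finsum_closed) (auto simp: E_fin)
  also have "\<dots> = (\<Oplus>\<^bsub>H\<^esub>e\<in>E. c e \<one>\<^bsub>H\<^esub> \<odot>\<^bsub>H\<^esub> e)"
    by (intro finsum_cong' refl Pi_I eta_kap_trace) auto
  also have "\<dots> = \<one>\<^bsub>H\<^esub>" by (simp add: c_expand)
  finally show ?thesis .
qed

lemma nonzero_integral: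
  obtains m where "m \<in> carrier H" "integral_of m \<noteq> \<zero>\<^bsub>H\<^esub>"
proof -
  have "\<exists>l\<in>E. integral_of l \<noteq> \<zero>\<^bsub>H\<^esub>"
  proof (rule ccontr)
    assume "\<not> ?thesis"
    then have "(\<Oplus>\<^bsub>H\<^esub>l\<in>E. eta l (integral_of l)) = (\<Oplus>\<^bsub>H\<^esub>l\<in>E. \<zero>\<^bsub>H\<^esub>)"
      using lin_zero[OF C_module C_module eta_lin[OF _ lin_id]] by (intro finsum_cong' refl) auto
    then have "\<one>\<^bsub>H\<^esub> = \<zero>\<^bsub>H\<^esub>" using eta_integral_of by simp
    then have "\<one>\<^bsub>k\<^esub> = \<zero>\<^bsub>k\<^esub>"
      using counit_one lin_zero[OF C_module scalar_module_module counit_functional] by simp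
    then show False by simp
  qed
  then show ?thesis using that E_H by blast
qed

end

text \<open>Outside the context these rules carry the premise \<open>dual_basis k H E c\<close>;
  they are enabled again wherever a basis has been fixed.\<close>

declare c_lin [lin_intros del] kap_lin [lin_intros del] eta_lin [lin_intros del]
  E_H [simp del] c_closed [simp del] kap_closed [simp del] eta_closed [simp del]
  integral_of_closed [simp del]

section \<open>Frobenius functionals and the inverse of the antipode\<close>

lemma right_integralD:
  "right_integral L \<Longrightarrow> L \<in> carrier H"
  "right_integral L \<Longrightarrow> n \<in> carrier H \<Longrightarrow> L \<otimes>\<^bsub>H\<^esub> n = counit H n \<odot>\<^bsub>H\<^esub> L"
  by (auto simp: right_integral_def)

text \<open>Evaluate \<open>\<Delta>(L n_1) (1 \<otimes> S(n_2))\<close> in two ways: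
  \<open>L n_1\<close> is a multiple of \<open>L\<close>, and on the other hand
  \<open>n_2 S(n_3)\<close> cancels in the second leg.\<close>

lemma integral_shift:
  assumes L: "right_integral L" and [simp]: "n \<in> carrier H" and M: "module k M" and b: "bilin H H M \<beta>"
  shows "sw M (\<lambda>x y. \<beta> (x \<otimes>\<^bsub>H\<^esub> n) y) L = sw M (\<lambda>x y. \<beta> x (y \<otimes>\<^bsub>H\<^esub> antipode H n)) L"
proof -
  let ?S = "antipode H"
  note [simp] = right_integralD(1)[OF L] M bilin_closed[OF b]
  note bl [lin_intros] = lin_comp[OF bilinD1[OF b]] lin_comp[OF bilinD2[OF b]]
  have "sw M (\<lambda>a c. sw M (\<lambda>x y. \<beta> x (y \<otimes>\<^bsub>H\<^esub> ?S c)) (L \<otimes>\<^bsub>H\<^esub> a)) n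
    = sw M (\<lambda>a c. counit H a \<odot>\<^bsub>M\<^esub> sw M (\<lambda>x y. \<beta> x (y \<otimes>\<^bsub>H\<^esub> ?S c)) L) n"
  proof (rule sw_cong, simp_all, (auto intro!: bilinI lin_intros)[1])
    fix a c assume [simp]: "a \<in> carrier H" "c \<in> carrier H"
    have "lin H M (\<lambda>z. sw M (\<lambda>x y. \<beta> x (y \<otimes>\<^bsub>H\<^esub> ?S c)) z)" by (auto intro!: bilinI lin_intros)
    then show "sw M (\<lambda>x y. \<beta> x (y \<otimes>\<^bsub>H\<^esub> ?S c)) (L \<otimes>\<^bsub>H\<^esub> a) = counit H a \<odot>\<^bsub>M\<^esub> sw M (\<lambda>x y. \<beta> x (y \<otimes>\<^bsub>H\<^esub> ?S c)) L"
      by (simp add: right_integralD(2)[OF L] lin_smult)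
  qed
  also have "\<dots> = sw M (\<lambda>x y. \<beta> x (y \<otimes>\<^bsub>H\<^esub> ?S n)) L"
    by (rule sw_counit_left) (auto intro!: bilinI lin_intros)
  finally have 1: "sw M (\<lambda>a c. sw M (\<lambda>x y. \<beta> x (y \<otimes>\<^bsub>H\<^esub> ?S c)) (L \<otimes>\<^bsub>H\<^esub> a)) n = sw M (\<lambda>x y. \<beta> x (y \<otimes>\<^bsub>H\<^esub> ?S n)) L" .
  have "sw M (\<lambda>a c. sw M (\<lambda>x y. \<beta> x (y \<otimes>\<^bsub>H\<^esub> ?S c)) (L \<otimes>\<^bsub>H\<^esub> a)) n
    = sw M (\<lambda>a c. sw M (\<lambda>p q. sw M (\<lambda>x y. \<beta> (x \<otimes>\<^bsub>H\<^esub> p) (y \<otimes>\<^bsub>H\<^esub> (q \<otimes>\<^bsub>H\<^esub> ?S c))) L) a) n"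
  proof (rule sw_cong, simp_all, (auto intro!: bilinI lin_intros)[1])
    fix a c assume [simp]: "a \<in> carrier H" "c \<in> carrier H"
    have "sw M (\<lambda>x y. \<beta> x (y \<otimes>\<^bsub>H\<^esub> ?S c)) (L \<otimes>\<^bsub>H\<^esub> a)
      = sw M (\<lambda>x y. sw M (\<lambda>p q. \<beta> (x \<otimes>\<^bsub>H\<^esub> p) (y \<otimes>\<^bsub>H\<^esub> q \<otimes>\<^bsub>H\<^esub> ?S c)) a) L"
      by (rule sw_mult) (auto intro!: bilinI lin_intros)
    also have "\<dots> = sw M (\<lambda>p q. sw M (\<lambda>x y. \<beta> (x \<otimes>\<^bsub>H\<^esub> p) (y \<otimes>\<^bsub>H\<^esub> q \<otimes>\<^bsub>H\<^esub> ?S c)) L) a"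
      by (rule sw_swap) (auto intro!: bilinI lin_intros)
    also have "\<dots> = sw M (\<lambda>p q. sw M (\<lambda>x y. \<beta> (x \<otimes>\<^bsub>H\<^esub> p) (y \<otimes>\<^bsub>H\<^esub> (q \<otimes>\<^bsub>H\<^esub> ?S c))) L) a"
      by (rule sw_cong, simp_all, (auto intro!: bilinI lin_intros)[1], rule sw_cong)
        (auto intro!: bilinI lin_intros simp: m_assoc)
    finally show "sw M (\<lambda>x y. \<beta> x (y \<otimes>\<^bsub>H\<^esub> ?S c)) (L \<otimes>\<^bsub>H\<^esub> a)
      = sw M (\<lambda>p q. sw M (\<lambda>x y. \<beta> (x \<otimes>\<^bsub>H\<^esub> p) (y \<otimes>\<^bsub>H\<^esub> (q \<otimes>\<^bsub>H\<^esub> ?S c))) L) a" .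
  qed
  also have "\<dots> = sw M (\<lambda>p c. sw M (\<lambda>q c. sw M (\<lambda>x y. \<beta> (x \<otimes>\<^bsub>H\<^esub> p) (y \<otimes>\<^bsub>H\<^esub> (q \<otimes>\<^bsub>H\<^esub> ?S c))) L) c) n"
    by (rule sw_coassoc) (auto intro!: bilinI lin_intros)
  also have "\<dots> = sw M (\<lambda>p c. counit H c \<odot>\<^bsub>M\<^esub> sw M (\<lambda>x y. \<beta> (x \<otimes>\<^bsub>H\<^esub> p) (y \<otimes>\<^bsub>H\<^esub> \<one>\<^bsub>H\<^esub>)) L) n"
    by (rule sw_cong, simp_all del: r_one, (auto intro!: bilinI lin_intros simp del: r_one)[1],
        rule sw_antipode_right[where F = "\<lambda>w. sw M (\<lambda>x y. \<beta> (x \<otimes>\<^bsub>H\<^esub> _) (y \<otimes>\<^bsub>H\<^esub> w)) L"])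
      (auto intro!: bilinI lin_intros)
  also have "\<dots> = sw M (\<lambda>x y. \<beta> (x \<otimes>\<^bsub>H\<^esub> n) (y \<otimes>\<^bsub>H\<^esub> \<one>\<^bsub>H\<^esub>)) L"
    by (rule sw_counit_right) (auto intro!: bilinI lin_intros)
  also have "\<dots> = sw M (\<lambda>x y. \<beta> (x \<otimes>\<^bsub>H\<^esub> n) y) L"
    by (rule sw_cong) (auto intro!: bilinI lin_intros)
  finally show ?thesis using 1 by simp
qed

lemma right_integral_exists:
  obtains L where "right_integral L" "L \<noteq> \<zero>\<^bsub>H\<^esub>"
proof -
  obtain E c where c: "dual_basis k H E c" by (rule H_basis)
  obtain m where "m \<in> carrier H" "integral_of E c m \<noteq> \<zero>\<^bsub>H\<^esub>" by (rule nonzero_integral[OF c])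
  then show ?thesis using right_integral_integral_of[OF c] that by blast
qed

text \<open>A nonzero right integral \<open>L\<close> is a Frobenius element: \<open>h \<mapsto> \<Sum> h(L\<^sub>(\<^sub>2\<^sub>)) L\<^sub>(\<^sub>1\<^sub>)\<close> hits \<open>\<one>\<close>,
  because \<open>\<Sum> L\<^sub>(\<^sub>1\<^sub>) S(L\<^sub>(\<^sub>2\<^sub>)) f(L\<^sub>(\<^sub>3\<^sub>)) = f(L)\<close>.\<close>

lemma frobenius_functional:
  assumes L: "right_integral L" and nz: "L \<noteq> \<zero>\<^bsub>H\<^esub>"
  obtains g where "functional H g" "sw H (\<lambda>x y. g y \<odot>\<^bsub>H\<^esub> x) L = \<one>\<^bsub>H\<^esub>"
proof -
  let ?S = "antipode H"
  obtain E c where c: "dual_basis k H E c" by (rule H_basis)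
  note [simp] = E_H[OF c] c_closed[OF c] and [lin_intros] = c_lin[OF c]
  have [simp]: "L \<in> carrier H" using L by (simp add: right_integral_def)
  obtain f0 where f0: "functional H f0" "f0 L \<noteq> \<zero>\<^bsub>k\<^esub>"
    using functional_separates[OF fin_dim, of L] nz by auto
  have f0L: "f0 L \<in> carrier k" using lin_closed[OF f0(1)] by simp
  then have inv: "inv\<^bsub>k\<^esub> (f0 L) \<in> carrier k" using f0(2) by simp
  define f where "f x = inv\<^bsub>k\<^esub> (f0 L) \<otimes>\<^bsub>k\<^esub> f0 x" for x
  have fl: "functional H f" unfolding f_def[abs_def] using inv f0 by (intro lin_scalar_mult2)
  have fL: "f L = \<one>\<^bsub>k\<^esub>" unfolding f_def using f0(2) f0L field_Units by (intro R.Units_l_inv) simp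
  note [lin_intros] = lin_comp[OF fl] and [simp] = lin_closed[OF fl, simplified]
  \<comment> \<open>The convolution product of \<open>c e\<close> with \<open>f\<close>.\<close>
  define h where "h e w = sw K1 (\<lambda>p q. c e p \<otimes>\<^bsub>k\<^esub> f q) w" for e w
  have hl [lin_intros]: "lin V H j \<Longrightarrow> e \<in> E \<Longrightarrow> functional V (\<lambda>x. h e (j x))" for V :: "('a, 'u, 'v) module_scheme" and j e
    unfolding h_def by (auto intro!: bilinI lin_intros)
  have hl' [lin_intros]: "e \<in> E \<Longrightarrow> functional H (\<lambda>x. h e x)" for e
    unfolding h_def by (auto intro!: bilinI lin_intros)
  note [lin_intros] = lin_comp[OF hl'] and [simp] = lin_closed[OF hl', simplified]
  \<comment> \<open>The shape comes from \<open>integral_shift\<close> with \<open>n = S(e)\<close>: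
    the factor \<open>S(S(e))\<close> on the second leg of \<open>L\<close> becomes
    \<open>S(e)\<close> on the first, and summing over \<open>e\<close> produces
    \<open>L_1 S(L_2) f(L_3)\<close>.\<close>
  define g where "g z = (\<Oplus>\<^bsub>k\<^esub>e\<in>E. h e (z \<otimes>\<^bsub>H\<^esub> ?S (?S e)))" for z
  have gl: "functional H g" unfolding g_def[abs_def] by (auto intro!: lin_intros)
  have "sw H (\<lambda>x y. g y \<odot>\<^bsub>H\<^esub> x) L = sw H (\<lambda>x y. \<Oplus>\<^bsub>H\<^esub>e\<in>E. h e (y \<otimes>\<^bsub>H\<^esub> ?S (?S e)) \<odot>\<^bsub>H\<^esub> x) L"
  proof (rule sw_cong, simp_all)
    show "bilin H H H (\<lambda>x y. g y \<odot>\<^bsub>H\<^esub> x)" using lin_closed[OF gl] gl by (auto intro!: bilinI lin_intros lin_comp[OF gl])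
    fix x y assume [simp]: "x \<in> carrier H" "y \<in> carrier H"
    show "g y \<odot>\<^bsub>H\<^esub> x = (\<Oplus>\<^bsub>H\<^esub>e\<in>E. h e (y \<otimes>\<^bsub>H\<^esub> ?S (?S e)) \<odot>\<^bsub>H\<^esub> x)"
      unfolding g_def finsum_scalar[symmetric]
      by (rule lin_finsum[OF scalar_module_module C_module]) (auto intro!: lin_smult_vec lin_id)
  qed
  also have "\<dots> = (\<Oplus>\<^bsub>H\<^esub>e\<in>E. sw H (\<lambda>x y. h e (y \<otimes>\<^bsub>H\<^esub> ?S (?S e)) \<odot>\<^bsub>H\<^esub> x) L)"
    by (rule sw_sum) (auto intro!: bilinI lin_intros)
  also have "\<dots> = (\<Oplus>\<^bsub>H\<^esub>e\<in>E. sw H (\<lambda>x y. h e y \<odot>\<^bsub>H\<^esub> (x \<otimes>\<^bsub>H\<^esub> ?S e)) L)"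
    by (intro finsum_cong' refl Pi_I sw_closed integral_shift[OF L, symmetric]) (auto intro!: bilinI lin_intros)
  also have "\<dots> = (\<Oplus>\<^bsub>H\<^esub>e\<in>E. sw H (\<lambda>x y. sw H (\<lambda>p q. c e p \<odot>\<^bsub>H\<^esub> (f q \<odot>\<^bsub>H\<^esub> (x \<otimes>\<^bsub>H\<^esub> ?S e))) y) L)"
  proof (intro finsum_cong' refl Pi_I)
    fix e assume [simp]: "e \<in> E"
    show "sw H (\<lambda>x y. h e y \<odot>\<^bsub>H\<^esub> (x \<otimes>\<^bsub>H\<^esub> ?S e)) L = sw H (\<lambda>x y. sw H (\<lambda>p q. c e p \<odot>\<^bsub>H\<^esub> (f q \<odot>\<^bsub>H\<^esub> (x \<otimes>\<^bsub>H\<^esub> ?S e))) y) L"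
    proof (rule sw_cong, simp_all, (auto intro!: bilinI lin_intros)[1])
      fix x y assume [simp]: "x \<in> carrier H" "y \<in> carrier H"
      have "h e y \<odot>\<^bsub>H\<^esub> (x \<otimes>\<^bsub>H\<^esub> ?S e) = sw H (\<lambda>p q. (c e p \<otimes>\<^bsub>k\<^esub> f q) \<odot>\<^bsub>H\<^esub> (x \<otimes>\<^bsub>H\<^esub> ?S e)) y"
        unfolding h_def by (rule sw_hom[OF scalar_module_module]) (auto intro!: bilinI lin_intros)
      also have "\<dots> = sw H (\<lambda>p q. c e p \<odot>\<^bsub>H\<^esub> (f q \<odot>\<^bsub>H\<^esub> (x \<otimes>\<^bsub>H\<^esub> ?S e))) y"
        by (rule sw_cong) (auto intro!: bilinI lin_intros simp: smult_assoc1)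
      finally show "h e y \<odot>\<^bsub>H\<^esub> (x \<otimes>\<^bsub>H\<^esub> ?S e) = sw H (\<lambda>p q. c e p \<odot>\<^bsub>H\<^esub> (f q \<odot>\<^bsub>H\<^esub> (x \<otimes>\<^bsub>H\<^esub> ?S e))) y" .
    qed
    show "sw H (\<lambda>x y. sw H (\<lambda>p q. c e p \<odot>\<^bsub>H\<^esub> (f q \<odot>\<^bsub>H\<^esub> (x \<otimes>\<^bsub>H\<^esub> ?S e))) y) L \<in> carrier H"
      by (rule sw_closed) (auto intro!: bilinI lin_intros)
  qed
  also have "\<dots> = sw H (\<lambda>x y. \<Oplus>\<^bsub>H\<^esub>e\<in>E. sw H (\<lambda>p q. c e p \<odot>\<^bsub>H\<^esub> (f q \<odot>\<^bsub>H\<^esub> (x \<otimes>\<^bsub>H\<^esub> ?S e))) y) L"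
    by (rule sw_sum[symmetric]) (auto intro!: bilinI lin_intros)
  also have "\<dots> = sw H (\<lambda>x y. sw H (\<lambda>p q. f q \<odot>\<^bsub>H\<^esub> (x \<otimes>\<^bsub>H\<^esub> ?S p)) y) L"
  proof (rule sw_cong, simp_all, (auto intro!: bilinI lin_intros)[1])
    fix x y assume [simp]: "x \<in> carrier H" "y \<in> carrier H"
    have "(\<Oplus>\<^bsub>H\<^esub>e\<in>E. sw H (\<lambda>p q. c e p \<odot>\<^bsub>H\<^esub> (f q \<odot>\<^bsub>H\<^esub> (x \<otimes>\<^bsub>H\<^esub> ?S e))) y)
      = sw H (\<lambda>p q. \<Oplus>\<^bsub>H\<^esub>e\<in>E. c e p \<odot>\<^bsub>H\<^esub> (f q \<odot>\<^bsub>H\<^esub> (x \<otimes>\<^bsub>H\<^esub> ?S e))) y"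
      by (rule sw_sum[symmetric]) (auto intro!: bilinI lin_intros)
    also have "\<dots> = sw H (\<lambda>p q. f q \<odot>\<^bsub>H\<^esub> (x \<otimes>\<^bsub>H\<^esub> ?S p)) y"
      by (rule sw_cong, simp_all, (auto intro!: bilinI lin_intros)[1], rule lin_c_expand[OF c])
        (auto intro!: lin_intros)
    finally show "(\<Oplus>\<^bsub>H\<^esub>e\<in>E. sw H (\<lambda>p q. c e p \<odot>\<^bsub>H\<^esub> (f q \<odot>\<^bsub>H\<^esub> (x \<otimes>\<^bsub>H\<^esub> ?S e))) y)
      = sw H (\<lambda>p q. f q \<odot>\<^bsub>H\<^esub> (x \<otimes>\<^bsub>H\<^esub> ?S p)) y" .
  qed
  also have "\<dots> = sw H (\<lambda>a q. sw H (\<lambda>x p. f q \<odot>\<^bsub>H\<^esub> (x \<otimes>\<^bsub>H\<^esub> ?S p)) a) L"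
    by (rule sw_coassoc[symmetric]) (auto intro!: lin_intros)
  also have "\<dots> = sw H (\<lambda>a q. counit H a \<odot>\<^bsub>H\<^esub> (f q \<odot>\<^bsub>H\<^esub> \<one>\<^bsub>H\<^esub>)) L"
    by (rule sw_cong, simp_all, (auto intro!: bilinI lin_intros)[1], rule sw_antipode_right)
      (auto intro!: lin_intros)
  also have "\<dots> = f L \<odot>\<^bsub>H\<^esub> \<one>\<^bsub>H\<^esub>" by (rule sw_counit_left) (auto intro!: lin_intros)
  finally show ?thesis using gl fL that by simp
qed

text \<open>Shifting makes the pair nondegenerate: first \<open>S\<close> becomes injective, hence
  bijective with inverse \<open>T\<close>; then \<open>f \<mapsto> \<Sum> f(L_2) L_1\<close> is
  injective, and this forces \<open>g\<close> to be an integral on \<open>H\<close>.\<close>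

lemma frobenius_data:
  obtains L g T where "right_integral L" "functional H g" "lin H H T"
    "sw H (\<lambda>x y. g y \<odot>\<^bsub>H\<^esub> x) L = \<one>\<^bsub>H\<^esub>"
    "\<And>y. y \<in> carrier H \<Longrightarrow> sw H (\<lambda>p q. g q \<odot>\<^bsub>H\<^esub> p) y = g y \<odot>\<^bsub>H\<^esub> \<one>\<^bsub>H\<^esub>"
    "\<And>q. q \<in> carrier H \<Longrightarrow> g (L \<otimes>\<^bsub>H\<^esub> q) = counit H q"
    "\<And>x. x \<in> carrier H \<Longrightarrow> antipode H (T x) = x"
    "\<And>x. x \<in> carrier H \<Longrightarrow> T (antipode H x) = x"
proof -
  let ?S = "antipode H"
  obtain E c where c: "dual_basis k H E c" by (rule H_basis)
  note [simp] = E_H[OF c] c_closed[OF c] and [lin_intros] = c_lin[OF c]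
  obtain L where L: "right_integral L" and nz: "L \<noteq> \<zero>\<^bsub>H\<^esub>" by (rule right_integral_exists)
  obtain g where g: "functional H g" and g1: "sw H (\<lambda>x y. g y \<odot>\<^bsub>H\<^esub> x) L = \<one>\<^bsub>H\<^esub>"
    by (rule frobenius_functional[OF L nz])
  note [lin_intros] = lin_comp[OF g] and [simp] = lin_closed[OF g, simplified]
  have [simp]: "L \<in> carrier H" using L by (simp add: right_integral_def)
  \<comment> \<open>Shifting \<open>S(n)\<close> off the second leg leaves
    \<open>g(L_2) L_1 n\<close>, which is \<open>n\<close>.\<close>
  have recover: "sw H (\<lambda>x y. g (y \<otimes>\<^bsub>H\<^esub> ?S n) \<odot>\<^bsub>H\<^esub> x) L = n" if [simp]: "n \<in> carrier H" for n
  proof -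
    have "sw H (\<lambda>x y. g (y \<otimes>\<^bsub>H\<^esub> ?S n) \<odot>\<^bsub>H\<^esub> x) L = sw H (\<lambda>x y. g y \<odot>\<^bsub>H\<^esub> (x \<otimes>\<^bsub>H\<^esub> n)) L"
      by (rule integral_shift[OF L, symmetric]) (auto intro!: bilinI lin_intros)
    also have "\<dots> = sw H (\<lambda>x y. (g y \<odot>\<^bsub>H\<^esub> x) \<otimes>\<^bsub>H\<^esub> n) L"
      by (rule sw_cong) (auto intro!: bilinI lin_intros simp: smult_mult_left)
    also have "\<dots> = \<one>\<^bsub>H\<^esub> \<otimes>\<^bsub>H\<^esub> n"
      unfolding g1[symmetric] by (rule sw_hom[symmetric]) (auto intro!: bilinI lin_intros)
    finally show ?thesis by simp
  qed
  have g0: "g \<zero>\<^bsub>H\<^esub> = \<zero>\<^bsub>k\<^esub>" using lin_zero[OF C_module scalar_module_module g] by simp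
  \<comment> \<open>By \<open>recover\<close>, \<open>x\<close> is determined by
    \<open>S(x)\<close>.\<close>
  have inj: "x = \<zero>\<^bsub>H\<^esub>" if x: "x \<in> carrier H" "?S x = \<zero>\<^bsub>H\<^esub>" for x
  proof -
    have "x = sw H (\<lambda>u v. g (v \<otimes>\<^bsub>H\<^esub> ?S x) \<odot>\<^bsub>H\<^esub> u) L"
      by (rule recover[OF x(1), symmetric])
    also have "\<dots> = sw H (\<lambda>u v. \<zero>\<^bsub>k\<^esub> \<odot>\<^bsub>H\<^esub> (u \<otimes>\<^bsub>H\<^esub> v)) L"
      by (rule sw_cong) (use x g0 in \<open>auto intro!: bilinI lin_intros\<close>)
    also have "\<dots> = \<zero>\<^bsub>k\<^esub> \<odot>\<^bsub>H\<^esub> sw H (\<lambda>u v. u \<otimes>\<^bsub>H\<^esub> v) L"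
      by (rule sw_hom[symmetric]) (auto intro!: bilinI lin_intros)
    also have "\<dots> = \<zero>\<^bsub>H\<^esub>" by (intro lmult_0 sw_closed) (auto intro!: bilinI lin_intros)
    finally show ?thesis .
  qed
  have inj': "x = y" if "x \<in> carrier H" "y \<in> carrier H" "?S x = ?S y" for x y
  proof -
    have "?S (x \<ominus>\<^bsub>H\<^esub> y) = \<zero>\<^bsub>H\<^esub>" using that lin_minus[OF C_module C_module antipode_linear] by simp
    then show ?thesis using inj[of "x \<ominus>\<^bsub>H\<^esub> y"] that by simp
  qed
  define T where "T x = (SOME z. z \<in> carrier H \<and> ?S z = x)" for x
  have T: "T x \<in> carrier H" "?S (T x) = x" if "x \<in> carrier H" for x
    using someI_ex[of "\<lambda>z. z \<in> carrier H \<and> ?S z = x"]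
      inj_endo_surj[OF fin_dim antipode_linear inj that] unfolding T_def by auto
  have TS: "T (?S x) = x" if "x \<in> carrier H" for x by (rule inj') (simp_all add: T that)
  have Tl: "lin H H T"
    by (rule linI, simp add: T, (rule inj'; simp add: T lin_add[OF antipode_linear] lin_smult[OF antipode_linear])+)
  note [lin_intros] = lin_comp[OF Tl] and [simp] = T
  \<comment> \<open>The identity \<open>y_2 T(y_1) = \<epsilon>(y)\<close>: apply \<open>S\<close>,
    which reverses products, and use that \<open>S\<close> is injective.\<close>
  have T_anti: "sw H (\<lambda>p r. F (r \<otimes>\<^bsub>H\<^esub> T p)) y = counit H y \<odot>\<^bsub>H\<^esub> F \<one>\<^bsub>H\<^esub>"
    if [simp]: "y \<in> carrier H" and F: "lin H H F" for y F
  proof -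
    have "?S (sw H (\<lambda>p r. r \<otimes>\<^bsub>H\<^esub> T p) y) = sw H (\<lambda>p r. ?S (r \<otimes>\<^bsub>H\<^esub> T p)) y"
      by (rule sw_hom) (auto intro!: bilinI lin_intros)
    also have "\<dots> = sw H (\<lambda>p r. p \<otimes>\<^bsub>H\<^esub> ?S r) y"
      by (rule sw_cong) (auto intro!: bilinI lin_intros simp: antipode_mult)
    also have "\<dots> = counit H y \<odot>\<^bsub>H\<^esub> \<one>\<^bsub>H\<^esub>" by (rule sw_antipode_right) (auto intro!: lin_intros)
    also have "\<dots> = ?S (counit H y \<odot>\<^bsub>H\<^esub> \<one>\<^bsub>H\<^esub>)" using lin_smult[OF antipode_linear] by simp
    finally have "sw H (\<lambda>p r. r \<otimes>\<^bsub>H\<^esub> T p) y = counit H y \<odot>\<^bsub>H\<^esub> \<one>\<^bsub>H\<^esub>"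
      by (rule inj'[rotated 2]) (auto intro!: sw_closed bilinI lin_intros)
    moreover have "F (sw H (\<lambda>p r. r \<otimes>\<^bsub>H\<^esub> T p) y) = sw H (\<lambda>p r. F (r \<otimes>\<^bsub>H\<^esub> T p)) y"
      by (rule sw_hom) (auto intro!: bilinI lin_intros F)
    ultimately show ?thesis using F by (simp add: lin_smult)
  qed
  \<comment> \<open>Since \<open>L_3 T(L_2)\<close> collapses, \<open>f(q0) L\<close> equals the sum
    of \<open>f(L_3 T(L_2) q0) L_1\<close>. Expanding the middle leg in a basis writes this through
    the sums \<open>f(L_2 q) L_1\<close>, which vanish by shifting.\<close>
  have finj: "f q0 = \<zero>\<^bsub>k\<^esub>"
    if f: "functional H f" and f0: "sw H (\<lambda>x y. f y \<odot>\<^bsub>H\<^esub> x) L = \<zero>\<^bsub>H\<^esub>" and [simp]: "q0 \<in> carrier H" for f q0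
  proof -
    note [lin_intros] = lin_comp[OF f] and [simp] = lin_closed[OF f, simplified]
    have shift: "sw H (\<lambda>x y. f (y \<otimes>\<^bsub>H\<^esub> q) \<odot>\<^bsub>H\<^esub> x) L = \<zero>\<^bsub>H\<^esub>" if [simp]: "q \<in> carrier H" for q
    proof -
      have "sw H (\<lambda>x y. f (y \<otimes>\<^bsub>H\<^esub> q) \<odot>\<^bsub>H\<^esub> x) L = sw H (\<lambda>x y. f (y \<otimes>\<^bsub>H\<^esub> ?S (T q)) \<odot>\<^bsub>H\<^esub> x) L" by simp
      also have "\<dots> = sw H (\<lambda>x y. f y \<odot>\<^bsub>H\<^esub> (x \<otimes>\<^bsub>H\<^esub> T q)) L"
        by (rule integral_shift[OF L, symmetric]) (auto intro!: bilinI lin_intros)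
      also have "\<dots> = sw H (\<lambda>x y. (f y \<odot>\<^bsub>H\<^esub> x) \<otimes>\<^bsub>H\<^esub> T q) L"
        by (rule sw_cong) (auto intro!: bilinI lin_intros simp: smult_mult_left)
      also have "\<dots> = \<zero>\<^bsub>H\<^esub> \<otimes>\<^bsub>H\<^esub> T q"
        unfolding f0[symmetric] by (rule sw_hom[symmetric]) (auto intro!: bilinI lin_intros)
      finally show ?thesis by simp
    qed
    let ?b = "\<lambda>x p r. f (r \<otimes>\<^bsub>H\<^esub> T p \<otimes>\<^bsub>H\<^esub> q0) \<odot>\<^bsub>H\<^esub> x"
    have "sw H (\<lambda>x y. sw H (\<lambda>p r. ?b x p r) y) L = sw H (\<lambda>x y. counit H y \<odot>\<^bsub>H\<^esub> (f (\<one>\<^bsub>H\<^esub> \<otimes>\<^bsub>H\<^esub> q0) \<odot>\<^bsub>H\<^esub> x)) L"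
      by (rule sw_cong, simp_all del: l_one, (auto intro!: bilinI lin_intros simp del: l_one)[1], rule T_anti)
        (auto intro!: lin_intros)
    also have "\<dots> = f (\<one>\<^bsub>H\<^esub> \<otimes>\<^bsub>H\<^esub> q0) \<odot>\<^bsub>H\<^esub> L" by (rule sw_counit_right) (auto intro!: lin_intros)
    finally have "f q0 \<odot>\<^bsub>H\<^esub> L = sw H (\<lambda>x y. sw H (\<lambda>p r. ?b x p r) y) L" by simp
    also have "\<dots> = sw H (\<lambda>a r. sw H (\<lambda>x p. ?b x p r) a) L"
      by (rule sw_coassoc[symmetric]) (auto intro!: lin_intros)
    also have "\<dots> = sw H (\<lambda>a r. \<Oplus>\<^bsub>H\<^esub>e\<in>E. ?b (sw H (\<lambda>u v. c e v \<odot>\<^bsub>H\<^esub> u) a) e r) L"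
      by (rule sw_cong, simp_all, (auto intro!: bilinI lin_intros)[1], rule sw_expand_left[OF c])
        (auto intro!: bilinI lin_intros)
    also have "\<dots> = (\<Oplus>\<^bsub>H\<^esub>e\<in>E. sw H (\<lambda>a r. ?b (sw H (\<lambda>u v. c e v \<odot>\<^bsub>H\<^esub> u) a) e r) L)"
      by (rule sw_sum) (auto intro!: bilinI lin_intros sw_closed)
    also have "\<dots> = (\<Oplus>\<^bsub>H\<^esub>e\<in>E. \<zero>\<^bsub>H\<^esub>)"
    proof (intro finsum_cong' refl)
      fix e assume [simp]: "e \<in> E"
      let ?s = "\<lambda>a. sw H (\<lambda>u v. c e v \<odot>\<^bsub>H\<^esub> u) a"
      have s: "lin H H ?s" by (auto intro!: bilinI lin_intros)
      note [simp] = lin_closed[OF s]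
      have "sw H (\<lambda>a r. ?b (?s a) e r) L = sw H (\<lambda>a r. ?s (f (r \<otimes>\<^bsub>H\<^esub> (T e \<otimes>\<^bsub>H\<^esub> q0)) \<odot>\<^bsub>H\<^esub> a)) L"
        by (rule sw_cong) (auto intro!: bilinI lin_intros simp: lin_smult[OF s] m_assoc)
      also have "\<dots> = ?s (sw H (\<lambda>a r. f (r \<otimes>\<^bsub>H\<^esub> (T e \<otimes>\<^bsub>H\<^esub> q0)) \<odot>\<^bsub>H\<^esub> a) L)"
        by (rule sw_hom[symmetric]) (auto intro!: bilinI lin_intros s)
      also have "\<dots> = \<zero>\<^bsub>H\<^esub>" using lin_zero[OF C_module C_module s] by (simp add: shift)
      finally show "sw H (\<lambda>a r. ?b (?s a) e r) L = \<zero>\<^bsub>H\<^esub>" .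
    qed auto
    finally have z: "f q0 \<odot>\<^bsub>H\<^esub> L = \<zero>\<^bsub>H\<^esub>" by simp
    show ?thesis
    proof (rule ccontr)
      assume n: "f q0 \<noteq> \<zero>\<^bsub>k\<^esub>"
      then have i: "inv\<^bsub>k\<^esub> (f q0) \<in> carrier k" "inv\<^bsub>k\<^esub> (f q0) \<otimes>\<^bsub>k\<^esub> f q0 = \<one>\<^bsub>k\<^esub>"
        using field_Units by (auto intro: R.Units_l_inv)
      have "L = (inv\<^bsub>k\<^esub> (f q0) \<otimes>\<^bsub>k\<^esub> f q0) \<odot>\<^bsub>H\<^esub> L" using i by simp
      also have "\<dots> = inv\<^bsub>k\<^esub> (f q0) \<odot>\<^bsub>H\<^esub> (f q0 \<odot>\<^bsub>H\<^esub> L)" using i by (intro smult_assoc1) auto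
      also have "\<dots> = \<zero>\<^bsub>H\<^esub>" using z i by simp
      finally show False using nz by simp
    qed
  qed
  \<comment> \<open>Test the identity with a functional \<open>h\<close>. By \<open>finj\<close> it
    suffices to contract the resulting functional with \<open>L\<close>, and both terms then give
    \<open>h(1) 1\<close>.\<close>
  have g_right: "sw H (\<lambda>p q. g q \<odot>\<^bsub>H\<^esub> p) y = g y \<odot>\<^bsub>H\<^esub> \<one>\<^bsub>H\<^esub>" if [simp]: "y \<in> carrier H" for y
  proof -
    let ?G = "\<lambda>y. sw H (\<lambda>p q. g q \<odot>\<^bsub>H\<^esub> p) y"
    have Gl: "lin H H ?G" by (auto intro!: bilinI lin_intros)
    note [simp] = lin_closed[OF Gl]
    have "h (?G y \<ominus>\<^bsub>H\<^esub> g y \<odot>\<^bsub>H\<^esub> \<one>\<^bsub>H\<^esub>) = \<zero>\<^bsub>k\<^esub>" if h: "functional H h" for h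
    proof -
      note [lin_intros] = lin_comp[OF h] and [simp] = lin_closed[OF h, simplified]
      let ?f = "\<lambda>y. h (?G y \<ominus>\<^bsub>H\<^esub> g y \<odot>\<^bsub>H\<^esub> \<one>\<^bsub>H\<^esub>)"
      let ?s = "\<lambda>a. sw H (\<lambda>u v. h v \<odot>\<^bsub>H\<^esub> u) a"
      have s: "lin H H ?s" by (auto intro!: bilinI lin_intros)
      note [simp] = lin_closed[OF s]
      \<comment> \<open>Regroup as \<open>L_1 h(L_2) g(L_3)\<close>: this is the slice by
        \<open>h\<close> of \<open>g(L_2) L_1\<close>, that is, of the unit.\<close>
      have 1: "sw H (\<lambda>x y. h (?G y) \<odot>\<^bsub>H\<^esub> x) L = h \<one>\<^bsub>H\<^esub> \<odot>\<^bsub>H\<^esub> \<one>\<^bsub>H\<^esub>"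
      proof -
        have "sw H (\<lambda>x y. h (?G y) \<odot>\<^bsub>H\<^esub> x) L = sw H (\<lambda>x y. sw H (\<lambda>p q. h (g q \<odot>\<^bsub>H\<^esub> p) \<odot>\<^bsub>H\<^esub> x) y) L"
          by (rule sw_cong, simp_all, (auto intro!: bilinI lin_intros)[1],
              rule sw_hom[where F = "\<lambda>z. h z \<odot>\<^bsub>H\<^esub> _"]) (auto intro!: bilinI lin_intros)
        also have "\<dots> = sw H (\<lambda>a q. sw H (\<lambda>x p. h (g q \<odot>\<^bsub>H\<^esub> p) \<odot>\<^bsub>H\<^esub> x) a) L"
          by (rule sw_coassoc[symmetric]) (auto intro!: lin_intros)
        also have "\<dots> = sw H (\<lambda>a q. ?s (g q \<odot>\<^bsub>H\<^esub> a)) L"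
        proof (rule sw_cong, simp_all, (auto intro!: bilinI lin_intros)[1])
          fix a q assume [simp]: "a \<in> carrier H" "q \<in> carrier H"
          have "sw H (\<lambda>x p. h (g q \<odot>\<^bsub>H\<^esub> p) \<odot>\<^bsub>H\<^esub> x) a = sw H (\<lambda>x p. g q \<odot>\<^bsub>H\<^esub> (h p \<odot>\<^bsub>H\<^esub> x)) a"
            by (rule sw_cong) (auto intro!: bilinI lin_intros simp: lin_smult[OF h] smult_assoc1)
          also have "\<dots> = g q \<odot>\<^bsub>H\<^esub> ?s a"
            by (rule sw_hom[symmetric]) (auto intro!: bilinI lin_intros)
          finally show "sw H (\<lambda>x p. h (g q \<odot>\<^bsub>H\<^esub> p) \<odot>\<^bsub>H\<^esub> x) a = ?s (g q \<odot>\<^bsub>H\<^esub> a)"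
            by (simp add: lin_smult[OF s])
        qed
        also have "\<dots> = ?s \<one>\<^bsub>H\<^esub>"
          unfolding g1[symmetric] by (rule sw_hom[symmetric]) (auto intro!: bilinI lin_intros s)
        also have "\<dots> = h \<one>\<^bsub>H\<^esub> \<odot>\<^bsub>H\<^esub> \<one>\<^bsub>H\<^esub>"
          by (rule sw_one) (auto intro!: bilinI lin_intros)
        finally show ?thesis .
      qed
      have 2: "sw H (\<lambda>x y. h (g y \<odot>\<^bsub>H\<^esub> \<one>\<^bsub>H\<^esub>) \<odot>\<^bsub>H\<^esub> x) L = h \<one>\<^bsub>H\<^esub> \<odot>\<^bsub>H\<^esub> \<one>\<^bsub>H\<^esub>"
      proof -
        have "sw H (\<lambda>x y. h (g y \<odot>\<^bsub>H\<^esub> \<one>\<^bsub>H\<^esub>) \<odot>\<^bsub>H\<^esub> x) L = sw H (\<lambda>x y. h \<one>\<^bsub>H\<^esub> \<odot>\<^bsub>H\<^esub> (g y \<odot>\<^bsub>H\<^esub> x)) L"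
          by (rule sw_cong)
            (auto intro!: bilinI lin_intros simp: lin_smult[OF h] smult_assoc1[symmetric] R.m_comm)
        also have "\<dots> = h \<one>\<^bsub>H\<^esub> \<odot>\<^bsub>H\<^esub> \<one>\<^bsub>H\<^esub>"
          unfolding g1[symmetric]
          by (rule sw_hom[symmetric, where F = "\<lambda>z. h (sw H (\<lambda>x y. g y \<odot>\<^bsub>H\<^esub> x) L) \<odot>\<^bsub>H\<^esub> z"])
            (auto intro!: bilinI lin_intros sw_closed)
        finally show ?thesis .
      qed
      have "sw H (\<lambda>x y. ?f y \<odot>\<^bsub>H\<^esub> x) L = sw H (\<lambda>x y. h (?G y) \<odot>\<^bsub>H\<^esub> x \<ominus>\<^bsub>H\<^esub> h (g y \<odot>\<^bsub>H\<^esub> \<one>\<^bsub>H\<^esub>) \<odot>\<^bsub>H\<^esub> x) L"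
        by (rule sw_cong, simp_all, (auto intro!: bilinI lin_intros)[1])
          (use lin_minus[OF C_module C_module lin_smult_vec[OF C_module _ lin_comp[OF h lin_id]]] in simp)
      also have "\<dots> = \<zero>\<^bsub>H\<^esub>"
        by (subst sw_diff) (auto intro!: bilinI lin_intros simp: 1 2)
      finally show ?thesis by (intro finj[of ?f]) (auto intro!: lin_intros bilinI)
    qed
    then have "?G y \<ominus>\<^bsub>H\<^esub> g y \<odot>\<^bsub>H\<^esub> \<one>\<^bsub>H\<^esub> = \<zero>\<^bsub>H\<^esub>"
      by (intro functional_separates[OF fin_dim]) auto
    then show ?thesis by simp
  qed
  \<comment> \<open>Apply the counit to \<open>recover\<close> at \<open>T q\<close>.\<close>
  have gL: "g (L \<otimes>\<^bsub>H\<^esub> q) = counit H q" if [simp]: "q \<in> carrier H" for q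
  proof -
    have "counit H (T q) = counit H (sw H (\<lambda>x y. g (y \<otimes>\<^bsub>H\<^esub> ?S (T q)) \<odot>\<^bsub>H\<^esub> x) L)" by (subst recover) simp_all
    also have "\<dots> = counit H (sw H (\<lambda>x y. g (y \<otimes>\<^bsub>H\<^esub> q) \<odot>\<^bsub>H\<^esub> x) L)" by simp
    also have "\<dots> = sw K1 (\<lambda>x y. counit H (g (y \<otimes>\<^bsub>H\<^esub> q) \<odot>\<^bsub>H\<^esub> x)) L"
      by (rule sw_hom) (auto intro!: bilinI lin_intros)
    also have "\<dots> = sw K1 (\<lambda>x y. counit H x \<odot>\<^bsub>K1\<^esub> g (y \<otimes>\<^bsub>H\<^esub> q)) L"
      by (rule sw_cong) (auto intro!: bilinI lin_intros simp: counit_linear R.m_comm)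
    also have "\<dots> = g (L \<otimes>\<^bsub>H\<^esub> q)" by (rule sw_counit_left) (auto intro!: lin_intros)
    finally show ?thesis using counit_antipode[of "T q"] by simp
  qed
  show ?thesis using L g Tl g1 g_right gL T(2) TS by (rule that)
qed

end

section \<open>Quotients by Hopf ideals\<close>

text \<open>The coideal condition is phrased as the vanishing of
  \<open>(\<pi> \<otimes> \<pi>) \<circ> \<Delta>\<close> on \<open>I\<close>, which is exactly
  well-definedness of the comultiplication of \<open>quot_hopf\<close>.\<close>

locale hopf_quotient = hopf_algebra +
  fixes I
  assumes I_sub: "LinearCombinations.submodule k I H"
    and I_left: "\<And>h i. h \<in> carrier H \<Longrightarrow> i \<in> I \<Longrightarrow> h \<otimes>\<^bsub>H\<^esub> i \<in> I"
    and I_right: "\<And>h i. h \<in> carrier H \<Longrightarrow> i \<in> I \<Longrightarrow> i \<otimes>\<^bsub>H\<^esub> h \<in> I"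
    and I_counit: "\<And>i. i \<in> I \<Longrightarrow> counit H i = \<zero>\<^bsub>k\<^esub>"
    and I_antipode: "\<And>i. i \<in> I \<Longrightarrow> antipode H i \<in> I"
    and I_comult: "\<And>i. i \<in> I \<Longrightarrow>
      sw (tensor_module k (quot_algebra H I) (quot_algebra H I))
        (\<lambda>u v. tens k (quot_algebra H I) (quot_algebra H I) (I +>\<^bsub>H\<^esub> u) (I +>\<^bsub>H\<^esub> v)) i
      = \<zero>\<^bsub>tensor_module k (quot_algebra H I) (quot_algebra H I)\<^esub>"
begin

abbreviation Q where "Q \<equiv> quot_hopf k H I"
abbreviation (input) Q0 where "Q0 \<equiv> quot_algebra H I"
definition proj where "proj x = I +>\<^bsub>H\<^esub> x"

lemma IH: "i \<in> I \<Longrightarrow> i \<in> carrier H"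
  using I_sub by (auto simp: LinearCombinations.submodule_def)

lemma Q_fields [simp]:
  "carrier Q = carrier Q0" "add Q = add Q0" "mult Q = mult Q0" "zero Q = zero Q0" "one Q = one Q0"
  "smult Q = smult Q0"
  by (simp_all add: quot_hopf_def module.extend_def)

lemma Q_tensor: "tensor_module k Q0 Q0 = tensor_module k Q Q" "tens k Q0 Q0 = tens k Q Q"
  by (rule tensor_module_cong; simp)+

lemma Q_module [simp]: "module k Q"
  by (rule module_cong[OF quot_module[OF I_sub]]) simp_all

lemma proj_linear: "lin H Q proj"
  using quot_proj_hom[OF I_sub] unfolding proj_def[abs_def]
  by (subst module_hom_cong[of H H Q Q0]) simp_all

lemma proj_lin [lin_intros]: "lin V H f \<Longrightarrow> lin V Q (\<lambda>x. proj (f x))"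
  by (rule lin_comp[OF proj_linear])

lemma proj_closed [simp]: "x \<in> carrier H \<Longrightarrow> proj x \<in> carrier Q0"
  using lin_closed[OF proj_linear] by simp

lemma Q_cases:
  assumes "X \<in> carrier Q" obtains x where "x \<in> carrier H" "X = proj x"
  using assms quot_carrier[of X I] unfolding proj_def by auto

lemma proj_eq_iff: "x \<in> carrier H \<Longrightarrow> y \<in> carrier H \<Longrightarrow> proj x = proj y \<longleftrightarrow> x \<ominus>\<^bsub>H\<^esub> y \<in> I"
  unfolding proj_def by (rule rcos_eq_iff[OF I_sub])

lemma proj_zero_iff: "x \<in> carrier H \<Longrightarrow> proj x = \<zero>\<^bsub>Q\<^esub> \<longleftrightarrow> x \<in> I"
  using proj_eq_iff[of x "\<zero>\<^bsub>H\<^esub>"] quot_zero[OF I_sub] by (simp add: proj_def a_minus_def)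

lemma I_ideal: "ideal I H"
proof -
  interpret abelian_subgroup I H by (rule submodule_abelian_subgroup[OF I_sub])
  show ?thesis
    by (rule idealI[OF ring_axioms a_subgroup]) (rule I_left I_right; assumption)+
qed

lemma proj_mult: "x \<in> carrier H \<Longrightarrow> y \<in> carrier H \<Longrightarrow> proj x \<otimes>\<^bsub>Q0\<^esub> proj y = proj (x \<otimes>\<^bsub>H\<^esub> y)"
  using ideal.rcoset_mult_add[OF I_ideal] by (simp add: quot_algebra_def proj_def)

lemma proj_one: "proj \<one>\<^bsub>H\<^esub> = \<one>\<^bsub>Q0\<^esub>"
  by (simp add: quot_algebra_def proj_def)

lemma Q_ring: "ring Q"
  by (rule ring_cong[OF ideal.quotient_is_ring[OF I_ideal]]) (simp_all add: FactRing_def quot_algebra_def)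

lemma Q_add: "x \<in> carrier H \<Longrightarrow> y \<in> carrier H \<Longrightarrow> proj x \<oplus>\<^bsub>Q0\<^esub> proj y = proj (x \<oplus>\<^bsub>H\<^esub> y)"
  using lin_add[OF proj_linear] by simp

lemma Q_smult: "c \<in> carrier k \<Longrightarrow> x \<in> carrier H \<Longrightarrow> c \<odot>\<^bsub>Q0\<^esub> proj x = proj (c \<odot>\<^bsub>H\<^esub> x)"
  using lin_smult[OF proj_linear] by simp

lemma Q_assoc_algebra: "assoc_algebra k Q"
  by (intro assoc_algebra.intro vectorspace.intro assoc_algebra_axioms.intro Q_module field_axioms Q_ring)
    (auto elim!: Q_cases[unfolded Q_fields] simp: Q_smult proj_mult smult_mult_left smult_mult_right)

lemma Q_lin_mult_right [lin_intros]:
  assumes "lin V Q f" "c \<in> carrier Q0" shows "lin V Q (\<lambda>x. f x \<otimes>\<^bsub>Q0\<^esub> c)"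
proof -
  interpret A: assoc_algebra k Q by (rule Q_assoc_algebra)
  show ?thesis
    using assms A.m_closed A.l_distr A.smult_mult_left lin_closed[OF assms(1)]
    by (intro linI) (simp_all add: lin_add[OF assms(1)] lin_smult[OF assms(1)])
qed

lemma Q_lin_mult_left [lin_intros]:
  assumes "lin V Q f" "c \<in> carrier Q0" shows "lin V Q (\<lambda>x. c \<otimes>\<^bsub>Q0\<^esub> f x)"
proof -
  interpret A: assoc_algebra k Q by (rule Q_assoc_algebra)
  show ?thesis
    using assms A.m_closed A.r_distr A.smult_mult_right lin_closed[OF assms(1)]
    by (intro linI) (simp_all add: lin_add[OF assms(1)] lin_smult[OF assms(1)])
qed

abbreviation QQ where "QQ \<equiv> tensor_module k Q Q"
abbreviation (input) TQ where "TQ \<equiv> tens k Q Q"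

lemma bilin_proj:
  assumes b: "bilin Q Q M \<beta>" shows "bilin H H M (\<lambda>u v. \<beta> (proj u) (proj v))"
  by (rule bilinI; rule lin_comp[OF bilinD1[OF b] proj_linear] lin_comp[OF bilinD2[OF b] proj_linear]) simp_all

lemma bTQ: "bilin H H QQ (\<lambda>u v. TQ (proj u) (proj v))"
  by (rule bilin_proj) (simp add: tens_bilin)

lemma Q_counit: "x \<in> carrier H \<Longrightarrow> counit Q (proj x) = counit H x"
  unfolding proj_def quot_hopf_def module.extend_def
  using rcos_lin_zero[OF C_module scalar_module_module I_sub counit_functional] I_counit by simp

lemma Q_antipode: "x \<in> carrier H \<Longrightarrow> antipode Q (proj x) = proj (antipode H x)"
  using rcos_lin_zero[OF C_module Q_module I_sub proj_lin[OF antipode_linear], of x]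
    I_antipode proj_zero_iff IH antipode_closed
  unfolding proj_def[symmetric] by (simp add: quot_hopf_def module.extend_def proj_def)

lemma Q_comult: "x \<in> carrier H \<Longrightarrow> comult Q (proj x) = sw QQ (\<lambda>u v. TQ (proj u) (proj v)) x"
proof -
  assume x: "x \<in> carrier H"
  let ?f = "\<lambda>x. sw QQ (\<lambda>u v. TQ (proj u) (proj v)) x"
  have f: "tensor_map k Q0 Q0 (\<lambda>y. I +>\<^bsub>H\<^esub> y) (\<lambda>y. I +>\<^bsub>H\<^esub> y) (comult H x) = ?f x" for x
    unfolding tensor_map_eq sweedler_def proj_def Q_tensor by (rule refl)
  have "comult Q (proj x) = the_elem (?f ` (I +>\<^bsub>H\<^esub> x))"
    unfolding f[symmetric] by (subst quot_hopf_def) (simp add: module.extend_def proj_def)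
  also have "\<dots> = ?f x"
    by (rule rcos_lin_zero[OF C_module _ I_sub sw_lin[OF _ bTQ] _ x])
      (use I_comult[unfolded Q_tensor] in \<open>simp_all add: proj_def\<close>)
  finally show ?thesis .
qed

sublocale Q: comult_space k Q
proof (intro comult_space.intro comult_space_axioms.intro field_axioms Q_module linI)
  note l = sw_lin[OF tensor_module_module[OF Q_module Q_module] bTQ]
  fix X assume "X \<in> carrier Q"
  then obtain x where x: "x \<in> carrier H" "X = proj x" by (rule Q_cases)
  show "comult Q X \<in> carrier QQ" using x lin_closed[OF l] by (simp add: Q_comult)
  show "comult Q (c \<odot>\<^bsub>Q\<^esub> X) = c \<odot>\<^bsub>QQ\<^esub> comult Q X" if "c \<in> carrier k" for c
    using x that by (simp add: Q_smult Q_comult lin_smult[OF l])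
  fix Y assume "Y \<in> carrier Q"
  then obtain y where "y \<in> carrier H" "Y = proj y" by (rule Q_cases)
  with x show "comult Q (X \<oplus>\<^bsub>Q\<^esub> Y) = comult Q X \<oplus>\<^bsub>QQ\<^esub> comult Q Y"
    by (simp add: Q_add Q_comult lin_add[OF l])
qed

text \<open>Sweedler sums in the quotient are computed on representatives, so the Hopf axioms
  descend from \<open>H\<close>.\<close>

lemma Q_sw:
  assumes M: "module k M" and b: "bilin Q Q M \<beta>" and x: "x \<in> carrier H"
  shows "Q.sw M \<beta> (proj x) = sw M (\<lambda>u v. \<beta> (proj u) (proj v)) x"
  unfolding sweedler_def[of _ Q]
  by (simp add: Q_comult[OF x], unfold sweedler_def)
    (rule tensor_lift_comp[of Q Q H H M proj proj], use M b x proj_linear in auto)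

lemma Q_mult:
  assumes [simp]: "x \<in> carrier H" "y \<in> carrier H"
  shows "Q.sw QQ TQ (proj x \<otimes>\<^bsub>Q0\<^esub> proj y) =
    Q.sw QQ (\<lambda>a b. Q.sw QQ (\<lambda>u v. TQ (a \<otimes>\<^bsub>Q0\<^esub> u) (b \<otimes>\<^bsub>Q0\<^esub> v)) (proj y)) (proj x)"
proof -
  interpret A: assoc_algebra k Q by (rule Q_assoc_algebra)
  note [simp] = A.m_closed[simplified]
  have "Q.sw QQ TQ (proj x \<otimes>\<^bsub>Q0\<^esub> proj y) = sw QQ (\<lambda>u v. TQ (proj u) (proj v)) (x \<otimes>\<^bsub>H\<^esub> y)"
    by (simp add: proj_mult Q_sw tens_bilin)
  also have "\<dots> = sw QQ (\<lambda>a b. sw QQ (\<lambda>u v. TQ (proj (a \<otimes>\<^bsub>H\<^esub> u)) (proj (b \<otimes>\<^bsub>H\<^esub> v))) y) x"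
    by (rule sw_mult[OF _ bTQ]) simp_all
  also have "\<dots> = sw QQ (\<lambda>a b. Q.sw QQ (\<lambda>u v. TQ (proj a \<otimes>\<^bsub>Q0\<^esub> u) (proj b \<otimes>\<^bsub>Q0\<^esub> v)) (proj y)) x"
  proof (rule sw_cong, simp_all, (auto intro!: bilinI lin_intros)[1])
    fix a b assume [simp]: "a \<in> carrier H" "b \<in> carrier H"
    have "Q.sw QQ (\<lambda>u v. TQ (proj a \<otimes>\<^bsub>Q0\<^esub> u) (proj b \<otimes>\<^bsub>Q0\<^esub> v)) (proj y)
      = sw QQ (\<lambda>u v. TQ (proj a \<otimes>\<^bsub>Q0\<^esub> proj u) (proj b \<otimes>\<^bsub>Q0\<^esub> proj v)) y"
      by (rule Q_sw) (auto intro!: bilinI lin_intros)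
    also have "\<dots> = sw QQ (\<lambda>u v. TQ (proj (a \<otimes>\<^bsub>H\<^esub> u)) (proj (b \<otimes>\<^bsub>H\<^esub> v))) y"
      by (rule sw_cong) (auto intro!: bilinI lin_intros simp: proj_mult)
    finally show "sw QQ (\<lambda>u v. TQ (proj (a \<otimes>\<^bsub>H\<^esub> u)) (proj (b \<otimes>\<^bsub>H\<^esub> v))) y
      = Q.sw QQ (\<lambda>u v. TQ (proj a \<otimes>\<^bsub>Q0\<^esub> u) (proj b \<otimes>\<^bsub>Q0\<^esub> v)) (proj y)" by simp
  qed
  also have "\<dots> = Q.sw QQ (\<lambda>a b. Q.sw QQ (\<lambda>u v. TQ (a \<otimes>\<^bsub>Q0\<^esub> u) (b \<otimes>\<^bsub>Q0\<^esub> v)) (proj y)) (proj x)"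
    by (rule Q_sw[symmetric]) (auto intro!: bilinI lin_intros)
  finally show ?thesis .
qed

lemma Q_coassoc:
  assumes [simp]: "x \<in> carrier H"
  shows "Q.sw Q.CCC (\<lambda>a b. Q.sw Q.CCC (\<lambda>a1 a2. tens k Q QQ a1 (TQ a2 b)) a) (proj x)
    = Q.sw Q.CCC (\<lambda>a b. Q.sw Q.CCC (\<lambda>b1 b2. tens k Q QQ a (TQ b1 b2)) b) (proj x)"
proof -
  let ?T = "\<lambda>a b c. tens k Q QQ (proj a) (TQ (proj b) (proj c))"
  have "Q.sw Q.CCC (\<lambda>a b. Q.sw Q.CCC (\<lambda>a1 a2. tens k Q QQ a1 (TQ a2 b)) a) (proj x)
    = sw Q.CCC (\<lambda>a b. Q.sw Q.CCC (\<lambda>a1 a2. tens k Q QQ a1 (TQ a2 (proj b))) (proj a)) x"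
    by (rule Q_sw) (auto intro!: bilinI lin_intros)
  also have "\<dots> = sw Q.CCC (\<lambda>a b. sw Q.CCC (\<lambda>a1 a2. ?T a1 a2 b) a) x"
    by (rule sw_cong, simp_all, (auto intro!: bilinI lin_intros)[1], rule Q_sw)
      (auto intro!: bilinI lin_intros)
  also have "\<dots> = sw Q.CCC (\<lambda>a b. sw Q.CCC (\<lambda>b1 b2. ?T a b1 b2) b) x"
    by (rule sw_coassoc) (auto intro!: lin_intros)
  also have "\<dots> = sw Q.CCC (\<lambda>a b. Q.sw Q.CCC (\<lambda>b1 b2. tens k Q QQ (proj a) (TQ b1 b2)) (proj b)) x"
    by (rule sw_cong, simp_all, (auto intro!: bilinI lin_intros)[1], rule Q_sw[symmetric])
      (auto intro!: bilinI lin_intros)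
  also have "\<dots> = Q.sw Q.CCC (\<lambda>a b. Q.sw Q.CCC (\<lambda>b1 b2. tens k Q QQ a (TQ b1 b2)) b) (proj x)"
    by (rule Q_sw[symmetric]) (auto intro!: bilinI lin_intros)
  finally show ?thesis .
qed

lemma Q_counit_lin: "functional Q (counit Q)"
  by (rule linI) (auto elim!: Q_cases[unfolded Q_fields] simp: Q_add Q_smult Q_counit
      lin_add[OF counit_functional] lin_smult[OF counit_functional])

lemma Q_antipode_lin: "lin Q Q (antipode Q)"
  by (rule linI) (auto elim!: Q_cases[unfolded Q_fields] simp: Q_add Q_smult Q_antipode
      lin_add[OF antipode_linear] lin_smult[OF antipode_linear])

lemma Q_hopf_algebra: "hopf_algebra k Q"
proof (rule Q.hopf_algebraI[OF Q_assoc_algebra])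
  interpret A: assoc_algebra k Q by (rule Q_assoc_algebra)
  note [simp] = A.m_closed[simplified] and [lin_intros] = lin_comp[OF Q_counit_lin] lin_comp[OF Q_antipode_lin]
  have [simp]: "counit Q X \<in> carrier k" if "X \<in> carrier Q0" for X
    using lin_closed[OF Q_counit_lin] that by simp
  have [simp]: "antipode Q X \<in> carrier Q0" if "X \<in> carrier Q0" for X
    using lin_closed[OF Q_antipode_lin] that by simp
  have l1: "lin Q Q (\<lambda>x. c \<odot>\<^bsub>Q0\<^esub> x)" if "c \<in> carrier k" for c
    using lin_const_smult[OF Q_module that lin_id] by simp
  have l2: "lin Q Q (\<lambda>x. counit Q x \<odot>\<^bsub>Q0\<^esub> w)" if "w \<in> carrier Q0" for w
    using lin_smult_vec[OF Q_module _ Q_counit_lin, of w] that by simp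
  show "comult Q \<one>\<^bsub>Q\<^esub> = TQ \<one>\<^bsub>Q\<^esub> \<one>\<^bsub>Q\<^esub>"
    using Q_comult[of "\<one>\<^bsub>H\<^esub>"] sw_one[OF _ bTQ] by (simp add: proj_one)
  show "counit Q \<in> ring_hom Q k"
    by (rule ring_hom_memI) (auto elim!: Q_cases[unfolded Q_fields] simp: Q_add Q_counit proj_mult proj_one[symmetric]
      lin_add[OF counit_functional])
  show "counit Q (c \<odot>\<^bsub>Q\<^esub> X) = c \<otimes>\<^bsub>k\<^esub> counit Q X" if "c \<in> carrier k" "X \<in> carrier Q" for c X
    using lin_smult[OF Q_counit_lin] that by simp
  show "antipode Q \<in> module_hom k Q Q" by (rule Q_antipode_lin)
  show "Q.sw QQ TQ (X \<otimes>\<^bsub>Q\<^esub> Y) = Q.sw QQ (\<lambda>a b. Q.sw QQ (\<lambda>u v. TQ (a \<otimes>\<^bsub>Q\<^esub> u) (b \<otimes>\<^bsub>Q\<^esub> v)) Y) X"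
    if "X \<in> carrier Q" "Y \<in> carrier Q" for X Y
    using that Q_mult by (auto elim!: Q_cases[unfolded Q_fields])
  fix X assume "X \<in> carrier Q"
  then obtain x where [simp]: "x \<in> carrier H" and X: "X = proj x" by (rule Q_cases)
  show "Q.sw Q.CCC (\<lambda>a b. Q.sw Q.CCC (\<lambda>a1 a2. tens k Q QQ a1 (TQ a2 b)) a) X
    = Q.sw Q.CCC (\<lambda>a b. Q.sw Q.CCC (\<lambda>b1 b2. tens k Q QQ a (TQ b1 b2)) b) X"
    unfolding X by (rule Q_coassoc) simp
  have "Q.sw Q (\<lambda>a b. counit Q a \<odot>\<^bsub>Q0\<^esub> b) (proj x) = sw Q (\<lambda>a b. counit Q (proj a) \<odot>\<^bsub>Q0\<^esub> proj b) x"
    by (rule Q_sw) (auto intro!: bilinI l1 l2)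
  also have "\<dots> = sw Q (\<lambda>a b. counit H a \<odot>\<^bsub>Q\<^esub> proj b) x"
    by (rule sw_cong) (auto intro!: bilinI lin_comp[OF l1 proj_linear] lin_comp[OF l2 proj_linear] simp: Q_counit)
  also have "\<dots> = proj x" by (rule sw_counit_left) (auto intro!: proj_linear)
  finally show "Q.sw Q (\<lambda>a b. counit Q a \<odot>\<^bsub>Q\<^esub> b) X = X" using X by simp
  have "Q.sw Q (\<lambda>a b. counit Q b \<odot>\<^bsub>Q0\<^esub> a) (proj x) = sw Q (\<lambda>a b. counit Q (proj b) \<odot>\<^bsub>Q0\<^esub> proj a) x"
    by (rule Q_sw) (auto intro!: bilinI l1 l2)
  also have "\<dots> = sw Q (\<lambda>a b. counit H b \<odot>\<^bsub>Q\<^esub> proj a) x"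
    by (rule sw_cong) (auto intro!: bilinI lin_comp[OF l1 proj_linear] lin_comp[OF l2 proj_linear] simp: Q_counit)
  also have "\<dots> = proj x" by (rule sw_counit_right) (auto intro!: proj_linear)
  finally show "Q.sw Q (\<lambda>a b. counit Q b \<odot>\<^bsub>Q\<^esub> a) X = X" using X by simp
  have "Q.sw Q (\<lambda>a b. antipode Q a \<otimes>\<^bsub>Q0\<^esub> b) (proj x) = sw Q (\<lambda>a b. antipode Q (proj a) \<otimes>\<^bsub>Q0\<^esub> proj b) x"
    by (rule Q_sw) (auto intro!: bilinI lin_intros)
  also have "\<dots> = sw Q (\<lambda>a b. proj (antipode H a \<otimes>\<^bsub>H\<^esub> b)) x"
    by (rule sw_cong) (auto intro!: bilinI lin_intros simp: Q_antipode proj_mult)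
  also have "\<dots> = counit H x \<odot>\<^bsub>Q\<^esub> proj \<one>\<^bsub>H\<^esub>" by (rule sw_antipode_left) (auto intro!: proj_linear)
  finally show "Q.sw Q (\<lambda>a b. antipode Q a \<otimes>\<^bsub>Q\<^esub> b) X = counit Q X \<odot>\<^bsub>Q\<^esub> \<one>\<^bsub>Q\<^esub>"
    using X by (simp add: Q_counit proj_one)
  have "Q.sw Q (\<lambda>a b. a \<otimes>\<^bsub>Q0\<^esub> antipode Q b) (proj x) = sw Q (\<lambda>a b. proj a \<otimes>\<^bsub>Q0\<^esub> antipode Q (proj b)) x"
    by (rule Q_sw) (auto intro!: bilinI lin_intros)
  also have "\<dots> = sw Q (\<lambda>a b. proj (a \<otimes>\<^bsub>H\<^esub> antipode H b)) x"
    by (rule sw_cong) (auto intro!: bilinI lin_intros simp: Q_antipode proj_mult)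
  also have "\<dots> = counit H x \<odot>\<^bsub>Q\<^esub> proj \<one>\<^bsub>H\<^esub>" by (rule sw_antipode_right) (auto intro!: proj_linear)
  finally show "Q.sw Q (\<lambda>a b. a \<otimes>\<^bsub>Q\<^esub> antipode Q b) X = counit Q X \<odot>\<^bsub>Q\<^esub> \<one>\<^bsub>Q\<^esub>"
    using X by (simp add: Q_counit proj_one)
qed

end

section \<open>The quotient by a normal Hopf subalgebra\<close>

context fd_hopf_algebra
begin

lemma hopf_subalgebra_carrier: "hopf_subalgebra k H (carrier H)"
proof (rule hopf_subalgebraI)
  fix x g assume "x \<in> carrier H" and g: "functional H g"
  note [lin_intros] = lin_comp[OF g] and [simp] = lin_closed[OF g, simplified]
  show "sw H (\<lambda>u v. g v \<odot>\<^bsub>H\<^esub> u) x \<in> carrier H" "sw H (\<lambda>u v. g u \<odot>\<^bsub>H\<^esub> v) x \<in> carrier H"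
    using \<open>x \<in> carrier H\<close> by (auto intro!: sw_closed bilinI lin_intros)
qed auto

text \<open>The counit turns both adjoint actions into multiplication by the counit of
  \<open>h\<close>, so they preserve augmentation ideals.\<close>

lemma counit_ad:
  assumes [simp]: "h \<in> carrier H" "a \<in> carrier H"
  shows "counit H (adl h a) = counit H h \<otimes>\<^bsub>k\<^esub> counit H a" "counit H (adr h a) = counit H h \<otimes>\<^bsub>k\<^esub> counit H a"
proof -
  have *: "sw K1 (\<lambda>x y. counit H x \<odot>\<^bsub>K1\<^esub> (counit H a \<otimes>\<^bsub>k\<^esub> counit H y)) h = counit H a \<otimes>\<^bsub>k\<^esub> counit H h"
    by (rule sw_counit_left) (auto intro!: lin_intros)
  have "counit H (adl h a) = sw K1 (\<lambda>x y. counit H (x \<otimes>\<^bsub>H\<^esub> a \<otimes>\<^bsub>H\<^esub> antipode H y)) h"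
    unfolding adl_def by (rule sw_hom) (auto intro!: bilinI lin_intros)
  also have "\<dots> = sw K1 (\<lambda>x y. counit H x \<odot>\<^bsub>K1\<^esub> (counit H a \<otimes>\<^bsub>k\<^esub> counit H y)) h"
    by (rule sw_cong) (auto intro!: bilinI lin_intros simp: R.m_assoc)
  finally show "counit H (adl h a) = counit H h \<otimes>\<^bsub>k\<^esub> counit H a" using * by (simp add: R.m_comm)
  have "counit H (adr h a) = sw K1 (\<lambda>x y. counit H (antipode H x \<otimes>\<^bsub>H\<^esub> a \<otimes>\<^bsub>H\<^esub> y)) h"
    unfolding adr_def by (rule sw_hom) (auto intro!: bilinI lin_intros)
  also have "\<dots> = sw K1 (\<lambda>x y. counit H x \<odot>\<^bsub>K1\<^esub> (counit H a \<otimes>\<^bsub>k\<^esub> counit H y)) h"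
    by (rule sw_cong) (auto intro!: bilinI lin_intros simp: R.m_assoc)
  finally show "counit H (adr h a) = counit H h \<otimes>\<^bsub>k\<^esub> counit H a" using * by (simp add: R.m_comm)
qed

text \<open>The augmentation of \<open>M\<close> is itself stable under \<open>D\<close>, so its
  elements can be moved past \<open>D\<close>; this makes \<open>H M^+\<close> a two-sided
  ideal.\<close>

lemma augmentation_commute:
  assumes M: "hopf_subalgebra k H M" and D: "hopf_subalgebra k H D" and nm: "normalizes D M"
  shows "span_prod k H (augmentation k H M) D = span_prod k H D (augmentation k H M)"
proof -
  let ?X = "augmentation k H M"
  note DH = hopf_subalgebra_D(3)[OF D] and MH = hopf_subalgebra_D(3)[OF M]
  have XM: "?X \<subseteq> M" and XH: "?X \<subseteq> carrier H" using MH by (auto simp: augmentation_def)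
  have a: "adl d x \<in> ?X \<and> adr d x \<in> ?X" if "d \<in> D" "x \<in> ?X" for d x
    using that nm DH MH counit_ad[of d x] by (auto simp: augmentation_def normalizes_def subset_iff)
  note c = normalizes_commute[OF M D nm XM a]
  show ?thesis
    using span_prod_subset[OF span_prod_closed(1)[OF DH XH], of ?X D]
      span_prod_subset[OF span_prod_closed(1)[OF XH DH], of D ?X] c by blast
qed

text \<open>The element is \<open>z (v - \<epsilon>(v) 1)\<close>: modulo \<open>H M^+\<close>,
  right multiplication by \<open>M\<close> acts through the counit.\<close>

lemma mult_aug_mem:
  assumes M: "hopf_subalgebra k H M" and z: "z \<in> carrier H" and v: "v \<in> M"
  shows "z \<otimes>\<^bsub>H\<^esub> v \<ominus>\<^bsub>H\<^esub> counit H v \<odot>\<^bsub>H\<^esub> z \<in> span_prod k H (carrier H) (augmentation k H M)"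
proof -
  note MD = hopf_subalgebra_D[OF M]
  have XH: "augmentation k H M \<subseteq> carrier H" using MD by (auto simp: augmentation_def)
  have [simp]: "z \<in> carrier H" "v \<in> carrier H" using z v MD by auto
  interpret MA: abelian_subgroup M H by (rule submodule_abelian_subgroup[OF MD(2)])
  interpret K1: module k K1 by simp
  have "v \<ominus>\<^bsub>H\<^esub> counit H v \<odot>\<^bsub>H\<^esub> \<one>\<^bsub>H\<^esub> \<in> M"
    using v MD(5,8) by (intro submodule_minus_closed[OF MD(2)]) auto
  moreover have "counit H (v \<ominus>\<^bsub>H\<^esub> counit H v \<odot>\<^bsub>H\<^esub> \<one>\<^bsub>H\<^esub>) = \<zero>\<^bsub>k\<^esub>"
  proof -
    have "counit H v \<ominus>\<^bsub>K1\<^esub> counit H v = \<zero>\<^bsub>K1\<^esub>" by (subst K1.minus_other_side) auto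
    then show ?thesis
      using lin_minus[OF C_module scalar_module_module counit_functional, of v "counit H v \<odot>\<^bsub>H\<^esub> \<one>\<^bsub>H\<^esub>"]
      by (simp add: counit_linear)
  qed
  ultimately have "z \<otimes>\<^bsub>H\<^esub> (v \<ominus>\<^bsub>H\<^esub> counit H v \<odot>\<^bsub>H\<^esub> \<one>\<^bsub>H\<^esub>) \<in> span_prod k H (carrier H) (augmentation k H M)"
    by (intro span_prod_closed(3)[OF subset_refl XH]) (auto simp: augmentation_def)
  moreover have "z \<otimes>\<^bsub>H\<^esub> (v \<ominus>\<^bsub>H\<^esub> counit H v \<odot>\<^bsub>H\<^esub> \<one>\<^bsub>H\<^esub>) = z \<otimes>\<^bsub>H\<^esub> v \<ominus>\<^bsub>H\<^esub> counit H v \<odot>\<^bsub>H\<^esub> z"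
    by (subst lin_minus[OF C_module C_module lin_mult_left[OF lin_id]]) (auto simp: smult_mult_right)
  ultimately show ?thesis by simp
qed

text \<open>For the coideal condition, the legs of \<open>y\<close> lie in \<open>M\<close> and act
  on the quotient by their counits, so \<open>(\<pi> \<otimes> \<pi>) (\<Delta>(x y))\<close> is
  \<open>\<epsilon>(y)\<close> times the value at \<open>x\<close>, hence zero for \<open>y\<close>
  in \<open>M^+\<close>.\<close>

lemma normal_hopf_quotient:
  assumes M: "hopf_subalgebra k H M" and nm: "normalizes (carrier H) M"
  shows "hopf_quotient k H (span_prod k H (carrier H) (augmentation k H M))"
proof (intro hopf_quotient.intro hopf_quotient_axioms.intro hopf_algebra_axioms)
  let ?X = "augmentation k H M"
  let ?I = "span_prod k H (carrier H) ?X"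
  note MD = hopf_subalgebra_D[OF M]
  have XM: "?X \<subseteq> M" and XH: "?X \<subseteq> carrier H" using MD by (auto simp: augmentation_def)
  have X0: "x \<in> carrier H" "counit H x = \<zero>\<^bsub>k\<^esub>" if "x \<in> ?X" for x using that XH by (auto simp: augmentation_def)
  note IC = span_prod_closed[OF subset_refl XH]
  have com: "span_prod k H ?X (carrier H) = ?I"
    by (rule augmentation_commute[OF M hopf_subalgebra_carrier nm])
  show sm: "LinearCombinations.submodule k ?I H" by (rule IC(1))
  have IH: "i \<in> carrier H" if "i \<in> ?I" for i using IC that by auto
  have xh: "x \<otimes>\<^bsub>H\<^esub> h \<in> ?I" if "x \<in> ?X" "h \<in> carrier H" for x h
    using span_prod_closed(3)[OF XH subset_refl that] com by simp
  show left: "h \<otimes>\<^bsub>H\<^esub> i \<in> ?I" if "h \<in> carrier H" "i \<in> ?I" for h i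
  proof (rule span_prod_lin_mem[OF _ IC(1) subset_refl XH _ that(2)])
    fix x y assume "x \<in> carrier H" "y \<in> ?X"
    then show "h \<otimes>\<^bsub>H\<^esub> (x \<otimes>\<^bsub>H\<^esub> y) \<in> ?I"
      using IC(3)[of "h \<otimes>\<^bsub>H\<^esub> x" y] that X0 by (simp add: m_assoc)
  qed (use that in \<open>auto intro!: lin_intros\<close>)
  show "i \<otimes>\<^bsub>H\<^esub> h \<in> ?I" if "h \<in> carrier H" "i \<in> ?I" for h i
  proof (rule span_prod_lin_mem[OF _ IC(1) subset_refl XH _ that(2)])
    fix x y assume "x \<in> carrier H" "y \<in> ?X"
    then show "(x \<otimes>\<^bsub>H\<^esub> y) \<otimes>\<^bsub>H\<^esub> h \<in> ?I"
      using left[OF _ xh[OF _ that(1)], of x y] that X0 by (simp add: m_assoc)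
  qed (use that in \<open>auto intro!: lin_intros\<close>)
  show "antipode H i \<in> ?I" if "i \<in> ?I" for i
  proof (rule span_prod_lin_mem[OF _ IC(1) subset_refl XH _ that])
    fix x y assume xy: "x \<in> carrier H" "y \<in> ?X"
    then have "antipode H y \<in> ?X" using MD by (auto simp: augmentation_def subset_iff)
    then show "antipode H (x \<otimes>\<^bsub>H\<^esub> y) \<in> ?I"
      using xh[of "antipode H y" "antipode H x"] xy X0 by (simp add: antipode_mult)
  qed (auto intro!: lin_intros)
  have ker: "F i = \<zero>\<^bsub>W\<^esub>" if W: "module k W" and F: "lin H W F" and i: "i \<in> ?I"
    and 0: "\<And>x y. x \<in> carrier H \<Longrightarrow> y \<in> ?X \<Longrightarrow> F (x \<otimes>\<^bsub>H\<^esub> y) = \<zero>\<^bsub>W\<^esub>"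
  for F i and W :: "('a, 'w, 'z) module_scheme"
    using span_prod_subset[OF submodule_kernel[OF C_module W F], of "carrier H" ?X] 0 i X0 by auto
  show "counit H i = \<zero>\<^bsub>k\<^esub>" if "i \<in> ?I" for i
    using ker[OF scalar_module_module counit_functional that] X0 by simp
  let ?Q = "quot_algebra H ?I"
  let ?p = "\<lambda>x. ?I +>\<^bsub>H\<^esub> x"
  have p: "lin H ?Q ?p" by (rule quot_proj_hom[OF sm])
  have Q: "module k ?Q" by (rule quot_module[OF sm])
  note [simp] = Q lin_closed[OF p] and [lin_intros] = lin_comp[OF p]
  show "sw (tensor_module k ?Q ?Q) (\<lambda>u v. tens k ?Q ?Q (?p u) (?p v)) i = \<zero>\<^bsub>tensor_module k ?Q ?Q\<^esub>"
    if i: "i \<in> ?I" for i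
  proof (rule ker[of "tensor_module k ?Q ?Q" "\<lambda>i. sw (tensor_module k ?Q ?Q) (\<lambda>u v. tens k ?Q ?Q (?p u) (?p v)) i", OF _ _ i])
    interpret TQ: module k "tensor_module k ?Q ?Q" using Q by simp
    let ?T = "tensor_module k ?Q ?Q"
    note [simp] = TQ.module_axioms
    fix x y assume xy: "x \<in> carrier H" "y \<in> ?X"
    have [simp]: "x \<in> carrier H" "y \<in> carrier H" and yM: "y \<in> M" using xy X0 XM by auto
    have pp: "?p (z \<otimes>\<^bsub>H\<^esub> v) = counit H v \<odot>\<^bsub>?Q\<^esub> ?p z" if z: "z \<in> carrier H" and v: "v \<in> M" for z v
    proof -
      have [simp]: "z \<in> carrier H" "v \<in> carrier H" using z v MD by auto
      have "?p (z \<otimes>\<^bsub>H\<^esub> v) = ?p (counit H v \<odot>\<^bsub>H\<^esub> z)"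
        using mult_aug_mem[OF M z v] by (subst rcos_eq_iff[OF sm]) auto
      then show ?thesis by (simp add: lin_smult[OF p])
    qed
    have "sw ?T (\<lambda>u v. tens k ?Q ?Q (?p u) (?p v)) (x \<otimes>\<^bsub>H\<^esub> y)
      = sw ?T (\<lambda>a b. sw ?T (\<lambda>u v. tens k ?Q ?Q (?p (a \<otimes>\<^bsub>H\<^esub> u)) (?p (b \<otimes>\<^bsub>H\<^esub> v))) y) x"
      by (rule sw_mult) (auto intro!: bilinI lin_intros)
    also have "\<dots> = sw ?T (\<lambda>a b. \<zero>\<^bsub>k\<^esub> \<odot>\<^bsub>?T\<^esub> tens k ?Q ?Q (?p a) (?p b)) x"
    proof (rule sw_cong, simp_all, (auto intro!: bilinI lin_intros)[1])
      fix a b assume [simp]: "a \<in> carrier H" "b \<in> carrier H"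
      have "sw ?T (\<lambda>u v. tens k ?Q ?Q (?p (a \<otimes>\<^bsub>H\<^esub> u)) (?p (b \<otimes>\<^bsub>H\<^esub> v))) y
        = sw ?T (\<lambda>u v. counit H u \<odot>\<^bsub>?T\<^esub> (counit H v \<odot>\<^bsub>?T\<^esub> tens k ?Q ?Q (?p a) (?p b))) y"
      proof (rule sw_cong_sub[OF M yM])
        fix u v assume uv: "u \<in> M" "v \<in> M"
        then have [simp]: "u \<in> carrier H" "v \<in> carrier H" using MD(3) by auto
        have "tens k ?Q ?Q (?p (a \<otimes>\<^bsub>H\<^esub> u)) (?p (b \<otimes>\<^bsub>H\<^esub> v))
          = tens k ?Q ?Q (counit H u \<odot>\<^bsub>?Q\<^esub> ?p a) (counit H v \<odot>\<^bsub>?Q\<^esub> ?p b)"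
          using uv by (simp add: pp)
        also have "\<dots> = counit H u \<odot>\<^bsub>?T\<^esub> tens k ?Q ?Q (?p a) (counit H v \<odot>\<^bsub>?Q\<^esub> ?p b)"
          by (rule lin_smult[OF bilinD2[OF tens_bilin[OF Q Q]]]) (simp_all add: Module.module.smult_closed[OF Q])
        also have "tens k ?Q ?Q (?p a) (counit H v \<odot>\<^bsub>?Q\<^esub> ?p b) = counit H v \<odot>\<^bsub>?T\<^esub> tens k ?Q ?Q (?p a) (?p b)"
          by (rule lin_smult[OF bilinD1[OF tens_bilin[OF Q Q]]]) simp_all
        finally show "tens k ?Q ?Q (?p (a \<otimes>\<^bsub>H\<^esub> u)) (?p (b \<otimes>\<^bsub>H\<^esub> v))
          = counit H u \<odot>\<^bsub>?T\<^esub> (counit H v \<odot>\<^bsub>?T\<^esub> tens k ?Q ?Q (?p a) (?p b))" .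
      qed (auto intro!: bilinI lin_intros)
      also have "\<dots> = counit H y \<odot>\<^bsub>?T\<^esub> tens k ?Q ?Q (?p a) (?p b)"
        by (rule sw_counit_left) (auto intro!: lin_intros)
      finally show "sw ?T (\<lambda>u v. tens k ?Q ?Q (?p (a \<otimes>\<^bsub>H\<^esub> u)) (?p (b \<otimes>\<^bsub>H\<^esub> v))) y = \<zero>\<^bsub>?T\<^esub>"
        using X0[OF xy(2)] by simp
    qed
    also have "\<dots> = \<zero>\<^bsub>k\<^esub> \<odot>\<^bsub>?T\<^esub> sw ?T (\<lambda>a b. tens k ?Q ?Q (?p a) (?p b)) x"
      by (rule sw_hom[symmetric]) (auto intro!: bilinI lin_intros)
    also have "\<dots> = \<zero>\<^bsub>?T\<^esub>" by (intro TQ.lmult_0 sw_closed) (auto intro!: bilinI lin_intros)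
    finally show "sw ?T (\<lambda>u v. tens k ?Q ?Q (?p u) (?p v)) (x \<otimes>\<^bsub>H\<^esub> y) = \<zero>\<^bsub>?T\<^esub>" .
  qed (auto intro!: bilinI lin_intros)
qed

end

lemma (in hopf_quotient) Q_fd:
  assumes "fd_hopf_algebra k H" shows "fd_hopf_algebra k Q"
proof -
  interpret S: hopf_algebra k Q by (rule Q_hopf_algebra)
  have "linear_map k H Q proj"
    by (intro linear_map.intro vectorspace.intro field_axioms mod_hom.intro
        mod_hom_axioms.intro C_module Q_module proj_linear)
  moreover have "proj ` carrier H = carrier Q"
    by (auto elim!: Q_cases[unfolded Q_fields])
  ultimately have "vectorspace.fin_dim k Q"
    using linear_map.rank_nullity_main(2) fd_hopf_algebra.fin_dim[OF assms] by blast
  then show ?thesis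
    by (intro fd_hopf_algebra.intro fd_hopf_algebra_axioms.intro Q_hopf_algebra)
qed

section \<open>Coinvariants and the modular law\<close>

context fd_hopf_algebra
begin

text \<open>The antipode axiom for the inverse \<open>T\<close> of the antipode, with the legs in
  opposite order.\<close>

lemma inverse_antipode:
  assumes T: "lin H H T" and ST: "\<And>x. x \<in> carrier H \<Longrightarrow> antipode H (T x) = x"
    and TS: "\<And>x. x \<in> carrier H \<Longrightarrow> T (antipode H x) = x"
    and F: "lin H H F" and [simp]: "y \<in> carrier H"
  shows "sw H (\<lambda>p r. F (r \<otimes>\<^bsub>H\<^esub> T p)) y = counit H y \<odot>\<^bsub>H\<^esub> F \<one>\<^bsub>H\<^esub>"
proof -
  note [simp] = lin_closed[OF T] ST and [lin_intros] = lin_comp[OF T]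
  have "T (antipode H (r \<otimes>\<^bsub>H\<^esub> T p)) = r \<otimes>\<^bsub>H\<^esub> T p" if "r \<in> carrier H" "p \<in> carrier H" for r p
    using that by (simp add: TS)
  then have "sw H (\<lambda>p r. F (r \<otimes>\<^bsub>H\<^esub> T p)) y = sw H (\<lambda>p r. F (T (p \<otimes>\<^bsub>H\<^esub> antipode H r))) y"
    by (intro sw_cong) (auto intro!: bilinI lin_intros lin_comp[OF F] simp: antipode_mult)
  also have "\<dots> = counit H y \<odot>\<^bsub>H\<^esub> F (T \<one>\<^bsub>H\<^esub>)"
    by (rule sw_antipode_right) (auto intro!: lin_intros lin_comp[OF F])
  finally show ?thesis using TS[of "\<one>\<^bsub>H\<^esub>"] by simp
qed

text \<open>A Frobenius pair of \<open>M\<close> as a Hopf algebra, with the functional extended to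
  \<open>H\<close> so that all sums can be formed there.\<close>

lemma sub_frobenius:
  assumes M: "hopf_subalgebra k H M"
  obtains L g where "L \<in> M" "functional H g" "sw H (\<lambda>x y. g y \<odot>\<^bsub>H\<^esub> x) L = \<one>\<^bsub>H\<^esub>"
    "\<And>m. m \<in> M \<Longrightarrow> L \<otimes>\<^bsub>H\<^esub> m = counit H m \<odot>\<^bsub>H\<^esub> L"
proof -
  let ?M = "sub_hopf k H M"
  interpret S: fd_hopf_algebra k ?M by (rule sub_hopf_is_fd[OF M])
  obtain L where L: "S.right_integral L" "L \<noteq> \<zero>\<^bsub>?M\<^esub>" by (rule S.right_integral_exists)
  obtain g where g: "functional ?M g" and g1: "S.sw ?M (\<lambda>x y. g y \<odot>\<^bsub>?M\<^esub> x) L = \<one>\<^bsub>?M\<^esub>"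
    by (rule S.frobenius_functional[OF L])
  obtain g' where g': "functional H g'" "\<And>x. x \<in> M \<Longrightarrow> g' x = g x" using functional_extend[OF M g] by blast
  have LM: "L \<in> M" using S.right_integralD(1)[OF L(1)] by simp
  have b: "bilin ?M ?M ?M (\<lambda>x y. g y \<odot>\<^bsub>?M\<^esub> x)"
    by (rule bilinI; rule lin_const_smult[OF S.C_module] lin_smult_vec[OF S.C_module])
      (use g lin_closed[OF g] in \<open>auto intro!: lin_id\<close>)
  have b': "bilin H H H (\<lambda>x y. g' y \<odot>\<^bsub>H\<^esub> x)"
    using lin_closed[OF g'(1)] by (auto intro!: bilinI lin_intros lin_comp[OF g'(1)])
  have "S.sw ?M (\<lambda>x y. g y \<odot>\<^bsub>?M\<^esub> x) L = S.sw ?M (\<lambda>x y. g' y \<odot>\<^bsub>H\<^esub> x) L"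
    by (rule S.sw_cong[OF S.C_module _ b]) (use LM g' in auto)
  also have "\<dots> = sw H (\<lambda>x y. g' y \<odot>\<^bsub>H\<^esub> x) L"
    by (rule sw_sub_hopf_incl[OF M b' _ LM], rule bilin_cong[OF b]) (use g' in auto)
  finally have "sw H (\<lambda>x y. g' y \<odot>\<^bsub>H\<^esub> x) L = \<one>\<^bsub>H\<^esub>" using g1 by simp
  then show ?thesis
    using that[OF LM g'(1)] S.right_integralD(2)[OF L(1)] by simp
qed

text \<open>A product \<open>d m\<close> is congruent to \<open>\<epsilon>(m) d\<close>, and
  \<open>H\<close> is spanned by such products.\<close>

lemma representative_mod_aug:
  assumes M: "hopf_subalgebra k H M" and D: "hopf_subalgebra k H D"
    and DM: "span_prod k H D M = carrier H" and h: "h \<in> carrier H"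
  obtains d where "d \<in> D" "h \<ominus>\<^bsub>H\<^esub> d \<in> span_prod k H (carrier H) (augmentation k H M)"
proof -
  let ?I = "span_prod k H (carrier H) (augmentation k H M)"
  note MD = hopf_subalgebra_D[OF M] and DD = hopf_subalgebra_D[OF D]
  have XH: "augmentation k H M \<subseteq> carrier H" using MD by (auto simp: augmentation_def)
  note IC = span_prod_closed[OF subset_refl XH]
  interpret I: LinearCombinations.submodule k ?I H by (rule IC(1))
  have [simp]: "d \<in> carrier H" if "d \<in> D" for d using that DD by auto
  let ?U = "{h \<in> carrier H. \<exists>d\<in>D. h \<ominus>\<^bsub>H\<^esub> d \<in> ?I}"
  have "LinearCombinations.submodule k ?U H"
  proof (intro LinearCombinations.submodule.intro C_module)
    show "\<zero>\<^bsub>H\<^esub> \<in> ?U" using DD(4) I.zero_closed by (auto intro!: bexI[of _ "\<zero>\<^bsub>H\<^esub>"] simp: a_minus_def)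
    fix v assume "v \<in> ?U"
    then obtain d where d: "v \<in> carrier H" "d \<in> D" "v \<ominus>\<^bsub>H\<^esub> d \<in> ?I" by auto
    show "c \<odot>\<^bsub>H\<^esub> v \<in> ?U" if "c \<in> carrier k" for c
    proof -
      have "c \<odot>\<^bsub>H\<^esub> v \<ominus>\<^bsub>H\<^esub> c \<odot>\<^bsub>H\<^esub> d = c \<odot>\<^bsub>H\<^esub> (v \<ominus>\<^bsub>H\<^esub> d)"
        using that d by (simp add: a_minus_def smult_r_distr smult_r_minus)
      then show ?thesis using that d DD(8) I.smult_closed by (auto intro!: bexI[of _ "c \<odot>\<^bsub>H\<^esub> d"])
    qed
    fix w assume "w \<in> ?U"
    then obtain e where e: "w \<in> carrier H" "e \<in> D" "w \<ominus>\<^bsub>H\<^esub> e \<in> ?I" by auto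
    have "(v \<oplus>\<^bsub>H\<^esub> w) \<ominus>\<^bsub>H\<^esub> (d \<oplus>\<^bsub>H\<^esub> e) = (v \<ominus>\<^bsub>H\<^esub> d) \<oplus>\<^bsub>H\<^esub> (w \<ominus>\<^bsub>H\<^esub> e)"
      using d e by (simp add: a_minus_def minus_add a_ac)
    then show "v \<oplus>\<^bsub>H\<^esub> w \<in> ?U" using d e DD(6) I.m_closed by (auto intro!: bexI[of _ "d \<oplus>\<^bsub>H\<^esub> e"])
  qed auto
  moreover have "x \<otimes>\<^bsub>H\<^esub> y \<in> ?U" if "x \<in> D" "y \<in> M" for x y
    using that mult_aug_mem[OF M _ that(2), of x] MD(3) DD(8)[of "counit H y" x]
    by (auto intro!: bexI[of _ "counit H y \<odot>\<^bsub>H\<^esub> x"])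
  ultimately have "span_prod k H D M \<subseteq> ?U" by (rule span_prod_subset)
  with h DM that show ?thesis by auto
qed

text \<open>After rewriting \<open>D M^+\<close> as \<open>M^+ D\<close>, the integral meets the
  factor from \<open>M^+\<close> first.\<close>

lemma integral_kills_augmentation:
  assumes M: "hopf_subalgebra k H M" and D: "hopf_subalgebra k H D" and nm: "normalizes D M"
    and L: "L \<in> M" "\<And>m. m \<in> M \<Longrightarrow> L \<otimes>\<^bsub>H\<^esub> m = counit H m \<odot>\<^bsub>H\<^esub> L"
    and i: "i \<in> span_prod k H D (augmentation k H M)"
  shows "L \<otimes>\<^bsub>H\<^esub> i = \<zero>\<^bsub>H\<^esub>"
proof -
  note MH = hopf_subalgebra_D(3)[OF M] and DH = hopf_subalgebra_D(3)[OF D]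
  have [simp]: "L \<in> carrier H" using L MH by auto
  have XH: "augmentation k H M \<subseteq> carrier H" using MH by (auto simp: augmentation_def)
  have i': "i \<in> span_prod k H (augmentation k H M) D" using i augmentation_commute[OF M D nm] by simp
  have "L \<otimes>\<^bsub>H\<^esub> i \<in> {\<zero>\<^bsub>H\<^esub>}"
  proof (rule span_prod_lin_mem[OF _ zero_submodule[OF C_module] XH DH _ i'])
    fix x y assume xy: "x \<in> augmentation k H M" "y \<in> D"
    then have [simp]: "x \<in> carrier H" "y \<in> carrier H" and x: "x \<in> M" "counit H x = \<zero>\<^bsub>k\<^esub>"
      using XH DH by (auto simp: augmentation_def)
    have "L \<otimes>\<^bsub>H\<^esub> (x \<otimes>\<^bsub>H\<^esub> y) = (L \<otimes>\<^bsub>H\<^esub> x) \<otimes>\<^bsub>H\<^esub> y" by (simp add: m_assoc)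
    also have "\<dots> = \<zero>\<^bsub>H\<^esub>" using L(2)[OF x(1)] x(2) by simp
    finally show "L \<otimes>\<^bsub>H\<^esub> (x \<otimes>\<^bsub>H\<^esub> y) \<in> {\<zero>\<^bsub>H\<^esub>}" by simp
  qed (auto intro!: lin_intros)
  then show ?thesis by simp
qed

text \<open>Elements that are coinvariant for \<open>H \<rightarrow> H/HM\<^sup>+\<close> lie in \<open>M\<close>: with a right integral \<open>L\<close> of \<open>M\<close>,
  coinvariance gives \<open>S\<^sup>-\<^sup>1(u) = \<Sum> g(L\<^sub>(\<^sub>2\<^sub>) u) L\<^sub>(\<^sub>1\<^sub>)\<close>.\<close>

lemma coinvariant_mem:
  assumes M: "hopf_subalgebra k H M" and LM: "L \<in> M" and g: "functional H g"
    and g1: "sw H (\<lambda>x y. g y \<odot>\<^bsub>H\<^esub> x) L = \<one>\<^bsub>H\<^esub>" and [simp]: "u \<in> carrier H"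
    and coinv: "\<And>\<beta>. bilin H H H \<beta> \<Longrightarrow> sw H (\<lambda>a b. \<beta> a (L \<otimes>\<^bsub>H\<^esub> b)) u = \<beta> u L"
  shows "u \<in> M"
proof -
  note MD = hopf_subalgebra_D[OF M]
  obtain L' g' T where T: "lin H H T"
    and ST: "\<And>x. x \<in> carrier H \<Longrightarrow> antipode H (T x) = x"
    and TS: "\<And>x. x \<in> carrier H \<Longrightarrow> T (antipode H x) = x"
    by (rule frobenius_data) blast
  have [simp]: "L \<in> carrier H" using LM MD by auto
  note [lin_intros] = lin_comp[OF g] lin_comp[OF T] and [simp] = lin_closed[OF g, simplified] lin_closed[OF T]
  \<comment> \<open>The test form \<open>g(z_2) z_1 T(a)\<close>: at \<open>(u, L)\<close> it gives
    \<open>T(u)\<close>, while along \<open>(u_1, L u_2)\<close> the factor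
    \<open>u_2 T(u_1)\<close> cancels and only legs of \<open>L\<close> remain.\<close>
  define \<beta> where "\<beta> a z = sw H (\<lambda>p q. g q \<odot>\<^bsub>H\<^esub> (p \<otimes>\<^bsub>H\<^esub> T a)) z" for a z
  have b: "bilin H H H \<beta>" unfolding \<beta>_def by (auto intro!: bilinI lin_intros)
  have "\<beta> u L = sw H (\<lambda>p q. (g q \<odot>\<^bsub>H\<^esub> p) \<otimes>\<^bsub>H\<^esub> T u) L"
    unfolding \<beta>_def by (rule sw_cong) (auto intro!: bilinI lin_intros simp: smult_mult_left)
  also have "\<dots> = \<one>\<^bsub>H\<^esub> \<otimes>\<^bsub>H\<^esub> T u"
    unfolding g1[symmetric] by (rule sw_hom[symmetric]) (auto intro!: bilinI lin_intros)
  finally have 1: "\<beta> u L = T u" by simp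
  have "sw H (\<lambda>a b. \<beta> a (L \<otimes>\<^bsub>H\<^esub> b)) u
    = sw H (\<lambda>a b. sw H (\<lambda>p q. sw H (\<lambda>b1 b2. g (q \<otimes>\<^bsub>H\<^esub> b2) \<odot>\<^bsub>H\<^esub> (p \<otimes>\<^bsub>H\<^esub> (b1 \<otimes>\<^bsub>H\<^esub> T a))) b) L) u"
  proof (rule sw_cong, simp_all)
    show "bilin H H H (\<lambda>a b. \<beta> a (L \<otimes>\<^bsub>H\<^esub> b))" unfolding \<beta>_def by (auto intro!: bilinI lin_intros)
    fix a b assume [simp]: "a \<in> carrier H" "b \<in> carrier H"
    have "\<beta> a (L \<otimes>\<^bsub>H\<^esub> b) = sw H (\<lambda>p q. sw H (\<lambda>b1 b2. g (q \<otimes>\<^bsub>H\<^esub> b2) \<odot>\<^bsub>H\<^esub> (p \<otimes>\<^bsub>H\<^esub> b1 \<otimes>\<^bsub>H\<^esub> T a)) b) L"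
      unfolding \<beta>_def by (rule sw_mult) (auto intro!: bilinI lin_intros)
    also have "\<dots> = sw H (\<lambda>p q. sw H (\<lambda>b1 b2. g (q \<otimes>\<^bsub>H\<^esub> b2) \<odot>\<^bsub>H\<^esub> (p \<otimes>\<^bsub>H\<^esub> (b1 \<otimes>\<^bsub>H\<^esub> T a))) b) L"
      by (rule sw_cong, simp_all, (auto intro!: bilinI lin_intros)[1], rule sw_cong)
        (auto intro!: bilinI lin_intros simp: m_assoc)
    finally show "\<beta> a (L \<otimes>\<^bsub>H\<^esub> b) = sw H (\<lambda>p q. sw H (\<lambda>b1 b2. g (q \<otimes>\<^bsub>H\<^esub> b2) \<odot>\<^bsub>H\<^esub> (p \<otimes>\<^bsub>H\<^esub> (b1 \<otimes>\<^bsub>H\<^esub> T a))) b) L" .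
  qed
  also have "\<dots> = sw H (\<lambda>p q. sw H (\<lambda>a b. sw H (\<lambda>b1 b2. g (q \<otimes>\<^bsub>H\<^esub> b2) \<odot>\<^bsub>H\<^esub> (p \<otimes>\<^bsub>H\<^esub> (b1 \<otimes>\<^bsub>H\<^esub> T a))) b) u) L"
    by (rule sw_swap) (auto intro!: bilinI lin_intros)
  also have "\<dots> = sw H (\<lambda>p q. g (q \<otimes>\<^bsub>H\<^esub> u) \<odot>\<^bsub>H\<^esub> p) L"
  proof (rule sw_cong, simp_all, (auto intro!: bilinI lin_intros)[1])
    fix p q assume [simp]: "p \<in> carrier H" "q \<in> carrier H"
    have "sw H (\<lambda>a b. sw H (\<lambda>b1 b2. g (q \<otimes>\<^bsub>H\<^esub> b2) \<odot>\<^bsub>H\<^esub> (p \<otimes>\<^bsub>H\<^esub> (b1 \<otimes>\<^bsub>H\<^esub> T a))) b) u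
      = sw H (\<lambda>b b2. sw H (\<lambda>a b1. g (q \<otimes>\<^bsub>H\<^esub> b2) \<odot>\<^bsub>H\<^esub> (p \<otimes>\<^bsub>H\<^esub> (b1 \<otimes>\<^bsub>H\<^esub> T a))) b) u"
      by (rule sw_coassoc[symmetric]) (auto intro!: lin_intros)
    also have "\<dots> = sw H (\<lambda>b b2. counit H b \<odot>\<^bsub>H\<^esub> (g (q \<otimes>\<^bsub>H\<^esub> b2) \<odot>\<^bsub>H\<^esub> (p \<otimes>\<^bsub>H\<^esub> \<one>\<^bsub>H\<^esub>))) u"
      by (rule sw_cong, simp_all del: r_one, (auto intro!: bilinI lin_intros simp del: r_one)[1], rule inverse_antipode[OF T ST TS])
        (auto intro!: lin_intros)
    also have "\<dots> = g (q \<otimes>\<^bsub>H\<^esub> u) \<odot>\<^bsub>H\<^esub> (p \<otimes>\<^bsub>H\<^esub> \<one>\<^bsub>H\<^esub>)"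
      by (rule sw_counit_left) (auto intro!: lin_intros)
    finally show "sw H (\<lambda>a b. sw H (\<lambda>b1 b2. g (q \<otimes>\<^bsub>H\<^esub> b2) \<odot>\<^bsub>H\<^esub> (p \<otimes>\<^bsub>H\<^esub> (b1 \<otimes>\<^bsub>H\<^esub> T a))) b) u = g (q \<otimes>\<^bsub>H\<^esub> u) \<odot>\<^bsub>H\<^esub> p"
      by simp
  qed
  finally have "T u = sw H (\<lambda>p q. g (q \<otimes>\<^bsub>H\<^esub> u) \<odot>\<^bsub>H\<^esub> p) L" using 1 coinv[OF b] by simp
  also have "\<dots> \<in> M"
    by (rule sw_mem[OF M LM C_module _ MD(2)]) (use MD in \<open>auto intro!: bilinI lin_intros\<close>)
  \<comment> \<open>So \<open>T(u)\<close> lies in \<open>M\<close>, and applying the antipode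
    returns to \<open>u\<close>.\<close>
  finally have "antipode H (T u) \<in> M" by (rule MD(9))
  then show ?thesis using ST by simp
qed

text \<open>With \<open>E(x) = \<Sum> x\<^sub>(\<^sub>1\<^sub>) \<lambda>(\<pi>(x\<^sub>(\<^sub>2\<^sub>)))\<close> for an integral \<open>\<lambda>\<close> on the quotient and a lift \<open>t\<close> of its
  dual integral, every \<open>d\<close> equals \<open>\<Sum> S(t\<^sub>(\<^sub>1\<^sub>)) E(t\<^sub>(\<^sub>2\<^sub>) d)\<close>, and \<open>E\<close> takes values in \<open>D \<inter> M\<close>.\<close>

lemma kernel_restricted:
  assumes M: "hopf_subalgebra k H M" and nm: "normalizes (carrier H) M"
    and D: "hopf_subalgebra k H D" and DM: "span_prod k H D M = carrier H"
    and d: "d \<in> D" "d \<in> span_prod k H (carrier H) (augmentation k H M)"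
  shows "d \<in> span_prod k H D (augmentation k H (D \<inter> M))"
proof -
  let ?I = "span_prod k H (carrier H) (augmentation k H M)"
  let ?S = "antipode H"
  interpret Qt: hopf_quotient k H ?I by (rule normal_hopf_quotient[OF M nm])
  interpret Qf: fd_hopf_algebra k Qt.Q by (rule Qt.Q_fd[OF fd_hopf_algebra_axioms])
  note MD = hopf_subalgebra_D[OF M] and DD = hopf_subalgebra_D[OF D]
  have [simp]: "d \<in> carrier H" using d DD by auto
  obtain LQ gQ TQ where LQ: "Qf.right_integral LQ" and gQ: "functional Qt.Q gQ"
    and gQ2: "\<And>y. y \<in> carrier Qt.Q \<Longrightarrow> Qt.Q.sw Qt.Q (\<lambda>p q. gQ q \<odot>\<^bsub>Qt.Q\<^esub> p) y = gQ y \<odot>\<^bsub>Qt.Q\<^esub> \<one>\<^bsub>Qt.Q\<^esub>"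
    and gQ3: "\<And>q. q \<in> carrier Qt.Q \<Longrightarrow> gQ (LQ \<otimes>\<^bsub>Qt.Q\<^esub> q) = counit Qt.Q q"
    by (rule Qf.frobenius_data) blast
  have "LQ \<in> carrier Qt.Q" by (rule Qf.right_integralD(1)[OF LQ])
  then obtain t0 where t0: "t0 \<in> carrier H" "LQ = Qt.proj t0" by (rule Qt.Q_cases)
  \<comment> \<open>Here \<open>P = DM\<close> is used (with \<open>P\<close> the whole of
    \<open>H\<close>): the integral of the quotient has a representative in
    \<open>D\<close>.\<close>
  obtain t where t: "t \<in> D" "t0 \<ominus>\<^bsub>H\<^esub> t \<in> ?I" by (rule representative_mod_aug[OF M D DM t0(1)])
  have [simp]: "t \<in> carrier H" using t DD by auto
  have LQt: "LQ = Qt.proj t" using t t0 Qt.proj_eq_iff by simp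
  define \<mu> where "\<mu> x = gQ (Qt.proj x)" for x
  have \<mu>: "functional H \<mu>" unfolding \<mu>_def[abs_def] by (rule lin_comp[OF gQ Qt.proj_linear])
  note [lin_intros] = lin_comp[OF \<mu>] and [simp] = lin_closed[OF \<mu>, simplified]
  have \<mu>I: "\<mu> i = \<zero>\<^bsub>k\<^esub>" if "i \<in> ?I" for i
    using iffD2[OF Qt.proj_zero_iff[OF Qt.IH[OF that]] that] lin_zero[OF Qt.Q_module scalar_module_module gQ]
    by (simp add: \<mu>_def)
  have \<mu>t: "\<mu> (t \<otimes>\<^bsub>H\<^esub> q) = counit H q" if "q \<in> carrier H" for q
    using gQ3[of "Qt.proj q"] that by (simp add: \<mu>_def LQt Qt.proj_mult Qt.Q_counit)
  define E where "E x = sw H (\<lambda>u v. \<mu> v \<odot>\<^bsub>H\<^esub> u) x" for x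
  have El: "lin H H E" unfolding E_def[abs_def] by (auto intro!: bilinI lin_intros)
  note [lin_intros] = lin_comp[OF El] and [simp] = lin_closed[OF El]
  have ED: "E x \<in> D" if "x \<in> D" for x unfolding E_def by (rule hopf_subalgebra_slices(1)[OF D that \<mu>])
  \<comment> \<open>The functional \<open>gQ\<close> is an integral on the quotient, so the class of
    \<open>E y\<close> is a multiple of the unit.\<close>
  have E_inv: "E y \<ominus>\<^bsub>H\<^esub> \<mu> y \<odot>\<^bsub>H\<^esub> \<one>\<^bsub>H\<^esub> \<in> ?I" if [simp]: "y \<in> carrier H" for y
  proof -
    have b: "bilin Qt.Q Qt.Q Qt.Q (\<lambda>p q. gQ q \<odot>\<^bsub>Qt.Q\<^esub> p)"
      by (rule bilinI; rule lin_const_smult[OF Qt.Q_module] lin_smult_vec[OF Qt.Q_module])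
        (use gQ lin_closed[OF gQ] in \<open>auto intro!: lin_id\<close>)
    have "Qt.proj (E y) = sw Qt.Q (\<lambda>u v. Qt.proj (\<mu> v \<odot>\<^bsub>H\<^esub> u)) y"
      unfolding E_def by (rule sw_hom) (auto intro!: bilinI lin_intros Qt.proj_linear)
    also have "\<dots> = sw Qt.Q (\<lambda>u v. gQ (Qt.proj v) \<odot>\<^bsub>Qt.Q\<^esub> Qt.proj u) y"
      by (rule sw_cong) (auto intro!: bilinI lin_intros Qt.proj_lin simp: \<mu>_def[symmetric] Qt.Q_smult)
    also have "\<dots> = Qt.Q.sw Qt.Q (\<lambda>p q. gQ q \<odot>\<^bsub>Qt.Q\<^esub> p) (Qt.proj y)"
      by (rule Qt.Q_sw[symmetric, OF Qt.Q_module b]) simp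
    also have "\<dots> = \<mu> y \<odot>\<^bsub>Qt.Q\<^esub> \<one>\<^bsub>Qt.Q\<^esub>" using gQ2[of "Qt.proj y"] by (simp add: \<mu>_def)
    also have "\<dots> = Qt.proj (\<mu> y \<odot>\<^bsub>H\<^esub> \<one>\<^bsub>H\<^esub>)" by (simp add: Qt.proj_one[symmetric] Qt.Q_smult)
    finally show ?thesis by (subst Qt.proj_eq_iff[symmetric]) auto
  qed
  obtain L g where L: "L \<in> M" "functional H g" "sw H (\<lambda>x y. g y \<odot>\<^bsub>H\<^esub> x) L = \<one>\<^bsub>H\<^esub>"
    "\<And>m. m \<in> M \<Longrightarrow> L \<otimes>\<^bsub>H\<^esub> m = counit H m \<odot>\<^bsub>H\<^esub> L"
    by (rule sub_frobenius[OF M]) blast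
  have [simp]: "L \<in> carrier H" using L MD by auto
  \<comment> \<open>The integral \<open>L\<close> of \<open>M\<close> kills \<open>H M^+\<close>, so
    \<open>E_inv\<close> becomes an equation in \<open>H\<close> itself.\<close>
  have LE: "L \<otimes>\<^bsub>H\<^esub> E y = \<mu> y \<odot>\<^bsub>H\<^esub> L" if [simp]: "y \<in> carrier H" for y
  proof -
    have "L \<otimes>\<^bsub>H\<^esub> (E y \<ominus>\<^bsub>H\<^esub> \<mu> y \<odot>\<^bsub>H\<^esub> \<one>\<^bsub>H\<^esub>) = \<zero>\<^bsub>H\<^esub>"
      by (rule integral_kills_augmentation[OF M hopf_subalgebra_carrier nm L(1,4) E_inv]) simp_all
    moreover have "L \<otimes>\<^bsub>H\<^esub> (E y \<ominus>\<^bsub>H\<^esub> \<mu> y \<odot>\<^bsub>H\<^esub> \<one>\<^bsub>H\<^esub>) = L \<otimes>\<^bsub>H\<^esub> E y \<ominus>\<^bsub>H\<^esub> \<mu> y \<odot>\<^bsub>H\<^esub> L"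
      by (subst lin_minus[OF C_module C_module lin_mult_left[OF lin_id]]) (auto simp: smult_mult_right)
    ultimately show ?thesis by simp
  qed
  \<comment> \<open>Coassociativity turns \<open>\<Delta>(E x)\<close> into
    \<open>x_1 \<otimes> E(x_2)\<close>; multiplying the second leg by \<open>L\<close> and using
    \<open>LE\<close> gives the coinvariance required by \<open>coinvariant_mem\<close>.\<close>
  have EM: "E x \<in> M" if [simp]: "x \<in> carrier H" for x
  proof (rule coinvariant_mem[OF M L(1-3)])
    fix \<beta> assume b: "bilin H H H \<beta>"
    note [lin_intros] = lin_comp[OF bilinD1[OF b]] lin_comp[OF bilinD2[OF b]] and [simp] = bilin_closed[OF b]
    have "sw H (\<lambda>a b. \<beta> a (L \<otimes>\<^bsub>H\<^esub> b)) (E x) = sw H (\<lambda>p q. sw H (\<lambda>a b. \<beta> a (L \<otimes>\<^bsub>H\<^esub> b)) (\<mu> q \<odot>\<^bsub>H\<^esub> p)) x"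
      unfolding E_def by (rule sw_hom) (auto intro!: bilinI lin_intros)
    also have "\<dots> = sw H (\<lambda>p q. sw H (\<lambda>a b. \<mu> q \<odot>\<^bsub>H\<^esub> \<beta> a (L \<otimes>\<^bsub>H\<^esub> b)) p) x"
    proof (rule sw_cong, simp_all, (auto intro!: bilinI lin_intros)[1])
      fix p q assume [simp]: "p \<in> carrier H" "q \<in> carrier H"
      have l: "lin H H (\<lambda>z. sw H (\<lambda>a b. \<beta> a (L \<otimes>\<^bsub>H\<^esub> b)) z)" by (auto intro!: bilinI lin_intros)
      have "sw H (\<lambda>a b. \<beta> a (L \<otimes>\<^bsub>H\<^esub> b)) (\<mu> q \<odot>\<^bsub>H\<^esub> p) = \<mu> q \<odot>\<^bsub>H\<^esub> sw H (\<lambda>a b. \<beta> a (L \<otimes>\<^bsub>H\<^esub> b)) p"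
        by (rule lin_smult[OF l]) simp_all
      also have "\<dots> = sw H (\<lambda>a b. \<mu> q \<odot>\<^bsub>H\<^esub> \<beta> a (L \<otimes>\<^bsub>H\<^esub> b)) p"
        by (rule sw_hom) (auto intro!: bilinI lin_intros)
      finally show "sw H (\<lambda>a b. \<beta> a (L \<otimes>\<^bsub>H\<^esub> b)) (\<mu> q \<odot>\<^bsub>H\<^esub> p) = sw H (\<lambda>a b. \<mu> q \<odot>\<^bsub>H\<^esub> \<beta> a (L \<otimes>\<^bsub>H\<^esub> b)) p" .
    qed
    also have "\<dots> = sw H (\<lambda>a y. sw H (\<lambda>b q. \<mu> q \<odot>\<^bsub>H\<^esub> \<beta> a (L \<otimes>\<^bsub>H\<^esub> b)) y) x"
      by (rule sw_coassoc) (auto intro!: lin_intros)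
    also have "\<dots> = sw H (\<lambda>a y. \<beta> (\<mu> y \<odot>\<^bsub>H\<^esub> a) L) x"
    proof (rule sw_cong, simp_all, (auto intro!: bilinI lin_intros)[1])
      fix a y assume [simp]: "a \<in> carrier H" "y \<in> carrier H"
      have l: "lin H H (\<lambda>z. \<beta> a (L \<otimes>\<^bsub>H\<^esub> z))" by (auto intro!: lin_intros)
      have "sw H (\<lambda>b q. \<mu> q \<odot>\<^bsub>H\<^esub> \<beta> a (L \<otimes>\<^bsub>H\<^esub> b)) y = sw H (\<lambda>b q. \<beta> a (L \<otimes>\<^bsub>H\<^esub> (\<mu> q \<odot>\<^bsub>H\<^esub> b))) y"
        by (rule sw_cong) (auto intro!: bilinI lin_intros simp: lin_smult[OF l])
      also have "\<dots> = \<beta> a (L \<otimes>\<^bsub>H\<^esub> E y)"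
        unfolding E_def by (rule sw_hom[symmetric]) (auto intro!: bilinI lin_intros l)
      also have "\<dots> = \<beta> (\<mu> y \<odot>\<^bsub>H\<^esub> a) L"
        by (simp add: LE lin_smult[OF bilinD1[OF b]] lin_smult[OF bilinD2[OF b]])
      finally show "sw H (\<lambda>b q. \<mu> q \<odot>\<^bsub>H\<^esub> \<beta> a (L \<otimes>\<^bsub>H\<^esub> b)) y = \<beta> (\<mu> y \<odot>\<^bsub>H\<^esub> a) L" .
    qed
    also have "\<dots> = \<beta> (E x) L"
      unfolding E_def by (rule sw_hom[symmetric, where F = "\<lambda>z. \<beta> z L"]) (auto intro!: bilinI lin_intros)
    finally show "sw H (\<lambda>a b. \<beta> a (L \<otimes>\<^bsub>H\<^esub> b)) (E x) = \<beta> (E x) L" .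
  qed simp
  have eps_E: "counit H (E z) = \<mu> z" if [simp]: "z \<in> carrier H" for z
  proof -
    have "counit H (E z) = sw K1 (\<lambda>u v. counit H (\<mu> v \<odot>\<^bsub>H\<^esub> u)) z"
      unfolding E_def by (rule sw_hom) (auto intro!: bilinI lin_intros)
    also have "\<dots> = sw K1 (\<lambda>u v. counit H u \<odot>\<^bsub>K1\<^esub> \<mu> v) z"
      by (rule sw_cong) (auto intro!: bilinI lin_intros simp: counit_linear R.m_comm)
    also have "\<dots> = \<mu> z" by (rule sw_counit_left) (auto intro!: \<mu>)
    finally show ?thesis .
  qed
  \<comment> \<open>Expanded, the sum is \<open>S(t_1) t_2 d_1 \<mu>(t_3 d_2)\<close>. The first two
    factors cancel, and \<open>\<mu>(t q)\<close> is the counit of \<open>q\<close>, so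
    \<open>d\<close> remains.\<close>
  have "sw H (\<lambda>x y. ?S x \<otimes>\<^bsub>H\<^esub> E (y \<otimes>\<^bsub>H\<^esub> d)) t
    = sw H (\<lambda>x y. sw H (\<lambda>a b. sw H (\<lambda>p q. \<mu> (b \<otimes>\<^bsub>H\<^esub> q) \<odot>\<^bsub>H\<^esub> (?S x \<otimes>\<^bsub>H\<^esub> a \<otimes>\<^bsub>H\<^esub> p)) d) y) t"
  proof (rule sw_cong, simp_all, (auto intro!: bilinI lin_intros)[1])
    fix x y assume [simp]: "x \<in> carrier H" "y \<in> carrier H"
    have "?S x \<otimes>\<^bsub>H\<^esub> E (y \<otimes>\<^bsub>H\<^esub> d) = sw H (\<lambda>u v. ?S x \<otimes>\<^bsub>H\<^esub> (\<mu> v \<odot>\<^bsub>H\<^esub> u)) (y \<otimes>\<^bsub>H\<^esub> d)"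
      unfolding E_def by (rule sw_hom) (auto intro!: bilinI lin_intros)
    also have "\<dots> = sw H (\<lambda>a b. sw H (\<lambda>p q. ?S x \<otimes>\<^bsub>H\<^esub> (\<mu> (b \<otimes>\<^bsub>H\<^esub> q) \<odot>\<^bsub>H\<^esub> (a \<otimes>\<^bsub>H\<^esub> p))) d) y"
      by (rule sw_mult) (auto intro!: bilinI lin_intros)
    also have "\<dots> = sw H (\<lambda>a b. sw H (\<lambda>p q. \<mu> (b \<otimes>\<^bsub>H\<^esub> q) \<odot>\<^bsub>H\<^esub> (?S x \<otimes>\<^bsub>H\<^esub> a \<otimes>\<^bsub>H\<^esub> p)) d) y"
      by (rule sw_cong, simp_all, (auto intro!: bilinI lin_intros)[1], rule sw_cong)
        (auto intro!: bilinI lin_intros simp: m_assoc smult_mult_right)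
    finally show "?S x \<otimes>\<^bsub>H\<^esub> E (y \<otimes>\<^bsub>H\<^esub> d) = sw H (\<lambda>a b. sw H (\<lambda>p q. \<mu> (b \<otimes>\<^bsub>H\<^esub> q) \<odot>\<^bsub>H\<^esub> (?S x \<otimes>\<^bsub>H\<^esub> a \<otimes>\<^bsub>H\<^esub> p)) d) y" .
  qed
  also have "\<dots> = sw H (\<lambda>y b. sw H (\<lambda>x a. sw H (\<lambda>p q. \<mu> (b \<otimes>\<^bsub>H\<^esub> q) \<odot>\<^bsub>H\<^esub> (?S x \<otimes>\<^bsub>H\<^esub> a \<otimes>\<^bsub>H\<^esub> p)) d) y) t"
    by (rule sw_coassoc[symmetric]) (auto intro!: bilinI lin_intros)
  also have "\<dots> = sw H (\<lambda>y b. counit H y \<odot>\<^bsub>H\<^esub> sw H (\<lambda>p q. \<mu> (b \<otimes>\<^bsub>H\<^esub> q) \<odot>\<^bsub>H\<^esub> (\<one>\<^bsub>H\<^esub> \<otimes>\<^bsub>H\<^esub> p)) d) t"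
    by (rule sw_cong, simp_all del: l_one, (auto intro!: bilinI lin_intros simp del: l_one)[1],
        rule sw_antipode_left[where F = "\<lambda>w. sw H (\<lambda>p q. \<mu> (_ \<otimes>\<^bsub>H\<^esub> q) \<odot>\<^bsub>H\<^esub> (w \<otimes>\<^bsub>H\<^esub> p)) d"])
      (auto intro!: bilinI lin_intros)
  also have "\<dots> = sw H (\<lambda>p q. \<mu> (t \<otimes>\<^bsub>H\<^esub> q) \<odot>\<^bsub>H\<^esub> (\<one>\<^bsub>H\<^esub> \<otimes>\<^bsub>H\<^esub> p)) d"
    by (rule sw_counit_left) (auto intro!: bilinI lin_intros)
  also have "\<dots> = sw H (\<lambda>p q. counit H q \<odot>\<^bsub>H\<^esub> p) d"
    by (rule sw_cong) (auto intro!: bilinI lin_intros simp: \<mu>t)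
  also have "\<dots> = d" by (rule sw_counit_right) (auto intro!: lin_intros)
  finally have eq: "sw H (\<lambda>x y. ?S x \<otimes>\<^bsub>H\<^esub> E (y \<otimes>\<^bsub>H\<^esub> d)) t = d" .
  have XH: "augmentation k H (D \<inter> M) \<subseteq> carrier H" using MD by (auto simp: augmentation_def)
  have "sw H (\<lambda>x y. ?S x \<otimes>\<^bsub>H\<^esub> E (y \<otimes>\<^bsub>H\<^esub> d)) t \<in> span_prod k H D (augmentation k H (D \<inter> M))"
  proof (rule sw_mem[OF D t(1) C_module _ span_prod_closed(1)[OF DD(3) XH]])
    fix x y assume xy: "x \<in> D" "y \<in> D"
    then have [simp]: "y \<in> carrier H" using DD by auto
    \<comment> \<open>The counit of \<open>E (y d)\<close> is \<open>\<mu> (y d)\<close>, which is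
      zero because \<open>y d\<close> stays in the ideal.\<close>
    have "E (y \<otimes>\<^bsub>H\<^esub> d) \<in> augmentation k H (D \<inter> M)"
      using ED[OF DD(7)[OF xy(2) d(1)]] EM[of "y \<otimes>\<^bsub>H\<^esub> d"] \<mu>I[OF Qt.I_left[OF _ d(2), of y]]
      by (simp add: augmentation_def eps_E)
    then show "?S x \<otimes>\<^bsub>H\<^esub> E (y \<otimes>\<^bsub>H\<^esub> d) \<in> span_prod k H D (augmentation k H (D \<inter> M))"
      using DD(9)[OF xy(1)] by (intro span_prod_closed(3)[OF DD(3) XH])
  qed (auto intro!: bilinI lin_intros)
  then show ?thesis using eq by simp
qed

section \<open>Transfer between a Hopf subalgebra and the ambient algebra, and the modular
  law\<close>

lemma normal_hopf_subalgebra_iff: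
  "normal_hopf_subalgebra k H K \<longleftrightarrow> hopf_subalgebra k H K \<and> normalizes (carrier H) K"
  by (auto simp: normal_hopf_subalgebra_def normalizes_def adl_def adr_def sweedler_def)

lemma submodule_sub_hopf:
  assumes L: "hopf_subalgebra k H L"
  shows "LinearCombinations.submodule k U (sub_hopf k H L) \<longleftrightarrow> LinearCombinations.submodule k U H \<and> U \<subseteq> L"
proof -
  interpret S: fd_hopf_algebra k "sub_hopf k H L" by (rule sub_hopf_is_fd[OF L])
  show ?thesis
    using C_module S.C_module hopf_subalgebra_D(3)[OF L] by (auto simp: LinearCombinations.submodule_def)
qed

lemma span_prod_sub_hopf:
  assumes L: "hopf_subalgebra k H L" and XY: "X \<subseteq> L" "Y \<subseteq> L"
  shows "span_prod k (sub_hopf k H L) X Y = span_prod k H X Y"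
proof -
  interpret S: fd_hopf_algebra k "sub_hopf k H L" by (rule sub_hopf_is_fd[OF L])
  note D = hopf_subalgebra_D[OF L]
  have XYH: "X \<subseteq> carrier H" "Y \<subseteq> carrier H" and XYS: "X \<subseteq> carrier (sub_hopf k H L)" "Y \<subseteq> carrier (sub_hopf k H L)"
    using XY D(3) by auto
  note c = span_prod_closed[OF XYH] and Sc = S.span_prod_closed[OF XYS]
  show ?thesis
  proof
    have "span_prod k H X Y \<subseteq> L" using XY by (intro span_prod_subset D(2,7)) auto
    then show "span_prod k (sub_hopf k H L) X Y \<subseteq> span_prod k H X Y"
      using c by (intro S.span_prod_subset) (auto simp: submodule_sub_hopf[OF L])
    show "span_prod k H X Y \<subseteq> span_prod k (sub_hopf k H L) X Y"
      using Sc by (intro span_prod_subset) (auto simp: submodule_sub_hopf[OF L])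
  qed
qed

lemma span_prod_mono:
  assumes "X \<subseteq> X'" "Y \<subseteq> Y'" "X' \<subseteq> carrier H" "Y' \<subseteq> carrier H"
  shows "span_prod k H X Y \<subseteq> span_prod k H X' Y'"
  using assms by (intro span_prod_subset span_prod_closed) auto

lemma span_prod_in_hopf_subalgebra:
  assumes L: "hopf_subalgebra k H L" and "X \<subseteq> L" "Y \<subseteq> L"
  shows "span_prod k H X Y \<subseteq> L"
  using assms(2,3) by (intro span_prod_subset hopf_subalgebra_D(2,7)[OF L]) auto

lemma augmentation_sub_hopf [simp]: "augmentation k (sub_hopf k H L) M = augmentation k H M"
  by (simp add: augmentation_def)

lemma minus_sub_hopf:
  assumes L: "hopf_subalgebra k H L" and "x \<in> L" "y \<in> L"
  shows "x \<ominus>\<^bsub>sub_hopf k H L\<^esub> y = x \<ominus>\<^bsub>H\<^esub> y"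
proof -
  interpret S: fd_hopf_algebra k "sub_hopf k H L" by (rule sub_hopf_is_fd[OF L])
  show ?thesis
    by (rule lin_minus[OF S.C_module C_module sub_hopf_lin(2)[OF L lin_id]]) (use assms in auto)
qed

text \<open>The sum equals \<open>g(L_2 c_2 S(c_3)) L_1 c_1\<close>, where the last two factors
  under \<open>g\<close> cancel. It expresses \<open>c\<close> through the products
  \<open>L a\<close> with \<open>a\<close> a leg of \<open>c\<close>.\<close>

lemma integral_expansion:
  assumes [simp]: "L \<in> carrier H" "c \<in> carrier H" and g: "functional H g"
    and g1: "sw H (\<lambda>x y. g y \<odot>\<^bsub>H\<^esub> x) L = \<one>\<^bsub>H\<^esub>"
  shows "sw H (\<lambda>a b. sw H (\<lambda>x y. g (y \<otimes>\<^bsub>H\<^esub> antipode H b) \<odot>\<^bsub>H\<^esub> x) (L \<otimes>\<^bsub>H\<^esub> a)) c = c"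
proof -
  let ?S = "antipode H"
  note [lin_intros] = lin_comp[OF g] and [simp] = lin_closed[OF g, simplified]
  have "sw H (\<lambda>a b. sw H (\<lambda>x y. g (y \<otimes>\<^bsub>H\<^esub> ?S b) \<odot>\<^bsub>H\<^esub> x) (L \<otimes>\<^bsub>H\<^esub> a)) c
    = sw H (\<lambda>a b. sw H (\<lambda>p q. sw H (\<lambda>r s. g (q \<otimes>\<^bsub>H\<^esub> s \<otimes>\<^bsub>H\<^esub> ?S b) \<odot>\<^bsub>H\<^esub> (p \<otimes>\<^bsub>H\<^esub> r)) a) L) c"
    by (rule sw_cong, simp_all, (auto intro!: bilinI lin_intros)[1], rule sw_mult) (auto intro!: bilinI lin_intros)
  also have "\<dots> = sw H (\<lambda>p q. sw H (\<lambda>a b. sw H (\<lambda>r s. g (q \<otimes>\<^bsub>H\<^esub> s \<otimes>\<^bsub>H\<^esub> ?S b) \<odot>\<^bsub>H\<^esub> (p \<otimes>\<^bsub>H\<^esub> r)) a) c) L"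
    by (rule sw_swap) (auto intro!: bilinI lin_intros)
  also have "\<dots> = sw H (\<lambda>p q. (g q \<odot>\<^bsub>H\<^esub> p) \<otimes>\<^bsub>H\<^esub> c) L"
  proof (rule sw_cong, simp_all, (auto intro!: bilinI lin_intros)[1])
    fix p q assume [simp]: "p \<in> carrier H" "q \<in> carrier H"
    have "sw H (\<lambda>a b. sw H (\<lambda>r s. g (q \<otimes>\<^bsub>H\<^esub> s \<otimes>\<^bsub>H\<^esub> ?S b) \<odot>\<^bsub>H\<^esub> (p \<otimes>\<^bsub>H\<^esub> r)) a) c
      = sw H (\<lambda>r y. sw H (\<lambda>s b. g (q \<otimes>\<^bsub>H\<^esub> s \<otimes>\<^bsub>H\<^esub> ?S b) \<odot>\<^bsub>H\<^esub> (p \<otimes>\<^bsub>H\<^esub> r)) y) c"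
      by (rule sw_coassoc) (auto intro!: lin_intros)
    also have "\<dots> = sw H (\<lambda>r y. sw H (\<lambda>s b. g (q \<otimes>\<^bsub>H\<^esub> (s \<otimes>\<^bsub>H\<^esub> ?S b)) \<odot>\<^bsub>H\<^esub> (p \<otimes>\<^bsub>H\<^esub> r)) y) c"
      by (rule sw_cong, simp_all, (auto intro!: bilinI lin_intros)[1], rule sw_cong)
        (auto intro!: bilinI lin_intros simp: m_assoc)
    also have "\<dots> = sw H (\<lambda>r y. counit H y \<odot>\<^bsub>H\<^esub> (g (q \<otimes>\<^bsub>H\<^esub> \<one>\<^bsub>H\<^esub>) \<odot>\<^bsub>H\<^esub> (p \<otimes>\<^bsub>H\<^esub> r))) c"
      by (rule sw_cong, simp_all del: r_one, (auto intro!: bilinI lin_intros)[1],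
        rule sw_antipode_right[where F = "\<lambda>w. g (_ \<otimes>\<^bsub>H\<^esub> w) \<odot>\<^bsub>H\<^esub> (_ \<otimes>\<^bsub>H\<^esub> _)"])
        (auto intro!: lin_intros)
    also have "\<dots> = g (q \<otimes>\<^bsub>H\<^esub> \<one>\<^bsub>H\<^esub>) \<odot>\<^bsub>H\<^esub> (p \<otimes>\<^bsub>H\<^esub> c)"
      by (rule sw_counit_right) (auto intro!: lin_intros)
    finally show "sw H (\<lambda>a b. sw H (\<lambda>r s. g (q \<otimes>\<^bsub>H\<^esub> s \<otimes>\<^bsub>H\<^esub> ?S b) \<odot>\<^bsub>H\<^esub> (p \<otimes>\<^bsub>H\<^esub> r)) a) c = (g q \<odot>\<^bsub>H\<^esub> p) \<otimes>\<^bsub>H\<^esub> c"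
      by (simp add: smult_mult_left)
  qed
  also have "\<dots> = \<one>\<^bsub>H\<^esub> \<otimes>\<^bsub>H\<^esub> c"
    unfolding g1[symmetric] by (rule sw_hom[symmetric]) (auto intro!: bilinI lin_intros)
  finally show ?thesis by simp
qed

text \<open>The argument runs inside \<open>?X\<close>, the Hopf algebra \<open>NK\<close>: there
  \<open>N\<close> is normal and \<open>CN\<close> is everything, so
  \<open>kernel_restricted\<close> applies to \<open>C\<close>.\<close>

lemma modular_law:
  assumes N: "hopf_subalgebra k H N" and K: "hopf_subalgebra k H K" and C: "hopf_subalgebra k H C"
    and nm: "normalizes C N" and KC: "K \<subseteq> C" and CNK: "C \<subseteq> span_prod k H N K"
  shows "C \<subseteq> span_prod k H (N \<inter> C) K"
proof
  fix c assume c: "c \<in> C"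
  let ?L = "span_prod k H N K"
  let ?X = "sub_hopf k H ?L"
  let ?N0 = "C \<inter> N"
  note ND = hopf_subalgebra_D[OF N] and KD = hopf_subalgebra_D[OF K] and CD = hopf_subalgebra_D[OF C]
  have nK: "normalizes K N" by (rule normalizes_mono[OF nm KC])
  note L = span_prod_hopf_subalgebra[OF N K nK]
  have N0: "hopf_subalgebra k H ?N0" by (rule hopf_subalgebra_Int[OF C N])
  have nN0: "normalizes C ?N0"
    using nm normalizes_sub[OF C subset_refl C] by (auto simp: normalizes_def)
  have nL: "normalizes ?L N"
    by (rule prod_normalizes[OF N ND(3) KD(3) normalizes_sub[OF N subset_refl N] nK])
  interpret X: fd_hopf_algebra k ?X by (rule sub_hopf_is_fd[OF L(1)])
  have XN: "hopf_subalgebra k ?X N" "X.normalizes (carrier ?X) N"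
    using nL N L normal_sub_hopf_iff[OF L(1), of N] X.normal_hopf_subalgebra_iff[of N] by auto
  have XK: "hopf_subalgebra k ?X K" and XC: "hopf_subalgebra k ?X C"
    using K C L CNK by (simp_all add: hopf_subalgebra_sub_hopf_iff)
  have XKN: "span_prod k ?X K N = carrier ?X"
    unfolding span_prod_sub_hopf[OF L(1,3,2)] using span_prod_commute[OF N K nK] by simp
  have XCN: "span_prod k ?X C N = carrier ?X"
    using X.span_prod_mono[of K C N N] XKN X.span_prod_closed(2)[of C N] KC CNK L by auto
  obtain L g where Lg: "L \<in> ?N0" "functional H g" "sw H (\<lambda>x y. g y \<odot>\<^bsub>H\<^esub> x) L = \<one>\<^bsub>H\<^esub>"
    "\<And>m. m \<in> ?N0 \<Longrightarrow> L \<otimes>\<^bsub>H\<^esub> m = counit H m \<odot>\<^bsub>H\<^esub> L"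
    by (rule sub_frobenius[OF N0]) blast
  have [simp]: "L \<in> carrier H" using Lg CD by auto
  note [lin_intros] = lin_comp[OF Lg(2)] and [simp] = lin_closed[OF Lg(2), simplified]
  interpret CA: abelian_subgroup C H by (rule submodule_abelian_subgroup[OF CD(2)])
  \<comment> \<open>The representative \<open>\<kappa>\<close> of \<open>a\<close> modulo
    \<open>(NK) N^+\<close> lies in \<open>K \<subseteq> C\<close>, so the difference lies in
    \<open>C\<close>; the kernel formula moves it to \<open>C (C \<inter> N)^+\<close>, which
    \<open>L\<close> kills.\<close>
  have rep: "\<exists>\<kappa>\<in>K. L \<otimes>\<^bsub>H\<^esub> a = L \<otimes>\<^bsub>H\<^esub> \<kappa>" if a: "a \<in> C" for a
  proof -
    obtain \<kappa> where \<kappa>: "\<kappa> \<in> K" "a \<ominus>\<^bsub>?X\<^esub> \<kappa> \<in> span_prod k ?X (carrier ?X) (augmentation k ?X N)"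
      by (rule X.representative_mod_aug[OF XN(1) XK XKN, of a]) (use a CNK in auto)
    have aH: "a \<in> carrier H" "\<kappa> \<in> carrier H" using a \<kappa> CD KD by auto
    have eq: "a \<ominus>\<^bsub>?X\<^esub> \<kappa> = a \<ominus>\<^bsub>H\<^esub> \<kappa>"
      by (rule minus_sub_hopf[OF L(1)]) (use a \<kappa> CNK L(3) in auto)
    have "a \<ominus>\<^bsub>H\<^esub> \<kappa> \<in> C" using a \<kappa> KC by (intro submodule_minus_closed[OF CD(2)]) auto
    then have "a \<ominus>\<^bsub>H\<^esub> \<kappa> \<in> span_prod k ?X C (augmentation k ?X (C \<inter> N))"
      using \<kappa>(2) unfolding eq by (intro X.kernel_restricted[OF XN XC XCN])
    then have "a \<ominus>\<^bsub>H\<^esub> \<kappa> \<in> span_prod k H C (augmentation k H ?N0)"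
      using span_prod_sub_hopf[OF L(1) CNK, of "augmentation k H ?N0"] CNK by (auto simp: augmentation_def)
    then have "L \<otimes>\<^bsub>H\<^esub> (a \<ominus>\<^bsub>H\<^esub> \<kappa>) = \<zero>\<^bsub>H\<^esub>"
      by (intro integral_kills_augmentation[OF N0 C nN0 Lg(1)]) (auto intro: Lg(4))
    then have "L \<otimes>\<^bsub>H\<^esub> a \<ominus>\<^bsub>H\<^esub> L \<otimes>\<^bsub>H\<^esub> \<kappa> = \<zero>\<^bsub>H\<^esub>"
      using aH by (subst (asm) lin_minus[OF C_module C_module lin_mult_left[OF lin_id]]) auto
    then have "L \<otimes>\<^bsub>H\<^esub> a = L \<otimes>\<^bsub>H\<^esub> \<kappa>" using aH by simp
    then show ?thesis using \<kappa> by auto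
  qed
  have NC: "N \<inter> C \<subseteq> carrier H" using CD by auto
  note PC = span_prod_closed[OF NC KD(3)]
  interpret P: LinearCombinations.submodule k "span_prod k H (N \<inter> C) K" H by (rule PC(1))
  \<comment> \<open>The expansion of \<open>c\<close> involves \<open>a\<close> only through
    \<open>L a = L \<kappa>\<close>, and first legs of \<open>L \<kappa>\<close> are products of
    legs of \<open>L\<close> in \<open>N \<inter> C\<close> and of \<open>\<kappa>\<close> in
    \<open>K\<close>.\<close>
  have "sw H (\<lambda>a b. sw H (\<lambda>x y. g (y \<otimes>\<^bsub>H\<^esub> antipode H b) \<odot>\<^bsub>H\<^esub> x) (L \<otimes>\<^bsub>H\<^esub> a)) c \<in> span_prod k H (N \<inter> C) K"
  proof (rule sw_mem[OF C c C_module _ PC(1)])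
    fix a b assume ab: "a \<in> C" "b \<in> C"
    obtain \<kappa> where \<kappa>: "\<kappa> \<in> K" "L \<otimes>\<^bsub>H\<^esub> a = L \<otimes>\<^bsub>H\<^esub> \<kappa>" using rep[OF ab(1)] by auto
    have [simp]: "\<kappa> \<in> carrier H" "b \<in> carrier H" using \<kappa> ab KD CD by auto
    have "sw H (\<lambda>x y. g (y \<otimes>\<^bsub>H\<^esub> antipode H b) \<odot>\<^bsub>H\<^esub> x) (L \<otimes>\<^bsub>H\<^esub> \<kappa>)
      = sw H (\<lambda>p q. sw H (\<lambda>r s. g (q \<otimes>\<^bsub>H\<^esub> s \<otimes>\<^bsub>H\<^esub> antipode H b) \<odot>\<^bsub>H\<^esub> (p \<otimes>\<^bsub>H\<^esub> r)) \<kappa>) L"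
      by (rule sw_mult) (auto intro!: bilinI lin_intros)
    also have "\<dots> \<in> span_prod k H (N \<inter> C) K"
    proof (rule sw_mem[OF N0 Lg(1) C_module _ PC(1)])
      fix p q assume pq: "p \<in> ?N0" "q \<in> ?N0"
      then have [simp]: "p \<in> carrier H" "q \<in> carrier H" using CD by auto
      show "sw H (\<lambda>r s. g (q \<otimes>\<^bsub>H\<^esub> s \<otimes>\<^bsub>H\<^esub> antipode H b) \<odot>\<^bsub>H\<^esub> (p \<otimes>\<^bsub>H\<^esub> r)) \<kappa> \<in> span_prod k H (N \<inter> C) K"
      proof (rule sw_mem[OF K \<kappa>(1) C_module _ PC(1)])
        fix r s assume rs: "r \<in> K" "s \<in> K"
        then have [simp]: "r \<in> carrier H" "s \<in> carrier H" using KD by auto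
        show "g (q \<otimes>\<^bsub>H\<^esub> s \<otimes>\<^bsub>H\<^esub> antipode H b) \<odot>\<^bsub>H\<^esub> (p \<otimes>\<^bsub>H\<^esub> r) \<in> span_prod k H (N \<inter> C) K"
          using PC(3)[of p r] pq rs by (intro P.smult_closed) auto
      qed (auto intro!: bilinI lin_intros)
    qed (auto intro!: bilinI lin_intros)
    finally show "sw H (\<lambda>x y. g (y \<otimes>\<^bsub>H\<^esub> antipode H b) \<odot>\<^bsub>H\<^esub> x) (L \<otimes>\<^bsub>H\<^esub> a) \<in> span_prod k H (N \<inter> C) K"
      unfolding \<kappa>(2) .
  qed (auto intro!: bilinI lin_intros)
  then show "c \<in> span_prod k H (N \<inter> C) K"
    using integral_expansion[OF _ _ Lg(2,3), of c] c CD by auto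
qed

end

text \<open>A surjective Hopf algebra map from \<open>D\<close> to \<open>Q\<close>, given by a
  linear map on all of \<open>H\<close> so that Sweedler sums over \<open>D\<close> can be formed in
  \<open>H\<close>; only its values on \<open>D\<close> carry meaning.\<close>

locale hopf_cover = fd_hopf_algebra k H
  for k :: "('a, 'm) ring_scheme" (structure) and H :: "('a, 'b, 'n) hopf_scheme" (structure) +
  fixes D :: "'b set" and Q :: "('a, 'c, 'o) hopf_scheme" and p :: "'b \<Rightarrow> 'c"
  assumes D: "hopf_subalgebra k H D" and Q: "hopf_algebra k Q"
    and p_linear: "lin H Q p" and p_onto: "p ` D = carrier Q"
    and p_mult: "\<And>d e. d \<in> D \<Longrightarrow> e \<in> D \<Longrightarrow> p (d \<otimes>\<^bsub>H\<^esub> e) = p d \<otimes>\<^bsub>Q\<^esub> p e"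
    and p_one: "p \<one>\<^bsub>H\<^esub> = \<one>\<^bsub>Q\<^esub>"
    and p_comult: "\<And>d. d \<in> D \<Longrightarrow>
      comult Q (p d) = sw (tensor_module k Q Q) (\<lambda>u v. tens k Q Q (p u) (p v)) d"
    and p_counit: "\<And>d. d \<in> D \<Longrightarrow> counit Q (p d) = counit H d"
    and p_antipode: "\<And>d. d \<in> D \<Longrightarrow> antipode Q (p d) = p (antipode H d)"

context fd_hopf_algebra
begin

text \<open>Two quotients of \<open>D\<close> with the same kernel are identified by sending the
  class \<open>p d\<close> to \<open>p' d\<close>.\<close>

lemma hopf_cover_isomorphic:
  assumes "hopf_cover k H D Q p" "hopf_cover k H D Q' p'"
    and ker: "\<And>d. d \<in> D \<Longrightarrow> p d = \<zero>\<^bsub>Q\<^esub> \<longleftrightarrow> p' d = \<zero>\<^bsub>Q'\<^esub>"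
  shows "hopf_isomorphic k Q Q'"
proof -
  interpret c: hopf_cover k H D Q p by fact
  interpret c': hopf_cover k H D Q' p' by fact
  interpret Q: hopf_algebra k Q by (rule c.Q)
  interpret Q': hopf_algebra k Q' by (rule c'.Q)
  note DD = hopf_subalgebra_D[OF c.D]
  have [simp]: "d \<in> carrier H" if "d \<in> D" for d using that DD by auto
  note [simp] = lin_closed[OF c.p_linear] lin_closed[OF c'.p_linear]
  have eq: "p d = p e \<longleftrightarrow> p' d = p' e" if de: "d \<in> D" "e \<in> D" for d e
  proof -
    have "d \<ominus>\<^bsub>H\<^esub> e \<in> D" using de by (intro submodule_minus_closed[OF DD(2)]) auto
    then show ?thesis
      using ker[of "d \<ominus>\<^bsub>H\<^esub> e"] de
      by (simp add: lin_minus[OF C_module Q.C_module c.p_linear] lin_minus[OF C_module Q'.C_module c'.p_linear])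
  qed
  \<comment> \<open>A preimage in \<open>D\<close> is chosen; equality of the kernels makes the
    value independent of the choice.\<close>
  define f where "f Y = p' (SOME d. d \<in> D \<and> p d = Y)" for Y
  have fp [simp]: "f (p d) = p' d" if "d \<in> D" for d
  proof -
    have "(SOME e. e \<in> D \<and> p e = p d) \<in> D \<and> p (SOME e. e \<in> D \<and> p e = p d) = p d"
      by (rule someI[of _ d]) (use that in simp)
    then show ?thesis unfolding f_def using eq that by blast
  qed
  have cases: "\<exists>d\<in>D. Y = p d" if "Y \<in> carrier Q" for Y
    using that c.p_onto by auto
  have padd: "p (d \<oplus>\<^bsub>H\<^esub> e) = p d \<oplus>\<^bsub>Q\<^esub> p e" "p' (d \<oplus>\<^bsub>H\<^esub> e) = p' d \<oplus>\<^bsub>Q'\<^esub> p' e" if "d \<in> D" "e \<in> D" for d e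
    using that lin_add[OF c.p_linear] lin_add[OF c'.p_linear] by simp_all
  have psm: "p (a \<odot>\<^bsub>H\<^esub> d) = a \<odot>\<^bsub>Q\<^esub> p d" "p' (a \<odot>\<^bsub>H\<^esub> d) = a \<odot>\<^bsub>Q'\<^esub> p' d" if "a \<in> carrier k" "d \<in> D" for a d
    using that lin_smult[OF c.p_linear] lin_smult[OF c'.p_linear] by simp_all
  have f_add: "f (x \<oplus>\<^bsub>Q\<^esub> y) = f x \<oplus>\<^bsub>Q'\<^esub> f y" if xy: "x \<in> carrier Q" "y \<in> carrier Q" for x y
  proof -
    obtain d e where "d \<in> D" "e \<in> D" "x = p d" "y = p e"
      using cases[OF xy(1)] cases[OF xy(2)] by auto
    then show ?thesis using DD(6) by (simp add: padd[symmetric])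
  qed
  have f_mult: "f (x \<otimes>\<^bsub>Q\<^esub> y) = f x \<otimes>\<^bsub>Q'\<^esub> f y" if xy: "x \<in> carrier Q" "y \<in> carrier Q" for x y
  proof -
    obtain d e where "d \<in> D" "e \<in> D" "x = p d" "y = p e"
      using cases[OF xy(1)] cases[OF xy(2)] by auto
    then show ?thesis using DD(7) by (simp add: c.p_mult[symmetric]) (simp add: c'.p_mult)
  qed
  have f_smult: "f (a \<odot>\<^bsub>Q\<^esub> x) = a \<odot>\<^bsub>Q'\<^esub> f x" if ax: "a \<in> carrier k" "x \<in> carrier Q" for a x
  proof -
    obtain d where "d \<in> D" "x = p d" using cases[OF ax(2)] by auto
    then show ?thesis using DD(8) ax by (simp add: psm[symmetric])
  qed
  have f_closed: "f x \<in> carrier Q'" if "x \<in> carrier Q" for x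
    using cases[OF that] by auto
  have f: "lin Q Q' f" by (rule linI) (simp_all add: f_closed f_add f_smult)
  have bij: "bij_betw f (carrier Q) (carrier Q')"
  proof (rule bij_betw_imageI)
    show "inj_on f (carrier Q)"
    proof (rule inj_onI)
      fix x y assume "x \<in> carrier Q" "y \<in> carrier Q" and fxy: "f x = f y"
      then obtain d e where "d \<in> D" "e \<in> D" "x = p d" "y = p e"
        using cases[of x] cases[of y] by auto
      then show "x = y" using fxy eq by simp
    qed
    have "f ` carrier Q = p' ` D" unfolding c.p_onto[symmetric] image_image by (rule image_cong) simp_all
    then show "f ` carrier Q = carrier Q'" using c'.p_onto by simp
  qed
  have f_hopf: "comult Q' (f x) = tensor_map k Q' Q' f f (comult Q x) \<and> counit Q' (f x) = counit Q x \<and>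
      antipode Q' (f x) = f (antipode Q x)" if x: "x \<in> carrier Q" for x
  proof -
    obtain d where d: "d \<in> D" "x = p d" using cases[OF x] by blast
    let ?T = "tensor_module k Q' Q'" and ?\<beta> = "\<lambda>a b. tens k Q' Q' (f a) (f b)"
    have bf: "bilin Q Q ?T ?\<beta>" by (rule tensor_map_bilin) (simp_all add: f)
    have fp_lin: "lin H Q' (\<lambda>x. f (p x))" by (rule lin_comp[OF f c.p_linear])
    have bp: "bilin H H (tensor_module k Q Q) (\<lambda>u v. tens k Q Q (p u) (p v))"
      by (rule tensor_map_bilin) (simp_all add: c.p_linear)
    have bfp: "bilin H H ?T (\<lambda>u v. ?\<beta> (p u) (p v))"
      by (rule tensor_map_bilin) (simp_all add: fp_lin)
    have "tensor_map k Q' Q' f f (comult Q x)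
      = tensor_lift k ?T ?\<beta> (sw (tensor_module k Q Q) (\<lambda>u v. tens k Q Q (p u) (p v)) d)"
      using d by (simp add: tensor_map_eq c.p_comult)
    also have "\<dots> = sw ?T (\<lambda>u v. tensor_lift k ?T ?\<beta> (tens k Q Q (p u) (p v))) d"
      by (rule sw_hom) (use d in \<open>simp_all add: bp tensor_lift_lin[OF _ _ _ bf]\<close>)
    also have "\<dots> = sw ?T (\<lambda>u v. ?\<beta> (p u) (p v)) d"
      by (rule sw_cong[symmetric]) (use d in \<open>simp_all add: bfp tensor_lift_tens[OF _ _ _ bf]\<close>)
    also have "\<dots> = sw ?T (\<lambda>u v. tens k Q' Q' (p' u) (p' v)) d"
      by (rule sw_cong_sub[OF c.D d(1)])
        (use bfp in \<open>simp_all add: tensor_map_bilin c'.p_linear\<close>)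
    also have "\<dots> = comult Q' (f x)" using d c'.p_comult by simp
    finally show ?thesis
      using d DD(9) by (simp add: c.p_counit c'.p_counit c.p_antipode c'.p_antipode)
  qed
  have "f \<in> ring_iso Q Q'"
    unfolding ring_iso_def ring_hom_def using bij f_closed f_add f_mult fp[OF DD(5)] c.p_one c'.p_one by auto
  then have "f \<in> hopf_iso k Q Q'" unfolding hopf_iso_def using f f_hopf by simp
  then show ?thesis unfolding hopf_isomorphic_def using c.Q c'.Q by auto
qed

text \<open>Since \<open>P = DM\<close>, the classes of elements of \<open>D\<close> exhaust
  \<open>P/PM^+\<close>, and \<open>kernel_restricted\<close> identifies the kernel by data that
  mention \<open>M\<close> only through \<open>D \<inter> M\<close>.\<close>

lemma normal_quotient_cover:
  assumes P: "hopf_subalgebra k H P" and D: "hopf_subalgebra k H D"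
    and nM: "normal_hopf_subalgebra k (sub_hopf k H P) M" and DM: "span_prod k H D M = P"
  obtains p where "hopf_cover k H D (normal_quotient k (sub_hopf k H P) M) p"
    "\<And>d. d \<in> D \<Longrightarrow> p d = \<zero>\<^bsub>normal_quotient k (sub_hopf k H P) M\<^esub> \<longleftrightarrow>
      d \<in> span_prod k H D (augmentation k H (D \<inter> M))"
proof -
  let ?X = "sub_hopf k H P"
  interpret X: fd_hopf_algebra k ?X by (rule sub_hopf_is_fd[OF P])
  have M: "hopf_subalgebra k H M" "M \<subseteq> P" using nM normal_sub_hopf_iff[OF P] by auto
  note PD = hopf_subalgebra_D[OF P] and DD = hopf_subalgebra_D[OF D] and MD = hopf_subalgebra_D[OF M(1)]
  have DP: "D \<subseteq> P"
  proof
    fix d assume "d \<in> D"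
    then show "d \<in> P" using span_prod_closed(3)[OF DD(3) MD(3) _ MD(5), of d] DM DD(3) by auto
  qed
  have XM: "hopf_subalgebra k ?X M" "X.normalizes (carrier ?X) M"
    using nM X.normal_hopf_subalgebra_iff[of M] by auto
  have XD: "hopf_subalgebra k ?X D" using D DP by (simp add: hopf_subalgebra_sub_hopf_iff[OF P])
  have XDM: "span_prod k ?X D M = carrier ?X" using DM by (simp add: span_prod_sub_hopf[OF P DP M(2)])
  define I where "I = span_prod k ?X (carrier ?X) (augmentation k ?X M)"
  interpret q: hopf_quotient k ?X I unfolding I_def by (rule X.normal_hopf_quotient[OF XM])
  let ?Q = "normal_quotient k ?X M"
  have Q: "?Q = q.Q" by (simp only: normal_quotient_def I_def)
  obtain r where "retracted_sub k H D r" using retraction[OF D] .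
  then interpret R: retracted_sub k H D r .
  \<comment> \<open>The retraction onto \<open>D\<close> extends the projection linearly to
    \<open>H\<close>.\<close>
  define p where "p x = q.proj (r x)" for x
  have [simp]: "d \<in> P" "d \<in> carrier H" "r d = d" if "d \<in> D" for d using that DP DD R.r_id by auto
  have rX: "lin H ?X r" using R.rK lin_add[OF R.r] lin_smult[OF R.r] by (intro linI) auto
  have p: "lin H q.Q p" unfolding p_def[abs_def] by (rule lin_comp[OF q.proj_linear rX])
  have pD: "p d = q.proj d" if "d \<in> D" for d using that by (simp add: p_def)
  have "hopf_cover k H D q.Q p"
  proof (intro hopf_cover.intro hopf_cover_axioms.intro fd_hopf_algebra_axioms D q.Q_hopf_algebra p)
    show "p ` D = carrier q.Q"
    proof
      show "p ` D \<subseteq> carrier q.Q" using lin_closed[OF p] by auto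
      show "carrier q.Q \<subseteq> p ` D"
      proof
        fix Y assume "Y \<in> carrier q.Q"
        then obtain x where x: "x \<in> carrier ?X" "Y = q.proj x" by (rule q.Q_cases)
        obtain d where d: "d \<in> D" "x \<ominus>\<^bsub>?X\<^esub> d \<in> I" unfolding I_def by (rule X.representative_mod_aug[OF XM(1) XD XDM x(1)])
        then have "q.proj x = q.proj d" using x by (subst q.proj_eq_iff) auto
        then show "Y \<in> p ` D" using x d pD by auto
      qed
    qed
    show "p (d \<otimes>\<^bsub>H\<^esub> e) = p d \<otimes>\<^bsub>q.Q\<^esub> p e" if "d \<in> D" "e \<in> D" for d e
      using that q.proj_mult[of d e] DD(7) by (simp add: pD)
    show "p \<one>\<^bsub>H\<^esub> = \<one>\<^bsub>q.Q\<^esub>" using q.proj_one DD(5) by (simp add: pD)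
    show "counit q.Q (p d) = counit H d" if "d \<in> D" for d using that q.Q_counit[of d] by (simp add: pD)
    show "antipode q.Q (p d) = p (antipode H d)" if "d \<in> D" for d
      using that q.Q_antipode[of d] DD(9) by (simp add: pD)
    show "comult q.Q (p d) = sw q.QQ (\<lambda>u v. tens k q.Q q.Q (p u) (p v)) d" if d: "d \<in> D" for d
    proof -
      have b: "bilin H H q.QQ (\<lambda>u v. tens k q.Q q.Q (p u) (p v))"
        by (rule tensor_map_bilin) (simp_all add: p)
      have "comult q.Q (p d) = X.sw q.QQ (\<lambda>u v. tens k q.Q q.Q (q.proj u) (q.proj v)) d"
        using q.Q_comult[of d] d by (simp add: pD)
      also have "\<dots> = X.sw q.QQ (\<lambda>u v. tens k q.Q q.Q (p u) (p v)) d"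
        by (rule X.sw_cong_sub[OF XD d _ q.bTQ sub_hopf_lin(3)[OF P b]]) (simp_all add: pD)
      also have "\<dots> = sw q.QQ (\<lambda>u v. tens k q.Q q.Q (p u) (p v)) d"
        by (rule sw_sub_hopf[OF P _ b]) (use d in simp_all)
      finally show ?thesis .
    qed
  qed
  moreover have "p d = \<zero>\<^bsub>?Q\<^esub> \<longleftrightarrow> d \<in> span_prod k H D (augmentation k H (D \<inter> M))" if d: "d \<in> D" for d
  proof -
    have a: "augmentation k H (D \<inter> M) \<subseteq> D" "augmentation k H (D \<inter> M) \<subseteq> augmentation k H M"
      "augmentation k H M \<subseteq> P"
      using M by (auto simp: augmentation_def)
    have I: "I = span_prod k H P (augmentation k H M)"
      using span_prod_sub_hopf[OF P subset_refl a(3)] by (simp add: I_def)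
    have "d \<in> I \<Longrightarrow> d \<in> span_prod k ?X D (augmentation k ?X (D \<inter> M))"
      unfolding I_def by (rule X.kernel_restricted[OF XM XD XDM d])
    moreover have "span_prod k ?X D (augmentation k ?X (D \<inter> M)) = span_prod k H D (augmentation k H (D \<inter> M))"
      using span_prod_sub_hopf[OF P DP, of "augmentation k H (D \<inter> M)"] a DP by simp
    moreover have "span_prod k H D (augmentation k H (D \<inter> M)) \<subseteq> I"
      unfolding I using DP a PD(3) by (intro span_prod_mono) auto
    ultimately show ?thesis using d q.proj_zero_iff[of d] by (auto simp: pD Q)
  qed
  ultimately show ?thesis using that unfolding Q by blast
qed

end

section \<open>The configuration of the theorem\<close>

locale zassenhaus = fd_hopf_algebra k H
  for k :: "('a, 'm) ring_scheme" (structure) and H :: "('a, 'b, 'n) hopf_scheme" (structure) +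
  fixes A B A' B'
  assumes A: "hopf_subalgebra k H A" and B: "hopf_subalgebra k H B"
    and A': "hopf_subalgebra k H A'" "A' \<subseteq> A" "normalizes A A'"
    and B': "hopf_subalgebra k H B'" "B' \<subseteq> B" "normalizes B B'"
begin

text \<open>The assumptions are symmetric in \<open>(A, A')\<close> and \<open>(B, B')\<close>, so
  each fact about one side holds for the other.\<close>

lemma swap: "zassenhaus k H B A B' A'"
  by (intro zassenhaus.intro zassenhaus_axioms.intro fd_hopf_algebra_axioms A B A' B')

lemma D: "hopf_subalgebra k H (A \<inter> B)" and E: "hopf_subalgebra k H (A \<inter> B')"
  by (rule hopf_subalgebra_Int A B B')+

lemma D_A': "normalizes (A \<inter> B) A'"
  by (rule normalizes_mono[OF A'(3)]) simp

text \<open>\<open>A \<inter> B\<close> preserves \<open>A\<close> because it lies in it, and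
  preserves \<open>B'\<close> because it lies in \<open>B\<close>.\<close>

lemma D_E: "normalizes (A \<inter> B) (A \<inter> B')"
  using normalizes_sub[OF A _ D] normalizes_mono[OF B'(3), of "A \<inter> B"] by (simp add: normalizes_def)

lemma E_A': "normalizes (A \<inter> B') A'"
  by (rule normalizes_mono[OF A'(3)]) simp

lemmas P = span_prod_hopf_subalgebra[OF A'(1) D D_A']
lemmas M = span_prod_hopf_subalgebra[OF A'(1) E E_A']

lemma M_subset: "span_prod k H A' (A \<inter> B') \<subseteq> span_prod k H A' (A \<inter> B)"
  using B'(2) hopf_subalgebra_D(3)[OF A] hopf_subalgebra_D(3)[OF A'(1)] by (intro span_prod_mono) auto

lemma normal:
  "normal_hopf_subalgebra k (sub_hopf k H (span_prod k H A' (A \<inter> B))) (span_prod k H A' (A \<inter> B'))"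
proof -
  note AH = hopf_subalgebra_D(3)[OF A'(1)]
  have "normalizes (A \<inter> B) (span_prod k H A' (A \<inter> B'))"
    by (rule normalizes_prod[OF D AH hopf_subalgebra_D(3)[OF E] D_A' D_E])
  then have "normalizes (span_prod k H A' (A \<inter> B)) (span_prod k H A' (A \<inter> B'))"
    by (intro prod_normalizes[OF M(1) AH hopf_subalgebra_D(3)[OF D]] normalizes_sub[OF M(1,2) A'(1)])
  then show ?thesis using M(1) M_subset by (simp add: normal_sub_hopf_iff[OF P(1)])
qed

lemma intersection: "span_prod k H A' (A \<inter> B') \<inter> A \<inter> B = span_prod k H (A' \<inter> B) (A \<inter> B')"
proof
  let ?M = "span_prod k H A' (A \<inter> B')"
  note AH = hopf_subalgebra_D(3)[OF A'(1)] and EH = hopf_subalgebra_D(3)[OF E]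
  \<comment> \<open>The modular law with \<open>N = A'\<close>, \<open>K = A \<inter> B'\<close> and
    \<open>C = ?M \<inter> (A \<inter> B)\<close>; then \<open>A' \<inter> C\<close> lies in
    \<open>A' \<inter> B\<close>.\<close>
  have "?M \<inter> (A \<inter> B) \<subseteq> span_prod k H (A' \<inter> (?M \<inter> (A \<inter> B))) (A \<inter> B')"
    using M(3) B'(2)
    by (intro modular_law[OF A'(1) E hopf_subalgebra_Int[OF M(1) D]] normalizes_mono[OF D_A']) auto
  also have "\<dots> \<subseteq> span_prod k H (A' \<inter> B) (A \<inter> B')"
    using AH EH by (intro span_prod_mono) auto
  finally show "?M \<inter> A \<inter> B \<subseteq> span_prod k H (A' \<inter> B) (A \<inter> B')" by (simp add: Int_assoc)
  have "span_prod k H (A' \<inter> B) (A \<inter> B') \<subseteq> A \<inter> B"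
    using A'(2) B'(2) by (intro span_prod_in_hopf_subalgebra[OF D]) auto
  moreover have "span_prod k H (A' \<inter> B) (A \<inter> B') \<subseteq> ?M"
    using AH EH by (intro span_prod_mono) auto
  ultimately show "span_prod k H (A' \<inter> B) (A \<inter> B') \<subseteq> ?M \<inter> A \<inter> B" by auto
qed

lemma span_prod_D_M: "span_prod k H (A \<inter> B) (span_prod k H A' (A \<inter> B')) = span_prod k H A' (A \<inter> B)"
proof
  note DH = hopf_subalgebra_D(3)[OF D] and MH = hopf_subalgebra_D(3)[OF M(1)]
  show "span_prod k H (A \<inter> B) (span_prod k H A' (A \<inter> B')) \<subseteq> span_prod k H A' (A \<inter> B)"
    by (rule span_prod_in_hopf_subalgebra[OF P(1,3) M_subset])
  have "span_prod k H A' (A \<inter> B) = span_prod k H (A \<inter> B) A'" by (rule span_prod_commute[OF A'(1) D D_A'])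
  also have "\<dots> \<subseteq> span_prod k H (A \<inter> B) (span_prod k H A' (A \<inter> B'))"
    by (rule span_prod_mono[OF subset_refl M(2) DH MH])
  finally show "span_prod k H A' (A \<inter> B) \<subseteq> span_prod k H (A \<inter> B) (span_prod k H A' (A \<inter> B'))" .
qed

end

theorem theorem3p10:
  fixes k :: "('a, 'm) ring_scheme" and H :: "('a, 'b, 'n) hopf_scheme"
    and A B A' B' :: "'b set"
  assumes "field k"
    and "hopf_algebra k H"
    and "vectorspace.fin_dim k H"
    and "hopf_subalgebra k H A"
    and "hopf_subalgebra k H B"
    and "normal_hopf_subalgebra k (sub_hopf k H A) A'"
    and "normal_hopf_subalgebra k (sub_hopf k H B) B'"
  shows
    "(hopf_subalgebra k H (span_prod k H A' (A \<inter> B)) \<and>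
      normal_hopf_subalgebra k (sub_hopf k H (span_prod k H A' (A \<inter> B)))
        (span_prod k H A' (A \<inter> B')))
     \<and> (hopf_subalgebra k H (span_prod k H B' (A \<inter> B)) \<and>
      normal_hopf_subalgebra k (sub_hopf k H (span_prod k H B' (A \<inter> B)))
        (span_prod k H B' (A' \<inter> B)))
     \<and> (span_prod k H A' (A \<inter> B') \<inter> A \<inter> B = span_prod k H (A' \<inter> B) (A \<inter> B') \<and>
      span_prod k H (A' \<inter> B) (A \<inter> B') = span_prod k H B' (A' \<inter> B) \<inter> A \<inter> B)
     \<and> hopf_isomorphic k
        (normal_quotient k (sub_hopf k H (span_prod k H A' (A \<inter> B)))
          (span_prod k H A' (A \<inter> B')))
        (normal_quotient k (sub_hopf k H (span_prod k H B' (A \<inter> B)))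
          (span_prod k H B' (A' \<inter> B)))"
proof -
  interpret fd_hopf_algebra k H
    using assms(2,3) by (intro fd_hopf_algebra.intro fd_hopf_algebra_axioms.intro)
  interpret Z: zassenhaus k H A B A' B'
    using assms(4-7) by (intro zassenhaus.intro zassenhaus_axioms.intro fd_hopf_algebra_axioms)
      (simp_all add: normal_sub_hopf_iff)
  interpret W: zassenhaus k H B A B' A' by (rule Z.swap)
  let ?D = "A \<inter> B" and ?M = "span_prod k H A' (A \<inter> B')" and ?M' = "span_prod k H B' (A' \<inter> B)"
  \<comment> \<open>The interpretation with exchanged roles yields the intersections in the opposite
    order.\<close>
  have c: "B \<inter> A = ?D" "B \<inter> A' = A' \<inter> B" "B' \<inter> A = A \<inter> B'" by auto
  \<comment> \<open>The two sides give the middle product in opposite orders; the factors commute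
    because \<open>A \<inter> B'\<close> normalizes \<open>A' \<inter> B\<close>.\<close>
  have "span_prod k H (A' \<inter> B) (A \<inter> B') = span_prod k H (A \<inter> B') (A' \<inter> B)"
    using Z.B'(2) W.D_E Z.E W.E unfolding c by (intro span_prod_commute normalizes_mono[OF W.D_E[unfolded c]]) auto
  then have iii: "span_prod k H (A' \<inter> B) (A \<inter> B') = ?M' \<inter> A \<inter> B"
    using W.intersection unfolding c by (simp add: Int_ac)
  \<comment> \<open>Both are the middle product of (iii), so the two projections from
    \<open>?D\<close> have the same kernel.\<close>
  have DM: "?D \<inter> ?M = ?D \<inter> ?M'" using Z.intersection iii by auto
  obtain p where p: "hopf_cover k H ?D (normal_quotient k (sub_hopf k H (span_prod k H A' ?D)) ?M) p"
    "\<And>d. d \<in> ?D \<Longrightarrow> p d = \<zero>\<^bsub>normal_quotient k (sub_hopf k H (span_prod k H A' ?D)) ?M\<^esub> \<longleftrightarrow>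
      d \<in> span_prod k H ?D (augmentation k H (?D \<inter> ?M))"
    by (rule normal_quotient_cover[OF Z.P(1) Z.D Z.normal Z.span_prod_D_M]) blast
  obtain p' where p': "hopf_cover k H ?D (normal_quotient k (sub_hopf k H (span_prod k H B' ?D)) ?M') p'"
    "\<And>d. d \<in> ?D \<Longrightarrow> p' d = \<zero>\<^bsub>normal_quotient k (sub_hopf k H (span_prod k H B' ?D)) ?M'\<^esub> \<longleftrightarrow>
      d \<in> span_prod k H ?D (augmentation k H (?D \<inter> ?M'))"
    by (rule normal_quotient_cover[OF W.P(1) W.D W.normal W.span_prod_D_M, unfolded c]) blast
  have "hopf_isomorphic k (normal_quotient k (sub_hopf k H (span_prod k H A' ?D)) ?M)
    (normal_quotient k (sub_hopf k H (span_prod k H B' ?D)) ?M')"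
    by (rule hopf_cover_isomorphic[OF p(1) p'(1)]) (simp only: p(2) p'(2) DM)
  then show ?thesis
    using Z.P(1) Z.normal W.P(1) W.normal Z.intersection iii unfolding c by blast
qed

end
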